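(* Let $G$ be a $PI$-group. Then the radical $\widetilde R(G)$ coincides with the set of all quasi-nil elements of $G$.
   Context: A group $G$ is a $PI$-group if there exist a field $P$ and an associative algebra $A$ with $1$ over $P$ satisfying a nontrivial polynomial identity (a $PI$-algebra) such that $G$ is isomorphic to a subgroup of the group of invertible elements of $A$. Words: $e_1(x,y)=[x,y]$ and $e_n(x,y)=[e_{n-1}(x,y),y]$ for $n\ge 2$, where $[x,y]$ denotes the group commutator (with one fixed standard convention, say $[x,y]=x^{-1}y^{-1}xy$). For positive integers $n_1,\dots,n_k$ define words $\varepsilon_{(n_1,\dots,n_k)}(x_1,\dots,x_k;y)$ inductively by $\varepsilon_{(n_1)}(x_1;y)=e_{n_1}(x_1,y)$ and $\varepsilon_{(n_1,\dots,n_k)}(x_1,\dots,x_k;y)=e_{n_k}\bigl(x_k,\varepsilon_{(n_1,\dots,n_{k-1})}(x_1,\dots,x_{k-1};y)\bigr)$. Quasi-nil elements: an element $g\in G$ is quasi-nil if there is $k=k(g)\ge 1$ such that for every sequence $(a_1,\dots,a_k)$ of elements of $G$ there is a compatible sequence $(n_1,\dots,n_k)$ of positive integers with $\varepsilon_{(n_1,\dots,n_k)}(a_1,\dots,a_k;g)=1$. Compatible means that each $n_i$ depends only on $a_1,\dots,a_i$ and $g$ and not on $a_{i+1},\dots,a_k$; that is, there are functions $N_i:G^i\to\mathbb{Z}_{\ge1}$, $i=1,\dots,k$, such that for all $(a_1,\dots,a_k)\in G^k$ the equality holds with $n_i=N_i(a_1,\dots,a_i)$. Radical: $R(G)=\mathrm{HP}(G)$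 is the locally nilpotent radical, the subgroup generated by all locally nilpotent normal subgroups of $G$ (a group is locally nilpotent if each finitely generated subgroup is nilpotent). The upper radical series of $G$ is the ascending transfinite series $1=R_0\subset R_1\subset\cdots\subset R_\alpha\subset\cdots$ with $R_{\alpha+1}/R_\alpha=R(G/R_\alpha)$ and unions taken at limit ordinals; its terminal member is $\widetilde R(G)$ (called the "solvable" radical). *)

theory Defs
  imports "HOL-Algebra.Module" "HOL-Algebra.Generated_Groups"
begin

section \<open>PI-algebras and PI-groups\<close>

text \<open>The library locale \<^locale>\<open>algebra\<close> is restricted to commutative algebras.\<close>

locale assoc_algebra = module P A + P?: field P + A?: ring A
    for P (structure) and A (structure) +
  assumes smult_assoc_left:
    "\<lbrakk>c \<in> carrier P; x \<in> carrier A; y \<in> carrier A\<rbrakk>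
      \<Longrightarrow> (c \<odot>\<^bsub>A\<^esub> x) \<otimes>\<^bsub>A\<^esub> y = c \<odot>\<^bsub>A\<^esub> (x \<otimes>\<^bsub>A\<^esub> y)"
  and smult_assoc_right:
    "\<lbrakk>c \<in> carrier P; x \<in> carrier A; y \<in> carrier A\<rbrakk>
      \<Longrightarrow> x \<otimes>\<^bsub>A\<^esub> (c \<odot>\<^bsub>A\<^esub> y) = c \<odot>\<^bsub>A\<^esub> (x \<otimes>\<^bsub>A\<^esub> y)"

text \<open>An element of the free associative algebra over \<open>P\<close> on variables \<open>X\<^sub>0, X\<^sub>1, \<dots>\<close> is given by
  its coefficient function on words, the word \<open>[i\<^sub>1, \<dots>, i\<^sub>m]\<close> standing for the monomial
  \<open>X\<^bsub>i\<^sub>1\<^esub> \<cdots> X\<^bsub>i\<^sub>m\<^esub>\<close>.\<close>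

definition nc_poly :: "('p, 'r) ring_scheme \<Rightarrow> (nat list \<Rightarrow> 'p) \<Rightarrow> bool"
  where "nc_poly P f \<longleftrightarrow> (\<forall>w. f w \<in> carrier P) \<and> finite {w. f w \<noteq> \<zero>\<^bsub>P\<^esub>}"

definition nc_monom_eval :: "('a, 'm) monoid_scheme \<Rightarrow> (nat \<Rightarrow> 'a) \<Rightarrow> nat list \<Rightarrow> 'a"
  where "nc_monom_eval A s w = foldr (\<lambda>i x. s i \<otimes>\<^bsub>A\<^esub> x) w \<one>\<^bsub>A\<^esub>"

definition nc_poly_eval ::
    "('p, 'r) ring_scheme \<Rightarrow> ('p, 'a, 'm) module_scheme \<Rightarrow> (nat list \<Rightarrow> 'p) \<Rightarrow> (nat \<Rightarrow> 'a) \<Rightarrow> 'a"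
  where "nc_poly_eval P A f s =
    (\<Oplus>\<^bsub>A\<^esub>w \<in> {w. f w \<noteq> \<zero>\<^bsub>P\<^esub>}. f w \<odot>\<^bsub>A\<^esub> nc_monom_eval A s w)"

definition PI_algebra :: "('p, 'r) ring_scheme \<Rightarrow> ('p, 'a, 'm) module_scheme \<Rightarrow> bool"
  where "PI_algebra P A \<longleftrightarrow> assoc_algebra P A \<and>
    (\<exists>f. nc_poly P f \<and> (\<exists>w. f w \<noteq> \<zero>\<^bsub>P\<^esub>) \<and>
         (\<forall>s \<in> UNIV \<rightarrow> carrier A. nc_poly_eval P A f s = \<zero>\<^bsub>A\<^esub>))"

text \<open>HOL cannot quantify over types inside a formula, so the types in which the field and the
  algebra live are parameters. A theorem with the hypothesis \<open>PI_group TYPE('p) TYPE('a) G\<close> and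
  free type variables \<open>'p\<close>, \<open>'a\<close> covers all fields and all algebras.\<close>

definition PI_group :: "'p itself \<Rightarrow> 'a itself \<Rightarrow> ('g, 'm) monoid_scheme \<Rightarrow> bool"
  where "PI_group _ _ G \<longleftrightarrow> group G \<and>
    (\<exists>(P :: 'p ring) (A :: ('p, 'a) module) H.
       PI_algebra P A \<and> subgroup H (units_of A) \<and> G \<cong> (units_of A)\<lparr>carrier := H\<rparr>)"

section \<open>Quasi-nil elements\<close>

definition comm :: "('g, 'm) monoid_scheme \<Rightarrow> 'g \<Rightarrow> 'g \<Rightarrow> 'g"
  where "comm G x y = inv\<^bsub>G\<^esub> x \<otimes>\<^bsub>G\<^esub> inv\<^bsub>G\<^esub> y \<otimes>\<^bsub>G\<^esub> x \<otimes>\<^bsub>G\<^esub> y"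

text \<open>The value of the word \<open>e\<^sub>n(x, y)\<close>; the additional value \<open>e\<^sub>0(x, y) = x\<close> gives
  \<open>e\<^sub>1(x, y) = [x, y]\<close>.\<close>

primrec engel :: "('g, 'm) monoid_scheme \<Rightarrow> nat \<Rightarrow> 'g \<Rightarrow> 'g \<Rightarrow> 'g"
  where
    "engel G 0 x y = x"
  | "engel G (Suc n) x y = comm G (engel G n x y) y"

text \<open>The value of the word \<open>\<epsilon>\<^bsub>(n\<^sub>1, \<dots>, n\<^sub>k)\<^esub>(a\<^sub>1, \<dots>, a\<^sub>k; y)\<close>, the entries being \<open>n i\<close> and
  \<open>a i\<close> for \<open>i = 1, \<dots>, k\<close>. The additional value \<open>y\<close> at \<open>k = 0\<close> gives \<open>e\<^bsub>n\<^sub>1\<^esub>(a\<^sub>1, y)\<close> at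
  \<open>k = 1\<close>.\<close>

primrec engel_iter ::
    "('g, 'm) monoid_scheme \<Rightarrow> nat \<Rightarrow> (nat \<Rightarrow> nat) \<Rightarrow> (nat \<Rightarrow> 'g) \<Rightarrow> 'g \<Rightarrow> 'g"
  where
    "engel_iter G 0 n a y = y"
  | "engel_iter G (Suc k) n a y = engel G (n (Suc k)) (a (Suc k)) (engel_iter G k n a y)"

text \<open>\<open>N i\<close> is the function \<open>N\<^sub>i : G\<^sup>i \<rightarrow> \<int>\<^bsub>\<ge>1\<^esub>\<close>, its argument being the list
  \<open>[a\<^sub>1, \<dots>, a\<^sub>i]\<close>.\<close>

definition quasi_nil :: "('g, 'm) monoid_scheme \<Rightarrow> 'g \<Rightarrow> bool"
  where "quasi_nil G g \<longleftrightarrow>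
    (\<exists>k \<ge> 1. \<exists>N :: nat \<Rightarrow> 'g list \<Rightarrow> nat.
       (\<forall>i \<in> {1..k}. \<forall>as. length as = i \<and> set as \<subseteq> carrier G \<longrightarrow> N i as \<ge> 1) \<and>
       (\<forall>a. (\<forall>i \<in> {1..k}. a i \<in> carrier G) \<longrightarrow>
          engel_iter G k (\<lambda>i. N i (map a [1..<Suc i])) a g = \<one>\<^bsub>G\<^esub>))"

section \<open>The locally nilpotent radical\<close>

primrec lower_central :: "('g, 'm) monoid_scheme \<Rightarrow> nat \<Rightarrow> 'g set"
  where
    "lower_central G 0 = carrier G"
  | "lower_central G (Suc n) =
       generate G {comm G x y | x y. x \<in> lower_central G n \<and> y \<in> carrier G}"

definition nilpotent_group :: "('g, 'm) monoid_scheme \<Rightarrow> bool"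
  where "nilpotent_group G \<longleftrightarrow> (\<exists>n. lower_central G n = {\<one>\<^bsub>G\<^esub>})"

definition locally_nilpotent :: "('g, 'm) monoid_scheme \<Rightarrow> bool"
  where "locally_nilpotent G \<longleftrightarrow>
    (\<forall>S. finite S \<and> S \<subseteq> carrier G \<longrightarrow> nilpotent_group (G\<lparr>carrier := generate G S\<rparr>))"

definition loc_nilp_radical :: "('g, 'm) monoid_scheme \<Rightarrow> 'g set"
  where "loc_nilp_radical G =
    generate G (\<Union>{N. N \<lhd> G \<and> locally_nilpotent (G\<lparr>carrier := N\<rparr>)})"

section \<open>The upper radical series\<close>

text \<open>The full preimage in \<open>G\<close> of the radical of \<open>G/N\<close>, that is, the subgroup \<open>M \<supseteq> N\<close> with
  \<open>M/N = R(G/N)\<close>.\<close>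

definition radical_over :: "('g, 'm) monoid_scheme \<Rightarrow> 'g set \<Rightarrow> 'g set"
  where "radical_over G N = {x \<in> carrier G. N #>\<^bsub>G\<^esub> x \<in> loc_nilp_radical (G Mod N)}"

text \<open>For a well-order \<open>r\<close>, the condition \<open>underS r j = under r i\<close> says that \<open>j\<close> is the immediate
  successor of \<open>i\<close>. The members of the series are indexed by the elements of the field of a
  well-order; see \<open>upper_radical_series_zero\<close>, \<open>_succ\<close>, \<open>_limit\<close> below for the
  recursion equations.\<close>

definition is_succ :: "'i rel \<Rightarrow> 'i \<Rightarrow> 'i \<Rightarrow> bool"
  where "is_succ r i j \<longleftrightarrow> i \<in> Field r \<and> j \<in> Field r \<and> underS r j = under r i"

definition upper_radical_series :: "('g, 'm) monoid_scheme \<Rightarrow> 'i rel \<Rightarrow> 'i \<Rightarrow> 'g set"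
  where "upper_radical_series G r = wo_rel.worec r (\<lambda>R j.
    if underS r j = {} then {\<one>\<^bsub>G\<^esub>}
    else if \<exists>i. is_succ r i j then radical_over G (R (THE i. is_succ r i j))
    else (\<Union>i \<in> underS r j. R i))"

text \<open>The series is indexed by the successor cardinal of the order of \<open>G\<close>. This is long enough for
  it to become stationary, so that the union is its terminal member; see
  \<open>solvable_radical_terminal\<close> below.\<close>

abbreviation series_index :: "('g, 'm) monoid_scheme \<Rightarrow> 'g set rel"
  where "series_index G \<equiv> cardSuc (card_of (carrier G))"

definition solvable_radical :: "('g, 'm) monoid_scheme \<Rightarrow> 'g set"
  where "solvable_radical G =
    (\<Union>i \<in> Field (series_index G). upper_radical_series G (series_index G) i)"

subsection \<open>The defining properties of the series\<close>

lemma is_succ_unique: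
  assumes "Well_order r" "is_succ r i j" "is_succ r i' j"
  shows "i = i'"
proof -
  have ord: "refl_on (Field r) r" "antisym r"
    using assms(1) by (auto simp: order_on_defs)
  have "under r i = under r i'" "i \<in> Field r" "i' \<in> Field r"
    using assms(2,3) by (auto simp: is_succ_def)
  then have "(i, i') \<in> r" "(i', i) \<in> r"
    using refl_onD[OF ord(1)] unfolding under_def by blast+
  then show ?thesis
    using ord(2) by (meson antisymD)
qed

lemma is_succ_underS:
  assumes "Well_order r" "is_succ r i j"
  shows "i \<in> underS r j"
  using assms refl_onD[of "Field r" r i] by (auto simp: is_succ_def under_def order_on_defs)

lemma the_succ: "Well_order r \<Longrightarrow> is_succ r i j \<Longrightarrow> (THE i. is_succ r i j) = i"
  using is_succ_unique by (metis (mono_tags, lifting) the_equality)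

lemma upper_radical_series_unfold:
  assumes wo: "Well_order r"
  shows "upper_radical_series G r j =
    (if underS r j = {} then {\<one>\<^bsub>G\<^esub>}
     else if \<exists>i. is_succ r i j
       then radical_over G (upper_radical_series G r (THE i. is_succ r i j))
     else (\<Union>i \<in> underS r j. upper_radical_series G r i))"
proof -
  have wo_rel: "wo_rel r"
    using wo by (simp add: wo_rel_def)
  let ?F = "\<lambda>R j. if underS r j = {} then {\<one>\<^bsub>G\<^esub>}
    else if \<exists>i. is_succ r i j then radical_over G (R (THE i. is_succ r i j))
    else (\<Union>i \<in> underS r j. R i)"
  have "?F f j = ?F g j" if "\<forall>i \<in> underS r j. f i = g i" for f g :: "'a \<Rightarrow> 'b set" and j
  proof (cases "\<exists>i. is_succ r i j")
    case True
    then obtain i where "is_succ r i j" ..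
    then have "(THE i. is_succ r i j) = i" "i \<in> underS r j"
      by (auto intro: the_succ[OF wo] is_succ_underS[OF wo])
    with True that show ?thesis by simp
  next
    case False
    then show ?thesis
      using that by auto
  qed
  then have "wo_rel.adm_wo r ?F"
    unfolding wo_rel.adm_wo_def[OF wo_rel] by blast
  from wo_rel.worec_fixpoint[OF wo_rel this] show ?thesis
    unfolding upper_radical_series_def by (rule fun_cong)
qed

lemma upper_radical_series_zero:
  "Well_order r \<Longrightarrow> underS r j = {} \<Longrightarrow> upper_radical_series G r j = {\<one>\<^bsub>G\<^esub>}"
  by (simp add: upper_radical_series_unfold)

lemma upper_radical_series_succ:
  assumes "Well_order r" "is_succ r i j"
  shows "upper_radical_series G r j = radical_over G (upper_radical_series G r i)"
  using is_succ_underS[OF assms] assms the_succ[OF assms]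
  by (subst upper_radical_series_unfold) auto

lemma upper_radical_series_limit:
  assumes "Well_order r" "underS r j \<noteq> {}" "\<nexists>i. is_succ r i j"
  shows "upper_radical_series G r j = (\<Union>i \<in> underS r j. upper_radical_series G r i)"
  using assms by (subst upper_radical_series_unfold) auto

subsection \<open>The series becomes stationary\<close>

context group
begin

lemma loc_nilp_radical_normal: "loc_nilp_radical G \<lhd> G"
  unfolding loc_nilp_radical_def
proof (rule normal_generateI)
  show "\<Union>{N. N \<lhd> G \<and> locally_nilpotent (G\<lparr>carrier := N\<rparr>)} \<subseteq> carrier G"
    by (rule Union_least) (metis (lifting) mem_Collect_eq normal_imp_subgroup subgroup.subset)
next
  fix h g
  assume "h \<in> \<Union>{N. N \<lhd> G \<and> locally_nilpotent (G\<lparr>carrier := N\<rparr>)}"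
    and g: "g \<in> carrier G"
  then obtain N where "N \<lhd> G" "locally_nilpotent (G\<lparr>carrier := N\<rparr>)" "h \<in> N"
    by auto
  moreover from this g have "g \<otimes> h \<otimes> inv g \<in> N"
    using normal.inv_op_closed2 by metis
  ultimately show "g \<otimes> h \<otimes> inv g \<in> \<Union>{N. N \<lhd> G \<and> locally_nilpotent (G\<lparr>carrier := N\<rparr>)}"
    using normal.inv_op_closed2 by blast
qed

lemma radical_over_normal:
  assumes N: "N \<lhd> G"
  shows "radical_over G N \<lhd> G"
proof -
  interpret N: normal N G by (rule N)
  interpret Q: group "G Mod N" by (rule N.factorgroup_is_group)
  interpret h: group_hom G "G Mod N" "\<lambda>x. N #> x"
    using N.r_coset_hom_Mod by unfold_locales
  interpret L: normal "loc_nilp_radical (G Mod N)" "G Mod N"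
    by (rule Q.loc_nilp_radical_normal)
  show ?thesis
    unfolding normal_inv_iff
  proof (intro conjI ballI)
    show "subgroup (radical_over G N) G"
    proof (rule subgroupI)
      show "radical_over G N \<subseteq> carrier G"
        by (auto simp: radical_over_def)
      have "\<one> \<in> radical_over G N"
        using L.one_closed h.hom_one by (simp add: radical_over_def del: one_FactGroup)
      then show "radical_over G N \<noteq> {}" by blast
      show "inv a \<in> radical_over G N" if "a \<in> radical_over G N" for a
        using that L.m_inv_closed h.hom_inv[of a] by (simp add: radical_over_def)
      show "a \<otimes> b \<in> radical_over G N" if "a \<in> radical_over G N" "b \<in> radical_over G N" for a b
        using that L.m_closed h.hom_mult[of a b] by (simp add: radical_over_def)
    qed
  next
    fix x h assume "x \<in> carrier G" "h \<in> radical_over G N"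
    then show "x \<otimes> h \<otimes> inv x \<in> radical_over G N"
      using L.inv_op_closed2[of "N #> x" "N #> h"] h.hom_mult h.hom_inv h.hom_closed
      by (simp add: radical_over_def)
  qed
qed

lemma subset_radical_over:
  assumes N: "N \<lhd> G"
  shows "N \<subseteq> radical_over G N"
proof
  interpret N: normal N G by (rule N)
  fix x assume x: "x \<in> N"
  then have "N #> x = \<one>\<^bsub>G Mod N\<^esub>"
    by (simp add: FactGroup_def N.subgroup_axioms subgroup.rcos_const)
  then show "x \<in> radical_over G N"
    using x generate.one[of "G Mod N"]
    by (auto simp: radical_over_def loc_nilp_radical_def simp del: one_FactGroup)
qed

lemma normal_Union_chain:
  assumes "I \<noteq> {}" "\<And>i. i \<in> I \<Longrightarrow> S i \<lhd> G"
    and chain: "\<And>i j. i \<in> I \<Longrightarrow> j \<in> I \<Longrightarrow> S i \<subseteq> S j \<or> S j \<subseteq> S i"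
  shows "(\<Union>i \<in> I. S i) \<lhd> G"
  unfolding normal_inv_iff
proof (intro conjI ballI)
  have sub: "\<And>i. i \<in> I \<Longrightarrow> subgroup (S i) G"
    using assms(2) normal_imp_subgroup by blast
  show "subgroup (\<Union>i \<in> I. S i) G"
  proof (rule subgroupI)
    show "(\<Union>i \<in> I. S i) \<subseteq> carrier G" using sub subgroup.subset by blast
    show "(\<Union>i \<in> I. S i) \<noteq> {}" using sub assms(1) subgroup.one_closed by fastforce
    show "inv a \<in> (\<Union>i \<in> I. S i)" if "a \<in> (\<Union>i \<in> I. S i)" for a
      using that sub subgroup.m_inv_closed by fastforce
    show "a \<otimes> b \<in> (\<Union>i \<in> I. S i)" if "a \<in> (\<Union>i \<in> I. S i)" "b \<in> (\<Union>i \<in> I. S i)" for a b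
    proof -
      obtain i j where ij: "i \<in> I" "a \<in> S i" "j \<in> I" "b \<in> S j"
        using \<open>a \<in> (\<Union>i \<in> I. S i)\<close> \<open>b \<in> (\<Union>i \<in> I. S i)\<close> by auto
      then obtain l where "l \<in> I" "a \<in> S l" "b \<in> S l"
        using chain[of i j] by blast
      then show ?thesis using sub subgroup.m_closed by fastforce
    qed
  qed
  show "x \<otimes> h \<otimes> inv x \<in> (\<Union>i \<in> I. S i)" if "x \<in> carrier G" "h \<in> (\<Union>i \<in> I. S i)" for x h
    using that assms(2) normal.inv_op_closed2 by fastforce
qed

lemma upper_radical_series_normal_mono:
  fixes r :: "'i rel"
  assumes wo: "Well_order r"
  shows "upper_radical_series G r j \<lhd> G \<and>
    (\<forall>i \<in> underS r j. radical_over G (upper_radical_series G r i) \<subseteq> upper_radical_series G r j)"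
    (is "?P j")
proof -
  have wo_rel: "wo_rel r" using wo by (simp add: wo_rel_def)
  note TOTALS = wo_rel.TOTALS[OF wo_rel] and TRANS = wo_rel.TRANS[OF wo_rel]
    and ANTISYM = wo_rel.ANTISYM[OF wo_rel] and REFL = wo_rel.REFL[OF wo_rel]
  let ?R = "upper_radical_series G r"
  show ?thesis
  proof (induction j rule: wo_rel.well_order_induct[OF wo_rel])
    case (1 j)
    then have IH: "?P i" if "i \<in> underS r j" for i
      using that by (auto simp: underS_def)
    have trans: "i \<in> underS r l" if "i \<in> underS r l'" "l' \<in> underS r l" for i l l'
      using that TRANS ANTISYM unfolding underS_def trans_def antisym_def by blast
    have mono: "?R i \<subseteq> ?R l" if "i \<in> underS r l" "l \<in> underS r j" for i l
      using that IH[OF that(2)] IH[OF trans[OF that]] subset_radical_over by blast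
    have total: "i = l \<or> i \<in> underS r l \<or> l \<in> underS r i"
      if "i \<in> underS r j" "l \<in> underS r j" for i l
    proof -
      have "i \<in> Field r" "l \<in> Field r"
        using that by (auto simp: underS_def Field_def)
      then show ?thesis
        using TOTALS unfolding underS_def by blast
    qed
    show ?case
    proof (cases "underS r j = {}")
      case True
      then show ?thesis
        using upper_radical_series_zero[OF wo True, of G] one_is_normal by simp
    next
      case ne: False
      show ?thesis
      proof (cases "\<exists>i. is_succ r i j")
        case True
        then obtain i where i: "is_succ r i j" ..
        have eq: "?R j = radical_over G (?R i)"
          by (rule upper_radical_series_succ[OF wo i])
        have ij: "i \<in> underS r j" by (rule is_succ_underS[OF wo i])
        have "radical_over G (?R l) \<subseteq> ?R j" if "l \<in> underS r j" for l
        proof (cases "l = i")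
          case False
          with that i have "l \<in> underS r i"
            by (auto simp: is_succ_def under_def underS_def)
          then have "radical_over G (?R l) \<subseteq> ?R i" using IH[OF ij] by blast
          also have "\<dots> \<subseteq> ?R j"
            unfolding eq using IH[OF ij] subset_radical_over by blast
          finally show ?thesis .
        qed (simp add: eq)
        then show ?thesis
          using IH[OF ij] radical_over_normal unfolding eq by blast
      next
        case False
        have eq: "?R j = (\<Union>i \<in> underS r j. ?R i)"
          by (rule upper_radical_series_limit[OF wo ne False])
        have "radical_over G (?R l) \<subseteq> ?R j" if l: "l \<in> underS r j" for l
        proof -
          have lf: "l \<in> Field r" and jf: "j \<in> Field r"
            using l by (auto simp: underS_def Field_def)
          have "underS r j \<noteq> under r l"
            using False lf jf unfolding is_succ_def by blast
          moreover have "under r l \<subseteq> underS r j"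
            using l TRANS ANTISYM unfolding underS_def under_def trans_def antisym_def by blast
          ultimately obtain m where m: "m \<in> underS r j" "m \<notin> under r l" by blast
          have "l \<noteq> m"
            using m lf REFL by (auto simp: under_def refl_on_def)
          then have "l \<in> underS r m"
            using total[OF l m(1)] m(2) by (auto simp: under_def underS_def)
          then have "radical_over G (?R l) \<subseteq> ?R m" using IH[OF m(1)] by blast
          then show ?thesis using m(1) eq by blast
        qed
        moreover have "?R j \<lhd> G"
          unfolding eq
        proof (rule normal_Union_chain[OF ne])
          show "?R i \<lhd> G" if "i \<in> underS r j" for i using IH[OF that] by blast
          show "?R i \<subseteq> ?R l \<or> ?R l \<subseteq> ?R i" if "i \<in> underS r j" "l \<in> underS r j" for i l
            using total[OF that] mono that by blast
        qed
        ultimately show ?thesis by blast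
      qed
    qed
  qed
qed

lemma upper_radical_series_stationary:
  fixes r :: "'i rel"
  assumes wo: "Well_order r"
    and i: "i \<in> Field r"
    and stat: "radical_over G (upper_radical_series G r i) = upper_radical_series G r i"
  shows "upper_radical_series G r j \<subseteq> upper_radical_series G r i"
proof -
  have wo_rel: "wo_rel r" using wo by (simp add: wo_rel_def)
  note TOTALS = wo_rel.TOTALS[OF wo_rel] and TRANS = wo_rel.TRANS[OF wo_rel]
    and ANTISYM = wo_rel.ANTISYM[OF wo_rel] and REFL = wo_rel.REFL[OF wo_rel]
  let ?R = "upper_radical_series G r"
  note NM = upper_radical_series_normal_mono[OF wo]
  have one: "\<one> \<in> ?R i"
    using NM normal_imp_subgroup subgroup.one_closed by blast
  show ?thesis
  proof (induction j rule: wo_rel.well_order_induct[OF wo_rel])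
    case (1 j)
    then have IH: "?R l \<subseteq> ?R i" if "l \<in> underS r j" for l
      using that by (auto simp: underS_def)
    show ?case
    proof (cases "underS r j = {}")
      case True
      then show ?thesis using upper_radical_series_zero[OF wo True, of G] one by simp
    next
      case ne: False
      show ?thesis
      proof (cases "\<exists>l. is_succ r l j")
        case True
        then obtain l where l: "is_succ r l j" ..
        have eq: "?R j = radical_over G (?R l)"
          by (rule upper_radical_series_succ[OF wo l])
        have lf: "l \<in> Field r" using l by (simp add: is_succ_def)
        consider "l = i" | "l \<in> underS r i" | "i \<in> underS r l"
          using TOTALS lf i unfolding underS_def by blast
        then show ?thesis
        proof cases
          case 3
          then have "?R i \<subseteq> ?R l" using NM subset_radical_over by blast
          then have "?R l = ?R i" using IH[OF is_succ_underS[OF wo l]] by blast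
          then show ?thesis using eq stat by simp
        qed (use eq stat NM in auto)
      next
        case False
        then show ?thesis using upper_radical_series_limit[OF wo ne False, of G] IH by blast
      qed
    qed
  qed
qed

lemma solvable_radical_terminal:
  "\<exists>i \<in> Field (series_index G).
     solvable_radical G = upper_radical_series G (series_index G) i \<and>
     radical_over G (solvable_radical G) = solvable_radical G"
proof -
  let ?r = "series_index G"
  let ?R = "upper_radical_series G ?r"
  have co: "Card_order ?r" by (rule cardSuc_Card_order) (rule card_of_Card_order)
  then have wo: "Well_order ?r" by (simp add: card_order_on_def)
  note TOTALS = wo_rel.TOTALS[OF wo_rel.intro[OF wo]]
  note NM = upper_radical_series_normal_mono[OF wo]
  have "\<exists>i \<in> Field ?r. radical_over G (?R i) = ?R i"
  proof (rule ccontr)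
    assume "\<not> ?thesis"
    then have "\<forall>i \<in> Field ?r. \<exists>x. x \<in> radical_over G (?R i) - ?R i"
      using NM subset_radical_over by blast
    then obtain f where f: "\<And>i. i \<in> Field ?r \<Longrightarrow> f i \<in> radical_over G (?R i) - ?R i"
      by metis
    have *: "f i \<noteq> f j" if "i \<in> underS ?r j" "i \<in> Field ?r" "j \<in> Field ?r" for i j
    proof -
      have "f i \<in> ?R j" using f[OF that(2)] NM[of j] that(1) by auto
      then show ?thesis using f[OF that(3)] by auto
    qed
    have "inj_on f (Field ?r)"
    proof (rule inj_onI, rule ccontr)
      fix i j assume ij: "i \<in> Field ?r" "j \<in> Field ?r" "f i = f j" "i \<noteq> j"
      then have "i \<in> underS ?r j \<or> j \<in> underS ?r i"
        using TOTALS unfolding underS_def by blast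
      then show False using * ij by metis
    qed
    moreover have "f ` Field ?r \<subseteq> carrier G"
      using f by (auto simp: radical_over_def)
    ultimately have "ordLeq3 (card_of (Field ?r)) (card_of (carrier G))"
      using card_of_ordLeq by blast
    then have "ordLeq3 ?r (card_of (carrier G))"
      using card_of_Field_ordIso[OF co] ordIso_symmetric ordIso_ordLeq_trans by blast
    moreover have "ordLess2 (card_of (carrier G)) ?r"
      by (rule cardSuc_greater) (rule card_of_Card_order)
    ultimately show False using not_ordLess_ordLeq by blast
  qed
  then obtain i where i: "i \<in> Field ?r" "radical_over G (?R i) = ?R i" by blast
  have "solvable_radical G = ?R i"
    unfolding solvable_radical_def
    using upper_radical_series_stationary[OF wo i] i(1) by blast
  then show ?thesis using i by metis
qed

end

end

theory Submission
 imports Defs "HOL-Algebra.Algebraic_Closure" "HOL-Algebra.UnivPoly" "HOL-Algebra.Zassenhaus"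
begin

text \<open>
 Embed \<open>G\<close> into the units of the PI-algebra \<open>A\<close> and let \<open>L\<close> be the largest locally nilpotent ideal
 of \<open>A\<close>. A nil left ideal of a PI-ring lies in \<open>L\<close>, and a non-nilpotent element survives in a
 simple module over the polynomial ring in one central indeterminate, whose dimension over a
 maximal subfield is bounded by the degree of the identity. Hence \<open>A/L\<close> embeds into a product of
 matrix rings of bounded size over algebraically closed fields, while \<open>G \<inter> (1 + L)\<close> is locally
 nilpotent.

 By Zassenhaus' theorem solvable matrix groups of bounded size have bounded derived length. So some
 term of the derived series of the radical lies in \<open>G \<inter> (1 + L)\<close>, which makes its elements
 quasi-nil. Conversely, by induction on \<open>k\<close> a quasi-nil element is Engel modulo the radical, and a
 conjugation-invariant set of Engel elements in a matrix group generates a solvable subgroup modulo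
 a solvable normal one. The latter is Baer's argument on intersections of maximal solvable
 subsets, where the finiteness needed comes from closing subsets under polynomial equations of
 bounded degree in the matrix entries; the degrees suffice because the derived length is bounded.
\<close>

section \<open>Conjugation, commutators and derived series\<close>

text \<open>Everything hinges on one bound \<open>f = zassenhaus_bound d\<close> that depends only
  on the degree of the identity. The representations of \<open>A/L\<close> are infinitely many and
  live over different fields, so what holds modulo each kernel passes to the intersection only if
  one derived length serves for all of them. The bound also keeps the derived length from growing
  when solvable normal subgroups are multiplied, and at matrix size \<open>n\<close> it fixes the
  degree \<open>2 ^ zassenhaus_bound n\<close> of the equations: a commutator is quadratic in each
  argument, so each derivation halves the degree, which ends at 1, where the kernel is cut out.

  The indeterminate turns non-nilpotence into properness: b (1 - x t) = 1 would force b to be the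
  geometric series of x t. In simple modules over \<open>A\<close> itself a non-nilpotent element of
  the Jacobson radical would be lost.

  The quasi-nil length of a radical element is \<open>f + 1\<close>: \<open>f\<close> entries with
  exponent 2 push it down the derived series into \<open>G \<inter> (1 + L)\<close>, and only the
  last exponent varies with the entries, since local nilpotence gives no common class.\<close>

definition conjg :: "('g, 'm) monoid_scheme => 'g => 'g => 'g"
 where "conjg G g x = inv\<^bsub>G\<^esub> g \<otimes>\<^bsub>G\<^esub> x \<otimes>\<^bsub>G\<^esub> g"

text \<open>Proved for commutative monoids so that, read as \<open>add.finprod_swap\<close>, it
  interchanges finite sums in rings and modules.\<close>

lemma (in comm_monoid) finprod_swap:
 assumes "finite A" "finite B" "\<And>x y. x \<in> A ==> y \<in> B ==> f x y \<in> carrier G"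
 shows "(\<Otimes>x \<in> A. \<Otimes>y \<in> B. f x y) = (\<Otimes>y \<in> B. \<Otimes>x \<in> A. f x y)"
 using assms(1,3)
proof (induction A rule: finite_induct)
 case (insert a A)
 have "(\<Otimes>x \<in> insert a A. \<Otimes>y \<in> B. f x y) = (\<Otimes>y \<in> B. f a y) \<otimes> (\<Otimes>y \<in> B. \<Otimes>x \<in> A. f x y)"
  using insert by (subst finprod_insert) auto
 also have "\<dots> = (\<Otimes>y \<in> B. f a y \<otimes> (\<Otimes>x \<in> A. f x y))"
  using insert by (intro finprod_multf[symmetric]) auto
 also have "\<dots> = (\<Otimes>y \<in> B. \<Otimes>x \<in> insert a A. f x y)"
  using insert by (intro finprod_cong') (auto intro!: finprod_insert[symmetric])
 finally show ?case .
qed simp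

context group
begin

lemma cancel_left [simp]:
 assumes "x \<in> carrier G" "y \<in> carrier G"
 shows "x \<otimes> (inv x \<otimes> y) = y" "inv x \<otimes> (x \<otimes> y) = y"
 using assms by (simp_all flip: m_assoc)

lemmas grp = m_assoc inv_mult_group comm_def conjg_def

lemma conjg_closed [simp]: "g \<in> carrier G ==> x \<in> carrier G ==> conjg G g x \<in> carrier G"
 by (simp add: conjg_def)

lemma comm_closed [simp]: "x \<in> carrier G ==> y \<in> carrier G ==> comm G x y \<in> carrier G"
 by (simp add: comm_def)

lemma engel_closed [simp]: "x \<in> carrier G ==> y \<in> carrier G ==> engel G n x y \<in> carrier G"
 by (induction n) auto

lemma conjg_one [simp]: "x \<in> carrier G ==> conjg G \<one> x = x"
 by (simp add: conjg_def)

lemma conjg_inv_conjg [simp]: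
 assumes "g \<in> carrier G" "x \<in> carrier G"
 shows "conjg G g (conjg G (inv g) x) = x" "conjg G (inv g) (conjg G g x) = x"
 using assms by (simp_all add: grp)

lemma inj_conjg: "g \<in> carrier G ==> inj_on (conjg G g) (carrier G)"
 by (metis conjg_inv_conjg(2) inj_onI)

lemma conjg_image_inv:
 assumes "g \<in> carrier G" "S \<subseteq> carrier G"
 shows "conjg G (inv g) ` conjg G g ` S = S"
proof -
 have "(\<lambda>x. conjg G (inv g) (conjg G g x)) ` S = (\<lambda>x. x) ` S"
  using assms by (intro image_cong) auto
 then show ?thesis by (simp add: image_image)
qed

lemma conjg_mult_left:
 "[|g \<in> carrier G; h \<in> carrier G; x \<in> carrier G|] ==> conjg G (g \<otimes> h) x = conjg G h (conjg G g x)"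
 by (simp add: grp)

lemma conjg_mult:
 "[|g \<in> carrier G; x \<in> carrier G; y \<in> carrier G|]
  ==> conjg G g (x \<otimes> y) = conjg G g x \<otimes> conjg G g y"
 by (simp add: grp)

lemma conjg_inv:
 "[|g \<in> carrier G; x \<in> carrier G|] ==> conjg G g (inv x) = inv (conjg G g x)"
 by (simp add: grp)

lemma conjg_eq_mult_comm:
 "[|g \<in> carrier G; x \<in> carrier G|] ==> conjg G g x = x \<otimes> comm G x g"
 by (simp add: grp)

lemma conjg_eq_mult_inv_comm:
 "[|g \<in> carrier G; x \<in> carrier G|] ==> conjg G g x = x \<otimes> inv (comm G g x)"
 by (simp add: grp)

lemma comm_eq_inv_mult_conjg:
 "[|x \<in> carrier G; y \<in> carrier G|] ==> comm G x y = inv x \<otimes> conjg G y x"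
 by (simp add: grp)

lemma normal_conjg: "N \<lhd> G ==> g \<in> carrier G ==> x \<in> N ==> conjg G g x \<in> N"
 unfolding conjg_def by (rule normal.inv_op_closed1)

lemma normalI_conjg:
 assumes "subgroup N G" "\<And>g x. g \<in> carrier G ==> x \<in> N ==> conjg G g x \<in> N"
 shows "N \<lhd> G"
 unfolding normal_inv_iff
proof (intro conjI ballI assms(1))
 fix x h assume "x \<in> carrier G" "h \<in> N"
 then show "x \<otimes> h \<otimes> inv x \<in> N"
  using assms(2)[of "inv x" h] by (simp add: conjg_def)
qed

lemma normal_comm_left: "N \<lhd> G ==> x \<in> N ==> y \<in> carrier G ==> comm G x y \<in> N"
 by (metis comm_eq_inv_mult_conjg normal_conjg normal_imp_subgroup subgroup.m_closed
   subgroup.m_inv_closed subgroup.mem_carrier)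

lemma comm_inv: "[|x \<in> carrier G; y \<in> carrier G|] ==> inv (comm G x y) = comm G y x"
 by (simp add: grp)

lemma normal_comm_right: "N \<lhd> G ==> x \<in> carrier G ==> y \<in> N ==> comm G x y \<in> N"
 by (metis comm_inv normal_comm_left normal_imp_subgroup subgroup.m_inv_closed subgroup.mem_carrier)

text \<open>The generating sets on the two sides may differ; this moves the group of a conjugate of
  a set \<open>F\<close> back to the group of \<open>F\<close>.\<close>

lemma conjg_generate:
 assumes "g \<in> carrier G" "S \<subseteq> carrier G" "\<And>s. s \<in> S ==> conjg G g s \<in> generate G T"
  "T \<subseteq> carrier G" "x \<in> generate G S"
 shows "conjg G g x \<in> generate G T"
 using assms(5)
proof induction
 case one
 then show ?case using assms(1) by (simp add: conjg_def generate.one)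
next
 case (inv h)
 then show ?case
  using assms generate_m_inv_closed[OF assms(4)] by (simp add: conjg_inv subsetD)
next
 case (eng h1 h2)
 then have "h1 \<in> carrier G" "h2 \<in> carrier G" using assms(2) generate_in_carrier by auto
 then show ?case using eng assms(1) generate.eng by (simp add: conjg_mult)
qed (use assms in auto)

lemma conjg_derived:
 assumes g: "g \<in> carrier G" and S: "S \<subseteq> carrier G"
  and closed: "\<And>x. x \<in> S ==> conjg G g x \<in> S" and x: "x \<in> derived G S"
 shows "conjg G g x \<in> derived G S"
 unfolding derived_def
proof (rule conjg_generate[OF g _ _ _ x[unfolded derived_def]])
 show "derived_set G S \<subseteq> carrier G" by (rule derived_set_in_carrier[OF S])
 then show "derived_set G S \<subseteq> carrier G" .
 fix s assume "s \<in> derived_set G S"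
 then obtain a b where ab: "a \<in> S" "b \<in> S" and s: "s = a \<otimes> b \<otimes> inv a \<otimes> inv b" by auto
 have "a \<in> carrier G" "b \<in> carrier G" using ab S by auto
 then have "conjg G g s
   = conjg G g a \<otimes> conjg G g b \<otimes> inv (conjg G g a) \<otimes> inv (conjg G g b)"
  using g by (simp add: s grp)
 then show "conjg G g s \<in> generate G (derived_set G S)"
  using ab closed by (intro generate.incl) auto
qed

lemma conjg_exp_derived:
 assumes "g \<in> carrier G" "S \<subseteq> carrier G" "\<And>x. x \<in> S ==> conjg G g x \<in> S"
 shows "x \<in> (derived G ^^ n) S ==> conjg G g x \<in> (derived G ^^ n) S"
proof (induction n arbitrary: x)
 case (Suc n)
 then show ?case
  using conjg_derived[OF assms(1) exp_of_derived_in_carrier[OF assms(2)]] by simp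
qed (use assms in simp)

lemma normal_exp_derived: "N \<lhd> G ==> (derived G ^^ n) N \<lhd> G"
 by (induction n) (simp_all add: derived_is_normal)

lemma comm_in_derived:
 assumes "subgroup H G" "x \<in> H" "y \<in> H"
 shows "comm G x y \<in> derived G H"
proof -
 have "inv x \<in> H" "inv y \<in> H" "x \<in> carrier G" "y \<in> carrier G"
  using assms subgroup.m_inv_closed subgroup.mem_carrier by metis+
 then have "comm G x y = inv x \<otimes> inv y \<otimes> inv (inv x) \<otimes> inv (inv y)"
  by (simp add: comm_def)
 then have "comm G x y \<in> derived_set G H"
  using `inv x \<in> H` `inv y \<in> H` by blast
 then show ?thesis
  unfolding derived_def by (rule generate.incl)
qed

text \<open>The set \<open>derived_set\<close> consists of the elements a b a^-1 b^-1, which are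
  \<open>comm\<close> at a^-1 and b^-1. In this form the commutators can be checked in the
  convention of \<open>comm\<close>.\<close>

lemma derived_subsetI:
 assumes H: "subgroup H G" and K: "subgroup K G"
  and comm: "\<And>x y. x \<in> H ==> y \<in> H ==> comm G x y \<in> K"
 shows "derived G H \<subseteq> K"
 unfolding derived_def
proof (rule generate_subgroup_incl[OF _ K], clarify)
 fix a b assume ab: "a \<in> H" "b \<in> H"
 then have "a \<in> carrier G" "b \<in> carrier G" using H by (auto intro: subgroup.mem_carrier)
 then show "a \<otimes> b \<otimes> inv a \<otimes> inv b \<in> K"
  using comm[of "inv a" "inv b"] ab subgroup.m_inv_closed[OF H] by (fastforce simp: comm_def)
qed

lemma derived_subset_subgroup: "subgroup H G ==> derived G H \<subseteq> H"
 by (rule derived_incl[OF subset_refl])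

lemma exp_derived_antimono:
 assumes "subgroup H G" "m \<le> n"
 shows "(derived G ^^ n) H \<subseteq> (derived G ^^ m) H"
 using assms(2)
proof (induction n rule: dec_induct)
 case (step n)
 then show ?case
  using derived_subset_subgroup[OF exp_of_derived_is_subgroup[OF assms(1)]] by fastforce
qed simp

lemma exp_derived_add: "(derived G ^^ (m + n)) H = (derived G ^^ m) ((derived G ^^ n) H)"
 by (simp add: funpow_add)

lemma exp_derived_mono:
 "subgroup K G ==> H \<subseteq> K ==> (derived G ^^ n) H \<subseteq> (derived G ^^ n) K"
 by (simp add: mono_exp_of_derived subgroup.subset)

end

section \<open>Linear algebra\<close>

text \<open>Gaussian elimination, by induction on the set \<open>E\<close> of equations, with the
  unknowns indexed by \<open>J\<close>. The bounds for vector spaces and for spaces of polynomial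
  functions all come from it.\<close>

lemma (in field) homogeneous_system:
 assumes "finite E" "finite J" "card E < card J"
  and "\<And>x i. x \<in> J ==> i \<in> E ==> f x i \<in> carrier R"
 shows "\<exists>c. (\<forall>x \<in> J. c x \<in> carrier R) \<and> (\<exists>x \<in> J. c x \<noteq> \<zero>) \<and>
  (\<forall>i \<in> E. (\<Oplus>x \<in> J. c x \<otimes> f x i) = \<zero>)"
 using assms
proof (induction E arbitrary: J f rule: finite_induct)
 case empty
 then have "J \<noteq> {}" by auto
 then obtain x where "x \<in> J" by blast
 then show ?case by (intro exI[of _ "\<lambda>_. \<one>"]) auto
next
 case (insert e E)
 note car = insert.prems(3)
 show ?case
 proof (cases "\<forall>x \<in> J. f x e = \<zero>")
  case True
  have "\<exists>c. (\<forall>x \<in> J. c x \<in> carrier R) \<and> (\<exists>x \<in> J. c x \<noteq> \<zero>) \<and>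
    (\<forall>i \<in> E. (\<Oplus>x \<in> J. c x \<otimes> f x i) = \<zero>)"
   using insert.prems insert.hyps by (intro insert.IH) auto
  then obtain c where c: "\<forall>x \<in> J. c x \<in> carrier R" "\<exists>x \<in> J. c x \<noteq> \<zero>"
   "\<forall>i \<in> E. (\<Oplus>x \<in> J. c x \<otimes> f x i) = \<zero>" by blast
  have "(\<Oplus>x \<in> J. c x \<otimes> f x e) = (\<Oplus>x \<in> J. \<zero>)"
   using True c(1) by (intro finsum_cong') auto
  then show ?thesis using c by auto
 next
  case False
  then obtain y where y: "y \<in> J" "f y e \<noteq> \<zero>" by auto
  define p where "p = inv (f y e)"
  have fy: "f y e \<in> carrier R" using car y by auto
  then have p: "p \<in> carrier R" "p \<otimes> f y e = \<one>"
   using y(2) field_Units unfolding p_def by auto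
  let ?J = "J - {y}"
  \<comment> \<open>Adding \<open>f x e\<close> times \<open>q\<close> to the column of
    \<open>x\<close> clears its entry in equation \<open>e\<close>; the unknown of the pivot
    \<open>y\<close> is recovered afterwards as \<open>\<ominus> (S e \<otimes> p)\<close>.\<close>
  define q where "q i = \<ominus> (p \<otimes> f y i)" for i
  have q: "q i \<in> carrier R" if "i \<in> insert e E" for i using that car y p by (simp add: q_def)
  have "\<exists>c. (\<forall>x \<in> ?J. c x \<in> carrier R) \<and> (\<exists>x \<in> ?J. c x \<noteq> \<zero>) \<and>
    (\<forall>i \<in> E. (\<Oplus>x \<in> ?J. c x \<otimes> (f x i \<oplus> f x e \<otimes> q i)) = \<zero>)"
   using insert.prems insert.hyps y q by (intro insert.IH) auto
  then obtain c where c: "\<And>x. x \<in> ?J ==> c x \<in> carrier R" "\<exists>x \<in> ?J. c x \<noteq> \<zero>"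
   "\<And>i. i \<in> E ==> (\<Oplus>x \<in> ?J. c x \<otimes> (f x i \<oplus> f x e \<otimes> q i)) = \<zero>" by blast
  define S where "S i = (\<Oplus>x \<in> ?J. c x \<otimes> f x i)" for i
  have cf: "c x \<otimes> f x i \<in> carrier R" if "x \<in> ?J" "i \<in> insert e E" for x i
   using that c(1) car by auto
  have S: "S i \<in> carrier R" if "i \<in> insert e E" for i
   unfolding S_def using cf[OF _ that] by (intro finsum_closed) auto
  define d where "d x = (if x = y then \<ominus> (S e \<otimes> p) else c x)" for x
  have d: "d x \<in> carrier R" if "x \<in> J" for x
   using that c(1) S[of e] p by (auto simp: d_def)
  have sum: "(\<Oplus>x \<in> J. d x \<otimes> f x i) = \<ominus> (S e \<otimes> p) \<otimes> f y i \<oplus> S i" if i: "i \<in> insert e E" for i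
  proof -
   have "(\<Oplus>x \<in> J. d x \<otimes> f x i) = (\<Oplus>x \<in> insert y ?J. d x \<otimes> f x i)"
    using y by (simp add: insert_absorb)
   also have "\<dots> = d y \<otimes> f y i \<oplus> (\<Oplus>x \<in> ?J. d x \<otimes> f x i)"
    using insert.prems(1) d car[OF _ i] y by (intro finsum_insert) auto
   also have "(\<Oplus>x \<in> ?J. d x \<otimes> f x i) = S i"
    unfolding S_def using cf[OF _ i] by (intro finsum_cong') (auto simp: d_def)
   finally show ?thesis by (simp add: d_def)
  qed
  have "(\<Oplus>x \<in> J. d x \<otimes> f x i) = \<zero>" if i: "i \<in> insert e E" for i
  proof (cases "i = e")
   case True
   have "\<ominus> (S e \<otimes> p) \<otimes> f y e = \<ominus> S e"
    using S[of e] p fy by (simp add: l_minus m_assoc)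
   then show ?thesis using sum[OF i] True S[of e] by (simp add: l_neg)
  next
   case False
   then have iE: "i \<in> E" using i by simp
   have "\<zero> = (\<Oplus>x \<in> ?J. c x \<otimes> f x i \<oplus> (c x \<otimes> f x e) \<otimes> q i)"
    using c(1) car iE q[OF i]
    by (subst c(3)[OF iE, symmetric], intro finsum_cong') (auto simp: r_distr m_assoc)
   also have "\<dots> = S i \<oplus> (\<Oplus>x \<in> ?J. (c x \<otimes> f x e) \<otimes> q i)"
    unfolding S_def using cf[OF _ i] cf[of _ e] q[OF i] by (intro finsum_addf) auto
   also have "(\<Oplus>x \<in> ?J. (c x \<otimes> f x e) \<otimes> q i) = S e \<otimes> q i"
    unfolding S_def using insert.prems(1) cf[of _ e] q[OF i]
    by (intro finsum_ldistr[symmetric]) auto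
   also have "S e \<otimes> q i = \<ominus> (S e \<otimes> p) \<otimes> f y i"
    using S[of e] p car[OF y(1) i] by (simp add: q_def l_minus r_minus m_assoc)
   finally show ?thesis using sum[OF i] S[OF i] S[of e] p car[OF y(1) i] by (simp add: a_comm)
  qed
  moreover have "\<exists>x \<in> J. d x \<noteq> \<zero>" using c(2) by (auto simp: d_def)
  ultimately show ?thesis using d by blast
 qed
qed

text \<open>Dedekind's independence argument: \<open>Rel\<close> is a space of linear relations between objects on
 which \<open>b \<in> Y\<close> acts with pairwise different characters \<open>\<chi> x\<close>.\<close>

lemma (in field) independence_of_characters:
 assumes "finite J"
  and chi: "\<And>x b. x \<in> J ==> b \<in> Y ==> \<chi> x b \<in> carrier R"
  and diff: "\<And>x y. x \<in> J ==> y \<in> J ==> x \<noteq> y ==> \<exists>b \<in> Y. \<chi> x b \<noteq> \<chi> y b"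
  and Rel_car: "\<And>c x. Rel c ==> x \<in> J ==> c x \<in> carrier R"
  and Rel_diff: "\<And>c k b. Rel c ==> b \<in> Y ==> k \<in> carrier R ==> Rel (\<lambda>x. c x \<otimes> (\<chi> x b \<ominus> k))"
  and Rel_single: "\<And>c x. Rel c ==> x \<in> J ==> c x \<noteq> \<zero> ==> (\<And>y. y \<in> J ==> y \<noteq> x ==> c y = \<zero>) ==> False"
  and "Rel c" "x \<in> J"
 shows "c x = \<zero>"
 using `Rel c` `x \<in> J`
proof (induction "card {y \<in> J. c y \<noteq> \<zero>}" arbitrary: c x rule: less_induct)
 case less
 show ?case
 proof (rule ccontr)
  assume cx: "c x \<noteq> \<zero>"
  then obtain y where y: "y \<in> J" "y \<noteq> x" "c y \<noteq> \<zero>"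
   using Rel_single[OF less.prems cx] by blast
  then obtain b where b: "b \<in> Y" "\<chi> x b \<noteq> \<chi> y b" using diff[of x y] less.prems(2) by metis
  \<comment> \<open>The new factor vanishes at \<open>x\<close> and not at \<open>y\<close>, so the
    support of the relation shrinks while \<open>y\<close> stays in it.\<close>
  let ?c = "\<lambda>z. c z \<otimes> (\<chi> z b \<ominus> \<chi> x b)"
  have Rel: "Rel ?c" using less.prems b chi by (intro Rel_diff) auto
  have "?c x = \<zero>" using less.prems b chi Rel_car by (simp add: a_minus_def r_neg)
  moreover have "c z \<noteq> \<zero>" if "?c z \<noteq> \<zero>" "z \<in> J" for z
   using that chi b less.prems by (auto)
  ultimately have "{z \<in> J. ?c z \<noteq> \<zero>} \<subset> {z \<in> J. c z \<noteq> \<zero>}"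
   using cx less.prems(2) by auto
  then have "card {z \<in> J. ?c z \<noteq> \<zero>} < card {z \<in> J. c z \<noteq> \<zero>}"
   using `finite J` by (intro psubset_card_mono) auto
  from less.hyps[OF this Rel y(1)] have "?c y = \<zero>" .
  moreover have "\<chi> y b \<ominus> \<chi> x b \<noteq> \<zero>"
   using b chi y(1) less.prems(2) by (auto simp: r_right_minus_eq)
  moreover have "\<chi> y b \<ominus> \<chi> x b \<in> carrier R" "c y \<in> carrier R"
   using b chi y(1) less.prems Rel_car by auto
  ultimately show False using y(3) integral by blast
 qed
qed

section \<open>Linear group actions on subquotients of a vector space\<close>

locale linear_action = K: field K + V: Module.module K V + G: group G
 for K :: "('k, 'r) ring_scheme" (structure) and V :: "('k, 'v, 'm) module_scheme"
  and G :: "('g, 'n) monoid_scheme" +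
 fixes act :: "'g => 'v => 'v"
 assumes act_closed [simp]: "g \<in> carrier G ==> v \<in> carrier V ==> act g v \<in> carrier V"
  and act_add: "g \<in> carrier G ==> v \<in> carrier V ==> w \<in> carrier V ==>
   act g (v \<oplus>\<^bsub>V\<^esub> w) = act g v \<oplus>\<^bsub>V\<^esub> act g w"
  and act_smult: "g \<in> carrier G ==> c \<in> carrier K ==> v \<in> carrier V ==>
   act g (c \<odot>\<^bsub>V\<^esub> v) = c \<odot>\<^bsub>V\<^esub> act g v"
  and act_mult: "g \<in> carrier G ==> h \<in> carrier G ==> v \<in> carrier V ==>
   act (g \<otimes>\<^bsub>G\<^esub> h) v = act g (act h v)"
  and act_one [simp]: "v \<in> carrier V ==> act \<one>\<^bsub>G\<^esub> v = v"
begin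

abbreviation vadd (infixl "+\<^sub>V" 65) where "vadd \<equiv> add V"
abbreviation vdiff (infixl "-\<^sub>V" 65) where "vdiff \<equiv> a_minus V"
abbreviation scale (infixl "\<bullet>" 70) where "scale \<equiv> smult V"
abbreviation vzero ("0\<^sub>V") where "vzero \<equiv> zero V"


definition subsp :: "'v set => bool"
 where "subsp W \<longleftrightarrow> W \<subseteq> carrier V \<and> 0\<^sub>V \<in> W \<and> (\<forall>x \<in> W. \<forall>y \<in> W. x +\<^sub>V y \<in> W) \<and>
  (\<forall>c \<in> carrier K. \<forall>x \<in> W. c \<bullet> x \<in> W)"

text \<open>A subquotient \<open>W2/W1\<close> is treated through congruence modulo
  \<open>W1\<close> of vectors in \<open>W2\<close>, so that inductions can move both ends without
  changing the type or the action.\<close>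

definition eqm :: "'v set => 'v => 'v => bool"
 where "eqm W x y \<longleftrightarrow> x \<in> carrier V \<and> y \<in> carrier V \<and> x -\<^sub>V y \<in> W"

definition stab :: "'g set => 'v set => bool"
 where "stab H W \<longleftrightarrow> H \<subseteq> carrier G \<and> (\<forall>g \<in> H. \<forall>w \<in> W. act g w \<in> W)"

lemma subspD:
 assumes "subsp W"
 shows "W \<subseteq> carrier V" "x \<in> W ==> x \<in> carrier V" "0\<^sub>V \<in> W"
  "x \<in> W ==> y \<in> W ==> x +\<^sub>V y \<in> W"
  "c \<in> carrier K ==> x \<in> W ==> c \<bullet> x \<in> W"
  "x \<in> W ==> \<ominus>\<^bsub>V\<^esub> x \<in> W"
  "x \<in> W ==> y \<in> W ==> x -\<^sub>V y \<in> W"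
proof -
 show 1: "W \<subseteq> carrier V" "0\<^sub>V \<in> W" "x \<in> W ==> y \<in> W ==> x +\<^sub>V y \<in> W"
  "c \<in> carrier K ==> x \<in> W ==> c \<bullet> x \<in> W" for x y c
  using assms by (auto simp: subsp_def)
 show 2: "x \<in> W ==> x \<in> carrier V" for x using 1 by auto
 show 3: "x \<in> W ==> \<ominus>\<^bsub>V\<^esub> x \<in> W" for x
  using 1(4)[of "\<ominus> \<one>" x] 2[of x] by (simp add: V.smult_l_minus)
 show "x \<in> W ==> y \<in> W ==> x -\<^sub>V y \<in> W"
  using 1 3 by (simp add: a_minus_def)
qed

lemma smult_finsum:
 assumes "c \<in> carrier K" "f \<in> J \<rightarrow> carrier V"
 shows "c \<bullet> (\<Oplus>\<^bsub>V\<^esub>x \<in> J. f x) = (\<Oplus>\<^bsub>V\<^esub>x \<in> J. c \<bullet> f x)"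
 using assms(2)
proof (induction J rule: infinite_finite_induct)
 case (insert x J)
 then have "f \<in> J \<rightarrow> carrier V" "f x \<in> carrier V" by auto
 then show ?case using insert assms(1) by (simp add: V.finsum_insert V.smult_r_distr Pi_def)
qed (simp_all add: assms(1) V.finsum_infinite)

lemma subsp_finsum:
 assumes W: "subsp W" and f: "f \<in> J \<rightarrow> W"
 shows "(\<Oplus>\<^bsub>V\<^esub>x \<in> J. f x) \<in> W"
 using f
proof (induction J rule: infinite_finite_induct)
 case (insert x J)
 then have "f \<in> J \<rightarrow> carrier V" "f x \<in> carrier V" using subspD(1)[OF W] by (auto simp: Pi_def)
 then show ?case using insert subspD[OF W] by (simp add: V.finsum_insert)
qed (simp_all add: subspD[OF W] V.finsum_infinite)

lemma eqm_carrier: "eqm W x y ==> x \<in> carrier V" "eqm W x y ==> y \<in> carrier V"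
 by (auto simp: eqm_def)

lemma eqm_refl [simp]: "subsp W ==> x \<in> carrier V ==> eqm W x x"
 by (simp add: eqm_def subspD V.r_neg a_minus_def)

lemma eqm_sym: "subsp W ==> eqm W x y ==> eqm W y x"
 using subspD(6)[of W "x -\<^sub>V y"]
 by (auto simp: eqm_def a_minus_def V.minus_add V.a_comm)

lemma eqm_trans [trans]:
 assumes "eqm W x y" "eqm W y z" "subsp W"
 shows "eqm W x z"
proof -
 have "x -\<^sub>V z = (x -\<^sub>V y) +\<^sub>V (y -\<^sub>V z)"
  using assms by (simp add: eqm_def a_minus_def V.a_assoc V.r_neg1)
 then show ?thesis using assms subspD(4) by (auto simp: eqm_def)
qed

lemma eqm_add:
 assumes "subsp W" "eqm W x y" "eqm W x' y'"
 shows "eqm W (x +\<^sub>V x') (y +\<^sub>V y')"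
proof -
 have "(x +\<^sub>V x') -\<^sub>V (y +\<^sub>V y') = (x -\<^sub>V y) +\<^sub>V (x' -\<^sub>V y')"
  using assms by (simp add: eqm_def a_minus_def V.minus_add V.a_ac)
 then show ?thesis using assms subspD(4) by (auto simp: eqm_def)
qed

lemma eqm_smult:
 assumes "subsp W" "eqm W x y" "c \<in> carrier K"
 shows "eqm W (c \<bullet> x) (c \<bullet> y)"
proof -
 have "c \<bullet> x -\<^sub>V c \<bullet> y = c \<bullet> (x -\<^sub>V y)"
  using assms by (simp add: eqm_def a_minus_def V.smult_r_distr V.smult_r_minus)
 then show ?thesis using assms subspD(5) by (auto simp: eqm_def)
qed

lemma act_minus:
 assumes "g \<in> carrier G" "x \<in> carrier V"
 shows "act g (\<ominus>\<^bsub>V\<^esub> x) = \<ominus>\<^bsub>V\<^esub> act g x"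
 using act_smult[OF assms(1) _ assms(2), of "\<ominus> \<one>"] assms by (simp add: V.smult_l_minus)

lemma act_zero [simp]: "g \<in> carrier G ==> act g 0\<^sub>V = 0\<^sub>V"
 using act_smult[of g \<zero> "0\<^sub>V"] by simp

lemma act_finsum:
 assumes "g \<in> carrier G" "f \<in> J \<rightarrow> carrier V"
 shows "act g (\<Oplus>\<^bsub>V\<^esub>x \<in> J. f x) = (\<Oplus>\<^bsub>V\<^esub>x \<in> J. act g (f x))"
 using assms(2)
proof (induction J rule: infinite_finite_induct)
 case (insert x J)
 then have "f \<in> J \<rightarrow> carrier V" "f x \<in> carrier V" by auto
 then show ?case using insert assms(1) by (simp add: V.finsum_insert act_add Pi_def)
qed (simp_all add: assms(1) V.finsum_infinite)

lemma eqm_act: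
 assumes "stab H W" "eqm W x y" "g \<in> H"
 shows "eqm W (act g x) (act g y)"
proof -
 have g: "g \<in> carrier G" using assms by (auto simp: stab_def)
 then have "act g x -\<^sub>V act g y = act g (x -\<^sub>V y)"
  using assms by (simp add: eqm_def a_minus_def act_add act_minus)
 then show ?thesis using assms g by (auto simp: eqm_def stab_def)
qed

lemma eqm_memI: "subsp U ==> W \<subseteq> U ==> eqm W x y ==> y \<in> U ==> x \<in> U"
proof -
 assume a: "subsp U" "W \<subseteq> U" "eqm W x y" "y \<in> U"
 then have "(x -\<^sub>V y) +\<^sub>V y \<in> U" using subspD(4) by (auto simp: eqm_def)
 then show "x \<in> U" using a by (simp add: eqm_def a_minus_def V.a_assoc V.l_neg)
qed

lemma eqm_zero_iff:
 assumes "x \<in> carrier V"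
 shows "eqm W x 0\<^sub>V \<longleftrightarrow> x \<in> W"
proof -
 have "x -\<^sub>V 0\<^sub>V = x" unfolding a_minus_def using assms by simp
 then show ?thesis using assms by (simp add: eqm_def)
qed

lemma eqm_smult_zeroD:
 assumes "subsp W" "c \<in> carrier K" "c \<noteq> \<zero>" "c \<bullet> x \<in> W" "x \<in> carrier V"
 shows "x \<in> W"
proof -
 have "inv c \<in> carrier K" "inv c \<otimes> c = \<one>" using assms K.field_Units by auto
 then have "x = inv c \<bullet> (c \<bullet> x)"
  using assms by (simp flip: V.smult_assoc1)
 then show ?thesis using assms subspD(5) `inv c \<in> carrier K` by metis
qed

lemma eqm_smult_cancel:
 assumes "subsp W" "x \<in> carrier V" "x \<notin> W" "c \<in> carrier K" "c' \<in> carrier K"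
  "eqm W (c \<bullet> x) (c' \<bullet> x)"
 shows "c = c'"
proof (rule ccontr)
 assume "c \<noteq> c'"
 then have "c \<ominus> c' \<noteq> \<zero>" using assms by (simp add: K.r_right_minus_eq)
 moreover have "(c \<ominus> c') \<bullet> x \<in> W"
  using assms by (simp add: eqm_def a_minus_def V.smult_l_distr V.smult_l_minus)
 ultimately show False using eqm_smult_zeroD[OF assms(1), of "c \<ominus> c'" x] assms by auto
qed

text \<open>The dimension of \<open>W2/W1\<close> is bounded by the length of chains of subspaces.\<close>

definition dimle :: "'v set => 'v set => nat => bool"
 where "dimle W1 W2 m \<longleftrightarrow> (\<forall>U k. (\<forall>i \<le> k. subsp (U i)) \<and> W1 \<subseteq> U 0 \<and> U k \<subseteq> W2 \<and>
  (\<forall>i < k. U i \<subset> U (Suc i)) --> k \<le> m)"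

text \<open>A chain above \<open>U\<close> becomes longer by one when \<open>W1\<close> is put in
  front of it; \<open>dimle_below\<close> appends \<open>W2\<close> in the same way.\<close>

lemma dimle_above:
 assumes "dimle W1 W2 (Suc m)" "subsp W1" "W1 \<subset> U"
 shows "dimle U W2 m"
 unfolding dimle_def
proof (intro allI impI, elim conjE)
 fix C :: "nat => 'v set" and k
 assume C: "\<forall>i \<le> k. subsp (C i)" "U \<subseteq> C 0" "C k \<subseteq> W2" "\<forall>i < k. C i \<subset> C (Suc i)"
 define D where "D i = (case i of 0 => W1 | Suc j => C j)" for i
 have "\<forall>i \<le> Suc k. subsp (D i)" "W1 \<subseteq> D 0" "D (Suc k) \<subseteq> W2"
  using C assms by (auto simp: D_def split: nat.split)
 moreover have "\<forall>i < Suc k. D i \<subset> D (Suc i)"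
  using C assms(3) by (auto simp: D_def split: nat.split)
 ultimately show "k \<le> m" using assms(1) unfolding dimle_def by blast
qed

lemma dimle_below:
 assumes "dimle W1 W2 (Suc m)" "subsp W2" "U \<subset> W2"
 shows "dimle W1 U m"
 unfolding dimle_def
proof (intro allI impI, elim conjE)
 fix C :: "nat => 'v set" and k
 assume C: "\<forall>i \<le> k. subsp (C i)" "W1 \<subseteq> C 0" "C k \<subseteq> U" "\<forall>i < k. C i \<subset> C (Suc i)"
 define D where "D i = (if i \<le> k then C i else W2)" for i
 have "\<forall>i \<le> Suc k. subsp (D i)" "W1 \<subseteq> D 0" "D (Suc k) \<subseteq> W2"
  using C assms by (auto simp: D_def)
 moreover have "\<forall>i < Suc k. D i \<subset> D (Suc i)"
  using C assms(3) by (auto simp: D_def less_Suc_eq)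
 ultimately show "k \<le> m" using assms(1) unfolding dimle_def by blast
qed

lemma not_dimle_zero: "subsp W1 ==> subsp W2 ==> W1 \<subset> W2 ==> \<not> dimle W1 W2 0"
proof
 assume a: "subsp W1" "subsp W2" "W1 \<subset> W2" "dimle W1 W2 0"
 let ?U = "\<lambda>i::nat. if i = 0 then W1 else W2"
 have "(\<forall>i \<le> 1. subsp (?U i)) \<and> W1 \<subseteq> ?U 0 \<and> ?U 1 \<subseteq> W2 \<and> (\<forall>i < 1. ?U i \<subset> ?U (Suc i))"
  using a by auto
 then have "(1::nat) \<le> 0"
  using a(4)[unfolded dimle_def, THEN spec, of ?U, THEN spec, of 1] by (rule rev_mp)
 then show False by simp
qed

definition extend :: "'v set => 'v => 'v set"
 where "extend W w = {u +\<^sub>V c \<bullet> w |u c. u \<in> W \<and> c \<in> carrier K}"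

lemma extendI: "u \<in> W ==> c \<in> carrier K ==> u +\<^sub>V c \<bullet> w \<in> extend W w"
 by (auto simp: extend_def)

lemma extend:
 assumes W: "subsp W" and w: "w \<in> carrier V"
 shows "subsp (extend W w)" "W \<subseteq> extend W w" "w \<in> extend W w"
  "subsp U ==> W \<subseteq> U ==> w \<in> U ==> extend W w \<subseteq> U"
proof -
 note WD = subspD[OF W]
 show "subsp (extend W w)"
  unfolding subsp_def
 proof (intro conjI ballI)
  show "extend W w \<subseteq> carrier V" using WD w by (auto simp: extend_def)
  show "0\<^sub>V \<in> extend W w" using extendI[OF WD(3), of \<zero> w] w by simp
 next
  fix x y assume "x \<in> extend W w" "y \<in> extend W w"
  then obtain u c u' c' where uc: "x = u +\<^sub>V c \<bullet> w" "u \<in> W" "c \<in> carrier K"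
   "y = u' +\<^sub>V c' \<bullet> w" "u' \<in> W" "c' \<in> carrier K" by (auto simp: extend_def)
  then have "x +\<^sub>V y = (u +\<^sub>V u') +\<^sub>V (c \<oplus> c') \<bullet> w"
   using WD w by (simp add: V.smult_l_distr V.a_ac)
  then show "x +\<^sub>V y \<in> extend W w" using extendI uc WD by auto
 next
  fix d x assume d: "d \<in> carrier K" and "x \<in> extend W w"
  then obtain u c where uc: "x = u +\<^sub>V c \<bullet> w" "u \<in> W" "c \<in> carrier K"
   by (auto simp: extend_def)
  then have "d \<bullet> x = d \<bullet> u +\<^sub>V (d \<otimes> c) \<bullet> w"
   using WD w d by (simp add: V.smult_r_distr V.smult_assoc1)
  then show "d \<bullet> x \<in> extend W w" using extendI uc d WD by auto
 qed
 show "W \<subseteq> extend W w"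
 proof
  fix u assume "u \<in> W"
  then show "u \<in> extend W w" using extendI[of u W \<zero> w] WD w by simp
 qed
 show "w \<in> extend W w" using extendI[OF WD(3), of \<one> w] w by simp
 show "subsp U ==> W \<subseteq> U ==> w \<in> U ==> extend W w \<subseteq> U"
  using subspD[of U] by (auto simp: extend_def)
qed

text \<open>A vector outside \<open>W1\<close> uses up one unit of the bound when it is adjoined to
  \<open>W1\<close>. The \<open>m\<close> vectors span but may be dependent: once
  \<open>W1 = W2\<close> is reached, the list is filled up with zeros.\<close>

lemma dimle_spanning:
 assumes "dimle W1 W2 m" "subsp W1" "subsp W2" "W1 \<subseteq> W2"
 shows "\<exists>e. (\<forall>i < m. e i \<in> W2) \<and> (\<forall>w \<in> W2. \<exists>k. (\<forall>i < m. k i \<in> carrier K) \<and>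
  eqm W1 w (\<Oplus>\<^bsub>V\<^esub>i \<in> {..<m}. k i \<bullet> e i))"
 using assms
proof (induction m arbitrary: W1)
 case 0
 then have "W1 = W2" using not_dimle_zero by blast
 then show ?case using 0 subspD eqm_zero_iff by (auto simp: V.finsum_empty)
next
 case (Suc m)
 note W2 = subspD[OF Suc.prems(3)]
 show ?case
 proof (cases "W1 = W2")
  case True
  have "eqm W1 w (\<Oplus>\<^bsub>V\<^esub>i \<in> {..<Suc m}. \<zero> \<bullet> 0\<^sub>V)" if "w \<in> W2" for w
   using that True eqm_zero_iff W2 by simp
  then show ?thesis using W2
   by (intro exI[of _ "\<lambda>_. 0\<^sub>V"]) (auto intro!: exI[of _ "\<lambda>_. \<zero>"])
 next
  case False
  then obtain w0 where w0: "w0 \<in> W2" "w0 \<notin> W1" using Suc.prems by blast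
  have w0c: "w0 \<in> carrier V" using W2 w0 by auto
  note ext = extend[OF Suc.prems(2) w0c]
  have "W1 \<subset> extend W1 w0" using ext w0 by blast
  then have "dimle (extend W1 w0) W2 m" using dimle_above Suc.prems by blast
  moreover have "extend W1 w0 \<subseteq> W2" using ext Suc.prems w0 by blast
  ultimately obtain e where e: "\<forall>i < m. e i \<in> W2" "\<forall>w \<in> W2. \<exists>k. (\<forall>i < m. k i \<in> carrier K) \<and>
   eqm (extend W1 w0) w (\<Oplus>\<^bsub>V\<^esub>i \<in> {..<m}. k i \<bullet> e i)"
   using Suc.IH ext(1) Suc.prems(3) by blast
  define e' where "e' = e(m := w0)"
  have ec: "e i \<in> carrier V" if "i < m" for i using that e W2 by auto
  have "\<exists>k. (\<forall>i < Suc m. k i \<in> carrier K) \<and>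
    eqm W1 w (\<Oplus>\<^bsub>V\<^esub>i \<in> {..<Suc m}. k i \<bullet> e' i)" if w: "w \<in> W2" for w
  proof -
   obtain k where k: "\<forall>i < m. k i \<in> carrier K"
    "eqm (extend W1 w0) w (\<Oplus>\<^bsub>V\<^esub>i \<in> {..<m}. k i \<bullet> e i)" using e(2) w by blast
   let ?s = "\<Oplus>\<^bsub>V\<^esub>i \<in> {..<m}. k i \<bullet> e i"
   obtain u c where uc: "u \<in> W1" "c \<in> carrier K" "w -\<^sub>V ?s = u +\<^sub>V c \<bullet> w0"
    using k(2) by (auto simp: eqm_def extend_def)
   have s: "?s \<in> carrier V" and wc: "w \<in> carrier V" using eqm_carrier[OF k(2)] by auto
   have u: "u \<in> carrier V" using uc subspD(2)[OF Suc.prems(2)] by auto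
   define k' where "k' = k(m := c)"
   have "(\<Oplus>\<^bsub>V\<^esub>i \<in> {..<Suc m}. k' i \<bullet> e' i)
     = c \<bullet> w0 +\<^sub>V (\<Oplus>\<^bsub>V\<^esub>i \<in> {..<m}. k' i \<bullet> e' i)"
    using ec k(1) uc w0c by (subst lessThan_Suc, subst V.finsum_insert) (auto simp: k'_def e'_def)
   also have "(\<Oplus>\<^bsub>V\<^esub>i \<in> {..<m}. k' i \<bullet> e' i) = ?s"
    using ec k(1) by (intro V.add.finprod_cong') (auto simp: k'_def e'_def)
   finally have sum: "(\<Oplus>\<^bsub>V\<^esub>i \<in> {..<Suc m}. k' i \<bullet> e' i) = c \<bullet> w0 +\<^sub>V ?s" .
   have "w -\<^sub>V (c \<bullet> w0 +\<^sub>V ?s) = (w -\<^sub>V ?s) -\<^sub>V c \<bullet> w0"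
    using s wc uc(2) w0c by (simp add: a_minus_def V.minus_add V.a_ac)
   also have "\<dots> = u"
    unfolding uc(3) using u uc(2) w0c by (simp add: a_minus_def V.a_assoc V.r_neg)
   finally have "eqm W1 w (\<Oplus>\<^bsub>V\<^esub>i \<in> {..<Suc m}. k' i \<bullet> e' i)"
    unfolding sum eqm_def using s wc uc w0c by auto
   then show ?thesis using k(1) uc(2) by (intro exI[of _ k']) (auto simp: k'_def)
  qed
  moreover have "\<forall>i < Suc m. e' i \<in> W2" using e(1) w0 by (auto simp: e'_def)
  ultimately show ?thesis by blast
 qed
qed

text \<open>In coordinates with respect to \<open>m\<close> spanning vectors, a relation amounts to
  \<open>t * m\<close> scalar equations. With \<open>t = 1\<close> the objects are vectors; with
  \<open>t = m\<close> they are linear maps given by their values on a spanning list.\<close>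

lemma many_vectors_dependent:
 assumes dim: "dimle W1 W2 m" and W: "subsp W1" "subsp W2" "W1 \<subseteq> W2"
  and J: "finite J" "card J > t * m" and F: "\<And>x i. x \<in> J ==> i < t ==> F x i \<in> W2"
 shows "\<exists>c. (\<forall>x \<in> J. c x \<in> carrier K) \<and> (\<exists>x \<in> J. c x \<noteq> \<zero>) \<and>
  (\<forall>i < t. (\<Oplus>\<^bsub>V\<^esub>x \<in> J. c x \<bullet> F x i) \<in> W1)"
proof -
 obtain e where e: "\<And>i. i < m ==> e i \<in> W2" "\<And>w. w \<in> W2 ==> \<exists>k. (\<forall>i < m. k i \<in> carrier K) \<and>
  eqm W1 w (\<Oplus>\<^bsub>V\<^esub>i \<in> {..<m}. k i \<bullet> e i)"
  using dimle_spanning[OF dim W] by blast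
 then obtain k where k: "\<And>w i. w \<in> W2 ==> i < m ==> k w i \<in> carrier K"
  "\<And>w. w \<in> W2 ==> eqm W1 w (\<Oplus>\<^bsub>V\<^esub>i \<in> {..<m}. k w i \<bullet> e i)" by metis
 have ec: "e i \<in> carrier V" if "i < m" for i using that e(1) subspD[OF W(2)] by auto
 have Fc: "F x i \<in> carrier V" if "x \<in> J" "i < t" for x i using F[OF that] subspD[OF W(2)] by auto
 have "\<exists>c. (\<forall>x \<in> J. c x \<in> carrier K) \<and> (\<exists>x \<in> J. c x \<noteq> \<zero>) \<and>
  (\<forall>p \<in> {..<t} \<times> {..<m}. (\<Oplus>x \<in> J. c x \<otimes> k (F x (fst p)) (snd p)) = \<zero>)"
  using J F k(1) by (intro K.homogeneous_system) (auto simp: card_cartesian_product)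
 then obtain c where c0: "\<forall>x \<in> J. c x \<in> carrier K" "\<exists>x \<in> J. c x \<noteq> \<zero>"
  "\<forall>p \<in> {..<t} \<times> {..<m}. (\<Oplus>x \<in> J. c x \<otimes> k (F x (fst p)) (snd p)) = \<zero>" by blast
 have c: "\<And>x. x \<in> J ==> c x \<in> carrier K" "\<exists>x \<in> J. c x \<noteq> \<zero>"
  "\<And>i j. i < t ==> j < m ==> (\<Oplus>x \<in> J. c x \<otimes> k (F x i) j) = \<zero>"
  using c0(1,2) c0(3)[rule_format, of "(_, _)"] by auto
 have "(\<Oplus>\<^bsub>V\<^esub>x \<in> J. c x \<bullet> F x i) \<in> W1" if i: "i < t" for i
 proof -
  have fin: "eqm W1 (\<Oplus>\<^bsub>V\<^esub>x \<in> Y. c x \<bullet> F x i)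
    (\<Oplus>\<^bsub>V\<^esub>j \<in> {..<m}. (\<Oplus>x \<in> Y. c x \<otimes> k (F x i) j) \<bullet> e j)" if "Y \<subseteq> J" for Y
   using finite_subset[OF that J(1)] that
  proof (induction Y rule: finite_induct)
   case empty
   have "(\<Oplus>\<^bsub>V\<^esub>j \<in> {..<m}. \<zero> \<bullet> e j) = (\<Oplus>\<^bsub>V\<^esub>j \<in> {..<m}. 0\<^sub>V)"
    using ec by (intro V.add.finprod_cong') auto
   then show ?case using W by simp
  next
   case (insert x Y)
   have xF: "F x i \<in> W2" "F x i \<in> carrier V" "c x \<in> carrier K"
    using insert.prems i F Fc c by auto
   have kc: "k (F y i) j \<in> carrier K" if "y \<in> insert x Y" "j < m" for y j
    using that insert.prems i F k(1) by auto
   have cc: "c y \<in> carrier K" if "y \<in> insert x Y" for y using that insert.prems c by auto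
   let ?S = "\<lambda>j. \<Oplus>x \<in> Y. c x \<otimes> k (F x i) j"
   have Sc: "?S j \<in> carrier K" if "j < m" for j
    using kc[OF _ that] cc by (intro K.finsum_closed) auto
   have "(\<Oplus>\<^bsub>V\<^esub>y \<in> insert x Y. c y \<bullet> F y i) = c x \<bullet> F x i +\<^sub>V (\<Oplus>\<^bsub>V\<^esub>y \<in> Y. c y \<bullet> F y i)"
    using insert.hyps insert.prems cc i Fc by (intro V.finsum_insert) auto
   moreover have "eqm W1 (c x \<bullet> F x i +\<^sub>V (\<Oplus>\<^bsub>V\<^esub>y \<in> Y. c y \<bullet> F y i))
    (c x \<bullet> (\<Oplus>\<^bsub>V\<^esub>j \<in> {..<m}. k (F x i) j \<bullet> e j) +\<^sub>V (\<Oplus>\<^bsub>V\<^esub>j \<in> {..<m}. ?S j \<bullet> e j))"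
    using insert.IH insert.prems W k(2) xF by (intro eqm_add eqm_smult) auto
   moreover have "c x \<bullet> (\<Oplus>\<^bsub>V\<^esub>j \<in> {..<m}. k (F x i) j \<bullet> e j)
     = (\<Oplus>\<^bsub>V\<^esub>j \<in> {..<m}. c x \<bullet> (k (F x i) j \<bullet> e j))"
    using ec kc xF by (intro smult_finsum) auto
   moreover have "(\<Oplus>\<^bsub>V\<^esub>j \<in> {..<m}. c x \<bullet> (k (F x i) j \<bullet> e j)) +\<^sub>V (\<Oplus>\<^bsub>V\<^esub>j \<in> {..<m}. ?S j \<bullet> e j)
     = (\<Oplus>\<^bsub>V\<^esub>j \<in> {..<m}. c x \<bullet> (k (F x i) j \<bullet> e j) +\<^sub>V ?S j \<bullet> e j)"
    using ec kc xF Sc by (intro V.finsum_addf[symmetric]) auto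
   moreover have "\<dots> = (\<Oplus>\<^bsub>V\<^esub>j \<in> {..<m}. (\<Oplus>x \<in> insert x Y. c x \<otimes> k (F x i) j) \<bullet> e j)"
   proof (intro V.add.finprod_cong' refl)
    fix j assume "j \<in> {..<m}"
    then have j: "j < m" by simp
    have "(\<Oplus>x \<in> insert x Y. c x \<otimes> k (F x i) j) = c x \<otimes> k (F x i) j \<oplus> ?S j"
     using insert.hyps cc kc[OF _ j] by (intro K.finsum_insert) auto
    then show "c x \<bullet> (k (F x i) j \<bullet> e j) +\<^sub>V ?S j \<bullet> e j
      = (\<Oplus>x \<in> insert x Y. c x \<otimes> k (F x i) j) \<bullet> e j"
     using xF kc[of x j] j ec Sc[OF j] by (simp add: V.smult_l_distr V.smult_assoc1)
   next
    have "(\<Oplus>x \<in> insert x Y. c x \<otimes> k (F x i) j) \<in> carrier K" if "j < m" for j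
     using kc[OF _ that] cc by (intro K.finsum_closed) auto
    then show "(\<lambda>j. (\<Oplus>x \<in> insert x Y. c x \<otimes> k (F x i) j) \<bullet> e j) \<in> {..<m} \<rightarrow> carrier V"
     using ec by auto
   qed
   ultimately show ?case by simp
  qed
  have "(\<Oplus>\<^bsub>V\<^esub>j \<in> {..<m}. (\<Oplus>x \<in> J. c x \<otimes> k (F x i) j) \<bullet> e j) = (\<Oplus>\<^bsub>V\<^esub>j \<in> {..<m}. 0\<^sub>V)"
   using ec c(3)[OF i] by (intro V.add.finprod_cong') auto
  then have "eqm W1 (\<Oplus>\<^bsub>V\<^esub>x \<in> J. c x \<bullet> F x i) 0\<^sub>V" using fin[of J] by simp
  then show ?thesis using eqm_zero_iff eqm_carrier by blast
 qed
 then show ?thesis using c by blast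
qed

end

text \<open>The images of the derived subgroups in the self-maps of \<open>J\<close> decrease, and
  the image of a derived subgroup depends only on the image of the group. So the sequence is
  constant from its first repetition on, which comes after at most \<open>card J ^ card J\<close>
  steps, and \<open>triv\<close> identifies the constant value.\<close>

lemma (in group) derived_acts_trivially:
 assumes N: "subgroup N G" and J: "finite J"
  and closed: "\<And>g x. g \<in> N ==> x \<in> J ==> p g x \<in> J"
  and mult: "\<And>g h x. g \<in> N ==> h \<in> N ==> x \<in> J ==> p (g \<otimes> h) x = p g (p h x)"
  and one: "\<And>x. x \<in> J ==> p \<one> x = x"
  and triv: "\<And>g x. g \<in> (derived G ^^ q) N ==> x \<in> J ==> p g x = x"
  and g: "g \<in> (derived G ^^ (card J ^ card J)) N" and x: "x \<in> J"
 shows "p g x = x"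
proof -
 define D where "D i = (derived G ^^ i) N" for i
 define P where "P i = (\<lambda>g. restrict (p g) J) ` D i" for i
 define L where "L = card J ^ card J"
 have D: "subgroup (D i) G" for i unfolding D_def by (rule exp_of_derived_is_subgroup[OF N])
 have D_mono: "D j \<subseteq> D i" if "i \<le> j" for i j
  unfolding D_def by (rule exp_derived_antimono[OF N that])
 have DN: "D i \<subseteq> N" for i using D_mono[of 0 i] by (simp add: D_def)
 have D_Suc: "D (Suc i) = generate G (derived_set G (D i))" for i
  by (simp add: D_def derived_def)
 define same where "same g h \<longleftrightarrow> (\<forall>x \<in> J. p g x = p h x)" for g h
 have P_same: "restrict (p g) J \<in> P i \<longleftrightarrow> (\<exists>h \<in> D i. same g h)" for g i
  unfolding P_def same_def image_iff by (metis restrict_apply' restrict_ext)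
 have same_mult: "same (g \<otimes> h) (g' \<otimes> h')"
  if "same g g'" "same h h'" "g \<in> N" "h \<in> N" "g' \<in> N" "h' \<in> N" for g h g' h'
  using that mult closed by (simp add: same_def)
 have Ninv: "inv g \<in> N" if "g \<in> N" for g using that by (rule subgroup.m_inv_closed[OF N])
 have Nc: "g \<in> carrier G" if "g \<in> N" for g using that by (rule subgroup.mem_carrier[OF N])
 have same_inv: "same (inv g) (inv g')" if s: "same g g'" and gN: "g \<in> N" "g' \<in> N" for g g'
  unfolding same_def
 proof
  fix x assume x: "x \<in> J"
  have ix: "p (inv g') x \<in> J" using x closed Ninv gN by blast
  have "x = p (g' \<otimes> inv g') x" using gN x one Nc by simp
  also have "\<dots> = p g' (p (inv g') x)" using gN x mult Ninv by blast
  also have "\<dots> = p g (p (inv g') x)" using s ix by (simp add: same_def)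
  finally have "p (inv g) x = p (inv g) (p g (p (inv g') x))" by simp
  also have "\<dots> = p (inv g \<otimes> g) (p (inv g') x)" using gN ix mult Ninv by simp
  also have "\<dots> = p (inv g') x" using gN ix one Nc by simp
  finally show "p (inv g) x = p (inv g') x" .
 qed
 \<comment> \<open>A commutator of elements of \<open>D i\<close> acts like the commutator of
   representatives in \<open>D (Suc i)\<close>, which lies one step deeper.\<close>
 have stable: "P (Suc i) \<subseteq> P (Suc (Suc i))" if eq: "P i \<subseteq> P (Suc i)" for i
 proof -
  have "\<exists>h \<in> D (Suc (Suc i)). same g h" if "g \<in> D (Suc i)" for g
   using that unfolding D_Suc[of i]
  proof induction
   case one
   have "same \<one> \<one>" by (simp add: same_def)
   then show ?case using subgroup.one_closed[OF D] by blast
  next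
   have gen: "\<exists>h \<in> D (Suc (Suc i)). same s h" if sD: "s \<in> derived_set G (D i)" for s
   proof -
    obtain a b where ab: "a \<in> D i" "b \<in> D i" "s = a \<otimes> b \<otimes> inv a \<otimes> inv b" using sD by auto
    have "restrict (p a) J \<in> P (Suc i)" "restrict (p b) J \<in> P (Suc i)"
     using ab eq unfolding P_def by blast+
    then obtain a' b' where ab': "a' \<in> D (Suc i)" "same a a'" "b' \<in> D (Suc i)" "same b b'"
     using P_same by blast
    have N4: "a \<in> N" "b \<in> N" "a' \<in> N" "b' \<in> N" using ab ab' DN by blast+
    have "same s (a' \<otimes> b' \<otimes> inv a' \<otimes> inv b')"
     unfolding ab(3) using ab' N4 Ninv same_inv
     by (intro same_mult subgroup.m_closed[OF N]) auto
    moreover have "a' \<otimes> b' \<otimes> inv a' \<otimes> inv b' \<in> D (Suc (Suc i))"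
     unfolding D_Suc[of "Suc i"] using ab' by (intro generate.incl) blast
    ultimately show ?thesis by blast
   qed
   {
    case (incl h)
    then show ?case by (rule gen)
   next
    case (inv h)
    obtain a b where "a \<in> D i" "b \<in> D i" "h = a \<otimes> b \<otimes> inv a \<otimes> inv b" using inv by auto
    then have "h \<in> N" using DN[of i] Ninv subgroup.m_closed[OF N] by (metis subsetD)
    obtain h' where h': "h' \<in> D (Suc (Suc i))" "same h h'" using gen inv by blast
    then have "same (inv h) (inv h')" using same_inv `h \<in> N` DN by blast
    then show ?case using subgroup.m_inv_closed[OF D h'(1)] by blast
   next
    case (eng h1 h2)
    obtain h1' h2' where h: "h1' \<in> D (Suc (Suc i))" "same h1 h1'"
     "h2' \<in> D (Suc (Suc i))" "same h2 h2'" using eng by blast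
    have "h1 \<in> N" "h2 \<in> N" using eng.hyps DN[of "Suc i"] by (auto simp: D_Suc)
    then have "same (h1 \<otimes> h2) (h1' \<otimes> h2')" using h DN by (intro same_mult) auto
    then show ?case using subgroup.m_closed[OF D h(1,3)] by blast
   }
  qed
  then show ?thesis unfolding P_def[of "Suc i"] using P_same by blast
 qed
 have P_dec: "P j \<subseteq> P i" if "i \<le> j" for i j unfolding P_def using D_mono[OF that] by blast
 have P_sub: "P i \<subseteq> J \<rightarrow>\<^sub>E J" for i
 proof -
  have "p g x \<in> J" if "g \<in> D i" "x \<in> J" for g x using closed DN[of i] that by blast
  then show ?thesis by (auto simp: P_def)
 qed
 have finE: "finite (J \<rightarrow>\<^sub>E J)" "card (J \<rightarrow>\<^sub>E J) = L"
  using J by (auto simp: L_def card_PiE intro: finite_PiE)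
 have finP: "finite (P i)" for i using P_sub finE finite_subset by blast
 \<comment> \<open>Otherwise the \<open>L + 2\<close> sets up to \<open>P (Suc L)\<close> would drop
   strictly in size, starting from at most \<open>L\<close>.\<close>
 have "\<exists>i \<le> L. P i \<subseteq> P (Suc i)"
 proof (rule ccontr)
  assume "\<not> ?thesis"
  then have less: "card (P (Suc i)) < card (P i)" if "i \<le> L" for i
   using that P_dec[of i "Suc i"] finP by (intro psubset_card_mono) auto
  have "card (P i) + i \<le> L" if "i \<le> Suc L" for i
   using that
  proof (induction i)
   case 0
   then show ?case using card_mono[OF finE(1) P_sub] finE(2) by simp
  next
   case (Suc i)
   then show ?case using less[of i] by simp
  qed
  from this[of "Suc L"] show False by simp
 qed
 then obtain i where i: "i \<le> L" "P i \<subseteq> P (Suc i)" by blast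
 have st: "P (i + k) \<subseteq> P (Suc (i + k))" for k
  by (induction k) (use i stable in auto)
 have "P i \<subseteq> P (i + k)" for k
  by (induction k) (use st in auto)
 then have "P L \<subseteq> P (i + q)" using P_dec[OF i(1)] by blast
 also have "\<dots> \<subseteq> P q" by (rule P_dec) simp
 finally have "restrict (p g) J \<in> P q" using g unfolding P_def D_def L_def by blast
 then obtain h where "h \<in> D q" "same g h" using P_same by blast
 then show ?thesis using triv x by (simp add: D_def same_def)
qed

section \<open>Eigenvectors and common eigenvectors\<close>

context linear_action
begin

text \<open>Polynomials are coefficient lists with the constant term first, the reverse of the order
  in \<open>K.eval\<close>, so that recursion is Horner's scheme: \<open>hev c p\<close> is p(c) and
  \<open>opv g v p\<close> is the vector p(g) v.\<close>

primrec hev :: "'k => 'k list => 'k"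
 where "hev c [] = \<zero>" | "hev c (x # p) = x \<oplus> c \<otimes> hev c p"

primrec opv :: "'g => 'v => 'k list => 'v"
 where "opv g v [] = 0\<^sub>V" | "opv g v (x # p) = x \<bullet> v +\<^sub>V act g (opv g v p)"

lemma hev_closed [simp]: "c \<in> carrier K ==> set p \<subseteq> carrier K ==> hev c p \<in> carrier K"
 by (induction p) auto

lemma opv_closed [simp]:
 "g \<in> carrier G ==> v \<in> carrier V ==> set p \<subseteq> carrier K ==> opv g v p \<in> carrier V"
 by (induction p) auto

lemma hev_eval: "c \<in> carrier K ==> set p \<subseteq> carrier K ==> hev c p = K.eval (rev p) c"
proof (induction p)
 case (Cons x p)
 then have "K.eval (rev p @ [x]) c = (K.eval (rev p) c \<otimes> c) \<oplus> x"
  by (intro K.eval_append_aux) auto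
 moreover have "K.eval (rev p) c \<in> carrier K" using Cons by (intro K.eval_in_carrier) auto
 ultimately show ?case using Cons by (simp add: K.m_comm K.a_comm)
qed simp

text \<open>Synthetic division p = (X - c) q + p(c), applied to \<open>v\<close>. The last
  coefficient is kept, so the quotient again has a nonzero leading coefficient if \<open>p\<close>
  has one.\<close>

lemma opv_division:
 assumes "g \<in> carrier G" "v \<in> carrier V" "c \<in> carrier K" "set p \<subseteq> carrier K" "p \<noteq> []"
 shows "\<exists>q. Suc (length q) = length p \<and> set q \<subseteq> carrier K \<and> (q \<noteq> [] --> last q = last p) \<and>
  opv g v p = (act g (opv g v q) -\<^sub>V c \<bullet> opv g v q) +\<^sub>V hev c p \<bullet> v"
 using assms(4,5)
proof (induction p)
 case (Cons x p)
 show ?case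
 proof (cases "p = []")
  case True
  then show ?thesis using assms(1-3) Cons.prems
   by (intro exI[of _ "[]"]) (simp add: a_minus_def)
 next
  case False
  then obtain q where q: "Suc (length q) = length p" "set q \<subseteq> carrier K" "q \<noteq> [] --> last q = last p"
   "opv g v p = (act g (opv g v q) -\<^sub>V c \<bullet> opv g v q) +\<^sub>V hev c p \<bullet> v"
   using Cons by auto
  define h where "h = hev c p"
  define Q where "Q = opv g v q"
  have car: "h \<in> carrier K" "Q \<in> carrier V" "x \<in> carrier K"
   using assms(1-3) Cons.prems q by (auto simp: h_def Q_def)
  have "opv g v (x # p) = (act g (opv g v (h # q)) -\<^sub>V c \<bullet> opv g v (h # q)) +\<^sub>V hev c (x # p) \<bullet> v"
  proof -
   have "opv g v (x # p)
     = x \<bullet> v +\<^sub>V (act g (act g Q) -\<^sub>V c \<bullet> act g Q +\<^sub>V h \<bullet> act g v)"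
    using q(4) car assms(1-3)
    by (simp add: act_add act_minus act_smult a_minus_def flip: Q_def h_def)
   also have "\<dots> = (act g (h \<bullet> v +\<^sub>V act g Q) -\<^sub>V c \<bullet> (h \<bullet> v +\<^sub>V act g Q))
     +\<^sub>V (x \<oplus> c \<otimes> h) \<bullet> v"
    using car assms(1-3)
    by (simp add: act_add act_smult a_minus_def V.smult_r_distr V.smult_l_distr V.minus_add
      V.smult_assoc1 V.a_ac V.r_neg1 V.r_neg2 V.r_neg V.l_neg)
   finally show ?thesis by (simp flip: Q_def h_def)
  qed
  moreover have "last (h # q) = last (x # p)"
  proof (cases "q = []")
   case True
   then obtain y where "p = [y]" using q(1) by (cases p) auto
   then show ?thesis using True Cons.prems by (simp add: h_def assms(3))
  qed (use q False in simp)
  ultimately show ?thesis using q car by (intro exI[of _ "h # q"]) auto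
 qed
qed simp

lemma opv_map_upt:
 assumes "g \<in> carrier G" "v \<in> carrier V" "\<And>i. i \<le> n ==> c i \<in> carrier K"
 shows "opv g v (map c [0..<Suc n]) = (\<Oplus>\<^bsub>V\<^esub>i \<in> {..n}. c i \<bullet> ((act g ^^ i) v))"
 using assms(3)
proof (induction n arbitrary: c)
 case 0
 then show ?case using assms by simp
next
 case (Suc n)
 have pow: "(act g ^^ i) v \<in> carrier V" for i using assms by (induction i) auto
 have "map c [0..<Suc (Suc n)] = c 0 # map (\<lambda>i. c (Suc i)) [0..<Suc n]"
  by (simp del: upt_Suc add: upt_conv_Cons map_Suc_upt[symmetric] comp_def)
 then have "opv g v (map c [0..<Suc (Suc n)])
   = c 0 \<bullet> v +\<^sub>V act g (opv g v (map (\<lambda>i. c (Suc i)) [0..<Suc n]))"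
  by (simp del: upt_Suc)
 also have "opv g v (map (\<lambda>i. c (Suc i)) [0..<Suc n])
   = (\<Oplus>\<^bsub>V\<^esub>i \<in> {..n}. c (Suc i) \<bullet> ((act g ^^ i) v))"
  using Suc.prems by (intro Suc.IH) auto
 also have "act g \<dots> = (\<Oplus>\<^bsub>V\<^esub>i \<in> {..n}. act g (c (Suc i) \<bullet> ((act g ^^ i) v)))"
  using assms(1) Suc.prems pow by (intro act_finsum) auto
 also have "\<dots> = (\<Oplus>\<^bsub>V\<^esub>i \<in> {..n}. c (Suc i) \<bullet> ((act g ^^ Suc i) v))"
  using assms(1) Suc.prems pow by (intro V.add.finprod_cong') (auto simp: act_smult)
 also have "c 0 \<bullet> v +\<^sub>V \<dots> = (\<Oplus>\<^bsub>V\<^esub>i \<in> {..Suc n}. c i \<bullet> ((act g ^^ i) v))"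
  using assms Suc.prems pow by (subst V.finsum_Suc2) (auto simp: V.a_comm simp del: funpow.simps(2) intro!: arg_cong2[where f = "add V"])
 finally show ?case .
qed

text \<open>For a fixed \<open>v\<close> outside \<open>W1\<close> take a shortest polynomial p with
  nonzero leading coefficient and p(g) v in \<open>W1\<close>, and a root c of it. If p = (X - c) q,
  then q(g) v is not in \<open>W1\<close> by minimality, and it is an eigenvector modulo
  \<open>W1\<close>.\<close>

lemma eigenvector:
 assumes closed: "algebraically_closed K"
  and W: "subsp W1" "subsp W2" "W1 \<subset> W2" and dim: "dimle W1 W2 m"
  and g: "g \<in> carrier G" "stab {g} W1" "stab {g} W2"
 shows "\<exists>c \<in> carrier K. \<exists>w \<in> W2 - W1. eqm W1 (act g w) (c \<bullet> w)"
proof -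
 obtain v where v: "v \<in> W2" "v \<notin> W1" using W by blast
 have vc: "v \<in> carrier V" using v subspD[OF W(2)] by blast
 have pow: "(act g ^^ i) v \<in> W2" for i using v g by (induction i) (auto simp: stab_def)
 let ?P = "\<lambda>p. p \<noteq> [] \<and> set p \<subseteq> carrier K \<and> last p \<noteq> \<zero> \<and> opv g v p \<in> W1"
 have "\<exists>p. ?P p"
 proof -
  \<comment> \<open>The \<open>m + 1\<close> vectors v, g v, ..., g^m v are dependent modulo
    \<open>W1\<close>. The sum is then cut at its last nonzero coefficient, which becomes the
    leading one.\<close>
  have "\<exists>c. (\<forall>x \<in> {..m}. c x \<in> carrier K) \<and> (\<exists>x \<in> {..m}. c x \<noteq> \<zero>) \<and>
   (\<forall>i < 1. (\<Oplus>\<^bsub>V\<^esub>x \<in> {..m}. c x \<bullet> (\<lambda>x (i::nat). (act g ^^ x) v) x i) \<in> W1)"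
   using W pow by (intro many_vectors_dependent[OF dim]) auto
  then obtain c where c: "\<And>x. x \<le> m ==> c x \<in> carrier K" "\<exists>x \<le> m. c x \<noteq> \<zero>"
   "(\<Oplus>\<^bsub>V\<^esub>x \<in> {..m}. c x \<bullet> ((act g ^^ x) v)) \<in> W1" by auto
  have "finite {x. x \<le> m \<and> c x \<noteq> \<zero>}" by simp
  define n where "n = Max {x. x \<le> m \<and> c x \<noteq> \<zero>}"
  have n: "n \<le> m" "c n \<noteq> \<zero>" using Max_in[of "{x. x \<le> m \<and> c x \<noteq> \<zero>}"] c(2) by (auto simp: n_def)
  have zero: "c x = \<zero>" if "n < x" "x \<le> m" for x
  proof (rule ccontr)
   assume "c x \<noteq> \<zero>"
   then have "x \<le> n" unfolding n_def using that by (intro Max_ge) auto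
   then show False using that by simp
  qed
  have powc: "(act g ^^ i) v \<in> carrier V" for i using pow subspD[OF W(2)] by blast
  have "(\<Oplus>\<^bsub>V\<^esub>x \<in> {..m}. c x \<bullet> ((act g ^^ x) v)) = (\<Oplus>\<^bsub>V\<^esub>x \<in> {..n}. c x \<bullet> ((act g ^^ x) v))"
   using n c(1) zero powc by (intro V.add.finprod_mono_neutral_cong_right) auto
  then have "opv g v (map c [0..<Suc n]) \<in> W1" using c n g vc by (subst opv_map_upt) auto
  then have "?P (map c [0..<Suc n])" using n c by (auto simp: last_map)
  then show ?thesis by blast
 qed
 then obtain p where p: "?P p" "\<And>q. ?P q ==> length p \<le> length q"
  using ex_has_least_nat[of ?P _ length] by metis
 have len: "length p \<ge> 2"
 proof (rule ccontr)
  assume "\<not> length p \<ge> 2"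
  then obtain x where "p = [x]" using p(1) by (cases p; cases "tl p") auto
  then show False using p(1) v vc g eqm_smult_zeroD[OF W(1), of x v] by auto
 qed
 have "rev p \<in> carrier (poly_ring K)"
  using p(1) by (simp add: univ_poly_def polynomial_def hd_rev)
 moreover have "K.splitted (rev p)"
  using algebraically_closed.roots_over_carrier[OF closed calculation] .
 ultimately obtain c where "c \<in># K.roots (rev p)"
  using len by (metis K.splitted_def One_nat_def diff_is_0_eq length_rev multiset_nonemptyE
    not_less_eq_eq numeral_2_eq_2 size_empty)
 then have "K.is_root (rev p) c" using K.roots_mem_iff_is_root[OF `rev p \<in> carrier (poly_ring K)`] by simp
 then have c: "c \<in> carrier K" "hev c p = \<zero>"
  using p(1) hev_eval[of c p] by (auto simp: K.is_root_def)
 obtain q where q: "Suc (length q) = length p" "set q \<subseteq> carrier K" "q \<noteq> [] --> last q = last p"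
  "opv g v p = (act g (opv g v q) -\<^sub>V c \<bullet> opv g v q) +\<^sub>V hev c p \<bullet> v"
  using opv_division[OF g(1) vc c(1), of p] p(1) by auto
 have qne: "q \<noteq> []" using q(1) len by auto
 let ?w = "opv g v q"
 have wc: "?w \<in> carrier V" using g vc q by simp
 have "?w \<notin> W1" using p(2)[of q] p(1) q qne by auto
 moreover have "opv g v q' \<in> W2" if "set q' \<subseteq> carrier K" for q'
  using that
 proof (induction q')
  case (Cons x q')
  then show ?case using v g subspD[OF W(2)] by (simp add: stab_def)
 qed (simp add: subspD[OF W(2)])
 then have "?w \<in> W2" using q by blast
 moreover have "eqm W1 (act g ?w) (c \<bullet> ?w)"
  using q(4) p(1) c vc wc g by (simp add: eqm_def)
 ultimately show ?thesis using c(1) by blast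
qed

definition scal :: "'v set => 'v set => 'g => bool"
 where "scal W1 W2 g \<longleftrightarrow> (\<exists>c \<in> carrier K. \<forall>w \<in> W2. eqm W1 (act g w) (c \<bullet> w))"

definition triv :: "'v set => 'v set => 'g set => bool"
 where "triv W1 W2 H \<longleftrightarrow> (\<forall>g \<in> H. \<forall>w \<in> W2. eqm W1 (act g w) w)"

lemma stab_mono: "stab H W ==> H' \<subseteq> H ==> stab H' W"
 by (auto simp: stab_def)

lemma eigenspace:
 assumes W: "subsp W1" "subsp W2" "W1 \<subseteq> W2" and c: "\<And>b. b \<in> C ==> c b \<in> carrier K"
  and C: "stab C W1"
 shows "subsp {w \<in> W2. \<forall>b \<in> C. eqm W1 (act b w) (c b \<bullet> w)}" (is "subsp ?U")
  and "W1 \<subseteq> {w \<in> W2. \<forall>b \<in> C. eqm W1 (act b w) (c b \<bullet> w)}"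
proof -
 have Cc: "b \<in> carrier G" if "b \<in> C" for b using that C by (auto simp: stab_def)
 note W2 = subspD[OF W(2)]
 show "W1 \<subseteq> ?U"
 proof
  fix w assume w: "w \<in> W1"
  then have wc: "w \<in> carrier V" using subspD[OF W(1)] by blast
  have "eqm W1 (act b w) (c b \<bullet> w)" if b: "b \<in> C" for b
  proof -
   have "act b w \<in> W1" "c b \<bullet> w \<in> W1" using w b C c subspD[OF W(1)] by (auto simp: stab_def)
   then show ?thesis using wc b Cc c subspD(7)[OF W(1)] by (auto simp: eqm_def)
  qed
  then show "w \<in> ?U" using w W by blast
 qed
 then have "0\<^sub>V \<in> ?U" using subspD[OF W(1)] by blast
 moreover have "x +\<^sub>V y \<in> ?U" if xy: "x \<in> ?U" "y \<in> ?U" for x y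
 proof -
  have car: "x \<in> carrier V" "y \<in> carrier V" using xy W2 by auto
  have "eqm W1 (act b (x +\<^sub>V y)) (c b \<bullet> (x +\<^sub>V y))" if b: "b \<in> C" for b
   using eqm_add[OF W(1), of "act b x" "c b \<bullet> x" "act b y" "c b \<bullet> y"] xy b car Cc c
   by (simp add: act_add V.smult_r_distr)
  then show ?thesis using xy W2 by blast
 qed
 moreover have "k \<bullet> x \<in> ?U" if xy: "x \<in> ?U" and k: "k \<in> carrier K" for k x
 proof -
  have car: "x \<in> carrier V" using xy W2 by auto
  have "eqm W1 (act b (k \<bullet> x)) (c b \<bullet> (k \<bullet> x))" if b: "b \<in> C" for b
   using eqm_smult[OF W(1), of "act b x" "c b \<bullet> x" k] xy b car Cc c k
   by (simp add: act_smult K.m_comm flip: V.smult_assoc1)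
  then show ?thesis using xy W2 k by blast
 qed
 moreover have "?U \<subseteq> carrier V" using W2 by blast
 ultimately show "subsp ?U" unfolding subsp_def by blast
qed

text \<open>If some \<open>b\<close> in \<open>C\<close> is not scalar, its eigenspace is proper,
  nonzero and by commutativity stable under \<open>C\<close>, and the dimension bound drops;
  otherwise every vector outside \<open>W1\<close> will do.\<close>

lemma common_eigenvector:
 assumes closed: "algebraically_closed K"
  and W: "subsp W1" "subsp W2" "W1 \<subset> W2" and dim: "dimle W1 W2 m"
  and C: "stab C W1" "stab C W2"
  and comm: "\<And>b b' w. b \<in> C ==> b' \<in> C ==> w \<in> W2 ==> eqm W1 (act b (act b' w)) (act b' (act b w))"
 shows "\<exists>w \<in> W2 - W1. \<forall>b \<in> C. \<exists>c \<in> carrier K. eqm W1 (act b w) (c \<bullet> w)"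
 using W dim C comm
proof (induction m arbitrary: W2)
 case 0
 then show ?case using not_dimle_zero by blast
next
 case (Suc m)
 show ?case
 proof (cases "\<forall>b \<in> C. scal W1 W2 b")
  case True
  then show ?thesis using Suc.prems(3) unfolding scal_def by blast
 next
  case False
  then obtain b where b: "b \<in> C" "\<not> scal W1 W2 b" by blast
  have bs: "b \<in> carrier G" "stab {b} W1" "stab {b} W2"
   using b Suc.prems by (auto simp: stab_def)
  obtain c w where cw: "c \<in> carrier K" "w \<in> W2 - W1" "eqm W1 (act b w) (c \<bullet> w)"
   using eigenvector[OF closed Suc.prems(1-4) bs] by blast
  define U where "U = {w \<in> W2. \<forall>b \<in> {b}. eqm W1 (act b w) (c \<bullet> w)}"
  have U: "subsp U" "W1 \<subseteq> U"
   unfolding U_def using eigenspace[of W1 W2 "{b}" "\<lambda>_. c"] Suc.prems cw(1) bs by auto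
  have "U \<subset> W2"
   using b(2) cw(1) unfolding U_def scal_def by blast
  then have dimU: "dimle W1 U m" using dimle_below Suc.prems by blast
  have "W1 \<subset> U" using U cw unfolding U_def by blast
  moreover have "stab C U"
   unfolding stab_def
  proof (intro conjI ballI)
   show "C \<subseteq> carrier G" using Suc.prems by (auto simp: stab_def)
   fix b' w assume b': "b' \<in> C" and w: "w \<in> U"
   have wc: "w \<in> carrier V" and w2: "w \<in> W2" using w subspD[OF U(1)] by (auto simp: U_def)
   have b'c: "b' \<in> carrier G" using b' `C \<subseteq> carrier G` by blast
   have "eqm W1 (act b (act b' w)) (act b' (act b w))" using Suc.prems(7)[OF b(1) b' w2] .
   also have "eqm W1 (act b' (act b w)) (act b' (c \<bullet> w))"
    using w b' by (intro eqm_act[OF Suc.prems(5)]) (auto simp: U_def)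
   also have "act b' (c \<bullet> w) = c \<bullet> act b' w" using act_smult b'c cw wc by blast
   finally have "eqm W1 (act b (act b' w)) (c \<bullet> act b' w)" using Suc.prems by simp
   then show "act b' w \<in> U" using w2 b' Suc.prems(6) by (auto simp: U_def stab_def)
  qed
  ultimately have "\<exists>w \<in> U - W1. \<forall>b \<in> C. \<exists>c \<in> carrier K. eqm W1 (act b w) (c \<bullet> w)"
   using Suc.prems U dimU U_def by (intro Suc.IH) auto
  then show ?thesis unfolding U_def by blast
 qed
qed

end

section \<open>Reducibility of solvable linear groups\<close>

context linear_action
begin

lemma act_conjg:
 assumes "g \<in> carrier G" "b \<in> carrier G" "w \<in> carrier V"
 shows "act b (act g w) = act g (act (conjg G g b) w)"
proof -
 have "b \<otimes>\<^bsub>G\<^esub> g = g \<otimes>\<^bsub>G\<^esub> conjg G g b" using assms by (simp add: G.grp)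
 then show ?thesis using assms by (metis G.conjg_closed act_mult)
qed

text \<open>The characters of \<open>Y\<close> which occur in a finite-dimensional representation are permuted by the
 normalizer, so that a bounded derived subgroup fixes all of them.\<close>

lemma characters_fixed:
 assumes dim: "dimle W1 W2 m" and W: "subsp W1" "subsp W2" "W1 \<subset> W2"
  and N: "subgroup N G" and Yc: "Y \<subseteq> carrier G"
  and Y: "\<And>g b. g \<in> N ==> b \<in> Y ==> conjg G g b \<in> Y"
  and S: "\<And>x. x \<in> S ==> x \<in> Y \<rightarrow>\<^sub>E carrier K"
  and S_act: "\<And>g x. g \<in> N ==> x \<in> S ==> (\<lambda>b \<in> Y. x (conjg G g b)) \<in> S"
  and F: "\<And>x i. x \<in> S ==> i < t ==> F x i \<in> W2"
  and F_twist: "\<And>J c b. J \<subseteq> S ==> finite J ==> c \<in> J \<rightarrow> carrier K ==> b \<in> Y ==>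
   (\<forall>i < t. (\<Oplus>\<^bsub>V\<^esub>x \<in> J. c x \<bullet> F x i) \<in> W1) ==>
   (\<forall>i < t. (\<Oplus>\<^bsub>V\<^esub>x \<in> J. (c x \<otimes> x b) \<bullet> F x i) \<in> W1)"
  and F_nz: "\<And>x. x \<in> S ==> \<exists>i < t. F x i \<notin> W1"
  and q: "triv W1 W2 ((derived G ^^ q) N)"
  and triv_fix: "\<And>g x b. g \<in> N ==> triv W1 W2 {g} ==> x \<in> S ==> b \<in> Y ==> x (conjg G g b) = x b"
  and M: "t * m \<le> M"
 shows "\<forall>g \<in> (derived G ^^ (M ^ M)) N. \<forall>x \<in> S. \<forall>b \<in> Y. x (conjg G g b) = x b"
proof -
 have Kx: "x b \<in> carrier K" if "x \<in> S" "b \<in> Y" for x b using S[OF that(1)] that(2) by auto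
 have Fc: "F x i \<in> carrier V" if "x \<in> S" "i < t" for x i using F[OF that] subspD[OF W(2)] by auto
 \<comment> \<open>Each character \<open>x\<close> is witnessed by the tuple
   \<open>F x 0, ..., F x (t - 1)\<close>, and \<open>Rel\<close> collects the relations between the
   tuples modulo \<open>W1\<close>. Dedekind's argument makes the tuples independent, and there is
   room for at most \<open>t * m\<close> of them.\<close>
 have bound: "card J \<le> t * m" if J: "J \<subseteq> S" "finite J" for J
 proof (rule ccontr)
  assume "\<not> card J \<le> t * m"
  then have cJ: "t * m < card J" by simp
  have "F x i \<in> W2" if "x \<in> J" "i < t" for x i using F that J(1) by blast
  from many_vectors_dependent[OF dim W(1,2) psubset_imp_subset[OF W(3)] J(2) cJ this]
  have "\<exists>c. (\<forall>x \<in> J. c x \<in> carrier K) \<and> (\<exists>x \<in> J. c x \<noteq> \<zero>) \<and>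
   (\<forall>i < t. (\<Oplus>\<^bsub>V\<^esub>x \<in> J. c x \<bullet> F x i) \<in> W1)" .
  then obtain c where c: "\<forall>x \<in> J. c x \<in> carrier K" "\<exists>x \<in> J. c x \<noteq> \<zero>"
   "\<forall>i < t. (\<Oplus>\<^bsub>V\<^esub>x \<in> J. c x \<bullet> F x i) \<in> W1"
   by (elim exE conjE)
  define Rel where "Rel c \<longleftrightarrow> c \<in> J \<rightarrow> carrier K \<and> (\<forall>i < t. (\<Oplus>\<^bsub>V\<^esub>x \<in> J. c x \<bullet> F x i) \<in> W1)" for c
  have "c x = \<zero>" if "x \<in> J" for x
  proof (rule K.independence_of_characters[where Y = Y and \<chi> = "\<lambda>x. x" and Rel = Rel and c = c and x = x, OF J(2)])
   show "x b \<in> carrier K" if "x \<in> J" "b \<in> Y" for x b using that Kx J by auto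
   show "\<exists>b \<in> Y. x b \<noteq> y b" if "x \<in> J" "y \<in> J" "x \<noteq> y" for x y
    using that S J(1) PiE_ext by (metis subsetD)
   show "c x \<in> carrier K" if "Rel c" "x \<in> J" for c x using that by (auto simp: Rel_def)
   show "Rel (\<lambda>x. c x \<otimes> (x b \<ominus> k))" if "Rel c" "b \<in> Y" "k \<in> carrier K" for c k b
   proof -
    have cJ: "c x \<in> carrier K" if "x \<in> J" for x using `Rel c` that by (auto simp: Rel_def)
    have xJ: "x b \<in> carrier K" if "x \<in> J" for x using that `b \<in> Y` Kx J by auto
    have "(\<Oplus>\<^bsub>V\<^esub>x \<in> J. (c x \<otimes> (x b \<ominus> k)) \<bullet> F x i) \<in> W1" if i: "i < t" for i
    proof -
     have FJ: "F x i \<in> carrier V" if "x \<in> J" for x using that i Fc J by auto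
     have "(\<Oplus>\<^bsub>V\<^esub>x \<in> J. (c x \<otimes> (x b \<ominus> k)) \<bullet> F x i)
      = (\<Oplus>\<^bsub>V\<^esub>x \<in> J. (c x \<otimes> x b) \<bullet> F x i +\<^sub>V (\<ominus> k) \<bullet> (c x \<bullet> F x i))"
      using cJ xJ FJ `k \<in> carrier K`
      by (intro V.add.finprod_cong') (auto simp: a_minus_def K.r_distr V.smult_l_distr K.r_minus
        K.m_comm simp flip: V.smult_assoc1)
     also have "\<dots> = (\<Oplus>\<^bsub>V\<^esub>x \<in> J. (c x \<otimes> x b) \<bullet> F x i)
       +\<^sub>V (\<Oplus>\<^bsub>V\<^esub>x \<in> J. (\<ominus> k) \<bullet> (c x \<bullet> F x i))"
      using cJ xJ FJ `k \<in> carrier K` by (intro V.finsum_addf) auto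
     also have "(\<Oplus>\<^bsub>V\<^esub>x \<in> J. (\<ominus> k) \<bullet> (c x \<bullet> F x i)) = (\<ominus> k) \<bullet> (\<Oplus>\<^bsub>V\<^esub>x \<in> J. c x \<bullet> F x i)"
      using cJ FJ `k \<in> carrier K` by (intro smult_finsum[symmetric]) auto
     finally show ?thesis
      using F_twist[OF J _ `b \<in> Y`, of c] `Rel c` i `k \<in> carrier K` subspD[OF W(1)]
      by (auto simp: Rel_def)
    qed
    then show ?thesis using cJ xJ `k \<in> carrier K` by (auto simp: Rel_def)
   qed
   show False if rel: "Rel c" and x: "x \<in> J" "c x \<noteq> \<zero>"
    and single: "\<And>y. y \<in> J ==> y \<noteq> x ==> c y = \<zero>" for c x
   proof -
    obtain i where i: "i < t" "F x i \<notin> W1" using F_nz x(1) J(1) by blast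
    have cJ: "c x \<in> carrier K" if "x \<in> J" for x using rel that by (auto simp: Rel_def)
    have FJ: "F x i \<in> carrier V" if "x \<in> J" for x using that i Fc J by auto
    have "(\<Oplus>\<^bsub>V\<^esub>y \<in> J. c y \<bullet> F y i) = (\<Oplus>\<^bsub>V\<^esub>y \<in> J. if x = y then c y \<bullet> F y i else 0\<^sub>V)"
     using cJ FJ single by (intro V.add.finprod_cong') auto
    also have "\<dots> = c x \<bullet> F x i"
     using cJ FJ J x by (intro V.finsum_singleton) auto
    finally have "c x \<bullet> F x i \<in> W1" using rel i by (auto simp: Rel_def)
    then show False using eqm_smult_zeroD[OF W(1) cJ[OF x(1)] x(2) _ FJ[OF x(1)]] i by blast
   qed
   show "Rel c" using c by (auto simp: Rel_def)
  qed (use that in auto)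
  then show False using c(2) by blast
 qed
 have finS: "finite S" "card S \<le> t * m"
  using bound finite_if_finite_subsets_card_bdd[of S "t * m"] by blast+
 \<comment> \<open>The action of \<open>N\<close> on the characters; restricting to \<open>Y\<close>
   matches the extensional functions of which \<open>S\<close> consists.\<close>
 define p where "p g x = (\<lambda>b \<in> Y. x (conjg G g b))" for g and x :: "'g => 'k"
 have Nc: "g \<in> carrier G" if "g \<in> N" for g using that by (rule subgroup.mem_carrier[OF N])
 have fix_iff: "p g x = x \<longleftrightarrow> (\<forall>b \<in> Y. x (conjg G g b) = x b)" if "x \<in> S" for g x
  using S[OF that] by (auto simp: p_def fun_eq_iff PiE_def extensional_def restrict_def)
 \<comment> \<open>The case without characters is separate because \<open>0 ^ 0 = 1\<close>.\<close>
 have M': "card S ^ card S \<le> M ^ M"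
 proof (cases "card S = 0")
  case True
  then show ?thesis by (cases "M = 0") auto
 next
  case False
  then have "card S ^ card S \<le> M ^ card S" using finS M by (intro power_mono) auto
  also have "\<dots> \<le> M ^ M" using finS(2) M False by (intro power_increasing) linarith+
  finally show ?thesis .
 qed
 have "p g x = x" if g: "g \<in> (derived G ^^ (M ^ M)) N" and x: "x \<in> S" for g x
 proof (rule G.derived_acts_trivially[OF N finS(1)])
  show "p g x \<in> S" if "g \<in> N" "x \<in> S" for g x using S_act that by (simp add: p_def)
  show "p (g \<otimes>\<^bsub>G\<^esub> h) x = p g (p h x)" if "g \<in> N" "h \<in> N" "x \<in> S" for g h x
   using that Y Yc Nc by (auto simp: p_def fun_eq_iff G.conjg_mult_left restrict_def subset_iff)
  show "p \<one>\<^bsub>G\<^esub> x = x" if "x \<in> S" for x using fix_iff[OF that] Yc by (auto simp: subset_iff)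
  show "p g x = x" if "g \<in> (derived G ^^ q) N" "x \<in> S" for g x
  proof -
   have "g \<in> N" using that G.exp_derived_antimono[OF N, of 0 q] by auto
   moreover have "triv W1 W2 {g}" using q that by (auto simp: triv_def)
   ultimately show ?thesis using fix_iff[OF that(2)] triv_fix that(2) by blast
  qed
  show "g \<in> (derived G ^^ (card S ^ card S)) N"
   using g G.exp_derived_antimono[OF N M'] by blast
 qed (use x in auto)
 then show ?thesis using fix_iff by blast
qed

lemma eqm_act_inv_cancel:
 assumes "stab {inv\<^bsub>G\<^esub> g} W" "g \<in> carrier G" "eqm W (act g x) (act g y)" "x \<in> carrier V" "y \<in> carrier V"
 shows "eqm W x y"
proof -
 have "eqm W (act (inv\<^bsub>G\<^esub> g) (act g x)) (act (inv\<^bsub>G\<^esub> g) (act g y))"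
  using eqm_act[OF assms(1,3)] by simp
 then show ?thesis using assms by (simp flip: act_mult)
qed

lemma commuting_subgroup:
 assumes W: "subsp W1" "subsp W2" and N: "subgroup N G" "stab N W1" "stab N W2" and a: "a \<in> N"
 shows "subgroup {g \<in> N. \<forall>w \<in> W2. eqm W1 (act a (act g w)) (act g (act a w))} G" (is "subgroup ?Q G")
proof (rule G.subgroupI)
 have Nc: "g \<in> carrier G" if "g \<in> N" for g using that by (rule subgroup.mem_carrier[OF N(1)])
 have Wc: "w \<in> carrier V" if "w \<in> W2" for w using that subspD[OF W(2)] by blast
 have sW: "act g w \<in> W2" if "g \<in> N" "w \<in> W2" for g w using N(3) that by (auto simp: stab_def)
 show "?Q \<subseteq> carrier G" using Nc by blast
 have "\<one>\<^bsub>G\<^esub> \<in> ?Q" using W a Nc Wc subgroup.one_closed[OF N(1)] by simp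
 then show "?Q \<noteq> {}" by blast
 show "g \<otimes>\<^bsub>G\<^esub> h \<in> ?Q" if "g \<in> ?Q" "h \<in> ?Q" for g h
 proof -
  have "eqm W1 (act a (act (g \<otimes>\<^bsub>G\<^esub> h) w)) (act (g \<otimes>\<^bsub>G\<^esub> h) (act a w))" if w: "w \<in> W2" for w
  proof -
   have "eqm W1 (act a (act g (act h w))) (act g (act a (act h w)))"
    using `g \<in> ?Q` `h \<in> ?Q` w sW by blast
   also have "eqm W1 (act g (act a (act h w))) (act g (act h (act a w)))"
    using `g \<in> ?Q` `h \<in> ?Q` w by (intro eqm_act[OF N(2)]) auto
   finally show ?thesis using `g \<in> ?Q` `h \<in> ?Q` w Wc Nc a sW W(1) by (simp add: act_mult)
  qed
  then show ?thesis using that subgroup.m_closed[OF N(1)] by blast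
 qed
 show "inv\<^bsub>G\<^esub> g \<in> ?Q" if g: "g \<in> ?Q" for g
 proof -
  have gN: "g \<in> N" "inv\<^bsub>G\<^esub> g \<in> N" using g subgroup.m_inv_closed[OF N(1)] by auto
  have gc: "g \<in> carrier G" and ac: "a \<in> carrier G" using Nc gN a by auto
  have "eqm W1 (act a (act (inv\<^bsub>G\<^esub> g) w)) (act (inv\<^bsub>G\<^esub> g) (act a w))" if w: "w \<in> W2" for w
  proof -
   have w': "act (inv\<^bsub>G\<^esub> g) w \<in> W2" using sW gN w by blast
   have gi: "act g (act (inv\<^bsub>G\<^esub> g) v) = v" if "v \<in> carrier V" for v
    using gc that by (simp flip: act_mult)
   have "eqm W1 (act g (act a (act (inv\<^bsub>G\<^esub> g) w))) (act a (act g (act (inv\<^bsub>G\<^esub> g) w)))"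
    using g w' W(1) by (auto intro: eqm_sym)
   then have "eqm W1 (act g (act a (act (inv\<^bsub>G\<^esub> g) w))) (act g (act (inv\<^bsub>G\<^esub> g) (act a w)))"
    using gi Wc w ac by simp
   moreover have "stab {inv\<^bsub>G\<^esub> g} W1" using N(2) gN stab_mono by blast
   ultimately show ?thesis using eqm_act_inv_cancel gc ac Wc w w' by auto
  qed
  then show ?thesis using gN by blast
 qed
qed

text \<open>The last derived subgroup \<open>A\<close> that is not scalar has scalar commutators.
  Either its centre \<open>C\<close> is not scalar, and \<open>N\<close> permutes the weights of
  \<open>C\<close>; or the commutators define a pairing \<open>lam\<close> on \<open>A\<close>, and
  \<open>N\<close> permutes the characters \<open>lam a\<close>. There are at most m^2 characters in
  both cases, so \<open>(m * m) ^ (m * m)\<close> derivations fix each of them; the second case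
  spends one more.\<close>

lemma solvable_reducible:
 assumes closed: "algebraically_closed K"
  and W: "subsp W1" "subsp W2" "W1 \<subset> W2" and dim: "dimle W1 W2 m"
  and N: "subgroup N G" "stab N W1" "stab N W2"
  and q: "triv W1 W2 ((derived G ^^ q) N)" and nonscal: "\<not> (\<forall>g \<in> N. scal W1 W2 g)"
 defines "L \<equiv> Suc ((m * m) ^ (m * m))"
 shows "\<exists>U. subsp U \<and> W1 \<subset> U \<and> U \<subset> W2 \<and> stab ((derived G ^^ L) N) U"
proof -
 define D where "D i = (derived G ^^ i) N" for i
 have D: "subgroup (D i) G" for i unfolding D_def by (rule G.exp_of_derived_is_subgroup[OF N(1)])
 have D_mono: "D j \<subseteq> D i" if "i \<le> j" for i j
  unfolding D_def by (rule G.exp_derived_antimono[OF N(1) that])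
 have DN: "D i \<subseteq> N" for i using D_mono[of 0 i] by (simp add: D_def)
 have Nc: "g \<in> carrier G" if "g \<in> N" for g using that by (rule subgroup.mem_carrier[OF N(1)])
 have Ninv: "inv\<^bsub>G\<^esub> g \<in> N" if "g \<in> N" for g using that by (rule subgroup.m_inv_closed[OF N(1)])
 have Wc: "w \<in> carrier V" if "w \<in> W2" for w using that subspD[OF W(2)] by blast
 have sW: "act g w \<in> W2" if "g \<in> N" "w \<in> W2" for g w using N(3) that by (auto simp: stab_def)
 have D_conjg: "conjg G g b \<in> D i" if "g \<in> N" "b \<in> D i" for g b i
  using that unfolding D_def
  by (intro G.conjg_exp_derived[where S = N] Nc subgroup.subset[OF N(1)])
   (auto simp: conjg_def intro!: subgroup.m_closed[OF N(1)] Ninv)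
 obtain w0 where w0: "w0 \<in> W2" "w0 \<notin> W1" using W by blast
 have m0: "m > 0" using not_dimle_zero[OF W] dim by (cases m) auto
 have "\<forall>g \<in> D q. scal W1 W2 g"
  using q Wc unfolding scal_def triv_def D_def by (auto intro!: bexI[of _ \<one>])
 moreover have "\<not> (\<forall>g \<in> D 0. scal W1 W2 g)" using nonscal by (simp add: D_def)
 ultimately obtain j where j: "\<not> (\<forall>g \<in> D j. scal W1 W2 g)" "\<forall>g \<in> D (Suc j). scal W1 W2 g"
  using inc_induct[of 0 q "\<lambda>j. \<forall>g \<in> D j. scal W1 W2 g"] by blast
 define A where "A = D j"
 have A: "subgroup A G" "A \<subseteq> N" using D DN by (auto simp: A_def)
 have A_conjg: "conjg G g b \<in> A" if "g \<in> N" "b \<in> A" for g b using D_conjg that by (simp add: A_def)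
 have Ac: "a \<in> carrier G" if "a \<in> A" for a using that A Nc by blast
 define commutes where "commutes a b \<longleftrightarrow> (\<forall>w \<in> W2. eqm W1 (act a (act b w)) (act b (act a w)))" for a b
 \<comment> \<open>The centre of \<open>A\<close> as a group of transformations of
   \<open>W2/W1\<close>.\<close>
 define C where "C = {b \<in> A. \<forall>a \<in> A. commutes b a}"
 have CA: "C \<subseteq> A" by (auto simp: C_def)
 have conjg_surj: "a = conjg G g (conjg G (inv\<^bsub>G\<^esub> g) a)" if "a \<in> A" "g \<in> N" for a g
  using that Ac Nc by simp
 have commutes_conjg: "commutes (conjg G g a) (conjg G g b)"
  if "commutes a b" "g \<in> N" "a \<in> A" "b \<in> A" for g a b
  unfolding commutes_def
 proof
  fix w assume w: "w \<in> W2"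
  have c: "g \<in> carrier G" "a \<in> carrier G" "b \<in> carrier G" "w \<in> carrier V" using that Nc Ac w Wc by auto
  have *: "act (conjg G g x) (act (conjg G g y) w) = act (inv\<^bsub>G\<^esub> g) (act x (act y (act g w)))"
   if "x \<in> carrier G" "y \<in> carrier G" for x y
   using that c by (simp add: G.grp flip: act_mult)
  have "eqm W1 (act a (act b (act g w))) (act b (act a (act g w)))"
   using that w sW by (auto simp: commutes_def)
  then have "eqm W1 (act (inv\<^bsub>G\<^esub> g) (act a (act b (act g w)))) (act (inv\<^bsub>G\<^esub> g) (act b (act a (act g w))))"
   using Ninv that by (intro eqm_act[OF N(2)])
  then show "eqm W1 (act (conjg G g a) (act (conjg G g b) w)) (act (conjg G g b) (act (conjg G g a) w))"
   using * c by simp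
 qed
 have C_conjg: "conjg G g b \<in> C" if "g \<in> N" "b \<in> C" for g b
 proof -
  have "commutes (conjg G g b) a" if a: "a \<in> A" for a
  proof -
   have "conjg G (inv\<^bsub>G\<^esub> g) a \<in> A" using a `g \<in> N` A_conjg Ninv by blast
   then have "commutes (conjg G g b) (conjg G g (conjg G (inv\<^bsub>G\<^esub> g) a))"
    using `b \<in> C` `g \<in> N` by (intro commutes_conjg) (auto simp: C_def)
   then show ?thesis using conjg_surj[OF a `g \<in> N`] by simp
  qed
  then show ?thesis using that A_conjg by (auto simp: C_def)
 qed
 show ?thesis
 proof (cases "\<forall>b \<in> C. scal W1 W2 b")
  case False
  then obtain b0 where b0: "b0 \<in> C" "\<not> scal W1 W2 b0" by blast
  have sC: "stab C W1" "stab C W2" using stab_mono N CA A by blast+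
  have Cc: "b \<in> carrier G" if "b \<in> C" for b using that CA Ac by blast
  define wt where "wt x w \<longleftrightarrow> w \<in> W2 - W1 \<and> (\<forall>b \<in> C. eqm W1 (act b w) (x b \<bullet> w))" for x w
  define S where "S = {x \<in> C \<rightarrow>\<^sub>E carrier K. \<exists>w. wt x w}"
  have "\<exists>w \<in> W2 - W1. \<forall>b \<in> C. \<exists>c \<in> carrier K. eqm W1 (act b w) (c \<bullet> w)"
   using CA by (intro common_eigenvector[OF closed W dim sC]) (auto simp: C_def commutes_def)
  then obtain w c where wc: "w \<in> W2 - W1" "\<And>b. b \<in> C ==> c b \<in> carrier K \<and> eqm W1 (act b w) (c b \<bullet> w)"
   by metis
  define x where "x = restrict c C"
  have "wt x w" using wc by (auto simp: wt_def x_def)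
  moreover have "x \<in> C \<rightarrow>\<^sub>E carrier K" using wc by (auto simp: x_def)
  ultimately have xS: "x \<in> S" by (auto simp: S_def)
  have S: "y \<in> C \<rightarrow>\<^sub>E carrier K" if "y \<in> S" for y using that by (auto simp: S_def)
  have Sk: "y b \<in> carrier K" if "y \<in> S" "b \<in> C" for y b using S[OF that(1)] that(2) by auto
  define v where "v y = (SOME w. wt y w)" for y
  have v: "wt y (v y)" if "y \<in> S" for y using that someI_ex[of "wt y"] by (auto simp: S_def v_def)
  have vc: "v y \<in> carrier V" if "y \<in> S" for y using v[OF that] Wc by (auto simp: wt_def)
  have fixed: "\<forall>g \<in> D ((m * m) ^ (m * m)). \<forall>y \<in> S. \<forall>b \<in> C. y (conjg G g b) = y b"
   unfolding D_def
  proof (rule characters_fixed[OF dim W N(1), where t = 1 and F = "\<lambda>y _. v y"])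
   show "C \<subseteq> carrier G" using Cc by blast
   show "conjg G g b \<in> C" if "g \<in> N" "b \<in> C" for g b using C_conjg that by blast
   show "y \<in> C \<rightarrow>\<^sub>E carrier K" if "y \<in> S" for y using S that by blast
   show "(\<lambda>b \<in> C. y (conjg G g b)) \<in> S" if gy: "g \<in> N" "y \<in> S" for g y
   proof -
    have gc: "g \<in> carrier G" using gy Nc by blast
    have "wt (\<lambda>b \<in> C. y (conjg G g b)) (act g (v y))"
     unfolding wt_def
    proof (intro conjI ballI)
     have v2: "v y \<in> W2" "v y \<notin> W1" using v[OF gy(2)] by (auto simp: wt_def)
     have "act g (v y) \<notin> W1"
     proof
      assume "act g (v y) \<in> W1"
      then have "act (inv\<^bsub>G\<^esub> g) (act g (v y)) \<in> W1" using N(2) Ninv[OF gy(1)] by (auto simp: stab_def)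
      then show False using v2 gc Wc by (simp flip: act_mult)
     qed
     then show "act g (v y) \<in> W2 - W1" using sW gy v2 by blast
     fix b assume b: "b \<in> C"
     have cb: "conjg G g b \<in> C" using C_conjg gy b by blast
     have "eqm W1 (act (conjg G g b) (v y)) (y (conjg G g b) \<bullet> v y)"
      using v[OF gy(2)] cb by (auto simp: wt_def)
     then have "eqm W1 (act g (act (conjg G g b) (v y))) (act g (y (conjg G g b) \<bullet> v y))"
      using gy by (intro eqm_act[OF N(2)])
     then show "eqm W1 (act b (act g (v y))) ((\<lambda>b \<in> C. y (conjg G g b)) b \<bullet> act g (v y))"
      using b cb gc gy act_conjg[OF gc Cc[OF b] vc[OF gy(2)]] act_smult[OF gc Sk[OF gy(2) cb] vc[OF gy(2)]]
      by simp
    qed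
    moreover have "(\<lambda>b \<in> C. y (conjg G g b)) \<in> C \<rightarrow>\<^sub>E carrier K" using Sk C_conjg gy by auto
    ultimately show ?thesis by (auto simp: S_def)
   qed
   show "v y \<in> W2" if "y \<in> S" for y using v[OF that] by (auto simp: wt_def)
   show "\<exists>i < 1::nat. v y \<notin> W1" if "y \<in> S" for y using v[OF that] by (auto simp: wt_def)
   show "triv W1 W2 ((derived G ^^ q) N)" by (rule q)
   show "1 * m \<le> m * m" using m0 by simp
   show "y (conjg G g b) = y b" if "g \<in> N" "triv W1 W2 {g}" "y \<in> S" "b \<in> C" for g y b
   proof (rule eqm_smult_cancel[OF W(1), of "v y"])
    have vy: "v y \<in> W2" "v y \<notin> W1" using v[OF `y \<in> S`] by (auto simp: wt_def)
    then show "v y \<in> carrier V" "v y \<notin> W1" using Wc by auto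
    have cb: "conjg G g b \<in> C" using C_conjg that by blast
    then show "y (conjg G g b) \<in> carrier K" "y b \<in> carrier K" using Sk that by auto
    have gc: "g \<in> carrier G" and bc: "b \<in> carrier G" using that Nc Cc by auto
    have tg: "eqm W1 (act g w) w" if "w \<in> W2" for w using `triv W1 W2 {g}` that by (auto simp: triv_def)
    have bN: "b \<in> N" using `b \<in> C` CA A by blast
    have "eqm W1 (y (conjg G g b) \<bullet> v y) (act (conjg G g b) (v y))"
     using v[OF `y \<in> S`] cb W(1) by (auto simp: wt_def intro: eqm_sym)
    also have "eqm W1 (act (conjg G g b) (v y)) (act g (act (conjg G g b) (v y)))"
     using tg[of "act (conjg G g b) (v y)"] cb CA A sW vy W(1) by (blast intro: eqm_sym)
    also have "act g (act (conjg G g b) (v y)) = act b (act g (v y))"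
     using act_conjg[OF gc bc Wc[OF vy(1)]] by simp
    also have "eqm W1 \<dots> (act b (v y))" using tg vy bN by (intro eqm_act[OF N(2)])
    also have "eqm W1 (act b (v y)) (y b \<bullet> v y)"
     using v[OF `y \<in> S`] `b \<in> C` by (auto simp: wt_def)
    finally show "eqm W1 (y (conjg G g b) \<bullet> v y) (y b \<bullet> v y)" using W(1) by simp
   qed
   show "\<forall>i < 1::nat. (\<Oplus>\<^bsub>V\<^esub>x \<in> J. (c x \<otimes> x b) \<bullet> v x) \<in> W1"
    if J: "J \<subseteq> S" "finite J" and c: "c \<in> J \<rightarrow> carrier K" and b: "b \<in> C"
     and rel: "\<forall>i < 1::nat. (\<Oplus>\<^bsub>V\<^esub>x \<in> J. c x \<bullet> v x) \<in> W1" for J c b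
   proof -
    have bc: "b \<in> carrier G" using b Cc by blast
    have car: "c x \<in> carrier K" "v x \<in> carrier V" "x b \<in> carrier K" if "x \<in> J" for x
     using that J c b vc Sk by auto
    have "act b (\<Oplus>\<^bsub>V\<^esub>x \<in> J. c x \<bullet> v x) \<in> W1" using rel sC(1) b by (auto simp: stab_def)
    moreover have "eqm W1 (\<Oplus>\<^bsub>V\<^esub>x \<in> J'. (c x \<otimes> x b) \<bullet> v x) (act b (\<Oplus>\<^bsub>V\<^esub>x \<in> J'. c x \<bullet> v x))"
     if "J' \<subseteq> J" for J'
     using finite_subset[OF that J(2)] that
    proof (induction J' rule: finite_induct)
     case (insert x J')
     have x: "x \<in> J" using insert by auto
     have sc: "(\<Oplus>\<^bsub>V\<^esub>x \<in> J'. c x \<bullet> v x) \<in> carrier V"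
      using insert.prems car by (intro V.finsum_closed) auto
     have 1: "(\<Oplus>\<^bsub>V\<^esub>x \<in> insert x J'. (c x \<otimes> x b) \<bullet> v x)
       = (c x \<otimes> x b) \<bullet> v x +\<^sub>V (\<Oplus>\<^bsub>V\<^esub>x \<in> J'. (c x \<otimes> x b) \<bullet> v x)"
      using insert.hyps insert.prems car x by (intro V.finsum_insert) auto
     have "(\<Oplus>\<^bsub>V\<^esub>x \<in> insert x J'. c x \<bullet> v x) = c x \<bullet> v x +\<^sub>V (\<Oplus>\<^bsub>V\<^esub>x \<in> J'. c x \<bullet> v x)"
      using insert.hyps insert.prems car x by (intro V.finsum_insert) auto
     then have 2: "act b (\<Oplus>\<^bsub>V\<^esub>x \<in> insert x J'. c x \<bullet> v x)
       = c x \<bullet> act b (v x) +\<^sub>V act b (\<Oplus>\<^bsub>V\<^esub>x \<in> J'. c x \<bullet> v x)"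
      using bc car x sc by (simp add: act_add act_smult)
     have 3: "(c x \<otimes> x b) \<bullet> v x = c x \<bullet> (x b \<bullet> v x)"
      using car[OF x] by (simp add: V.smult_assoc1)
     have "eqm W1 (act b (v x)) (x b \<bullet> v x)" using v[of x] x J(1) b by (auto simp: wt_def)
     then have "eqm W1 (x b \<bullet> v x) (act b (v x))" by (rule eqm_sym[OF W(1)])
     then show ?case
      unfolding 1 2 3 using insert car x W(1) by (intro eqm_add eqm_smult) auto
    qed (use W bc in simp)
    ultimately show ?thesis using eqm_memI[OF W(1) subset_refl] by blast
   qed
  qed
  \<comment> \<open>The weight space of one character: nonzero because of \<open>w\<close>, proper
    because \<open>b0\<close> is not scalar, and stable under every \<open>g\<close> that fixes the
    character.\<close>
  define U where "U = {w \<in> W2. \<forall>b \<in> C. eqm W1 (act b w) (x b \<bullet> w)}"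
  have U: "subsp U" "W1 \<subseteq> U"
   unfolding U_def using W sC Sk xS by (intro eigenspace; auto)+
  moreover have "w \<in> U" "w \<notin> W1" using `wt x w` by (auto simp: wt_def U_def)
  moreover have "U \<noteq> W2"
   using b0 Sk[OF xS b0(1)] unfolding scal_def U_def by blast
  moreover have "stab (D L) U"
   unfolding stab_def
  proof (intro conjI ballI)
   show "D L \<subseteq> carrier G" using DN Nc by blast
   fix g w assume g: "g \<in> D L" and w: "w \<in> U"
   have gN: "g \<in> N" using g DN by blast
   have wW: "w \<in> W2" using w by (simp add: U_def)
   have gf: "g \<in> D ((m * m) ^ (m * m))" using g D_mono[of "(m * m) ^ (m * m)" L] by (auto simp: L_def)
   have "eqm W1 (act b (act g w)) (x b \<bullet> act g w)" if b: "b \<in> C" for b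
   proof -
    have cb: "conjg G g b \<in> C" using C_conjg gN b by blast
    have "eqm W1 (act (conjg G g b) w) (x (conjg G g b) \<bullet> w)" using w cb by (auto simp: U_def)
    then have "eqm W1 (act g (act (conjg G g b) w)) (act g (x (conjg G g b) \<bullet> w))"
     using gN by (intro eqm_act[OF N(2)])
    moreover have "x (conjg G g b) = x b" using fixed gf xS b by blast
    ultimately show ?thesis
     using act_conjg[OF Nc[OF gN] Cc[OF b] Wc[OF wW]] act_smult[OF Nc[OF gN] Sk[OF xS b] Wc[OF wW]] by simp
   qed
   then show "act g w \<in> U" using sW gN wW by (simp add: U_def)
  qed
  ultimately show ?thesis unfolding D_def U_def by blast
 next
  case Cscal: True
  obtain a0 where a0: "a0 \<in> A" "\<not> scal W1 W2 a0" using j(1) by (auto simp: A_def)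
  \<comment> \<open>\<open>comm G a b\<close> lies in \<open>D (Suc j)\<close>, hence acts as a
    scalar, and this scalar is the factor by which a b and b a differ.\<close>
  have "\<exists>c. c \<in> carrier K \<and> c \<noteq> \<zero> \<and> (\<forall>w \<in> W2. eqm W1 (act a (act b w)) (c \<bullet> act b (act a w)))"
   if ab: "a \<in> A" "b \<in> A" for a b
  proof -
   have "comm G a b \<in> D (Suc j)"
    using G.comm_in_derived[OF A(1) ab] by (simp add: A_def D_def)
   then obtain c where c: "c \<in> carrier K" "\<And>w. w \<in> W2 ==> eqm W1 (act (comm G a b) w) (c \<bullet> w)"
    using j(2) by (auto simp: scal_def)
   have abc: "a \<in> carrier G" "b \<in> carrier G" and abN: "a \<in> N" "b \<in> N" using ab Ac A by auto
   have main: "eqm W1 (act a (act b w)) (c \<bullet> act b (act a w))" if w: "w \<in> W2" for w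
   proof -
    have "b \<otimes>\<^bsub>G\<^esub> a \<in> N" using abN subgroup.m_closed[OF N(1)] by blast
    then have "eqm W1 (act (b \<otimes>\<^bsub>G\<^esub> a) (act (comm G a b) w)) (act (b \<otimes>\<^bsub>G\<^esub> a) (c \<bullet> w))"
     using c(2)[OF w] by (intro eqm_act[OF N(2)])
    moreover have "act (b \<otimes>\<^bsub>G\<^esub> a) (act (comm G a b) w) = act (a \<otimes>\<^bsub>G\<^esub> b) w"
     using abc w Wc by (simp add: G.grp flip: act_mult)
    ultimately show ?thesis using abc w Wc c(1) by (simp add: act_smult act_mult)
   qed
   moreover have "c \<noteq> \<zero>"
   proof
    assume "c = \<zero>"
    then have "eqm W1 (act (comm G a b) w0) 0\<^sub>V" using c(2)[OF w0(1)] w0(1) Wc by simp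
    then have "act (comm G a b) w0 \<in> W1" using eqm_zero_iff abc w0 Wc by simp
    moreover have "inv\<^bsub>G\<^esub> (comm G a b) \<in> N"
     using Ninv `comm G a b \<in> D (Suc j)` DN by blast
    ultimately have "act (inv\<^bsub>G\<^esub> (comm G a b)) (act (comm G a b) w0) \<in> W1"
     using N(2) by (auto simp: stab_def)
    then show False using w0 Wc abc by (simp flip: act_mult)
   qed
   ultimately show ?thesis using c(1) by blast
  qed
  then obtain lam where lam: "\<And>a b. a \<in> A ==> b \<in> A ==> lam a b \<in> carrier K"
   "\<And>a b. a \<in> A ==> b \<in> A ==> lam a b \<noteq> \<zero>"
   "\<And>a b w. a \<in> A ==> b \<in> A ==> w \<in> W2 ==> eqm W1 (act a (act b w)) (lam a b \<bullet> act b (act a w))"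
   by metis
  have actW1: "act g w \<notin> W1" if "g \<in> N" "w \<in> W2" "w \<notin> W1" for g w
  proof
   assume "act g w \<in> W1"
   then have "act (inv\<^bsub>G\<^esub> g) (act g w) \<in> W1" using N(2) Ninv that by (auto simp: stab_def)
   then show False using that Nc Wc by (simp flip: act_mult)
  qed
  have lam_eqI: "lam a b = c" if "a \<in> A" "b \<in> A" "c \<in> carrier K"
   "eqm W1 (act a (act b w0)) (c \<bullet> act b (act a w0))" for a b c
  proof (rule eqm_smult_cancel[OF W(1)])
   have abN: "a \<in> N" "b \<in> N" using that A by auto
   show "act b (act a w0) \<in> carrier V" using w0 Wc sW abN by blast
   show "act b (act a w0) \<notin> W1" using actW1 w0 abN sW by blast
   show "eqm W1 (lam a b \<bullet> act b (act a w0)) (c \<bullet> act b (act a w0))"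
    using eqm_trans[OF eqm_sym[OF W(1) lam(3)[OF that(1,2) w0(1)]] that(4) W(1)] .
  qed (use that lam in auto)
  have lam_conjg: "lam (conjg G g a) (conjg G g b) = lam a b" if g: "g \<in> N" and ab: "a \<in> A" "b \<in> A" for g a b
  proof (rule lam_eqI)
   have c: "g \<in> carrier G" "a \<in> carrier G" "b \<in> carrier G" "w0 \<in> carrier V" using that Nc Ac w0 Wc by auto
   have *: "act (conjg G g x) (act (conjg G g y) w0) = act (inv\<^bsub>G\<^esub> g) (act x (act y (act g w0)))"
    if "x \<in> carrier G" "y \<in> carrier G" for x y
    using that c by (simp add: G.grp flip: act_mult)
   have "eqm W1 (act a (act b (act g w0))) (lam a b \<bullet> act b (act a (act g w0)))"
    using lam(3) ab sW g w0 by blast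
   then have "eqm W1 (act (inv\<^bsub>G\<^esub> g) (act a (act b (act g w0))))
     (act (inv\<^bsub>G\<^esub> g) (lam a b \<bullet> act b (act a (act g w0))))"
    using Ninv g by (intro eqm_act[OF N(2)])
   then show "eqm W1 (act (conjg G g a) (act (conjg G g b) w0))
     (lam a b \<bullet> act (conjg G g b) (act (conjg G g a) w0))"
    using * c lam(1)[OF ab] by (simp add: act_smult)
  qed (use that A_conjg lam in auto)
  have lam_one: "commutes a b" if "lam a b = \<one>" "a \<in> A" "b \<in> A" for a b
   unfolding commutes_def using lam(3)[OF that(2,3)] that Wc sW A by (auto simp: subset_iff)
  have comm_lam: "lam a b = \<one>" if "commutes a b" "a \<in> A" "b \<in> A" for a b
   using that w0 Wc sW A by (intro lam_eqI) (auto simp: commutes_def subset_iff)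
  define S where "S = (\<lambda>a. \<lambda>b \<in> A. lam a b) ` A"
  \<comment> \<open>A representative in \<open>A\<close> for each character. As operators the
    representatives are eigenvectors of conjugation by \<open>A\<close>, with the values of the
    characters as eigenvalues.\<close>
  define r where "r y = (SOME a. a \<in> A \<and> y = (\<lambda>b \<in> A. lam a b))" for y
  have r: "r y \<in> A" "y = (\<lambda>b \<in> A. lam (r y) b)" if "y \<in> S" for y
   using that someI_ex[of "\<lambda>a. a \<in> A \<and> y = (\<lambda>b \<in> A. lam a b)"] by (auto simp: S_def r_def)
  have yb: "y b = lam (r y) b" if "y \<in> S" "b \<in> A" for y b using r(2)[OF that(1)] that(2) by (metis restrict_apply')
  \<comment> \<open>Operators are compared through their values on \<open>m\<close> spanning
    vectors; hence \<open>t = m\<close> below and the bound \<open>m * m\<close> on the number of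
    characters.\<close>
  obtain e where e: "\<And>i. i < m ==> e i \<in> W2" "\<And>w. w \<in> W2 ==> \<exists>k. (\<forall>i < m. k i \<in> carrier K) \<and>
    eqm W1 w (\<Oplus>\<^bsub>V\<^esub>i \<in> {..<m}. k i \<bullet> e i)"
   using dimle_spanning[OF dim] W by blast
  have fixed: "\<forall>g \<in> D ((m * m) ^ (m * m)). \<forall>y \<in> S. \<forall>b \<in> A. y (conjg G g b) = y b"
   unfolding D_def
  proof (rule characters_fixed[OF dim W N(1), where t = m and F = "\<lambda>y i. act (r y) (e i)"])
   show "A \<subseteq> carrier G" using Ac by blast
   show "conjg G g b \<in> A" if "g \<in> N" "b \<in> A" for g b using A_conjg that by blast
   show "y \<in> A \<rightarrow>\<^sub>E carrier K" if "y \<in> S" for y using that lam(1) by (auto simp: S_def)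
   show "(\<lambda>b \<in> A. y (conjg G g b)) \<in> S" if gy: "g \<in> N" "y \<in> S" for g y
   proof -
    obtain a where a: "a \<in> A" "y = (\<lambda>b \<in> A. lam a b)" using gy by (auto simp: S_def)
    have a': "conjg G (inv\<^bsub>G\<^esub> g) a \<in> A" using A_conjg Ninv gy a by blast
    have "lam a (conjg G g b) = lam (conjg G (inv\<^bsub>G\<^esub> g) a) b" if b: "b \<in> A" for b
     using lam_conjg[OF gy(1) a' b] conjg_surj[OF a(1) gy(1)] by simp
    then have "(\<lambda>b \<in> A. y (conjg G g b)) = (\<lambda>b \<in> A. lam (conjg G (inv\<^bsub>G\<^esub> g) a) b)"
     using A_conjg gy a by (auto simp: fun_eq_iff restrict_def)
    then show ?thesis using a' by (auto simp: S_def)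
   qed
   show "act (r y) (e i) \<in> W2" if "y \<in> S" "i < m" for y i using that r A sW e by blast
   show "triv W1 W2 ((derived G ^^ q) N)" by (rule q)
   show "y (conjg G g b) = y b" if "g \<in> N" "triv W1 W2 {g}" "y \<in> S" "b \<in> A" for g y b
   proof -
    have ry: "r y \<in> A" and cb: "conjg G g b \<in> A" using r that A_conjg by auto
    have tg: "eqm W1 (act g w) w" if "w \<in> W2" for w using `triv W1 W2 {g}` that by (auto simp: triv_def)
    have gc: "g \<in> carrier G" and bc: "b \<in> carrier G" using that Nc Ac by auto
    have same: "eqm W1 (act (conjg G g b) w) (act b w)" if w: "w \<in> W2" for w
    proof -
     have "eqm W1 (act (conjg G g b) w) (act g (act (conjg G g b) w))"
      using tg[of "act (conjg G g b) w"] cb A sW w W(1) by (blast intro: eqm_sym)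
     also have "act g (act (conjg G g b) w) = act b (act g w)"
      using act_conjg[OF gc bc Wc[OF w]] by simp
     also have "eqm W1 \<dots> (act b w)" using tg w `b \<in> A` A by (intro eqm_act[OF N(2)]) auto
     finally show ?thesis using W(1) by simp
    qed
    have "lam (r y) (conjg G g b) = lam (r y) b"
    proof (rule lam_eqI[OF ry cb])
     have ryW: "act (r y) w0 \<in> W2" using sW ry A w0 by blast
     have "eqm W1 (act (r y) (act (conjg G g b) w0)) (act (r y) (act b w0))"
      using same w0 ry A by (intro eqm_act[OF N(2)]) auto
     also have "eqm W1 (act (r y) (act b w0)) (lam (r y) b \<bullet> act b (act (r y) w0))"
      using lam(3) ry `b \<in> A` w0 by blast
     also have "eqm W1 (lam (r y) b \<bullet> act b (act (r y) w0))
       (lam (r y) b \<bullet> act (conjg G g b) (act (r y) w0))"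
      using same[OF ryW] lam(1) ry `b \<in> A` W(1) by (intro eqm_smult) (auto intro: eqm_sym)
     finally show "eqm W1 (act (r y) (act (conjg G g b) w0))
       (lam (r y) b \<bullet> act (conjg G g b) (act (r y) w0))" using W(1) by simp
    qed (use lam ry that in auto)
    then show ?thesis using yb that cb by simp
   qed
   show "\<exists>i < m. act (r y) (e i) \<notin> W1" if y: "y \<in> S" for y
   proof (rule ccontr)
    assume "\<not> ?thesis"
    then have all: "act (r y) (e i) \<in> W1" if "i < m" for i using that by blast
    have ry: "r y \<in> carrier G" "r y \<in> N" using r[OF y] A Ac by auto
    have "e i \<in> W1" if "i < m" for i using all[OF that] actW1[OF ry(2) e(1)[OF that]] by blast
    then have "(\<Oplus>\<^bsub>V\<^esub>i \<in> {..<m}. k i \<bullet> e i) \<in> W1" if "\<forall>i < m. k i \<in> carrier K" for k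
     using that subspD[OF W(1)] by (intro subsp_finsum[OF W(1)]) auto
    then have "w0 \<in> W1" using e(2)[OF w0(1)] eqm_memI[OF W(1) subset_refl] by blast
    then show False using w0 by blast
   qed
   show "\<forall>i < m. (\<Oplus>\<^bsub>V\<^esub>x \<in> J. (c x \<otimes> x b) \<bullet> act (r x) (e i)) \<in> W1"
    if J: "J \<subseteq> S" "finite J" and c: "c \<in> J \<rightarrow> carrier K" and b: "b \<in> A"
     and rel: "\<forall>i < m. (\<Oplus>\<^bsub>V\<^esub>x \<in> J. c x \<bullet> act (r x) (e i)) \<in> W1" for J c b
   proof -
    have bc: "b \<in> carrier G" and bN: "b \<in> N" using b Ac A by auto
    have rx: "r x \<in> A" "r x \<in> carrier G" "r x \<in> N" if "x \<in> J" for x using that J r A Ac by blast+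
    have cx: "c x \<in> carrier K" "x b \<in> carrier K" if x: "x \<in> J" for x
    proof -
     have "x \<in> S" using x J by blast
     then show "c x \<in> carrier K" "x b \<in> carrier K" using x c lam(1)[OF r(1) b] yb[OF _ b] by auto
    qed
    \<comment> \<open>A combination of operators that vanishes on the spanning vectors vanishes on
      \<open>W2\<close>. Evaluated at b w it is b applied to the twisted combination at w, and b is
      invertible.\<close>
    define f where "f w = (\<Oplus>\<^bsub>V\<^esub>x \<in> J. c x \<bullet> act (r x) w)" for w
    have fin: "f w \<in> W1" if w: "w \<in> W2" for w
    proof -
     obtain k where k: "\<forall>i < m. k i \<in> carrier K" "eqm W1 w (\<Oplus>\<^bsub>V\<^esub>i \<in> {..<m}. k i \<bullet> e i)"
      using e(2) w by blast
     have ec: "e i \<in> carrier V" if "i < m" for i using that e Wc by blast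
     let ?s = "\<Oplus>\<^bsub>V\<^esub>i \<in> {..<m}. k i \<bullet> e i"
     have trm: "c x \<bullet> act (r x) ?s = (\<Oplus>\<^bsub>V\<^esub>i \<in> {..<m}. k i \<bullet> (c x \<bullet> act (r x) (e i)))"
      if x: "x \<in> J" for x
     proof -
      have "act (r x) ?s = (\<Oplus>\<^bsub>V\<^esub>i \<in> {..<m}. act (r x) (k i \<bullet> e i))"
       using rx x k ec by (intro act_finsum) auto
      then have "c x \<bullet> act (r x) ?s = (\<Oplus>\<^bsub>V\<^esub>i \<in> {..<m}. c x \<bullet> act (r x) (k i \<bullet> e i))"
       using rx x k ec cx by (simp add: smult_finsum Pi_def)
      also have "\<dots> = (\<Oplus>\<^bsub>V\<^esub>i \<in> {..<m}. k i \<bullet> (c x \<bullet> act (r x) (e i)))"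
       using rx x k ec cx
       by (intro V.add.finprod_cong') (auto simp: act_smult K.m_comm simp flip: V.smult_assoc1)
      finally show ?thesis .
     qed
     have "eqm W1 (\<Oplus>\<^bsub>V\<^esub>x \<in> J'. c x \<bullet> act (r x) w) (\<Oplus>\<^bsub>V\<^esub>x \<in> J'. c x \<bullet> act (r x) ?s)"
      if "J' \<subseteq> J" for J'
      using finite_subset[OF that J(2)] that
     proof (induction J' rule: finite_induct)
      case (insert x J')
      have x: "x \<in> J" using insert by auto
      have scl: "?s \<in> carrier V" and wcl: "w \<in> carrier V" using eqm_carrier[OF k(2)] by auto
      have "eqm W1 (c x \<bullet> act (r x) w) (c x \<bullet> act (r x) ?s)"
       using cx[OF x] rx(3)[OF x] by (intro eqm_smult[OF W(1) eqm_act[OF N(2) k(2)]])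
      moreover have "(\<Oplus>\<^bsub>V\<^esub>x \<in> insert x J'. c x \<bullet> act (r x) z)
        = c x \<bullet> act (r x) z +\<^sub>V (\<Oplus>\<^bsub>V\<^esub>x \<in> J'. c x \<bullet> act (r x) z)" if "z \<in> carrier V" for z
       using insert.hyps insert.prems cx rx x that by (intro V.finsum_insert) auto
      ultimately show ?case using insert eqm_add[OF W(1)] scl wcl by simp
     qed (use W in simp)
     then have "eqm W1 (f w) (f ?s)" unfolding f_def by blast
     moreover have "f ?s = (\<Oplus>\<^bsub>V\<^esub>x \<in> J. \<Oplus>\<^bsub>V\<^esub>i \<in> {..<m}. k i \<bullet> (c x \<bullet> act (r x) (e i)))"
      unfolding f_def using trm rx k ec cx by (intro V.add.finprod_cong') auto
     moreover have "\<dots> = (\<Oplus>\<^bsub>V\<^esub>i \<in> {..<m}. \<Oplus>\<^bsub>V\<^esub>x \<in> J. k i \<bullet> (c x \<bullet> act (r x) (e i)))"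
      using rx k ec cx J by (intro V.add.finprod_swap) auto
     moreover have "\<dots> = (\<Oplus>\<^bsub>V\<^esub>i \<in> {..<m}. k i \<bullet> f (e i))"
      unfolding f_def using rx k ec cx
      by (intro V.add.finprod_cong' smult_finsum[symmetric]) auto
     moreover have "\<dots> \<in> W1"
      using rel k subspD[OF W(1)] by (intro subsp_finsum[OF W(1)]) (auto simp: f_def)
     ultimately show ?thesis using eqm_memI[OF W(1) subset_refl] by metis
    qed
    have "(\<Oplus>\<^bsub>V\<^esub>x \<in> J. (c x \<otimes> x b) \<bullet> act (r x) w) \<in> W1" if w: "w \<in> W2" for w
    proof -
     have wc: "w \<in> carrier V" using w Wc by blast
     have "eqm W1 (act b (\<Oplus>\<^bsub>V\<^esub>x \<in> J'. (c x \<otimes> x b) \<bullet> act (r x) w))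
       (\<Oplus>\<^bsub>V\<^esub>x \<in> J'. c x \<bullet> act (r x) (act b w))" if "J' \<subseteq> J" for J'
      using finite_subset[OF that J(2)] that
     proof (induction J' rule: finite_induct)
      case (insert x J')
      have x: "x \<in> J" using insert by auto
      have scl: "(\<Oplus>\<^bsub>V\<^esub>x \<in> J'. (c x \<otimes> x b) \<bullet> act (r x) w) \<in> carrier V"
       using insert.prems cx rx wc by (intro V.finsum_closed) auto
      have 1: "(\<Oplus>\<^bsub>V\<^esub>x \<in> insert x J'. (c x \<otimes> x b) \<bullet> act (r x) w)
       = (c x \<otimes> x b) \<bullet> act (r x) w +\<^sub>V (\<Oplus>\<^bsub>V\<^esub>x \<in> J'. (c x \<otimes> x b) \<bullet> act (r x) w)"
       using insert.hyps insert.prems cx rx x wc by (intro V.finsum_insert) auto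
      have 2: "(\<Oplus>\<^bsub>V\<^esub>x \<in> insert x J'. c x \<bullet> act (r x) (act b w))
       = c x \<bullet> act (r x) (act b w) +\<^sub>V (\<Oplus>\<^bsub>V\<^esub>x \<in> J'. c x \<bullet> act (r x) (act b w))"
       using insert.hyps insert.prems cx rx x wc bc by (intro V.finsum_insert) auto
      have 3: "act b (\<Oplus>\<^bsub>V\<^esub>x \<in> insert x J'. (c x \<otimes> x b) \<bullet> act (r x) w)
       = c x \<bullet> (x b \<bullet> act b (act (r x) w))
        +\<^sub>V act b (\<Oplus>\<^bsub>V\<^esub>x \<in> J'. (c x \<otimes> x b) \<bullet> act (r x) w)"
       unfolding 1 using bc wc rx x cx scl by (simp add: act_add act_smult V.smult_assoc1)
      have "eqm W1 (act (r x) (act b w)) (x b \<bullet> act b (act (r x) w))"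
       using lam(3)[OF rx(1)[OF x] b w] yb[of x b] x J(1) b by auto
      then have "eqm W1 (c x \<bullet> (x b \<bullet> act b (act (r x) w))) (c x \<bullet> act (r x) (act b w))"
       using cx[OF x] eqm_smult[OF W(1) eqm_sym[OF W(1)]] by blast
      then show ?case unfolding 2 3 using insert by (intro eqm_add[OF W(1)]) auto
     qed (use W bc in simp)
     then have "eqm W1 (act b (\<Oplus>\<^bsub>V\<^esub>x \<in> J. (c x \<otimes> x b) \<bullet> act (r x) w)) (f (act b w))"
      unfolding f_def by blast
     then have "act b (\<Oplus>\<^bsub>V\<^esub>x \<in> J. (c x \<otimes> x b) \<bullet> act (r x) w) \<in> W1"
      using fin[of "act b w"] sW[OF bN w] eqm_memI[OF W(1) subset_refl] by blast
     moreover have "(\<Oplus>\<^bsub>V\<^esub>x \<in> J. (c x \<otimes> x b) \<bullet> act (r x) w) \<in> W2"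
      using cx rx sW w subspD[OF W(2)] by (intro subsp_finsum[OF W(2)]) auto
     ultimately show ?thesis using actW1[OF bN] by blast
    qed
    then show ?thesis using e(1) by blast
   qed
  qed simp
  define T where "T = D ((m * m) ^ (m * m))"
  have TN: "T \<subseteq> N" and T: "subgroup T G" using DN D by (auto simp: T_def)
  have proj: "\<exists>c \<in> carrier K. c \<noteq> \<zero> \<and> (\<forall>w \<in> W2. eqm W1 (act a0 (act g w)) (c \<bullet> act g (act a0 w)))"
   if g: "g \<in> T" for g
  proof -
   have gN: "g \<in> N" and gc: "g \<in> carrier G" using g TN Nc by auto
   have ac: "a0 \<in> carrier G" and aN: "a0 \<in> N" using a0 Ac A by auto
   define a1 where "a1 = conjg G g a0"
   have a1: "a1 \<in> A" "a1 \<in> carrier G" using A_conjg gN a0 Ac by (auto simp: a1_def)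
   have lam1: "lam a1 b = lam a0 b" if b: "b \<in> A" for b
   proof -
    have b': "conjg G (inv\<^bsub>G\<^esub> g) b \<in> A" using A_conjg Ninv gN b by blast
    have gi: "inv\<^bsub>G\<^esub> g \<in> T" using subgroup.m_inv_closed[OF T g] .
    have "lam a1 b = lam a0 (conjg G (inv\<^bsub>G\<^esub> g) b)"
     using lam_conjg[OF gN a0(1) b'] conjg_surj[OF b gN] by (simp add: a1_def)
    also have "\<dots> = (\<lambda>b \<in> A. lam a0 b) (conjg G (inv\<^bsub>G\<^esub> g) b)" using b' by simp
    also have "\<dots> = (\<lambda>b \<in> A. lam a0 b) b"
     using fixed gi b a0(1) unfolding T_def S_def by blast
    finally show ?thesis using b by simp
   qed
   \<comment> \<open>Since \<open>g\<close> fixes the character of \<open>a0\<close>, the element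
     \<open>z\<close> commutes with \<open>A\<close> on \<open>W2/W1\<close>. So it lies in
     \<open>C\<close> and is scalar: \<open>a0\<close> and \<open>g\<close> commute up to a
     factor.\<close>
   define z where "z = inv\<^bsub>G\<^esub> a0 \<otimes>\<^bsub>G\<^esub> a1"
   have zA: "z \<in> A" unfolding z_def
    using a0 a1 subgroup.m_closed[OF A(1)] subgroup.m_inv_closed[OF A(1)] by blast
   have zc: "z \<in> carrier G" and zN: "z \<in> N" using zA Ac A by auto
   have az: "act a1 w = act a0 (act z w)" if "w \<in> carrier V" for w
    using that ac a1 by (simp add: z_def flip: act_mult)
   have "commutes z b" if b: "b \<in> A" for b
    unfolding commutes_def
   proof
    fix w assume w: "w \<in> W2"
    have bN: "b \<in> N" and bc: "b \<in> carrier G" using b A Ac by auto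
    have wc: "w \<in> carrier V" using w Wc by blast
    have zw: "act z w \<in> W2" and bw: "act b w \<in> W2" using sW zN bN w by auto
    have "eqm W1 (act a0 (act z (act b w))) (lam a0 b \<bullet> act b (act a1 w))"
     using lam(3)[OF a1(1) b w] lam1[OF b] az bc wc by simp
    also have "lam a0 b \<bullet> act b (act a1 w) = lam a0 b \<bullet> act b (act a0 (act z w))"
     using az wc by simp
    also have "eqm W1 \<dots> (act a0 (act b (act z w)))"
     by (rule eqm_sym[OF W(1) lam(3)[OF a0(1) b zw]])
    finally have "eqm W1 (act a0 (act z (act b w))) (act a0 (act b (act z w)))" using W(1) by simp
    moreover have "stab {inv\<^bsub>G\<^esub> a0} W1" using N(2) Ninv[OF aN] stab_mono by blast
    ultimately show "eqm W1 (act z (act b w)) (act b (act z w))"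
     using eqm_act_inv_cancel ac wc zc bc by auto
   qed
   then have "z \<in> C" using zA by (auto simp: C_def)
   then obtain c where c: "c \<in> carrier K" "\<And>w. w \<in> W2 ==> eqm W1 (act z w) (c \<bullet> w)"
    using Cscal by (auto simp: scal_def)
   have "c \<noteq> \<zero>"
   proof
    assume "c = \<zero>"
    then have "eqm W1 (act z w0) 0\<^sub>V" using c(2)[OF w0(1)] w0(1) Wc by simp
    then have "act z w0 \<in> W1" using eqm_zero_iff zc w0 Wc by simp
    then show False using actW1[OF zN w0] by blast
   qed
   moreover have "eqm W1 (act a0 (act g w)) (c \<bullet> act g (act a0 w))" if w: "w \<in> W2" for w
   proof -
    have wc: "w \<in> carrier V" using w Wc by blast
    have "act a0 (act g w) = act g (act a0 (act z w))"
     using act_conjg[OF gc ac wc] az[OF wc] by (simp add: a1_def)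
    moreover have "eqm W1 (act g (act a0 (act z w))) (act g (act a0 (c \<bullet> w)))"
     using c(2)[OF w] aN gN by (intro eqm_act[OF N(2)])
    ultimately show ?thesis using wc gc ac c(1) by (simp add: act_smult)
   qed
   ultimately show ?thesis using c(1) by blast
  qed
  have aN: "a0 \<in> N" and ac: "a0 \<in> carrier G" using a0 A Ac by auto
  \<comment> \<open>The factors belonging to \<open>g\<close> and \<open>h\<close> cancel in their
    commutator, so the derived subgroup of \<open>T\<close> commutes with \<open>a0\<close> and
    preserves its eigenspaces. This accounts for the \<open>Suc\<close> in \<open>L\<close>.\<close>
  have "derived G T \<subseteq> {g \<in> N. \<forall>w \<in> W2. eqm W1 (act a0 (act g w)) (act g (act a0 w))}"
  proof (rule G.derived_subsetI[OF T commuting_subgroup[OF W(1,2) N aN]])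
   fix g h assume gh: "g \<in> T" "h \<in> T"
   have ghN: "g \<in> N" "h \<in> N" "g \<in> carrier G" "h \<in> carrier G" using gh TN Nc by auto
   obtain c where c: "c \<in> carrier K" "\<And>w. w \<in> W2 ==> eqm W1 (act a0 (act g w)) (c \<bullet> act g (act a0 w))"
    and nzc: "c \<noteq> \<zero>"
    using proj[OF gh(1)] by blast
   obtain d where d: "d \<in> carrier K" "\<And>w. w \<in> W2 ==> eqm W1 (act a0 (act h w)) (d \<bullet> act h (act a0 w))"
    and nzd: "d \<noteq> \<zero>"
    using proj[OF gh(2)] by blast
   have two: "eqm W1 (act a0 (act x (act y w))) ((k \<otimes> l) \<bullet> act x (act y (act a0 w)))"
    if x: "x \<in> N" "\<And>w. w \<in> W2 ==> eqm W1 (act a0 (act x w)) (k \<bullet> act x (act a0 w))"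
     and y: "y \<in> N" "\<And>w. w \<in> W2 ==> eqm W1 (act a0 (act y w)) (l \<bullet> act y (act a0 w))"
     and kl: "k \<in> carrier K" "l \<in> carrier K" and w: "w \<in> W2" for x y k l w
   proof -
    have "eqm W1 (act a0 (act x (act y w))) (k \<bullet> act x (act a0 (act y w)))"
     using x y w sW by blast
    also have "eqm W1 (k \<bullet> act x (act a0 (act y w))) (k \<bullet> act x (l \<bullet> act y (act a0 w)))"
     by (rule eqm_smult[OF W(1) eqm_act[OF N(2) y(2)[OF w] x(1)] kl(1)])
    also have "k \<bullet> act x (l \<bullet> act y (act a0 w)) = (k \<otimes> l) \<bullet> act x (act y (act a0 w))"
     using x(1) y(1) kl w Wc Nc ac by (simp add: act_smult V.smult_assoc1)
    finally show ?thesis using W(1) by simp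
   qed
   have "eqm W1 (act a0 (act (comm G g h) w)) (act (comm G g h) (act a0 w))" if w: "w \<in> W2" for w
   proof -
    have hg: "h \<otimes>\<^bsub>G\<^esub> g \<in> N" using ghN subgroup.m_closed[OF N(1)] by blast
    have cN: "comm G g h \<in> N" using G.comm_in_derived[OF N(1) ghN(1,2)]
     G.derived_subset_subgroup[OF N(1)] by blast
    have wc: "w \<in> carrier V" using w Wc by blast
    let ?u = "act (comm G g h) w"
    have u: "?u \<in> W2" using sW cN w by blast
    have uc: "?u \<in> carrier V" using u Wc by blast
    have hgu: "act h (act g ?u) = act g (act h w)"
     using ghN wc by (simp add: G.grp flip: act_mult)
    have hga: "act h (act g (act (comm G g h) (act a0 w))) = act g (act h (act a0 w))"
     using ghN wc ac by (simp add: G.grp flip: act_mult)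
    have "eqm W1 ((d \<otimes> c) \<bullet> act h (act g (act a0 ?u))) (act a0 (act h (act g ?u)))"
     using two[OF ghN(2) d(2) ghN(1) c(2) d(1) c(1) u] by (rule eqm_sym[OF W(1)])
    also have "act a0 (act h (act g ?u)) = act a0 (act g (act h w))" by (simp add: hgu)
    also have "eqm W1 \<dots> ((c \<otimes> d) \<bullet> act g (act h (act a0 w)))"
     using two[OF ghN(1) c(2) ghN(2) d(2) c(1) d(1) w] .
    also have "(c \<otimes> d) \<bullet> act g (act h (act a0 w))
      = (d \<otimes> c) \<bullet> act h (act g (act (comm G g h) (act a0 w)))"
     using c(1) d(1) by (simp add: hga K.m_comm)
    finally have *: "eqm W1 ((d \<otimes> c) \<bullet> act h (act g (act a0 ?u)))
      ((d \<otimes> c) \<bullet> act h (act g (act (comm G g h) (act a0 w))))" using W(1) by simp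
    have "d \<otimes> c \<in> carrier K" "d \<otimes> c \<noteq> \<zero>" using c d nzc nzd K.integral by auto
    then have i: "inv (d \<otimes> c) \<in> carrier K" "inv (d \<otimes> c) \<otimes> (d \<otimes> c) = \<one>" using K.field_Units by auto
    have "eqm W1 (inv (d \<otimes> c) \<bullet> ((d \<otimes> c) \<bullet> act h (act g (act a0 ?u))))
      (inv (d \<otimes> c) \<bullet> ((d \<otimes> c) \<bullet> act h (act g (act (comm G g h) (act a0 w)))))"
     by (rule eqm_smult[OF W(1) * i(1)])
    then have "eqm W1 (act h (act g (act a0 ?u))) (act h (act g (act (comm G g h) (act a0 w))))"
     using i `d \<otimes> c \<in> carrier K` ghN ac uc wc by (simp flip: V.smult_assoc1)
    then have "eqm W1 (act (h \<otimes>\<^bsub>G\<^esub> g) (act a0 ?u)) (act (h \<otimes>\<^bsub>G\<^esub> g) (act (comm G g h) (act a0 w)))"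
     using ghN ac uc wc by (simp add: act_mult)
    moreover have "stab {inv\<^bsub>G\<^esub> (h \<otimes>\<^bsub>G\<^esub> g)} W1" using N(2) Ninv[OF hg] stab_mono by blast
    ultimately show ?thesis
     using eqm_act_inv_cancel[of "h \<otimes>\<^bsub>G\<^esub> g" W1 "act a0 ?u" "act (comm G g h) (act a0 w)"] ghN ac uc wc
     by simp
   qed
   moreover have "comm G g h \<in> N" using G.comm_in_derived[OF N(1) ghN(1,2)]
     G.derived_subset_subgroup[OF N(1)] by blast
   ultimately show "comm G g h \<in> {g \<in> N. \<forall>w \<in> W2. eqm W1 (act a0 (act g w)) (act g (act a0 w))}"
    by blast
  qed
  moreover have "derived G T = D L" by (simp add: T_def D_def L_def)
  ultimately have DL: "D L \<subseteq> N" "\<And>g w. g \<in> D L ==> w \<in> W2 ==> eqm W1 (act a0 (act g w)) (act g (act a0 w))"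
   by blast+
  have "stab {a0} W1" "stab {a0} W2" using N stab_mono aN by blast+
  then obtain c w where cw: "c \<in> carrier K" "w \<in> W2 - W1" "eqm W1 (act a0 w) (c \<bullet> w)"
   using eigenvector[OF closed W dim ac] by blast
  define U where "U = {w \<in> W2. \<forall>b \<in> {a0}. eqm W1 (act b w) (c \<bullet> w)}"
  have U: "subsp U" "W1 \<subseteq> U"
   unfolding U_def using eigenspace[of W1 W2 "{a0}" "\<lambda>_. c"] W cw(1) `stab {a0} W1` by auto
  moreover have "w \<in> U" "w \<notin> W1" using cw by (auto simp: U_def)
  moreover have "U \<noteq> W2" using a0(2) cw(1) unfolding U_def scal_def by blast
  moreover have "stab (D L) U"
   unfolding stab_def
  proof (intro conjI ballI)
   show "D L \<subseteq> carrier G" using DN Nc by blast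
   fix g w assume g: "g \<in> D L" and w: "w \<in> U"
   have gN: "g \<in> N" and gc: "g \<in> carrier G" using g DN Nc by auto
   have wW: "w \<in> W2" and wc: "w \<in> carrier V" using w Wc by (auto simp: U_def)
   have "eqm W1 (act a0 (act g w)) (act g (act a0 w))" using DL g wW by blast
   also have "eqm W1 (act g (act a0 w)) (act g (c \<bullet> w))"
    using w gN by (intro eqm_act[OF N(2)]) (auto simp: U_def)
   also have "act g (c \<bullet> w) = c \<bullet> act g w" using gc cw(1) wc by (rule act_smult)
   finally have "eqm W1 (act a0 (act g w)) (c \<bullet> act g w)" using W(1) by simp
   then show "act g w \<in> U" using sW gN wW by (simp add: U_def)
  qed
  ultimately show ?thesis unfolding D_def U_def by blast
 qed
qed

end

text \<open>For dimension \<open>Suc m\<close>: the second summand makes the action reducible by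
  \<open>solvable_reducible\<close>, the first makes it trivial on both factors, and the outer
  \<open>Suc\<close> is for a group that acts trivially on \<open>U/W1\<close> and on
  \<open>W2/U\<close>, which is commutative on \<open>W2/W1\<close>.\<close>

primrec zassenhaus_bound :: "nat => nat"
 where "zassenhaus_bound 0 = 0"
 | "zassenhaus_bound (Suc m) =
   Suc (zassenhaus_bound m + Suc ((Suc m * Suc m) ^ (Suc m * Suc m)))"

lemma zassenhaus_bound_mono: "m \<le> n ==> zassenhaus_bound m \<le> zassenhaus_bound n"
 by (rule lift_Suc_mono_le) auto

context linear_action
begin

text \<open>The unknown length \<open>q\<close> disappears because each reduction spends a number of
  derivations determined by the dimension alone, while both factors inherit the hypothesis with the
  same \<open>q\<close>.\<close>

theorem zassenhaus:
 assumes closed: "algebraically_closed K"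
  and "subsp W1" "subsp W2" "W1 \<subseteq> W2" "dimle W1 W2 m"
  and "subgroup N G" "stab N W1" "stab N W2" "triv W1 W2 ((derived G ^^ q) N)"
 shows "triv W1 W2 ((derived G ^^ zassenhaus_bound m) N)"
 using assms(2-)
proof (induction m arbitrary: W1 W2 N)
 case 0
 then have "W1 = W2" using not_dimle_zero by blast
 moreover have "act g w \<in> W2" if "g \<in> N" "w \<in> W2" for g w using 0 that by (auto simp: stab_def)
 moreover have "g \<in> carrier G" if "g \<in> N" for g using 0 that by (auto simp: stab_def)
 ultimately show ?case using subspD[OF 0(2)] by (auto simp: triv_def eqm_def)
next
 case (Suc m)
 note W = Suc.prems(1,2) and N = Suc.prems(5-7)
 let ?L = "Suc ((Suc m * Suc m) ^ (Suc m * Suc m))"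
 have Nc: "g \<in> carrier G" if "g \<in> N" for g using that by (rule subgroup.mem_carrier[OF N(1)])
 have Wc: "w \<in> carrier V" if "w \<in> W2" for w using that subspD[OF W(2)] by blast
 have sW: "act g w \<in> W2" if "g \<in> N" "w \<in> W2" for g w using N(3) that by (auto simp: stab_def)
 have DN: "(derived G ^^ i) N \<subseteq> N" for i using G.exp_derived_antimono[OF N(1), of 0 i] by simp
 have triv_mono: "triv W1 W2 H ==> H' \<subseteq> H ==> triv W1 W2 H'" for H H' by (auto simp: triv_def)
 have triv_commI: "triv W1 W2 (derived G T)"
  if T: "subgroup T G" "T \<subseteq> N" and tc: "\<And>g h w. g \<in> T ==> h \<in> T ==> w \<in> W2 ==>
   eqm W1 (act g (act h w)) (act h (act g w))" for T
 proof -
  have sub: "subgroup {g \<in> N. \<forall>w \<in> W2. eqm W1 (act g w) w} G" (is "subgroup ?Q G")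
  proof (rule G.subgroupI)
   show "?Q \<subseteq> carrier G" using Nc by blast
   have "\<one>\<^bsub>G\<^esub> \<in> ?Q" using W Wc subgroup.one_closed[OF N(1)] by simp
   then show "?Q \<noteq> {}" by blast
   show "inv\<^bsub>G\<^esub> g \<in> ?Q" if g: "g \<in> ?Q" for g
   proof -
    have gN: "g \<in> N" "inv\<^bsub>G\<^esub> g \<in> N" using g subgroup.m_inv_closed[OF N(1)] by auto
    have "eqm W1 (act (inv\<^bsub>G\<^esub> g) w) w" if w: "w \<in> W2" for w
    proof -
     have "eqm W1 (act (inv\<^bsub>G\<^esub> g) (act g w)) (act (inv\<^bsub>G\<^esub> g) w)"
      using g w gN by (intro eqm_act[OF N(2)]) auto
     then show ?thesis using gN Nc Wc w eqm_sym[OF W(1)] by (simp flip: act_mult)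
    qed
    then show ?thesis using gN by blast
   qed
   show "g \<otimes>\<^bsub>G\<^esub> h \<in> ?Q" if gh: "g \<in> ?Q" "h \<in> ?Q" for g h
   proof -
    have "eqm W1 (act (g \<otimes>\<^bsub>G\<^esub> h) w) w" if w: "w \<in> W2" for w
    proof -
     have "eqm W1 (act g (act h w)) (act g w)" using gh w by (intro eqm_act[OF N(2)]) auto
     also have "eqm W1 (act g w) w" using gh w by auto
     finally show ?thesis using gh Nc Wc w W(1) by (simp add: act_mult)
    qed
    then show ?thesis using gh subgroup.m_closed[OF N(1)] by blast
   qed
  qed
  have "derived G T \<subseteq> ?Q"
  proof (rule G.derived_subsetI[OF T(1) sub])
   fix g h assume gh: "g \<in> T" "h \<in> T"
   have ghN: "g \<in> N" "h \<in> N" "g \<in> carrier G" "h \<in> carrier G" using gh T Nc by auto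
   have cN: "comm G g h \<in> N"
    using G.comm_in_derived[OF N(1) ghN(1,2)] G.derived_subset_subgroup[OF N(1)] by blast
   have hg: "h \<otimes>\<^bsub>G\<^esub> g \<in> N" using ghN subgroup.m_closed[OF N(1)] by blast
   have "eqm W1 (act (comm G g h) w) w" if w: "w \<in> W2" for w
   proof -
    have wc: "w \<in> carrier V" using w Wc by blast
    have "eqm W1 (act (h \<otimes>\<^bsub>G\<^esub> g) (act (comm G g h) w)) (act (h \<otimes>\<^bsub>G\<^esub> g) w)"
    proof -
     have "act (h \<otimes>\<^bsub>G\<^esub> g) (act (comm G g h) w) = act g (act h w)"
      using ghN wc by (simp add: G.grp flip: act_mult)
     then show ?thesis using tc[OF gh w] ghN wc by (simp add: act_mult)
    qed
    moreover have "stab {inv\<^bsub>G\<^esub> (h \<otimes>\<^bsub>G\<^esub> g)} W1"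
     using N(2) subgroup.m_inv_closed[OF N(1) hg] stab_mono by blast
    ultimately show ?thesis using eqm_act_inv_cancel ghN wc by auto
   qed
   then show "comm G g h \<in> ?Q" using cN by blast
  qed
  then show ?thesis by (auto simp: triv_def)
 qed
 show ?case
 proof (cases "\<forall>g \<in> N. scal W1 W2 g")
  case True
  have "triv W1 W2 (derived G N)"
  proof (rule triv_commI[OF N(1) subset_refl])
   fix g h w assume gh: "g \<in> N" "h \<in> N" and w: "w \<in> W2"
   obtain c d where c: "c \<in> carrier K" "\<And>w. w \<in> W2 ==> eqm W1 (act g w) (c \<bullet> w)"
    and d: "d \<in> carrier K" "\<And>w. w \<in> W2 ==> eqm W1 (act h w) (d \<bullet> w)"
    using True gh unfolding scal_def by meson
   have wc: "w \<in> carrier V" using w Wc by blast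
   have "eqm W1 (act g (act h w)) (c \<bullet> act h w)" using c gh sW w by blast
   also have "eqm W1 (c \<bullet> act h w) (c \<bullet> (d \<bullet> w))" by (rule eqm_smult[OF W(1) d(2)[OF w] c(1)])
   also have "c \<bullet> (d \<bullet> w) = d \<bullet> (c \<bullet> w)" using c d wc by (simp add: K.m_comm flip: V.smult_assoc1)
   also have "eqm W1 \<dots> (d \<bullet> act g w)"
    by (rule eqm_smult[OF W(1) eqm_sym[OF W(1) c(2)[OF w]] d(1)])
   also have "eqm W1 (d \<bullet> act g w) (act h (act g w))"
    using d gh sW w by (blast intro: eqm_sym[OF W(1)])
   finally show "eqm W1 (act g (act h w)) (act h (act g w))" using W(1) by simp
  qed
  then show ?thesis
   using triv_mono G.exp_derived_antimono[OF N(1), of 1 "zassenhaus_bound (Suc m)"] by simp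
 next
  case False
  have "W1 \<noteq> W2"
  proof
   assume eq: "W1 = W2"
   have "scal W1 W2 g" if g: "g \<in> N" for g
   proof -
    have "eqm W1 (act g w) (\<zero> \<bullet> w)" if "w \<in> W2" for w
     using that eq sW[OF g that] Wc Nc[OF g] eqm_zero_iff by simp
    then show ?thesis unfolding scal_def by blast
   qed
   then show False using False by blast
  qed
  then have WW: "W1 \<subset> W2" using Suc.prems(3) by blast
  obtain U where U: "subsp U" "W1 \<subset> U" "U \<subset> W2" "stab ((derived G ^^ ?L) N) U"
   using solvable_reducible[OF closed W WW Suc.prems(4) N Suc.prems(8) False] by blast
  let ?M = "(derived G ^^ ?L) N"
  have M: "subgroup ?M G" by (rule G.exp_of_derived_is_subgroup[OF N(1)])
  have MW: "stab ?M W1" "stab ?M W2" using N DN stab_mono by blast+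
  have tM: "triv W1 W2 ((derived G ^^ q) ?M)"
  proof -
   have "(derived G ^^ q) ?M = (derived G ^^ (q + ?L)) N" by (rule G.exp_derived_add[symmetric])
   also have "\<dots> \<subseteq> (derived G ^^ q) N" by (rule G.exp_derived_antimono[OF N(1)]) simp
   finally show ?thesis using triv_mono Suc.prems(8) by blast
  qed
  have t1: "triv W1 U ((derived G ^^ q) ?M)" using tM U(3) by (auto simp: triv_def)
  have t2: "triv U W2 ((derived G ^^ q) ?M)" using tM U(2) by (auto simp: triv_def eqm_def)
  let ?T = "(derived G ^^ zassenhaus_bound m) ?M"
  have r1: "triv W1 U ?T"
   using Suc.prems U M MW t1 dimle_below by (intro Suc.IH) auto
  have r2: "triv U W2 ?T"
   using Suc.prems U M MW t2 dimle_above by (intro Suc.IH) auto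
  have T: "subgroup ?T G" by (rule G.exp_of_derived_is_subgroup[OF M])
  have TN: "?T \<subseteq> N" using G.exp_derived_antimono[OF M, of 0 "zassenhaus_bound m"] DN[of ?L] by auto
  have "triv W1 W2 (derived G ?T)"
  proof (rule triv_commI[OF T TN])
   fix g h w assume gh: "g \<in> ?T" "h \<in> ?T" and w: "w \<in> W2"
   have ghN: "g \<in> N" "h \<in> N" "g \<in> carrier G" "h \<in> carrier G" using gh TN Nc by auto
   have wc: "w \<in> carrier V" using w Wc by blast
   \<comment> \<open>g - 1 and h - 1 map \<open>W2\<close> into \<open>U\<close> and
     \<open>U\<close> into \<open>W1\<close>. Modulo \<open>W1\<close> their products vanish, and
     both g h w and h g w are w + u + v.\<close>
   define u where "u = act g w -\<^sub>V w"
   define v where "v = act h w -\<^sub>V w"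
   have uv: "u \<in> U" "v \<in> U" using r2 gh w by (auto simp: triv_def eqm_def u_def v_def)
   have uvc: "u \<in> carrier V" "v \<in> carrier V" using ghN wc by (auto simp: u_def v_def)
   have gw: "act g w = w +\<^sub>V u" "act h w = w +\<^sub>V v"
    using ghN wc by (simp_all add: u_def v_def a_minus_def V.a_ac V.r_neg1 V.r_neg2 V.r_neg)
   have ru: "eqm W1 (act h u) u" "eqm W1 (act g v) v" using r1 uv gh by (auto simp: triv_def)
   have "act g (act h w) = (w +\<^sub>V u) +\<^sub>V act g v" using gw ghN wc uvc by (simp add: act_add)
   moreover have "eqm W1 ((w +\<^sub>V u) +\<^sub>V act g v) ((w +\<^sub>V u) +\<^sub>V v)"
    using ru wc uvc W(1) by (intro eqm_add) auto
   moreover have "(w +\<^sub>V u) +\<^sub>V v = (w +\<^sub>V v) +\<^sub>V u" using wc uvc by (simp add: V.a_ac)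
   moreover have "eqm W1 ((w +\<^sub>V v) +\<^sub>V u) ((w +\<^sub>V v) +\<^sub>V act h u)"
    using ru wc uvc W(1) by (intro eqm_add) (auto intro: eqm_sym)
   moreover have "(w +\<^sub>V v) +\<^sub>V act h u = act h (act g w)" using gw ghN wc uvc by (simp add: act_add)
   ultimately show "eqm W1 (act g (act h w)) (act h (act g w))" using eqm_trans W(1) by metis
  qed
  moreover have "derived G ?T = (derived G ^^ zassenhaus_bound (Suc m)) N"
   unfolding zassenhaus_bound.simps(2) funpow.simps(2) o_apply G.exp_derived_add ..
  ultimately show ?thesis by metis
 qed
qed

end

lemma (in abelian_group) minus_eq_zero_iff [simp]:
 assumes "x \<in> carrier G" "y \<in> carrier G"
 shows "x \<ominus> y = \<zero> \<longleftrightarrow> x = y"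
proof
 assume "x \<ominus> y = \<zero>"
 then have "\<ominus> (\<ominus> y) = x" using assms by (intro minus_equality) (simp_all add: a_minus_def)
 then show "x = y" using assms by simp
qed (use assms in \<open>simp add: a_minus_def r_neg\<close>)

section \<open>Matrix representations\<close>

locale matrix_rep = K: field K + G: group G
 for K :: "('k, 'r) ring_scheme" (structure) and G :: "('g, 'n) monoid_scheme" +
 fixes n :: nat and \<phi> :: "'g => nat => nat => 'k"
 assumes rep_closed: "g \<in> carrier G ==> i < n ==> j < n ==> \<phi> g i j \<in> carrier K"
  and rep_mult: "g \<in> carrier G ==> h \<in> carrier G ==> i < n ==> j < n ==>
   \<phi> (g \<otimes>\<^bsub>G\<^esub> h) i j = (\<Oplus>l \<in> {..<n}. \<phi> g i l \<otimes> \<phi> h l j)"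
  and rep_one: "i < n ==> j < n ==> \<phi> \<one>\<^bsub>G\<^esub> i j = (if i = j then \<one> else \<zero>)"
begin

definition Ker :: "'g set"
 where "Ker = {g \<in> carrier G. \<forall>i < n. \<forall>j < n. \<phi> g i j = \<phi> \<one>\<^bsub>G\<^esub> i j}"

text \<open>Vectors of length \<open>n\<close> are functions that vanish from \<open>n\<close> on,
  which makes equality of vectors equality of functions. The multiplication and the unit demanded by
  the record type are placeholders.\<close>

definition V :: "('k, nat => 'k) module"
 where "V = \<lparr>carrier = {v. (\<forall>i < n. v i \<in> carrier K) \<and> (\<forall>i \<ge> n. v i = \<zero>)},
  monoid.mult = \<lambda>v w. v, one = \<lambda>_. \<zero>, zero = \<lambda>_. \<zero>, add = \<lambda>v w i. v i \<oplus> w i, module.smult = \<lambda>c v i. c \<otimes> v i\<rparr>"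

definition act :: "'g => (nat => 'k) => nat => 'k"
 where "act g v i = (if i < n then \<Oplus>j \<in> {..<n}. \<phi> g i j \<otimes> v j else \<zero>)"

lemma V_closed: "v \<in> carrier V ==> v i \<in> carrier K"
 by (cases "i < n") (auto simp: V_def)

lemma V_memI: "(\<And>i. i < n ==> v i \<in> carrier K) ==> (\<And>i. i \<ge> n ==> v i = \<zero>) ==> v \<in> carrier V"
 by (auto simp: V_def)

lemma V_out: "v \<in> carrier V ==> i \<ge> n ==> v i = \<zero>"
 by (auto simp: V_def)

lemma V_simps: "\<zero>\<^bsub>V\<^esub> = (\<lambda>_. \<zero>)" "v \<oplus>\<^bsub>V\<^esub> w = (\<lambda>i. v i \<oplus> w i)" "c \<odot>\<^bsub>V\<^esub> v = (\<lambda>i. c \<otimes> v i)"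
 by (auto simp: V_def)

lemma V_module: "Module.module K V"
proof (rule moduleI)
 show "cring K" by (rule K.is_cring)
 show "abelian_group V"
 proof (rule abelian_groupI)
  fix x assume x: "x \<in> carrier V"
  have "(\<lambda>i. \<ominus> x i) \<in> carrier V" using x by (intro V_memI) (auto simp: V_closed V_out)
  moreover have "(\<lambda>i. \<ominus> x i) \<oplus>\<^bsub>V\<^esub> x = \<zero>\<^bsub>V\<^esub>" using x by (simp add: V_simps K.l_neg V_closed)
  ultimately show "\<exists>y \<in> carrier V. y \<oplus>\<^bsub>V\<^esub> x = \<zero>\<^bsub>V\<^esub>" by blast
 qed (auto simp: V_simps V_closed K.a_ac intro!: V_memI simp: V_out)
qed (auto simp: V_simps V_closed K.l_distr K.r_distr K.m_assoc intro!: V_memI simp: V_out)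

sublocale act: linear_action K V G act
proof -
 interpret V: Module.module K V by (rule V_module)
 have prod: "(\<lambda>j. \<phi> g i j \<otimes> v j) \<in> {..<n} \<rightarrow> carrier K" if "g \<in> carrier G" "v \<in> carrier V" "i < n" for g v i
  using that rep_closed V_closed by auto
 show "linear_action K V G act"
 proof unfold_locales
  fix g v assume g: "g \<in> carrier G" and v: "v \<in> carrier V"
  show "act g v \<in> carrier V" using prod[OF g v] by (intro V_memI) (auto simp: act_def)
  {
   fix w assume w: "w \<in> carrier V"
   show "act g (v \<oplus>\<^bsub>V\<^esub> w) = act g v \<oplus>\<^bsub>V\<^esub> act g w"
   proof
    fix i
    show "act g (v \<oplus>\<^bsub>V\<^esub> w) i = (act g v \<oplus>\<^bsub>V\<^esub> act g w) i"
    proof (cases "i < n")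
     case True
     have "(\<Oplus>j \<in> {..<n}. \<phi> g i j \<otimes> (v j \<oplus> w j)) = (\<Oplus>j \<in> {..<n}. \<phi> g i j \<otimes> v j \<oplus> \<phi> g i j \<otimes> w j)"
      using g v w True rep_closed V_closed by (intro K.finsum_cong') (auto simp: K.r_distr)
     also have "\<dots> = (\<Oplus>j \<in> {..<n}. \<phi> g i j \<otimes> v j) \<oplus> (\<Oplus>j \<in> {..<n}. \<phi> g i j \<otimes> w j)"
      using prod[OF g v True] prod[OF g w True] by (rule K.finsum_addf)
     finally show ?thesis using True by (simp add: act_def V_simps)
    qed (simp add: act_def V_simps)
   qed
  next
   fix c assume c: "c \<in> carrier K"
   show "act g (c \<odot>\<^bsub>V\<^esub> v) = c \<odot>\<^bsub>V\<^esub> act g v"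
   proof
    fix i
    show "act g (c \<odot>\<^bsub>V\<^esub> v) i = (c \<odot>\<^bsub>V\<^esub> act g v) i"
    proof (cases "i < n")
     case True
     have "(\<Oplus>j \<in> {..<n}. \<phi> g i j \<otimes> (c \<otimes> v j)) = (\<Oplus>j \<in> {..<n}. c \<otimes> (\<phi> g i j \<otimes> v j))"
      using g v c True rep_closed V_closed by (intro K.finsum_cong') (auto simp: K.m_lcomm)
     also have "\<dots> = c \<otimes> (\<Oplus>j \<in> {..<n}. \<phi> g i j \<otimes> v j)"
      using prod[OF g v True] c by (intro K.finsum_rdistr[symmetric]) auto
     finally show ?thesis using True by (simp add: act_def V_simps)
    qed (simp add: act_def V_simps c)
   qed
  next
   fix h assume h: "h \<in> carrier G"
   show "act (g \<otimes>\<^bsub>G\<^esub> h) v = act g (act h v)"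
   proof
    fix i
    show "act (g \<otimes>\<^bsub>G\<^esub> h) v i = act g (act h v) i"
    proof (cases "i < n")
     case True
     have t: "\<phi> g i l \<otimes> \<phi> h l j \<otimes> v j \<in> carrier K" if "l < n" "j < n" for l j
      using that True g h v rep_closed V_closed by simp
     have "(\<Oplus>j \<in> {..<n}. \<phi> (g \<otimes>\<^bsub>G\<^esub> h) i j \<otimes> v j)
       = (\<Oplus>j \<in> {..<n}. \<Oplus>l \<in> {..<n}. \<phi> g i l \<otimes> \<phi> h l j \<otimes> v j)"
      using g h v True rep_closed V_closed t
      by (intro K.finsum_cong') (auto simp: rep_mult Pi_def intro!: K.finsum_ldistr)
     also have "\<dots> = (\<Oplus>l \<in> {..<n}. \<Oplus>j \<in> {..<n}. \<phi> g i l \<otimes> \<phi> h l j \<otimes> v j)"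
      using t by (intro K.add.finprod_swap) auto
     also have "\<dots> = (\<Oplus>l \<in> {..<n}. \<phi> g i l \<otimes> (\<Oplus>j \<in> {..<n}. \<phi> h l j \<otimes> v j))"
     proof (intro K.finsum_cong' refl)
      fix l assume "l \<in> {..<n}"
      then have l: "l < n" by simp
      have "\<phi> g i l \<otimes> (\<Oplus>j \<in> {..<n}. \<phi> h l j \<otimes> v j) = (\<Oplus>j \<in> {..<n}. \<phi> g i l \<otimes> (\<phi> h l j \<otimes> v j))"
       using prod[OF h v l] rep_closed[OF g True l] by (intro K.finsum_rdistr) auto
      also have "\<dots> = (\<Oplus>j \<in> {..<n}. \<phi> g i l \<otimes> \<phi> h l j \<otimes> v j)"
       using g h v True l rep_closed V_closed t by (intro K.finsum_cong') (auto simp: K.m_assoc)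
      finally show "(\<Oplus>j \<in> {..<n}. \<phi> g i l \<otimes> \<phi> h l j \<otimes> v j) = \<phi> g i l \<otimes> (\<Oplus>j \<in> {..<n}. \<phi> h l j \<otimes> v j)"
       by simp
     qed (use prod[OF h v] rep_closed[OF g True] in auto)
     also have "\<dots> = (\<Oplus>l \<in> {..<n}. \<phi> g i l \<otimes> act h v l)"
      using prod[OF h v] rep_closed[OF g True] by (intro K.finsum_cong') (auto simp: act_def)
     finally show ?thesis using True by (simp add: act_def)
    qed (simp add: act_def)
   qed
  }
 next
  show "act \<one>\<^bsub>G\<^esub> v = v" if "v \<in> carrier V" for v
  proof
   fix i
   show "act \<one>\<^bsub>G\<^esub> v i = v i"
   proof (cases "i < n")
    case True
    have "(\<Oplus>j \<in> {..<n}. \<phi> \<one>\<^bsub>G\<^esub> i j \<otimes> v j) = (\<Oplus>j \<in> {..<n}. if i = j then v j else \<zero>)"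
     using True V_closed[OF that] by (intro K.finsum_cong') (auto simp: rep_one)
    also have "\<dots> = v i" using True V_closed[OF that] by (intro K.finsum_singleton) auto
    finally show ?thesis using True by (simp add: act_def)
   qed (simp add: act_def V_out[OF that])
  qed
 qed
qed

lemma V_finsum:
 assumes "finite J" "f \<in> J \<rightarrow> carrier V"
 shows "(\<Oplus>\<^bsub>V\<^esub>x \<in> J. f x) i = (\<Oplus>x \<in> J. f x i)"
 using assms
proof (induction J rule: finite_induct)
 case (insert x J)
 then have "f \<in> J \<rightarrow> carrier V" "f x \<in> carrier V" by auto
 then show ?case using insert V_closed
  by (simp add: act.V.finsum_insert K.finsum_insert Pi_def V_simps)
qed (simp add: V_simps)

text \<open>In a chain of length k > n choose \<open>u i\<close> in \<open>U (Suc i)\<close> outside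
  \<open>U i\<close>. A relation between these k vectors, solved for its last term, puts that term
  into a space from which it was excluded.\<close>

lemma V_dimle: "act.dimle {\<zero>\<^bsub>V\<^esub>} (carrier V) n"
 unfolding act.dimle_def
proof (intro allI impI, elim conjE)
 fix U :: "nat => (nat => 'k) set" and k
 assume U: "\<forall>i \<le> k. act.subsp (U i)" "\<forall>i < k. U i \<subset> U (Suc i)"
 show "k \<le> n"
 proof (rule ccontr)
  assume nk: "\<not> k \<le> n"
  have "\<exists>u. u \<in> U (Suc i) - U i" if "i < k" for i using U(2) that by blast
  then obtain u where u: "\<And>i. i < k ==> u i \<in> U (Suc i) - U i" by metis
  have mono: "U i \<subseteq> U j" if "i \<le> j" "j \<le> k" for i j
   using that by (induction j rule: dec_induct) (use U(2) in \<open>auto dest: Suc_le_lessD\<close>)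
  have uc: "u i \<in> carrier V" if "i < k" for i
   using u[OF that] U(1) that act.subspD(1)[of "U (Suc i)"] by auto
  have "\<exists>c. (\<forall>i \<in> {..<k}. c i \<in> carrier K) \<and> (\<exists>i \<in> {..<k}. c i \<noteq> \<zero>) \<and>
   (\<forall>j \<in> {..<n}. (\<Oplus>i \<in> {..<k}. c i \<otimes> u i j) = \<zero>)"
   using nk uc V_closed by (intro K.homogeneous_system) auto
  then obtain c where c: "\<And>i. i < k ==> c i \<in> carrier K" "\<exists>i < k. c i \<noteq> \<zero>"
   "\<And>j. j < n ==> (\<Oplus>i \<in> {..<k}. c i \<otimes> u i j) = \<zero>" by auto
  define m where "m = Max {i. i < k \<and> c i \<noteq> \<zero>}"
  have m: "m < k" "c m \<noteq> \<zero>" using Max_in[of "{i. i < k \<and> c i \<noteq> \<zero>}"] c(2) by (auto simp: m_def)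
  have zero: "c i = \<zero>" if "m < i" "i < k" for i
  proof (rule ccontr)
   assume "c i \<noteq> \<zero>"
   then have "i \<le> m" using that unfolding m_def by (intro Max_ge) auto
   then show False using that by simp
  qed
  have cu: "c i \<odot>\<^bsub>V\<^esub> u i \<in> carrier V" if "i < k" for i using that c uc by simp
  have "(\<Oplus>\<^bsub>V\<^esub>i \<in> {..<k}. c i \<odot>\<^bsub>V\<^esub> u i) = \<zero>\<^bsub>V\<^esub>"
  proof
   fix j
   have "(\<Oplus>\<^bsub>V\<^esub>i \<in> {..<k}. c i \<odot>\<^bsub>V\<^esub> u i) j = (\<Oplus>i \<in> {..<k}. c i \<otimes> u i j)"
    using cu by (subst V_finsum) (auto simp: V_simps)
   also have "\<dots> = \<zero>"
   proof (cases "j < n")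
    case False
    have "(\<Oplus>i \<in> {..<k}. c i \<otimes> u i j) = (\<Oplus>i \<in> {..<k}. \<zero>)"
     using False c uc V_out[of "u _" j] by (intro K.finsum_cong') auto
    then show ?thesis by simp
   qed (use c in blast)
   finally show "(\<Oplus>\<^bsub>V\<^esub>i \<in> {..<k}. c i \<odot>\<^bsub>V\<^esub> u i) j = \<zero>\<^bsub>V\<^esub> j" by (simp add: V_simps)
  qed
  moreover have "(\<Oplus>\<^bsub>V\<^esub>i \<in> {..<k}. c i \<odot>\<^bsub>V\<^esub> u i) = (\<Oplus>\<^bsub>V\<^esub>i \<in> insert m {..<m}. c i \<odot>\<^bsub>V\<^esub> u i)"
   using m c uc zero by (intro act.V.add.finprod_mono_neutral_cong_right) (auto simp: not_less le_less)
  moreover have "\<dots> = c m \<odot>\<^bsub>V\<^esub> u m \<oplus>\<^bsub>V\<^esub> (\<Oplus>\<^bsub>V\<^esub>i \<in> {..<m}. c i \<odot>\<^bsub>V\<^esub> u i)"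
   using m cu by (intro act.V.finsum_insert) auto
  moreover have Um: "act.subsp (U m)" using U(1) m by auto
  moreover have "(\<Oplus>\<^bsub>V\<^esub>i \<in> {..<m}. c i \<odot>\<^bsub>V\<^esub> u i) \<in> U m"
  proof (rule act.subsp_finsum[OF Um], rule)
   fix i assume "i \<in> {..<m}"
   then have "u i \<in> U m" using u[of i] mono[of "Suc i" m] m by auto
   then show "c i \<odot>\<^bsub>V\<^esub> u i \<in> U m" using act.subspD(5)[OF Um] c `i \<in> {..<m}` m by auto
  qed
  ultimately have *: "c m \<odot>\<^bsub>V\<^esub> u m \<oplus>\<^bsub>V\<^esub> (\<Oplus>\<^bsub>V\<^esub>i \<in> {..<m}. c i \<odot>\<^bsub>V\<^esub> u i) = \<zero>\<^bsub>V\<^esub>"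
   "(\<Oplus>\<^bsub>V\<^esub>i \<in> {..<m}. c i \<odot>\<^bsub>V\<^esub> u i) \<in> U m" by simp_all
  then have "c m \<odot>\<^bsub>V\<^esub> u m = \<ominus>\<^bsub>V\<^esub> (\<Oplus>\<^bsub>V\<^esub>i \<in> {..<m}. c i \<odot>\<^bsub>V\<^esub> u i)"
   using cu[OF m(1)] act.subspD(2)[OF Um] by (intro act.V.minus_equality[symmetric]) auto
  then have "c m \<odot>\<^bsub>V\<^esub> u m \<in> U m" using *(2) act.subspD(6)[OF Um] by simp
  then have "u m \<in> U m" using act.eqm_smult_zeroD[OF Um] m c uc by blast
  then show False using u m by blast
 qed
qed

lemma triv_iff_Ker:
 assumes "H \<subseteq> carrier G"
 shows "act.triv {\<zero>\<^bsub>V\<^esub>} (carrier V) H \<longleftrightarrow> H \<subseteq> Ker"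
proof
 assume t: "act.triv {\<zero>\<^bsub>V\<^esub>} (carrier V) H"
 show "H \<subseteq> Ker"
 proof
  fix g assume g: "g \<in> H"
  have gc: "g \<in> carrier G" using g assms by blast
  have fix_act: "act g v = v" if "v \<in> carrier V" for v
   using t g that gc act.act_closed by (auto simp: act.triv_def act.eqm_def act.V.minus_eq_zero_iff)
  have "\<phi> g i j = \<phi> \<one>\<^bsub>G\<^esub> i j" if ij: "i < n" "j < n" for i j
  proof -
   let ?e = "\<lambda>k. if k = j then \<one> else \<zero>"
   have e: "?e \<in> carrier V" using ij by (intro V_memI) auto
   have "act g ?e i = (\<Oplus>k \<in> {..<n}. if j = k then \<phi> g i k else \<zero>)"
    using ij gc rep_closed unfolding act_def by (auto intro!: K.finsum_cong')
   also have "\<dots> = \<phi> g i j" using ij gc rep_closed by (intro K.finsum_singleton) auto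
   finally show ?thesis using fix_act[OF e] ij by (simp add: rep_one)
  qed
  then show "g \<in> Ker" using gc by (simp add: Ker_def)
 qed
next
 assume H: "H \<subseteq> Ker"
 have "act g v = v" if g: "g \<in> H" and v: "v \<in> carrier V" for g v
 proof -
  have "act g v = act \<one>\<^bsub>G\<^esub> v"
  proof
   fix i
   show "act g v i = act \<one>\<^bsub>G\<^esub> v i"
    using H g V_closed[OF v] rep_closed[of "\<one>\<^bsub>G\<^esub>"]
    by (auto simp: act_def Ker_def intro!: K.finsum_cong')
  qed
  then show ?thesis using v by simp
 qed
 then show "act.triv {\<zero>\<^bsub>V\<^esub>} (carrier V) H"
  by (auto simp: act.triv_def act.eqm_def act.V.r_neg a_minus_def)
qed

lemma exp_derived_subset_Ker:
 assumes "algebraically_closed K" "subgroup N G" "(derived G ^^ q) N \<subseteq> Ker"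
 shows "(derived G ^^ zassenhaus_bound n) N \<subseteq> Ker"
proof -
 have "act.subsp {\<zero>\<^bsub>V\<^esub>}" "act.subsp (carrier V)" by (auto simp: act.subsp_def)
 moreover have "act.stab N {\<zero>\<^bsub>V\<^esub>}" "act.stab N (carrier V)"
  using subgroup.subset[OF assms(2)] by (auto simp: act.stab_def)
 moreover have D: "(derived G ^^ k) N \<subseteq> carrier G" for k
  using G.exp_of_derived_in_carrier[OF subgroup.subset[OF assms(2)]] .
 ultimately have "act.triv {\<zero>\<^bsub>V\<^esub>} (carrier V) ((derived G ^^ zassenhaus_bound n) N)"
  using act.zassenhaus[OF assms(1) _ _ _ V_dimle assms(2)] assms(3) triv_iff_Ker[OF D] by simp
 then show ?thesis using triv_iff_Ker[OF D] by simp
qed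

lemma Ker_normal: "Ker \<lhd> G"
proof -
 have Ker_iff: "g \<in> Ker \<longleftrightarrow> g \<in> carrier G \<and> (\<forall>v \<in> carrier V. act g v = v)" for g
  using triv_iff_Ker[of "{g}"] act.act_closed
  by (auto simp: act.triv_def act.eqm_def act.V.minus_eq_zero_iff Ker_def)
 have inv_Ker: "inv\<^bsub>G\<^esub> a \<in> Ker" if "a \<in> Ker" for a
 proof -
  have "act (inv\<^bsub>G\<^esub> a) v = v" if v: "v \<in> carrier V" for v
  proof -
   have "act (inv\<^bsub>G\<^esub> a) (act a v) = act (inv\<^bsub>G\<^esub> a) v" using `a \<in> Ker` v Ker_iff by simp
   moreover have "act (inv\<^bsub>G\<^esub> a) (act a v) = v"
    using `a \<in> Ker` v Ker_iff act.act_mult[of "inv\<^bsub>G\<^esub> a" a v] by simp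
   ultimately show ?thesis by simp
  qed
  then show ?thesis using that Ker_iff by simp
 qed
 show ?thesis
 proof (rule G.normalI_conjg)
  have "\<one>\<^bsub>G\<^esub> \<in> Ker" by (simp add: Ker_iff)
  then have "Ker \<noteq> {}" by blast
  then show "subgroup Ker G"
   by (intro G.subgroupI) (auto simp: Ker_iff inv_Ker[unfolded Ker_iff] act.act_mult)
  fix g x assume g: "g \<in> carrier G" and x: "x \<in> Ker"
  have "act (conjg G g x) v = v" if v: "v \<in> carrier V" for v
  proof -
   have "act (conjg G g x) v = act (inv\<^bsub>G\<^esub> g) (act x (act g v))"
    using g x v unfolding Ker_iff conjg_def
    by (metis G.inv_closed G.m_closed act.act_closed act.act_mult)
   also have "\<dots> = act (inv\<^bsub>G\<^esub> g) (act g v)" using g x v by (simp add: Ker_iff)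
   also have "\<dots> = v" using g v act.act_mult[of "inv\<^bsub>G\<^esub> g" g v] by simp
   finally show ?thesis .
  qed
  then show "conjg G g x \<in> Ker" using g x Ker_iff by simp
 qed
qed

subsection \<open>Polynomial functions and closures\<close>

text \<open>Coordinate functions: tag 0 is the constant 1, tag 1 an entry of \<open>g\<close>, tag 2
  an entry of its inverse. The constant lets words of length exactly \<open>D\<close> cover all
  degrees up to \<open>D\<close>, and the inverse entries make inversion a map of degree 1.\<close>

definition gen :: "nat \<times> nat \<times> nat => 'g => 'k"
 where "gen s g = (case s of (k, i, j) => if k = 0 then \<one> else if k = 1 then \<phi> g i j else \<phi> (inv\<^bsub>G\<^esub> g) i j)"

definition Sym :: "(nat \<times> nat \<times> nat) set"
 where "Sym = insert (0, 0, 0) ({1, 2} \<times> {..<n} \<times> {..<n})"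

definition mon :: "(nat \<times> nat \<times> nat) list => 'g => 'k"
 where "mon l g = foldr (\<lambda>s x. gen s g \<otimes> x) l \<one>"

definition Mon :: "nat => (nat \<times> nat \<times> nat) list set"
 where "Mon D = {l. set l \<subseteq> Sym \<and> length l = D}"

text \<open>Linear combinations of monomials, built up term by term; adding a term may change a
  function outside \<open>carrier G\<close>, where its values do not matter.\<close>

inductive pf :: "nat => ('g => 'k) => bool" for D
 where
  zero: "(\<And>g. g \<in> carrier G ==> f g = \<zero>) ==> pf D f"
 | add: "pf D f ==> c \<in> carrier K ==> l \<in> Mon D ==>
   (\<And>g. g \<in> carrier G ==> f' g = c \<otimes> mon l g \<oplus> f g) ==> pf D f'"

lemma finite_Mon: "finite (Mon D)"
 unfolding Mon_def by (rule finite_lists_length_eq) (simp add: Sym_def)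

lemma gen_closed: "s \<in> Sym ==> g \<in> carrier G ==> gen s g \<in> carrier K"
 by (auto simp: Sym_def gen_def rep_closed)

lemma mon_closed: "set l \<subseteq> Sym ==> g \<in> carrier G ==> mon l g \<in> carrier K"
 by (induction l) (auto simp: mon_def gen_closed)

lemma mon_append:
 "set l \<subseteq> Sym ==> set k \<subseteq> Sym ==> g \<in> carrier G ==> mon (l @ k) g = mon l g \<otimes> mon k g"
proof (induction l)
 case Nil
 then show ?case using mon_closed[of k g] by (simp add: mon_def)
next
 case (Cons s l)
 then show ?case
  using mon_closed[of l g] mon_closed[of k g] gen_closed[of s g]
  by (simp add: mon_def K.m_assoc)
qed

lemma pf_closed: "pf D f ==> g \<in> carrier G ==> f g \<in> carrier K"
 by (induction rule: pf.induct) (auto simp: Mon_def mon_closed)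

lemma pf_cong: "pf D f ==> (\<And>g. g \<in> carrier G ==> f' g = f g) ==> pf D f'"
 by (induction rule: pf.cases) (auto intro: pf.intros)

lemma pf_add: "pf D f ==> pf D h ==> pf D (\<lambda>g. f g \<oplus> h g)"
proof (induction rule: pf.induct)
 case (zero f)
 then show ?case using pf_closed by (intro pf_cong[OF zero(2)]) auto
next
 case (add f c l f')
 have "pf D (\<lambda>g. f g \<oplus> h g)" using add by blast
 then show ?case
 proof (rule pf.add[OF _ add.hyps(2,3)])
  fix g assume g: "g \<in> carrier G"
  then show "f' g \<oplus> h g = c \<otimes> mon l g \<oplus> (f g \<oplus> h g)"
   using add pf_closed[OF add.hyps(1) g] pf_closed[OF add.prems g] mon_closed[of l g]
   by (simp add: K.a_assoc Mon_def)
 qed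
qed

lemma pf_mon_mult:
 assumes "pf D f" "c \<in> carrier K" "l \<in> Mon E"
 shows "pf (E + D) (\<lambda>g. c \<otimes> mon l g \<otimes> f g)"
 using assms(1)
proof (induction rule: pf.induct)
 case (zero f)
 then show ?case using assms mon_closed[of l] by (intro pf.zero) (auto simp: Mon_def)
next
 case (add f d k f')
 show ?case
 proof (rule pf.add[OF add.IH])
  show "c \<otimes> d \<in> carrier K" using assms add by simp
  show "l @ k \<in> Mon (E + D)" using assms add by (auto simp: Mon_def)
  fix g assume g: "g \<in> carrier G"
  then show "c \<otimes> mon l g \<otimes> f' g = c \<otimes> d \<otimes> mon (l @ k) g \<oplus> c \<otimes> mon l g \<otimes> f g"
   using add pf_closed[OF add.hyps(1) g] mon_closed[of l g] mon_closed[of k g] assms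
   by (simp add: Mon_def mon_append K.r_distr K.m_ac)
 qed
qed

lemma pf_mult: "pf E f ==> pf D h ==> pf (E + D) (\<lambda>g. f g \<otimes> h g)"
proof (induction rule: pf.induct)
 case (zero f)
 then show ?case using pf_closed by (intro pf.zero) auto
next
 case (add f c l f')
 have "pf (E + D) (\<lambda>g. c \<otimes> mon l g \<otimes> h g \<oplus> f g \<otimes> h g)"
  using add by (intro pf_add pf_mon_mult) auto
 then show ?case
 proof (rule pf_cong)
  fix g assume g: "g \<in> carrier G"
  then show "f' g \<otimes> h g = c \<otimes> mon l g \<otimes> h g \<oplus> f g \<otimes> h g"
   using add pf_closed[OF add.hyps(1) g] pf_closed[OF add.prems g] mon_closed[of l g]
   by (simp add: Mon_def K.l_distr)
 qed
qed

lemma pf_const: "c \<in> carrier K ==> pf D (\<lambda>_. c)"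
proof (rule pf.add[OF pf.zero[of "\<lambda>_. \<zero>"]])
 show "replicate D (0, 0, 0) \<in> Mon D" by (auto simp: Mon_def Sym_def)
 have "mon (replicate D (0, 0, 0)) g = \<one>" for g by (induction D) (auto simp: mon_def gen_def)
 then show "c = c \<otimes> mon (replicate D (0, 0, 0)) g \<oplus> \<zero>" if "c \<in> carrier K" for g using that by simp
qed auto

lemma pf_smult: "pf D f ==> c \<in> carrier K ==> pf D (\<lambda>g. c \<otimes> f g)"
 using pf_mult[OF pf_const[of c 0], of D f] by simp

lemma pf_gen: "s \<in> Sym ==> pf 1 (gen s)"
 using pf.add[OF pf.zero[of "\<lambda>_. \<zero>"], of \<one> "[s]" 1 "gen s"] gen_closed[of s]
 by (auto simp: Mon_def mon_def)

lemma pf_entry: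
 assumes "i < n" "j < n"
 shows "pf 1 (\<lambda>g. \<phi> g i j)" "pf 1 (\<lambda>g. \<phi> (inv\<^bsub>G\<^esub> g) i j)"
 using pf_gen[of "(1, i, j)"] pf_gen[of "(2, i, j)"] assms by (auto simp: Sym_def gen_def[abs_def])

lemma pf_finsum:
 assumes "finite J" "\<And>x. x \<in> J ==> pf D (f x)"
 shows "pf D (\<lambda>g. \<Oplus>x \<in> J. f x g)"
 using assms
proof (induction J rule: finite_induct)
 case (insert x J)
 have "pf D (\<lambda>g. f x g \<oplus> (\<Oplus>x \<in> J. f x g))" using insert by (intro pf_add) auto
 then show ?case
  by (rule pf_cong) (use insert pf_closed in \<open>auto intro!: K.finsum_insert\<close>)
qed (simp add: pf.zero)

text \<open>The entries of the inverse of \<open>w g\<close> are included because \<open>gen\<close>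
  refers to them. In this way substitution multiplies degrees, as \<open>pf_comp\<close>
  shows.\<close>

definition morph :: "nat => ('g => 'g) => bool"
 where "morph e w \<longleftrightarrow> (\<forall>g \<in> carrier G. w g \<in> carrier G) \<and>
  (\<forall>i < n. \<forall>j < n. pf e (\<lambda>g. \<phi> (w g) i j) \<and> pf e (\<lambda>g. \<phi> (inv\<^bsub>G\<^esub> (w g)) i j))"

lemma morph_const: "a \<in> carrier G ==> morph 0 (\<lambda>_. a)"
 by (simp add: morph_def pf_const rep_closed)

lemma morph_id: "morph 1 (\<lambda>g. g)"
 using pf_entry by (simp add: morph_def)

lemma morph_inv: "morph e w ==> morph e (\<lambda>g. inv\<^bsub>G\<^esub> (w g))"
proof -
 assume w: "morph e w"
 have "pf e (\<lambda>g. \<phi> (inv\<^bsub>G\<^esub> (inv\<^bsub>G\<^esub> (w g))) i j)" if "i < n" "j < n" for i j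
  by (rule pf_cong[of e "\<lambda>g. \<phi> (w g) i j"]) (use w that in \<open>auto simp: morph_def\<close>)
 then show "morph e (\<lambda>g. inv\<^bsub>G\<^esub> (w g))" using w by (auto simp: morph_def)
qed

lemma morph_mult:
 assumes w: "morph e w" and w': "morph e' w'"
 shows "morph (e + e') (\<lambda>g. w g \<otimes>\<^bsub>G\<^esub> w' g)"
proof -
 have 1: "pf (e + e') (\<lambda>g. \<phi> (w g \<otimes>\<^bsub>G\<^esub> w' g) i j)" if ij: "i < n" "j < n" for i j
 proof -
  have "pf (e + e') (\<lambda>g. \<Oplus>l \<in> {..<n}. \<phi> (w g) i l \<otimes> \<phi> (w' g) l j)"
   using w w' ij by (intro pf_finsum pf_mult) (auto simp: morph_def)
  then show ?thesis by (rule pf_cong) (use w w' ij in \<open>auto simp: morph_def rep_mult\<close>)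
 qed
 have 2: "pf (e + e') (\<lambda>g. \<phi> (inv\<^bsub>G\<^esub> (w g \<otimes>\<^bsub>G\<^esub> w' g)) i j)" if ij: "i < n" "j < n" for i j
 proof -
  have "pf (e' + e) (\<lambda>g. \<Oplus>l \<in> {..<n}. \<phi> (inv\<^bsub>G\<^esub> (w' g)) i l \<otimes> \<phi> (inv\<^bsub>G\<^esub> (w g)) l j)"
   using w w' ij by (intro pf_finsum pf_mult) (auto simp: morph_def)
  then have "pf (e' + e) (\<lambda>g. \<phi> (inv\<^bsub>G\<^esub> (w g \<otimes>\<^bsub>G\<^esub> w' g)) i j)"
   by (rule pf_cong) (use w w' ij in \<open>auto simp: morph_def rep_mult G.inv_mult_group\<close>)
  then show ?thesis by (simp add: add.commute)
 qed
 show ?thesis using 1 2 w w' by (simp add: morph_def)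
qed

lemma pf_comp:
 assumes "pf D f" "morph e w"
 shows "pf (e * D) (\<lambda>g. f (w g))"
 using assms(1)
proof (induction rule: pf.induct)
 case (zero f)
 then show ?case using assms(2) by (intro pf.zero) (auto simp: morph_def)
next
 case (add f c l f')
 have sym: "pf e (\<lambda>g. gen s (w g))" if "s \<in> Sym" for s
  using that assms(2) by (auto simp: Sym_def gen_def morph_def pf_const)
 have "pf (e * length l) (\<lambda>g. mon l (w g))" if "set l \<subseteq> Sym" for l
  using that
 proof (induction l)
  case Nil
  then show ?case by (simp add: mon_def pf_const)
 next
  case (Cons s l)
  then have "pf (e + e * length l) (\<lambda>g. gen s (w g) \<otimes> mon l (w g))"
   using sym by (intro pf_mult) auto
  then show ?case by (simp add: mon_def)
 qed
 then have "pf (e * D) (\<lambda>g. mon l (w g))" using add(3) by (auto simp: Mon_def)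
 then have "pf (e * D) (\<lambda>g. c \<otimes> mon l (w g) \<oplus> f (w g))"
  using add by (intro pf_add pf_smult)
 then show ?case by (rule pf_cong) (use add assms(2) in \<open>auto simp: morph_def\<close>)
qed

text \<open>A Zariski closure with equations of degree at most \<open>D\<close>. With the degree
  fixed the equations form a finite-dimensional space, so chains of closed sets have bounded
  length.\<close>

definition cl :: "nat => 'g set => 'g set"
 where "cl D Y = {g \<in> carrier G. \<forall>f. pf D f --> (\<forall>y \<in> Y. f y = \<zero>) --> f g = \<zero>}"

lemma subset_cl: "Y \<subseteq> carrier G ==> Y \<subseteq> cl D Y"
 by (auto simp: cl_def)

lemma cl_carrier: "cl D Y \<subseteq> carrier G"
 by (auto simp: cl_def)

lemma cl_minimal: "Y \<subseteq> cl D Z ==> cl D Y \<subseteq> cl D Z"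
 unfolding cl_def by blast

text \<open>Continuity with a price: an equation of degree \<open>D\<close> pulled back along
  \<open>w\<close> has degree \<open>e * D\<close>.\<close>

lemma cl_morph:
 assumes "x \<in> cl (e * D) Y" "morph e w" "\<And>y. y \<in> Y ==> w y \<in> cl D Z"
 shows "w x \<in> cl D Z"
proof -
 have "f (w x) = \<zero>" if f: "pf D f" "\<forall>z \<in> Z. f z = \<zero>" for f
 proof -
  have "\<forall>y \<in> Y. f (w y) = \<zero>" using assms(3) f unfolding cl_def by blast
  then show ?thesis using assms(1) pf_comp[OF f(1) assms(2)] unfolding cl_def by blast
 qed
 then show ?thesis using assms(1,2) by (auto simp: cl_def morph_def)
qed

text \<open>Translations and inversion have degree 1, so the usual argument in two steps, first with
  one factor in \<open>M\<close> and then with both in the closure, keeps the degree.\<close>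

lemma cl_subgroup:
 assumes M: "subgroup M G"
 shows "subgroup (cl D M) G"
proof -
 have Mc: "M \<subseteq> carrier G" by (rule subgroup.subset[OF M])
 have c1: "x \<in> cl (1 * D) M" if "x \<in> cl D M" for x using that by simp
 have left: "a \<otimes>\<^bsub>G\<^esub> x \<in> cl D M" if a: "a \<in> M" and x: "x \<in> cl D M" for a x
 proof (rule cl_morph[OF c1[OF x]])
  show "morph 1 (\<lambda>x. a \<otimes>\<^bsub>G\<^esub> x)" using morph_mult[OF morph_const morph_id, of a] a Mc by auto
  show "a \<otimes>\<^bsub>G\<^esub> y \<in> cl D M" if "y \<in> M" for y
   using that a subgroup.m_closed[OF M] subset_cl[OF Mc] by blast
 qed
 have mult: "x \<otimes>\<^bsub>G\<^esub> y \<in> cl D M" if x: "x \<in> cl D M" and y: "y \<in> cl D M" for x y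
 proof (rule cl_morph[OF c1[OF x]])
  show "morph 1 (\<lambda>x. x \<otimes>\<^bsub>G\<^esub> y)" using morph_mult[OF morph_id morph_const, of y] y cl_carrier by auto
 qed (use left y in blast)
 have inv: "inv\<^bsub>G\<^esub> x \<in> cl D M" if x: "x \<in> cl D M" for x
 proof (rule cl_morph[OF c1[OF x]])
  show "morph 1 (\<lambda>x. inv\<^bsub>G\<^esub> x)" by (rule morph_inv[OF morph_id])
  show "inv\<^bsub>G\<^esub> y \<in> cl D M" if "y \<in> M" for y
   using that subgroup.m_inv_closed[OF M] subset_cl[OF Mc] by blast
 qed
 have "\<one>\<^bsub>G\<^esub> \<in> cl D M" using subgroup.one_closed[OF M] subset_cl[OF Mc] by blast
 then show ?thesis using cl_carrier mult inv by (intro G.subgroupI) auto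
qed

text \<open>With one argument fixed, a commutator contains the other and its inverse once each and
  is of degree 2. The two arguments are moved from \<open>M\<close> into the closure one after the
  other.\<close>

lemma cl_derived:
 assumes M: "subgroup M G"
 shows "derived G (cl (2 * D) M) \<subseteq> cl D (derived G M)"
proof (rule G.derived_subsetI[OF cl_subgroup[OF M]])
 have Mc: "M \<subseteq> carrier G" by (rule subgroup.subset[OF M])
 have DM: "subgroup (derived G M) G" by (rule G.derived_is_subgroup[OF Mc])
 then show "subgroup (cl D (derived G M)) G" by (rule cl_subgroup)
 have one: "comm G x a \<in> cl D (derived G M)" if x: "x \<in> cl (2 * D) M" and a: "a \<in> M" for x a
 proof (rule cl_morph[OF x])
  have ac: "a \<in> carrier G" using a Mc by blast
  show "morph 2 (\<lambda>x. comm G x a)"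
   using morph_mult[OF morph_mult[OF morph_mult[OF morph_inv[OF morph_id] morph_const] morph_id] morph_const,
     of "inv\<^bsub>G\<^esub> a" a] ac by (simp add: comm_def numeral_2_eq_2)
  show "comm G y a \<in> cl D (derived G M)" if "y \<in> M" for y
   using G.comm_in_derived[OF M that a] subset_cl[OF subgroup.subset[OF DM]] by blast
 qed
 show "comm G x y \<in> cl D (derived G M)" if x: "x \<in> cl (2 * D) M" and y: "y \<in> cl (2 * D) M" for x y
 proof (rule cl_morph[OF y])
  have xc: "x \<in> carrier G" using x cl_carrier by blast
  show "morph 2 (\<lambda>y. comm G x y)"
   using morph_mult[OF morph_mult[OF morph_mult[OF morph_const morph_inv[OF morph_id]] morph_const] morph_id,
     of "inv\<^bsub>G\<^esub> x" x] xc by (simp add: comm_def numeral_2_eq_2)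
 qed (use one x in blast)
qed

lemma cl_exp_derived:
 assumes M: "subgroup M G"
 shows "(derived G ^^ q) (cl (2 ^ q * D) M) \<subseteq> cl D ((derived G ^^ q) M)"
proof (induction q arbitrary: D)
 case (Suc q)
 have "(derived G ^^ Suc q) (cl (2 ^ Suc q * D) M) = derived G ((derived G ^^ q) (cl (2 ^ q * (2 * D)) M))"
  by (simp add: mult.assoc mult.left_commute)
 also have "\<dots> \<subseteq> derived G (cl (2 * D) ((derived G ^^ q) M))"
  using Suc[of "2 * D"] cl_carrier by (intro G.mono_derived) auto
 also have "\<dots> \<subseteq> cl D (derived G ((derived G ^^ q) M))"
  by (rule cl_derived[OF G.exp_of_derived_is_subgroup[OF M]])
 finally show ?case by simp
qed simp

text \<open>The kernel is defined by inhomogeneous linear equations in the entries.\<close>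

lemma cl_Ker: "cl 1 Ker \<subseteq> Ker"
proof
 fix g assume g: "g \<in> cl 1 Ker"
 then have gc: "g \<in> carrier G" using cl_carrier by blast
 have "\<phi> g i j = \<phi> \<one>\<^bsub>G\<^esub> i j" if ij: "i < n" "j < n" for i j
 proof -
  have c: "\<phi> \<one>\<^bsub>G\<^esub> i j \<in> carrier K" using rep_closed ij by simp
  have "pf 1 (\<lambda>g. \<phi> g i j \<oplus> \<ominus> \<phi> \<one>\<^bsub>G\<^esub> i j)"
   using ij c by (intro pf_add pf_entry pf_const) auto
  moreover have "\<forall>y \<in> Ker. \<phi> y i j \<oplus> \<ominus> \<phi> \<one>\<^bsub>G\<^esub> i j = \<zero>"
   using c ij by (auto simp: Ker_def K.r_neg)
  ultimately have "\<phi> g i j \<oplus> \<ominus> \<phi> \<one>\<^bsub>G\<^esub> i j = \<zero>" using g unfolding cl_def by blast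
  then show ?thesis using c rep_closed[OF gc ij] by (metis K.minus_equality K.minus_minus K.a_inv_closed)
 qed
 then show "g \<in> Ker" using gc by (simp add: Ker_def)
qed

text \<open>Each member avoids the closure of those behind it, so lists grow at the head. The
  maximal length of such a list inside a subgroup will be the rank of a flat.\<close>

primrec indep :: "nat => 'g list => bool"
 where "indep D [] = True"
 | "indep D (g # gs) = (g \<in> carrier G \<and> g \<notin> cl D (set gs) \<and> indep D gs)"

lemma indep_carrier: "indep D gs ==> set gs \<subseteq> carrier G"
 by (induction gs) auto

lemma indep_distinct: "indep D gs ==> distinct gs"
 using indep_carrier subset_cl by (induction gs) (auto, blast)

text \<open>Evaluation at the members is triangular: some function of degree \<open>D\<close>
  vanishes on the tail and not at the head.\<close>

lemma indep_relation:
 assumes "indep D gs" "c \<in> set gs \<rightarrow> carrier K"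
  and "\<And>f. pf D f ==> (\<Oplus>x \<in> set gs. c x \<otimes> f x) = \<zero>" and "x \<in> set gs"
 shows "c x = \<zero>"
 using assms
proof (induction gs)
 case (Cons g gs)
 have gc: "g \<in> carrier G" and gsc: "set gs \<subseteq> carrier G" and gn: "g \<notin> set gs"
  using Cons.prems(1) indep_carrier[of D "g # gs"] indep_distinct[of D "g # gs"] by auto
 obtain f where f: "pf D f" "\<forall>y \<in> set gs. f y = \<zero>" "f g \<noteq> \<zero>"
  using Cons.prems(1) gc by (auto simp: cl_def)
 have cg: "c g \<in> carrier K" "\<And>x. x \<in> set gs ==> c x \<in> carrier K" using Cons.prems(2) by auto
 have sum: "(\<Oplus>x \<in> set (g # gs). c x \<otimes> h x) = c g \<otimes> h g \<oplus> (\<Oplus>x \<in> set gs. c x \<otimes> h x)"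
  if "pf D h" for h
  using gn cg gc gsc pf_closed[OF that] by (simp, intro K.finsum_insert) auto
 have "(\<Oplus>x \<in> set gs. c x \<otimes> f x) = (\<Oplus>x \<in> set gs. \<zero>)"
  using f cg by (intro K.finsum_cong') auto
 then have "c g \<otimes> f g = \<zero>"
  using sum[OF f(1)] Cons.prems(3)[OF f(1)] cg pf_closed[OF f(1) gc] by simp
 then have c0: "c g = \<zero>" using f(3) cg(1) pf_closed[OF f(1) gc] K.integral by blast
 have "(\<Oplus>x \<in> set gs. c x \<otimes> h x) = \<zero>" if h: "pf D h" for h
 proof -
  have "(\<Oplus>x \<in> set gs. c x \<otimes> h x) \<in> carrier K"
   using cg gsc pf_closed[OF h] by (intro K.finsum_closed) auto
  then show ?thesis using sum[OF h] Cons.prems(3)[OF h] c0 pf_closed[OF h gc] by simp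
 qed
 then have "x \<in> set gs ==> c x = \<zero>" using Cons cg by auto
 then show ?case using Cons.prems(4) c0 by auto
qed simp

text \<open>More points than monomials would admit a nontrivial relation between their evaluations
  on all monomials, hence on all of \<open>pf D\<close>.\<close>

lemma indep_bound:
 assumes "indep D gs"
 shows "length gs \<le> card (Mon D)"
proof (rule ccontr)
 assume "\<not> length gs \<le> card (Mon D)"
 then have "card (Mon D) < card (set gs)" using indep_distinct[OF assms] distinct_card by fastforce
 then have "\<exists>c. (\<forall>x \<in> set gs. c x \<in> carrier K) \<and> (\<exists>x \<in> set gs. c x \<noteq> \<zero>) \<and>
  (\<forall>l \<in> Mon D. (\<Oplus>x \<in> set gs. c x \<otimes> mon l x) = \<zero>)"
  using finite_Mon indep_carrier[OF assms] mon_closed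
  by (intro K.homogeneous_system) (auto simp: Mon_def)
 then obtain c where c: "\<And>x. x \<in> set gs ==> c x \<in> carrier K" "\<exists>x \<in> set gs. c x \<noteq> \<zero>"
  "\<And>l. l \<in> Mon D ==> (\<Oplus>x \<in> set gs. c x \<otimes> mon l x) = \<zero>" by blast
 note gsc = indep_carrier[OF assms]
 have "(\<Oplus>x \<in> set gs. c x \<otimes> f x) = \<zero>" if "pf D f" for f
  using that
 proof (induction rule: pf.induct)
  case (zero f)
  have "(\<Oplus>x \<in> set gs. c x \<otimes> f x) = (\<Oplus>x \<in> set gs. \<zero>)"
   using zero c gsc by (intro K.finsum_cong') auto
  then show ?case by simp
 next
  case (add f d l f')
  have ml: "mon l x \<in> carrier K" if "x \<in> set gs" for x
   using that gsc add mon_closed[of l x] by (auto simp: Mon_def)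
  have fx: "f x \<in> carrier K" if "x \<in> set gs" for x using that gsc pf_closed[OF add.hyps(1)] by auto
  have "(\<Oplus>x \<in> set gs. c x \<otimes> f' x) = (\<Oplus>x \<in> set gs. d \<otimes> (c x \<otimes> mon l x) \<oplus> c x \<otimes> f x)"
   using add ml fx c gsc by (intro K.finsum_cong') (auto simp: K.r_distr K.m_lcomm subset_iff)
  also have "\<dots> = (\<Oplus>x \<in> set gs. d \<otimes> (c x \<otimes> mon l x)) \<oplus> (\<Oplus>x \<in> set gs. c x \<otimes> f x)"
   using ml fx c add by (intro K.finsum_addf) auto
  also have "(\<Oplus>x \<in> set gs. d \<otimes> (c x \<otimes> mon l x)) = d \<otimes> (\<Oplus>x \<in> set gs. c x \<otimes> mon l x)"
   using ml c add by (intro K.finsum_rdistr[symmetric]) auto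
  finally show ?case using add c by simp
 qed
 then have "c x = \<zero>" if "x \<in> set gs" for x using indep_relation[OF assms] c(1) that by blast
 then show False using c(2) by blast
qed

end

section \<open>A Baer-type theorem for families of flats\<close>

text \<open>The axioms isolate what Baer's argument uses. \<open>\<F>\<close> stands for the closed
  subsets of \<open>\<Delta>\<close>; the bounded, strictly monotone \<open>rk\<close> takes the
  place of chain conditions; by \<open>flat_solv\<close> a solvable set can be closed up without
  losing solvability, which is always meant modulo \<open>R\<close>.\<close>

locale engel_flats = group G for G (structure) +
 fixes R \<Delta> and \<F> :: "'a set set" and rk :: "'a set => nat" and B :: nat
 assumes R: "R \<lhd> G"
  and Delta: "\<Delta> \<subseteq> carrier G"
  and Delta_conjg: "\<And>u g. u \<in> \<Delta> ==> g \<in> carrier G ==> conjg G g u \<in> \<Delta>"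
  and flat_Delta: "\<And>F. F \<in> \<F> ==> F \<subseteq> \<Delta>"
  and flat_Int: "\<And>F F'. F \<in> \<F> ==> F' \<in> \<F> ==> F \<inter> F' \<in> \<F>"
  and flat_conjg: "\<And>F g. F \<in> \<F> ==> g \<in> carrier G ==> conjg G g ` F \<in> \<F>"
  and flat_closed: "\<And>F. F \<in> \<F> ==> \<Delta> \<inter> generate G (F \<union> R) \<subseteq> F"
  and rk_less: "\<And>F F'. F \<in> \<F> ==> F' \<in> \<F> ==> F \<subset> F' ==> rk F < rk F'"
  and rk_le: "\<And>F. F \<in> \<F> ==> rk F \<le> B"
  and flat_solv: "\<And>Y q. Y \<subseteq> \<Delta> ==> (derived G ^^ q) (generate G (Y \<union> R)) \<subseteq> R ==>
    \<exists>F \<in> \<F>. Y \<subseteq> F \<and> (\<exists>q. (derived G ^^ q) (generate G (F \<union> R)) \<subseteq> R)"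
  and engel: "\<And>u a. u \<in> \<Delta> ==> a \<in> carrier G ==> \<exists>m. engel G m a u \<in> R"
begin

definition solv :: "'a set => bool"
 where "solv Y \<longleftrightarrow> (\<exists>q. (derived G ^^ q) (generate G (Y \<union> R)) \<subseteq> R)"

lemma R_sub: "R \<subseteq> carrier G"
 by (rule subgroup.subset[OF normal_imp_subgroup[OF R]])

lemma gen_sub: "Y \<subseteq> \<Delta> ==> Y \<union> R \<subseteq> carrier G"
 using R_sub Delta by blast

lemma gen_subgroup: "Y \<subseteq> \<Delta> ==> subgroup (generate G (Y \<union> R)) G"
 by (rule generate_is_subgroup[OF gen_sub])

lemma in_gen: "x \<in> Y ==> x \<in> generate G (Y \<union> R)" "x \<in> R ==> x \<in> generate G (Y \<union> R)"
 by (auto intro: generate.incl)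

lemma solv_mono:
 assumes "Y' \<subseteq> \<Delta>" "Y \<subseteq> Y'" "solv Y'"
 shows "solv Y"
proof -
 have "generate G (Y \<union> R) \<subseteq> generate G (Y' \<union> R)"
  using assms gen_sub by (intro mono_generate) auto
 then show ?thesis
  using exp_derived_mono[OF gen_subgroup[OF assms(1)]] assms(3) unfolding solv_def by blast
qed

lemma flat_conjg_gen:
 assumes F: "F \<in> \<F>" and g: "g \<in> generate G (F \<union> R)" and t: "t \<in> F"
 shows "conjg G g t \<in> F"
proof -
 note sg = gen_subgroup[OF flat_Delta[OF F]]
 have "conjg G g t \<in> generate G (F \<union> R)"
  unfolding conjg_def using subgroup.m_inv_closed[OF sg g] g in_gen(1)[OF t]
  by (intro subgroup.m_closed[OF sg])
 moreover have "conjg G g t \<in> \<Delta>"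
  using F t g flat_Delta subgroup.mem_carrier[OF sg] by (intro Delta_conjg) auto
 ultimately show ?thesis using flat_closed[OF F] by blast
qed

text \<open>Otherwise the iterated conjugates of \<open>F\<close> would form an infinite strictly
  descending chain of flats, with descending ranks.\<close>

lemma conjg_flat_eqI:
 assumes F: "F \<in> \<F>" and g: "g \<in> carrier G" and sub: "\<And>t. t \<in> F ==> conjg G g t \<in> F"
 shows "conjg G g ` F = F"
proof (rule ccontr)
 assume neq: "conjg G g ` F \<noteq> F"
 define c where "c n = ((`) (conjg G g) ^^ n) F" for n
 have c0: "c 0 = F" and cS: "c (Suc n) = conjg G g ` c n" for n by (simp_all add: c_def)
 have car: "F \<subseteq> carrier G" using flat_Delta[OF F] Delta by blast
 have c: "c n \<in> \<F> \<and> c (Suc n) \<subset> c n" for n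
 proof (induction n)
  case 0
  then show ?case using F sub neq by (auto simp: c0 cS)
 next
  case (Suc n)
  have "c (Suc n) \<in> \<F>" using Suc flat_conjg g cS by metis
  moreover have "c n \<subseteq> carrier G" using Suc flat_Delta Delta by blast
  then have "conjg G g ` c (Suc n) \<subset> conjg G g ` c n"
   using Suc inj_on_image_eq_iff[OF inj_conjg[OF g], of "c (Suc n)" "c n"] by blast
  ultimately show ?case by (simp add: cS)
 qed
 have "rk (c (Suc n)) < rk (c n)" for n using c[of n] c[of "Suc n"] rk_less by blast
 then have "rk (c n) + n \<le> rk (c 0)" for n
  by (induction n) (simp, metis Suc_le_eq add_Suc_right add_less_mono1 le_less_trans less_le_trans not_less)
 from this[of "Suc (rk (c 0))"] show False by simp
qed

text \<open>The analogue of the normalizer condition for nilpotent groups; the Engel condition takes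
  over the role of nilpotency, and the derived series of the group generated by \<open>U\<close>
  that of a central series.\<close>

lemma solv_normalizer_grows:
 assumes "U \<in> \<F>" "I \<in> \<F>" "I \<subset> U" "solv U"
 shows "\<exists>u \<in> U - I. conjg G u ` I = I"
 using assms
proof (induction "rk U" arbitrary: U I rule: less_induct)
 case less
 note U = less.prems(1) and I = less.prems(2) and IU = less.prems(3)
 define W where "W = generate G (U \<union> R)"
 define H where "H = generate G (I \<union> R)"
 define D where "D j = (derived G ^^ j) W" for j
 define C where "C j = H <#> D j" for j
 have W: "subgroup W G" unfolding W_def by (rule gen_subgroup[OF flat_Delta[OF U]])
 have H: "subgroup H G" unfolding H_def by (rule gen_subgroup[OF flat_Delta[OF I]])
 have HW: "H \<subseteq> W"
  unfolding W_def H_def using IU gen_sub[OF flat_Delta[OF U]] by (intro mono_generate) auto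
 have D: "subgroup (D j) G" for j unfolding D_def by (rule exp_of_derived_is_subgroup[OF W])
 have "U \<subseteq> carrier G" "I \<subseteq> carrier G" using U I flat_Delta Delta by blast+
 then have car: "x \<in> U ==> x \<in> carrier G" "x \<in> I ==> x \<in> carrier G" "x \<in> W ==> x \<in> carrier G"
   "x \<in> H ==> x \<in> carrier G" "x \<in> D j ==> x \<in> carrier G" for x j
  using subgroup.subset[OF W] subgroup.subset[OF H] subgroup.subset[OF D[of j]] by blast+
 have W_W: "conjg G g x \<in> W" if "g \<in> W" "x \<in> W" for g x
  unfolding conjg_def using that by (intro subgroup.m_closed[OF W] subgroup.m_inv_closed[OF W])
 have D_W: "conjg G g x \<in> D j" if "g \<in> W" "x \<in> D j" for g x j
  using that conjg_exp_derived[OF _ subgroup.subset[OF W] W_W] car unfolding D_def by blast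
 have D_le: "D (Suc j) \<subseteq> D j" for j
  unfolding D_def by (rule exp_derived_antimono[OF W]) simp
 have DW: "D j \<subseteq> W" for j
  using exp_derived_antimono[OF W, of 0 j] by (simp add: D_def)
 have D_comm: "comm G x y \<in> D (Suc j)" if "x \<in> D j" "y \<in> D j" for x y j
  using comm_in_derived[OF D that] by (simp add: D_def)
 have C: "subgroup (C j) G" for j
 proof (rule subgroupI)
  show "C j \<subseteq> carrier G" unfolding C_def set_mult_def using car by auto
  have "\<one> \<otimes> \<one> \<in> C j" unfolding C_def set_mult_def
   using subgroup.one_closed[OF H] subgroup.one_closed[OF D] by blast
  then show "C j \<noteq> {}" by blast
 next
  fix a assume "a \<in> C j"
  then obtain h d where hd: "h \<in> H" "d \<in> D j" "a = h \<otimes> d" by (auto simp: C_def set_mult_def)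
  have "inv a = inv h \<otimes> conjg G (inv h) (inv d)"
   using hd by (simp add: grp car)
  moreover have "inv h \<in> H" using hd subgroup.m_inv_closed[OF H] by auto
  moreover have "conjg G (inv h) (inv d) \<in> D j"
   using calculation(2) HW hd(2) subgroup.m_inv_closed[OF D] by (intro D_W) auto
  ultimately show "inv a \<in> C j" by (auto simp: C_def set_mult_def)
 next
  fix a b assume "a \<in> C j" "b \<in> C j"
  then obtain h d h' d' where hd: "h \<in> H" "d \<in> D j" "a = h \<otimes> d"
   "h' \<in> H" "d' \<in> D j" "b = h' \<otimes> d'" by (auto simp: C_def set_mult_def)
  have "a \<otimes> b = (h \<otimes> h') \<otimes> (conjg G h' d \<otimes> d')"
   using hd by (simp add: grp car)
  moreover have "h \<otimes> h' \<in> H" using hd subgroup.m_closed[OF H] by auto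
  moreover have "conjg G h' d \<otimes> d' \<in> D j"
   using hd HW by (intro subgroup.m_closed[OF D] D_W) auto
  ultimately show "a \<otimes> b \<in> C j" by (auto simp: C_def set_mult_def)
 qed
 have HC: "h \<in> C j" if "h \<in> H" for h j
 proof -
  have "h \<otimes> \<one> \<in> C j" unfolding C_def set_mult_def
   using subgroup.one_closed[OF D] that by blast
  then show ?thesis using that car by simp
 qed
 have DC: "d \<in> C j" if "d \<in> D j" for d j
 proof -
  have "\<one> \<otimes> d \<in> C j" unfolding C_def set_mult_def
   using subgroup.one_closed[OF H] that by blast
  then show ?thesis using that car by simp
 qed
 have IH: "I \<subseteq> H" and RH: "R \<subseteq> H" and UW: "U \<subseteq> W"
  unfolding H_def W_def using in_gen by auto
 obtain q where q: "D q \<subseteq> R" using less.prems(4) by (auto simp: solv_def D_def W_def)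
 have "U \<inter> C q \<subseteq> I"
 proof -
  have "C q \<subseteq> H"
   unfolding C_def set_mult_def using q RH subgroup.m_closed[OF H] by auto
  then show ?thesis using flat_closed[OF I] flat_Delta[OF U] unfolding H_def by blast
 qed
 moreover have "\<not> U \<inter> C 0 \<subseteq> I"
  using IU UW DC[of _ 0] by (auto simp: D_def)
 \<comment> \<open>\<open>C j\<close> descends from all of \<open>W\<close> into \<open>H\<close>.
   At level \<open>j\<close> it still meets \<open>U\<close> outside \<open>I\<close>, one level
   further down no longer.\<close>
 ultimately obtain j where j: "\<not> U \<inter> C j \<subseteq> I" "U \<inter> C (Suc j) \<subseteq> I"
  using inc_induct[of 0 q "\<lambda>j. U \<inter> C j \<subseteq> I"] by blast
 define \<Omega> where "\<Omega> = {w \<in> D j. w \<notin> C (Suc j) \<and> (\<exists>h \<in> H. h \<otimes> w \<in> U \<or> h \<otimes> inv w \<in> U)}"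
 \<comment> \<open>The part of \<open>I\<close> that \<open>w\<close> keeps inside \<open>I\<close>.
   It is a flat, the intersection of \<open>I\<close> with a conjugate of \<open>I\<close>, and
   \<open>w\<close> will be a candidate for which its rank is maximal.\<close>
 define Y where "Y w = {t \<in> I. conjg G w t \<in> I}" for w
 have Y: "Y w \<in> \<F>" if "w \<in> carrier G" for w
 proof -
  have "Y w = I \<inter> conjg G (inv w) ` I"
  proof (intro equalityI subsetI)
   fix t assume "t \<in> Y w"
   then have "t = conjg G (inv w) (conjg G w t)" "t \<in> I" "conjg G w t \<in> I"
    using that car by (auto simp: Y_def)
   then show "t \<in> I \<inter> conjg G (inv w) ` I" by blast
  qed (use that car in \<open>auto simp: Y_def\<close>)
  then show ?thesis using flat_Int[OF I flat_conjg[OF I]] that by auto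
 qed
 have "\<Omega> \<noteq> {}"
 proof -
  obtain u h w where u: "u \<in> U" "u \<notin> I" "u = h \<otimes> w" and hw: "h \<in> H" "w \<in> D j"
   using j(1) by (auto simp: C_def set_mult_def)
  then have "u \<notin> C (Suc j)" using j(2) by auto
  then have "w \<notin> C (Suc j)" using u(3) HC[OF hw(1)] subgroup.m_closed[OF C] by blast
  then show ?thesis using u hw by (auto simp: \<Omega>_def)
 qed
 then obtain w where w: "w \<in> \<Omega>" and max: "\<And>w'. w' \<in> \<Omega> ==> rk (Y w') \<le> rk (Y w)"
  using ex_has_greatest_nat[of "\<lambda>w. w \<in> \<Omega>" _ "\<lambda>w. rk (Y w)" "Suc B"] Y rk_le car
  by (metis (no_types, lifting) \<Omega>_def all_not_in_conv le_imp_less_Suc mem_Collect_eq)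
 have wD: "w \<in> D j" and wc: "w \<in> carrier G" using w car by (auto simp: \<Omega>_def)
 show ?case
 proof (cases "Y w = I")
  case True
  have wI: "conjg G w ` I = I"
   using True by (intro conjg_flat_eqI[OF I wc]) (auto simp: Y_def)
  then have wI': "conjg G (inv w) t \<in> I" if "t \<in> I" for t
  proof -
   have "I \<subseteq> carrier G" using car by blast
   then have "conjg G (inv w) ` I = I" using conjg_image_inv[OF wc, of I] wI by simp
   then show ?thesis using that by blast
  qed
  obtain h v where h: "h \<in> H" "h \<otimes> v \<in> U" "v = w \<or> v = inv w"
   using w by (auto simp: \<Omega>_def)
  have vc: "v \<in> carrier G" using h wc by auto
  have "h \<otimes> v \<notin> I"
  proof
   assume "h \<otimes> v \<in> I"
   then have "inv h \<otimes> (h \<otimes> v) \<in> H"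
    using IH h(1) subgroup.m_closed[OF H] subgroup.m_inv_closed[OF H] by blast
   then have "v \<in> H" using h vc car by simp
   then have "w \<in> H" using h(3) subgroup.m_inv_closed[OF H] wc by (metis inv_inv)
   then show False using HC w by (auto simp: \<Omega>_def)
  qed
  moreover have "conjg G (h \<otimes> v) t \<in> I" if t: "t \<in> I" for t
  proof -
   have "conjg G h t \<in> I" using flat_conjg_gen[OF I] t h(1) by (simp add: H_def)
   then have "conjg G v (conjg G h t) \<in> I" using wI wI' h(3) by auto
   then show ?thesis using t h(1) vc car by (simp add: conjg_mult_left)
  qed
  ultimately show ?thesis
   using h conjg_flat_eqI[OF I, of "h \<otimes> v"] car by blast
 next
  case False
  then have YI: "Y w \<subset> I" by (auto simp: Y_def)
  have "rk I < rk U" by (rule rk_less[OF I U IU])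
  moreover have "solv I" using solv_mono[OF flat_Delta[OF U]] IU less.prems(4) by blast
  \<comment> \<open>The induction hypothesis is applied one level down, to the proper subflat
    \<open>Y w\<close> of \<open>I\<close>: \<open>t\<close> normalizes \<open>Y w\<close>, and
    \<open>w\<close> moves \<open>t\<close> out of \<open>I\<close>.\<close>
  ultimately obtain t where t: "t \<in> I - Y w" "conjg G t ` Y w = Y w"
   using less.hyps[OF _ I Y[OF wc] YI] by blast
  have tH: "t \<in> H" and tc: "t \<in> carrier G" using t IH car by auto
  have tY: "conjg G (inv t) y \<in> Y w" if "y \<in> Y w" for y
  proof -
   have "Y w \<subseteq> carrier G" using YI car by blast
   then have "conjg G (inv t) ` Y w = Y w" using conjg_image_inv[OF tc, of "Y w"] t(2) by simp
   then show ?thesis using that by blast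
  qed
  define z where "z k = engel G k w t" for k
  have zS: "z (Suc k) = comm G (z k) t" for k by (simp add: z_def)
  have zc: "z k \<in> carrier G" for k using wc tc by (simp add: z_def)
  let ?C = "C (Suc j)"
  have conjg_C: "conjg G v x \<in> ?C" if "v \<in> D j" "x \<in> D j" "x \<in> ?C" for v x
   using that D_comm[of x j v] DC car
   by (auto simp: conjg_eq_mult_comm intro!: subgroup.m_closed[OF C])
  have yD: "comm G y v \<in> D j" if "y \<in> Y w" "v \<in> D j" for y v
  proof -
   have "y \<in> W" using that YI IH HW by auto
   then have "inv (conjg G y (inv v)) \<in> D j"
    using that subgroup.m_inv_closed[OF D] D_W by metis
   moreover have "y \<in> carrier G" "v \<in> carrier G" using that car `y \<in> W` by auto
   ultimately have "conjg G y v \<in> D j" using conjg_inv by simp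
   then have "inv (conjg G y v) \<otimes> v \<in> D j"
    using that(2) subgroup.m_inv_closed[OF D] subgroup.m_closed[OF D] by metis
   then show ?thesis
    using `y \<in> carrier G` `v \<in> carrier G` by (simp add: grp)
  qed
  \<comment> \<open>Commutators of \<open>Y w\<close> with every \<open>z k\<close> fall into
    \<open>C (Suc j)\<close>. For \<open>w\<close> this is so because both y and y^w lie in
    \<open>I\<close>; taking commutators with \<open>t\<close> preserves it since \<open>t\<close>
    normalizes \<open>Y w\<close>.\<close>
  have z: "z k \<in> D j \<and> (\<forall>y \<in> Y w. comm G y (z k) \<in> ?C)" for k
  proof (induction k)
   case 0
   have "comm G y w \<in> ?C" if "y \<in> Y w" for y
   proof -
    have "y \<in> I" "conjg G w y \<in> I" using that by (auto simp: Y_def)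
    then have "inv y \<otimes> conjg G w y \<in> H"
     using IH subgroup.m_closed[OF H] subgroup.m_inv_closed[OF H] by blast
    then show ?thesis
     using HC comm_eq_inv_mult_conjg[of y w] wc car `y \<in> I` by auto
   qed
   then show ?case using wD by (simp add: z_def)
  next
   case (Suc k)
   have cz: "conjg G t (z k) \<in> D j" using Suc tH HW D_W by blast
   have iz: "inv (z k) \<in> D j" using Suc subgroup.m_inv_closed[OF D] by metis
   have eq: "z (Suc k) = inv (z k) \<otimes> conjg G t (z k)"
    using zc tc by (simp add: zS comm_eq_inv_mult_conjg)
   have "comm G y (z (Suc k)) \<in> ?C" if y: "y \<in> Y w" for y
   proof -
    have yc: "y \<in> carrier G" using y YI car by blast
    have 1: "comm G y (inv (z k)) \<in> ?C"
    proof -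
     have "conjg G (inv (z k)) (inv (comm G y (z k))) \<in> ?C"
      using Suc y yD iz by (intro conjg_C subgroup.m_inv_closed[OF C]
        subgroup.m_inv_closed[OF D]) auto
     then show ?thesis using yc zc by (simp add: grp)
    qed
    have 2: "comm G y (conjg G t (z k)) \<in> ?C"
    proof -
     have "comm G (conjg G (inv t) y) (z k) \<in> ?C" using Suc tY[OF y] by blast
     then have "conjg G t (comm G (conjg G (inv t) y) (z k)) \<in> ?C"
      unfolding conjg_def[of _ t] using HC[OF tH]
      by (intro subgroup.m_closed[OF C] subgroup.m_inv_closed[OF C])
     then show ?thesis using yc zc tc by (simp add: grp)
    qed
    have "comm G y (z (Suc k)) =
      comm G y (conjg G t (z k)) \<otimes> conjg G (conjg G t (z k)) (comm G y (inv (z k)))"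
     using yc zc tc by (simp add: eq grp)
    moreover have "conjg G (conjg G t (z k)) (comm G y (inv (z k))) \<in> ?C"
     using 1 cz yD[OF y iz] by (intro conjg_C)
    ultimately show ?thesis using 2 subgroup.m_closed[OF C] by metis
   qed
   moreover have "z (Suc k) \<in> D j"
    unfolding eq using cz iz by (intro subgroup.m_closed[OF D])
   ultimately show ?case by blast
  qed
  have U_z: "conjg G (z k) x \<in> U" if "x \<in> U" for x k
   using flat_conjg_gen[OF U _ that] z DW unfolding W_def by blast
  \<comment> \<open>y^(z k) = y [y, z k] lies in \<open>U\<close> and in \<open>C (Suc j)\<close>,
    hence in \<open>I\<close>.\<close>
  have Yz: "Y w \<subseteq> Y (z k)" for k
  proof
   fix y assume y: "y \<in> Y w"
   then have yI: "y \<in> I" and yc: "y \<in> carrier G" using YI car by auto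
   have "y \<otimes> comm G y (z k) \<in> ?C"
    using z y HC IH yI by (intro subgroup.m_closed[OF C]) auto
   then have "conjg G (z k) y \<in> I"
    using j(2) U_z[of y k] yI IU yc zc by (auto simp: conjg_eq_mult_comm)
   then show "y \<in> Y (z k)" using yI by (simp add: Y_def)
  qed
  obtain m where "z m \<in> R" using engel[of t w] t I flat_Delta wc unfolding z_def by blast
  then have "z m \<notin> \<Omega>" using RH HC by (auto simp: \<Omega>_def)
  moreover have "z 0 \<in> \<Omega>" using w by (simp add: z_def)
  \<comment> \<open>Where the sequence leaves \<open>\<Omega>\<close>, the element t^(z k) = t (z (k
    + 1))^-1 lies in \<open>U\<close>, so \<open>z (Suc k)\<close> can have left only by being in
    \<open>C (Suc j)\<close>. Then \<open>t\<close> belongs to \<open>Y (z k)\<close>, which is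
    larger than \<open>Y w\<close>, against the choice of \<open>w\<close>.\<close>
  ultimately obtain k where k: "z k \<in> \<Omega>" "z (Suc k) \<notin> \<Omega>"
   using inc_induct[of 0 m "\<lambda>k. z k \<notin> \<Omega>"] by blast
  have tz: "conjg G (z k) t = t \<otimes> inv (z (Suc k))"
   using zc tc by (simp add: zS conjg_eq_mult_inv_comm)
  have tU: "t \<otimes> inv (z (Suc k)) \<in> U" using U_z[of t k] t IU tz by auto
  then have "z (Suc k) \<in> ?C" using k(2) z tH by (auto simp: \<Omega>_def)
  then have "t \<otimes> inv (z (Suc k)) \<in> ?C"
   using HC[OF tH] by (intro subgroup.m_closed[OF C] subgroup.m_inv_closed[OF C])
  then have "t \<in> Y (z k)" using tU j(2) tz t by (auto simp: Y_def)
  then have "Y w \<subset> Y (z k)" using Yz t by blast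
  then have "rk (Y w) < rk (Y (z k))" using Y wc zc by (intro rk_less) auto
  then show ?thesis using max[OF k(1)] by simp
 qed
qed

definition max_solv :: "'a set => bool"
 where "max_solv U \<longleftrightarrow> U \<in> \<F> \<and> solv U \<and> (\<forall>F \<in> \<F>. solv F \<and> U \<subseteq> F --> F = U)"

lemma ex_max_solv:
 assumes "Y \<subseteq> \<Delta>" "solv Y"
 shows "\<exists>U. max_solv U \<and> Y \<subseteq> U"
proof -
 let ?P = "\<lambda>F. F \<in> \<F> \<and> solv F \<and> Y \<subseteq> F"
 obtain F where "?P F" using flat_solv assms unfolding solv_def by blast
 then obtain U where U: "?P U" "\<And>F. ?P F ==> rk F \<le> rk U"
  using ex_has_greatest_nat[of ?P F rk "Suc B"] rk_le by (auto simp: less_Suc_eq_le)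
 have "F = U" if "F \<in> \<F>" "solv F" "U \<subseteq> F" for F
  using that U rk_less[of U F] by (metis dual_order.trans leD psubsetI)
 then show ?thesis using U(1) unfolding max_solv_def by blast
qed

text \<open>The group generated by \<open>u\<close>, \<open>U\<close> and \<open>R\<close> is
  contained in the products u^k x with x in \<open>W\<close>, and \<open>u\<close> normalizes
  \<open>W\<close>. So its quotient by \<open>W\<close> is cyclic, and the derived length grows by
  at most 1.\<close>

lemma solv_insert:
 assumes U: "U \<subseteq> \<Delta>" "solv U" and u: "u \<in> \<Delta>"
  and norm: "\<And>t. t \<in> U ==> conjg G u t \<in> U"
  and norm': "\<And>t. t \<in> U ==> conjg G (inv u) t \<in> U"
 shows "solv (insert u U)"
proof -
 define W where "W = generate G (U \<union> R)"
 define W' where "W' = generate G (insert u U \<union> R)"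
 have uc: "u \<in> carrier G" using u Delta by blast
 have W: "subgroup W G" unfolding W_def by (rule gen_subgroup[OF U(1)])
 have W': "subgroup W' G"
  unfolding W'_def using u U(1) by (intro gen_subgroup) auto
 have Uc: "U \<union> R \<subseteq> carrier G" by (rule gen_sub[OF U(1)])
 have gen_closed: "conjg G g x \<in> W"
  if g: "g \<in> carrier G" and gU: "\<And>t. t \<in> U ==> conjg G g t \<in> U" and x: "x \<in> W" for g x
 proof -
  have "conjg G g s \<in> generate G (U \<union> R)" if "s \<in> U \<union> R" for s
   using that gU normal_conjg[OF R g] in_gen by blast
  then show ?thesis using conjg_generate[OF g Uc _ Uc] x unfolding W_def by blast
 qed
 have u_W: "conjg G u x \<in> W" "conjg G (inv u) x \<in> W" if "x \<in> W" for x
  using that uc gen_closed norm norm' by auto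
 define N where "N = {g \<in> carrier G. \<forall>x \<in> W. conjg G g x \<in> W \<and> conjg G (inv g) x \<in> W}"
 have Wc: "x \<in> carrier G" if "x \<in> W" for x using that subgroup.mem_carrier[OF W] by auto
 have N: "subgroup N G"
  by (rule subgroupI) (auto simp: N_def Wc conjg_mult_left inv_mult_group subgroup.one_closed[OF W]
    intro!: exI[of _ \<one>])
 have WN: "W \<subseteq> N"
  by (auto simp: N_def conjg_def Wc intro!: subgroup.m_closed[OF W] subgroup.m_inv_closed[OF W])
 have uN: "u \<in> N" using uc u_W by (auto simp: N_def)
 define Q where "Q = {g \<in> N. \<exists>k::int. \<exists>x \<in> W. g = u [^] k \<otimes> x}"
 have Nc: "x \<in> carrier G" if "x \<in> N" for x using that by (auto simp: N_def)
 have uk: "u [^] (k::int) \<in> N" for k using uN N subgroup_int_pow_closed by metis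
 have Q: "subgroup Q G"
 proof (rule subgroupI)
  show "Q \<subseteq> carrier G" by (auto simp: Q_def N_def)
  have "\<one> \<in> Q" using subgroup.one_closed[OF N] subgroup.one_closed[OF W]
   by (auto simp: Q_def intro!: exI[of _ "0::int"] bexI[of _ \<one>])
  then show "Q \<noteq> {}" by blast
 next
  fix a assume "a \<in> Q"
  then obtain k x where a: "a \<in> N" "x \<in> W" "a = u [^] (k::int) \<otimes> x" by (auto simp: Q_def)
  have "inv a = u [^] (- k) \<otimes> conjg G (inv (u [^] k)) (inv x)"
   using a uc Wc by (simp add: grp int_pow_neg)
  moreover have "conjg G (inv (u [^] k)) (inv x) \<in> W"
   using uk[of k] a(2) subgroup.m_inv_closed[OF W] by (auto simp: N_def)
  ultimately show "inv a \<in> Q" using subgroup.m_inv_closed[OF N a(1)] by (auto simp: Q_def)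
 next
  fix a b assume "a \<in> Q" "b \<in> Q"
  then obtain k x l y where ab: "a \<in> N" "x \<in> W" "a = u [^] (k::int) \<otimes> x"
   "b \<in> N" "y \<in> W" "b = u [^] (l::int) \<otimes> y" by (auto simp: Q_def)
  have "a \<otimes> b = u [^] (k + l) \<otimes> (conjg G (u [^] l) x \<otimes> y)"
   using ab uc Wc by (simp add: grp int_pow_mult)
  moreover have "conjg G (u [^] l) x \<otimes> y \<in> W"
   using uk[of l] ab by (intro subgroup.m_closed[OF W]) (auto simp: N_def)
  ultimately show "a \<otimes> b \<in> Q" using subgroup.m_closed[OF N ab(1,4)] by (auto simp: Q_def)
 qed
 have "W' \<subseteq> Q"
  unfolding W'_def
 proof (rule generate_subgroup_incl[OF _ Q])
  have "x \<in> Q" if "x \<in> W" for x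
   using that WN Wc by (auto simp: Q_def intro!: exI[of _ "0::int"] bexI[of _ x])
  moreover have "u \<in> Q"
   using uN uc subgroup.one_closed[OF W]
   by (auto simp: Q_def int_pow_1 intro!: exI[of _ "1::int"] bexI[of _ \<one>])
  moreover have "U \<union> R \<subseteq> W" unfolding W_def using in_gen by auto
  ultimately show "insert u U \<union> R \<subseteq> Q" by blast
 qed
 moreover have "comm G a b \<in> W" if "a \<in> Q" "b \<in> Q" for a b
 proof -
  obtain k x where ax: "x \<in> W" "a = u [^] (k::int) \<otimes> x"
   using `a \<in> Q` unfolding Q_def by blast
  obtain l y where bY: "y \<in> W" "b = u [^] (l::int) \<otimes> y"
   using `b \<in> Q` unfolding Q_def by blast
  note ab = ax bY
  define p where "p = u [^] k"
  define r where "r = u [^] l"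
  have pr: "p \<in> N" "r \<in> N" "p \<otimes> r = r \<otimes> p"
   using uk uc by (auto simp: p_def r_def simp flip: int_pow_mult) (simp add: add.commute)
  have c: "p \<in> carrier G" "r \<in> carrier G" "x \<in> carrier G" "y \<in> carrier G" using pr Nc ab Wc by auto
  have "inv r \<otimes> p = inv r \<otimes> (p \<otimes> r) \<otimes> inv r" using c by (simp add: m_assoc)
  also have "\<dots> = p \<otimes> inv r" using c by (simp add: pr(3) m_assoc)
  finally have rp: "inv r \<otimes> p = p \<otimes> inv r" .
  have "comm G a b = inv x \<otimes> (inv p \<otimes> (inv y \<otimes> (inv r \<otimes> p \<otimes> (x \<otimes> (r \<otimes> y)))))"
   using c by (simp add: ab(2,4) grp flip: p_def r_def)
  also have "\<dots> = inv x \<otimes> conjg G p (inv y) \<otimes> conjg G r x \<otimes> y"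
   unfolding rp using c by (simp add: grp)
  finally have "comm G a b = inv x \<otimes> conjg G p (inv y) \<otimes> conjg G r x \<otimes> y" .
  moreover have "conjg G p (inv y) \<in> W" "conjg G r x \<in> W"
   using pr ab subgroup.m_inv_closed[OF W] by (auto simp: N_def)
  ultimately show ?thesis
   using ab subgroup.m_inv_closed[OF W] subgroup.m_closed[OF W] by metis
 qed
 ultimately have "derived G W' \<subseteq> W"
  by (intro derived_subsetI[OF W' W]) auto
 moreover obtain q where "(derived G ^^ q) W \<subseteq> R" using U(2) by (auto simp: solv_def W_def)
 ultimately have "(derived G ^^ Suc q) W' \<subseteq> R"
  using exp_derived_mono[OF W, of "derived G W'" q] by (simp add: funpow_swap1)
 then show ?thesis unfolding solv_def W'_def by blast
qed

lemma solv_empty: "solv {}"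
proof -
 have "generate G ({} \<union> R) = R"
  using R normal_imp_subgroup generate_subgroup_incl[of R R] in_gen by fastforce
 then show ?thesis unfolding solv_def by (intro exI[of _ 0]) simp
qed

lemma solv_singleton: "u \<in> \<Delta> ==> solv {u}"
 using solv_insert[of "{}" u] solv_empty by simp

lemma solv_insert_flat:
 assumes U: "U \<in> \<F>" "solv U" and u: "u \<in> \<Delta>" and norm: "\<And>t. t \<in> U ==> conjg G u t \<in> U"
 shows "solv (insert u U)"
proof (rule solv_insert[OF flat_Delta[OF U(1)] U(2) u norm])
 have uc: "u \<in> carrier G" using u Delta by blast
 have "U \<subseteq> carrier G" using flat_Delta[OF U(1)] Delta by blast
 then have "conjg G (inv u) ` U = U"
  using conjg_image_inv[OF uc, of U] conjg_flat_eqI[OF U(1) uc norm] by simp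
 then show "conjg G (inv u) t \<in> U" if "t \<in> U" for t using that by blast
qed

lemma max_solv_conjg:
 assumes U: "max_solv U" and g: "g \<in> carrier G"
 shows "max_solv (conjg G g ` U)"
proof -
 have solv_conjg: "solv (conjg G g ` F)" if FF: "F \<in> \<F>" "solv F" "g \<in> carrier G" for F g
 proof -
  have Fc: "F \<union> R \<subseteq> carrier G" and FD: "F \<subseteq> \<Delta>" using flat_Delta[OF FF(1)] gen_sub by auto
  have FD': "conjg G g ` F \<subseteq> \<Delta>" using flat_Delta flat_conjg FF by blast
  let ?W = "generate G (F \<union> R)" and ?W' = "generate G (conjg G g ` F \<union> R)"
  have W: "subgroup ?W G" "subgroup ?W' G" using gen_subgroup FD FD' by auto
  obtain q where q: "(derived G ^^ q) ?W \<subseteq> R" using FF(2) by (auto simp: solv_def)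
  have "conjg G (inv g) x \<in> ?W" if x: "x \<in> ?W'" for x
   using x
  proof (rule conjg_generate[rotated 4])
   fix s assume "s \<in> conjg G g ` F \<union> R"
   then show "conjg G (inv g) s \<in> ?W"
    using `g \<in> carrier G` Fc normal_conjg[OF R, of "inv g"]
    by (auto intro!: generate.incl simp: subset_iff)
  qed (use `g \<in> carrier G` Fc gen_sub[OF FD'] in auto)
  then have *: "?W' \<subseteq> conjg G g ` ?W"
   using `g \<in> carrier G` subgroup.mem_carrier[OF W(2)]
   by (metis (no_types, lifting) conjg_inv_conjg(1) image_eqI subsetI)
  have "x \<in> (derived G ^^ n) ?W' ==> conjg G (inv g) x \<in> (derived G ^^ n) ?W" for n x
  proof (induction n arbitrary: x)
   case 0
   then show ?case using * `g \<in> carrier G` subgroup.mem_carrier[OF W(1)] by auto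
  next
   case (Suc n)
   let ?D = "(derived G ^^ n) ?W" and ?D' = "(derived G ^^ n) ?W'"
   have D: "subgroup ?D G" "subgroup ?D' G" using W exp_of_derived_is_subgroup by auto
   have "conjg G (inv g) x \<in> generate G (derived_set G ?D)"
   proof (rule conjg_generate)
    show "x \<in> generate G (derived_set G ?D')" using Suc.prems by (simp flip: derived_def)
    show "derived_set G ?D' \<subseteq> carrier G" "derived_set G ?D \<subseteq> carrier G"
     using derived_set_in_carrier[OF subgroup.subset] D by blast+
    fix s assume "s \<in> derived_set G ?D'"
    then obtain a b where ab: "a \<in> ?D'" "b \<in> ?D'" and s: "s = a \<otimes> b \<otimes> inv a \<otimes> inv b" by auto
    let ?c = "conjg G (inv g)"
    have "a \<in> carrier G" "b \<in> carrier G" using ab(1,2) subgroup.mem_carrier[OF D(2)] by auto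
    then have "?c s = ?c a \<otimes> ?c b \<otimes> inv (?c a) \<otimes> inv (?c b)"
     using `g \<in> carrier G` by (simp add: s grp)
    then show "?c s \<in> generate G (derived_set G ?D)"
     using Suc.IH ab by (intro generate.incl) auto
   qed (use `g \<in> carrier G` in auto)
   then show ?case by (simp flip: derived_def)
  qed
  note dn = this
  have "(derived G ^^ q) ?W' \<subseteq> R"
  proof (intro subsetI)
   fix x assume x: "x \<in> (derived G ^^ q) ?W'"
   have "x \<in> carrier G" using subgroup.mem_carrier[OF exp_of_derived_is_subgroup[OF W(2)] x] .
   then have "x = conjg G g (conjg G (inv g) x)" using `g \<in> carrier G` by simp
   moreover have "conjg G (inv g) x \<in> R" using dn[OF x] q by blast
   ultimately show "x \<in> R" using normal_conjg[OF R `g \<in> carrier G`] by metis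
  qed
  then show ?thesis by (auto simp: solv_def)
 qed
 have UF: "U \<in> \<F>" "solv U" using U by (auto simp: max_solv_def)
 have "F = conjg G g ` U" if F: "F \<in> \<F>" "solv F" "conjg G g ` U \<subseteq> F" for F
 proof -
  have Uc: "U \<subseteq> carrier G" and Fc: "F \<subseteq> carrier G" using UF F flat_Delta Delta by blast+
  have "U \<subseteq> conjg G (inv g) ` F"
  proof
   fix t assume t: "t \<in> U"
   then have "t = conjg G (inv g) (conjg G g t)" using Uc g by auto
   then show "t \<in> conjg G (inv g) ` F" using t F(3) by blast
  qed
  moreover have "conjg G (inv g) ` F \<in> \<F>" "solv (conjg G (inv g) ` F)"
   using F g flat_conjg solv_conjg by auto
  ultimately have "conjg G (inv g) ` F = U" using U unfolding max_solv_def by blast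
  then have "conjg G g ` U = (\<lambda>x. conjg G g (conjg G (inv g) x)) ` F" by auto
  also have "\<dots> = F" using g Fc by (auto simp: subset_iff image_iff)
  finally show ?thesis by simp
 qed
 then show ?thesis
  using UF g flat_conjg solv_conjg unfolding max_solv_def by blast
qed

text \<open>Two different maximal solvable flats, chosen with an intersection \<open>I\<close> of
  largest rank, would contain elements u and v outside \<open>I\<close> that normalize
  \<open>I\<close>. The Engel sequence of v by u, followed backwards from its end in
  \<open>R\<close>, normalizes the first flat, and so v is forced into it.\<close>

theorem engel_flats_solvable: "\<exists>q. (derived G ^^ q) (generate G (\<Delta> \<union> R)) \<subseteq> R"
proof (cases "\<exists>U V. max_solv U \<and> max_solv V \<and> U \<noteq> V")
 case False
 obtain U where U: "max_solv U" using ex_max_solv[OF empty_subsetI solv_empty] by blast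
 have "\<Delta> \<subseteq> U"
  using solv_singleton ex_max_solv False U by (metis empty_subsetI insert_subset subsetI)
 then have "\<Delta> = U" using U flat_Delta unfolding max_solv_def by blast
 then show ?thesis using U unfolding max_solv_def solv_def by blast
next
 case True
 let ?P = "\<lambda>UV. max_solv (fst UV) \<and> max_solv (snd UV) \<and> fst UV \<noteq> snd UV"
 obtain U0 V0 where "?P (U0, V0)" using True by auto
 then obtain UV where UV0: "?P UV" by blast
 have "\<forall>UV. ?P UV --> rk (fst UV \<inter> snd UV) < Suc B"
  using rk_le flat_Int by (simp add: max_solv_def less_Suc_eq_le)
 from ex_has_greatest_nat[of ?P, OF UV0 this]
 obtain U V where UV: "max_solv U" "max_solv V" "U \<noteq> V"
  and max: "\<And>U' V'. max_solv U' ==> max_solv V' ==> U' \<noteq> V' ==> rk (U' \<inter> V') \<le> rk (U \<inter> V)"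
  by (metis fst_conv snd_conv)
 define I where "I = U \<inter> V"
 have U: "U \<in> \<F>" "solv U" and V: "V \<in> \<F>" "solv V" using UV by (auto simp: max_solv_def)
 have I: "I \<in> \<F>" unfolding I_def by (rule flat_Int[OF U(1) V(1)])
 have IU: "I \<subset> U" "I \<subset> V" using UV unfolding I_def max_solv_def by blast+
 obtain u where u: "u \<in> U - I" "conjg G u ` I = I"
  using solv_normalizer_grows[OF U(1) I IU(1) U(2)] by blast
 obtain v where v: "v \<in> V - I" "conjg G v ` I = I"
  using solv_normalizer_grows[OF V(1) I IU(2) V(2)] by blast
 have uc: "u \<in> carrier G" and vc: "v \<in> carrier G" and uD: "u \<in> \<Delta>" and vD: "v \<in> \<Delta>"
  using u v U V flat_Delta Delta by blast+
 have Ic: "t \<in> carrier G" if "t \<in> I" for t using that I flat_Delta Delta by blast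
 have uI: "conjg G (inv u) ` I = I"
 proof -
  have "conjg G (inv u) ` (conjg G u ` I) = I"
   using Ic by (intro conjg_image_inv[OF uc]) blast
  then show ?thesis using u(2) by simp
 qed
 define z where "z k = engel G k v u" for k
 have zS: "z (Suc k) = comm G (z k) u" for k by (simp add: z_def)
 have zc: "z k \<in> carrier G" for k using uc vc by (simp add: z_def)
 have zI: "conjg G (z k) ` I = I \<and> conjg G (inv (z k)) ` I = I" for k
 proof (induction k)
  case 0
  have "conjg G (inv v) ` (conjg G v ` I) = I"
   using Ic by (intro conjg_image_inv[OF vc]) blast
  then show ?case using v(2) by (simp add: z_def)
 next
  case (Suc k)
  have "conjg G (z (Suc k)) ` I = conjg G u ` conjg G (z k) ` conjg G (inv u) ` conjg G (inv (z k)) ` I"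
   unfolding image_image using uc zc Ic by (intro image_cong) (auto simp: zS grp)
  then have *: "conjg G (z (Suc k)) ` I = I" using Suc u(2) uI by simp
  have "conjg G (inv (z (Suc k))) ` (conjg G (z (Suc k)) ` I) = I"
   using Ic by (intro conjg_image_inv[OF zc]) blast
  then show ?case using * by simp
 qed
 have uz: "conjg G (z k) u = u \<otimes> inv (z (Suc k))" for k
  using zc uc by (simp add: zS conjg_eq_mult_inv_comm)
 obtain m where m: "z m \<in> R" using engel[OF uD vc] unfolding z_def by blast
 \<comment> \<open>Downward induction: if \<open>z (Suc k)\<close> normalizes \<open>U\<close>, so
   does u^(z k) = u (z (k + 1))^-1, and by maximality this conjugate belongs to \<open>U\<close>. If
   \<open>z k\<close> did not normalize \<open>U\<close>, then \<open>U\<close> and its conjugate by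
   \<open>z k\<close> would be two maximal solvable flats that meet in more than
   \<open>I\<close>.\<close>
 have "conjg G (z 0) ` U = U"
 proof (rule inc_induct[of 0 m])
  show "conjg G (z m) ` U = U"
   using flat_conjg_gen[OF U(1)] m zc in_gen(2) by (intro conjg_flat_eqI[OF U(1)]) auto
 next
  fix k assume IH: "conjg G (z (Suc k)) ` U = U"
  have Uc: "t \<in> carrier G" if "t \<in> U" for t using that U flat_Delta Delta by blast
  have inv_z: "conjg G (inv (z (Suc k))) t \<in> U" if "t \<in> U" for t
  proof -
   have "U \<subseteq> carrier G" using Uc by blast
   then have "conjg G (inv (z (Suc k))) ` U = U"
    using conjg_image_inv[OF zc[of "Suc k"], of U] IH by simp
   then show ?thesis using that by blast
  qed
  have "conjg G (conjg G (z k) u) t \<in> U" if t: "t \<in> U" for t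
  proof -
   have "conjg G u t \<in> U" using flat_conjg_gen[OF U(1) _ t] in_gen(1) u by blast
   then have "conjg G (inv (z (Suc k))) (conjg G u t) \<in> U" by (rule inv_z)
   then show ?thesis using uc zc Uc t by (simp add: uz conjg_mult_left)
  qed
  moreover have ucz: "conjg G (z k) u \<in> \<Delta>" using Delta_conjg uD zc by blast
  ultimately have "solv (insert (conjg G (z k) u) U)" by (intro solv_insert_flat[OF U])
  then obtain F where "max_solv F" "insert (conjg G (z k) u) U \<subseteq> F"
   using ex_max_solv ucz flat_Delta[OF U(1)] by (metis insert_subset)
  then have czU: "conjg G (z k) u \<in> U"
   using UV(1) unfolding max_solv_def by blast
  show "conjg G (z k) ` U = U"
  proof (rule ccontr)
   assume neq: "conjg G (z k) ` U \<noteq> U"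
   have mx: "max_solv (conjg G (z k) ` U)" by (rule max_solv_conjg[OF UV(1) zc])
   have "I \<subseteq> U \<inter> conjg G (z k) ` U" using zI[of k] I_def by blast
   moreover have "conjg G (z k) u \<in> U \<inter> conjg G (z k) ` U" using czU u by blast
   moreover have "conjg G (z k) u \<notin> I"
   proof
    assume "conjg G (z k) u \<in> I"
    then have "conjg G (inv (z k)) (conjg G (z k) u) \<in> I" using zI by blast
    then show False using u zc uc by simp
   qed
   ultimately have "I \<subset> U \<inter> conjg G (z k) ` U" by blast
   then have "rk I < rk (U \<inter> conjg G (z k) ` U)"
    using rk_less[OF I flat_Int[OF U(1)]] mx max_solv_def by blast
   then show False using max[OF UV(1) mx] neq I_def by simp
  qed
 qed simp
 then have "conjg G v t \<in> U" if "t \<in> U" for t using that by (auto simp: z_def)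
 then have "solv (insert v U)" by (intro solv_insert_flat[OF U vD])
 then obtain F where "max_solv F" "insert v U \<subseteq> F"
  using ex_max_solv vD flat_Delta[OF U(1)] by (metis insert_subset)
 then have "v \<in> U" using UV(1) unfolding max_solv_def by blast
 then show ?thesis using v I_def by blast
qed

end

section \<open>Engel sets in matrix groups\<close>

context matrix_rep
begin

text \<open>Flats are the subsets of \<open>\<Delta>\<close> closed under equations of degree
  \<open>2 ^ b\<close>. The degree can be fixed beforehand because every solvable subgroup that
  occurs has derived length at most \<open>b\<close> modulo the kernel, whatever its length modulo
  \<open>R\<close>.\<close>

theorem linear_engel:
 assumes closed: "algebraically_closed K"
  and R: "R \<lhd> G" "Ker \<subseteq> R" "(derived G ^^ s) R \<subseteq> Ker"
  and Delta: "\<Delta> \<subseteq> carrier G" "\<And>u g. u \<in> \<Delta> ==> g \<in> carrier G ==> conjg G g u \<in> \<Delta>"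
  and engel: "\<And>u a. u \<in> \<Delta> ==> a \<in> carrier G ==> \<exists>m. engel G m a u \<in> R"
 shows "(derived G ^^ zassenhaus_bound n) (generate G (\<Delta> \<union> R)) \<subseteq> Ker"
proof -
 define b where "b = zassenhaus_bound n"
 define D0 :: nat where "D0 = 2 ^ b"
 define H where "H F = generate G (F \<union> R)" for F
 have Rc: "R \<subseteq> carrier G" using R(1) by (simp add: normal_imp_subgroup subgroup.subset)
 have Hs: "subgroup (H F) G" if "F \<subseteq> \<Delta>" for F
  unfolding H_def using that Delta(1) Rc by (intro G.generate_is_subgroup) auto
 have Hc: "H F \<subseteq> carrier G" if "F \<subseteq> \<Delta>" for F using subgroup.subset[OF Hs[OF that]] .
 have sub_H: "F \<union> R \<subseteq> H F" for F by (auto simp: H_def intro: generate.incl)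
 have H_mono: "H F \<subseteq> H F'" if "F \<subseteq> F'" "F' \<subseteq> \<Delta>" for F F'
  unfolding H_def using that Delta(1) Rc by (intro G.mono_generate) auto
 have cl_mono: "cl D0 A \<subseteq> cl D0 B" if "A \<subseteq> B" "B \<subseteq> carrier G" for A B
  using that subset_cl by (intro cl_minimal) blast
 \<comment> \<open>The length \<open>q\<close> modulo \<open>R\<close> and the length
   \<open>s\<close> of \<open>R\<close> modulo the kernel add up to some length modulo the kernel,
   which Zassenhaus replaces by \<open>b\<close>.\<close>
 have solvable_bound: "(derived G ^^ b) (H Y) \<subseteq> Ker"
  if "Y \<subseteq> \<Delta>" "(derived G ^^ q) (H Y) \<subseteq> R" for Y q
 proof -
  have "(derived G ^^ (s + q)) (H Y) = (derived G ^^ s) ((derived G ^^ q) (H Y))"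
   by (rule G.exp_derived_add)
  also have "\<dots> \<subseteq> (derived G ^^ s) R"
   using that(2) R(1) by (intro G.exp_derived_mono normal_imp_subgroup)
  also have "\<dots> \<subseteq> Ker" by (rule R(3))
  finally show ?thesis unfolding b_def by (rule exp_derived_subset_Ker[OF closed Hs[OF that(1)]])
 qed
 define \<F> where "\<F> = {F. F \<subseteq> \<Delta> \<and> \<Delta> \<inter> cl D0 (H F) \<subseteq> F}"
 define chains where "chains F = {length gs |gs. indep D0 gs \<and> set gs \<subseteq> H F}" for F
 have fin: "finite (chains F)" for F
  by (rule finite_subset[of _ "{..card (Mon D0)}"]) (auto simp: chains_def indep_bound)
 have "0 \<in> chains F" for F by (auto simp: chains_def intro!: exI[of _ "[]"])
 then have ne: "chains F \<noteq> {}" for F by blast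
 interpret flats: engel_flats G R \<Delta> \<F> "\<lambda>F. Max (chains F)" "card (Mon D0)"
 proof (intro engel_flats.intro engel_flats_axioms.intro)
  show "group G" by (rule G.is_group)
  show "R \<lhd> G" by (rule R(1))
  show "\<Delta> \<subseteq> carrier G" by (rule Delta(1))
  show "conjg G g u \<in> \<Delta>" if "u \<in> \<Delta>" "g \<in> carrier G" for u g using Delta(2) that .
  show "\<exists>m. engel G m a u \<in> R" if "u \<in> \<Delta>" "a \<in> carrier G" for u a using engel that .
  show "F \<subseteq> \<Delta>" if "F \<in> \<F>" for F using that by (simp add: \<F>_def)
  show "F \<inter> F' \<in> \<F>" if "F \<in> \<F>" "F' \<in> \<F>" for F F'
  proof -
   have "cl D0 (H (F \<inter> F')) \<subseteq> cl D0 (H F)" "cl D0 (H (F \<inter> F')) \<subseteq> cl D0 (H F')"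
    using that by (intro cl_mono H_mono Hc; auto simp: \<F>_def)+
   then show ?thesis using that unfolding \<F>_def by blast
  qed
  show "conjg G g ` F \<in> \<F>" if F: "F \<in> \<F>" and g: "g \<in> carrier G" for F g
  proof -
   have FD: "F \<subseteq> \<Delta>" "\<Delta> \<inter> cl D0 (H F) \<subseteq> F" using F by (auto simp: \<F>_def)
   have "x \<in> conjg G g ` F" if x: "x \<in> \<Delta>" "x \<in> cl D0 (H (conjg G g ` F))" for x
   proof -
    have xc: "x \<in> carrier G" using x Delta(1) by blast
    have gF: "conjg G g ` F \<subseteq> \<Delta>" using FD Delta(2) g by blast
    have "conjg G (inv\<^bsub>G\<^esub> g) x \<in> cl D0 (H F)"
    proof (rule cl_morph[of x 1 D0])
     show "x \<in> cl (1 * D0) (H (conjg G g ` F))" using x by simp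
     show "morph 1 (conjg G (inv\<^bsub>G\<^esub> g))"
      using morph_mult[OF morph_mult[OF morph_const morph_id] morph_const, of g "inv\<^bsub>G\<^esub> g"] g
      by (simp add: conjg_def[abs_def])
     fix y assume y: "y \<in> H (conjg G g ` F)"
     have "conjg G (inv\<^bsub>G\<^esub> g) y \<in> generate G (F \<union> R)"
     proof (rule G.conjg_generate[OF _ _ _ _ y[unfolded H_def]])
      show "inv\<^bsub>G\<^esub> g \<in> carrier G" using g by simp
      show "conjg G g ` F \<union> R \<subseteq> carrier G" "F \<union> R \<subseteq> carrier G" using gF FD Delta(1) Rc by auto
      fix t assume t: "t \<in> conjg G g ` F \<union> R"
      then show "conjg G (inv\<^bsub>G\<^esub> g) t \<in> generate G (F \<union> R)"
      proof
       assume "t \<in> conjg G g ` F"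
       then obtain f where f: "f \<in> F" "t = conjg G g f" by blast
       then have "conjg G (inv\<^bsub>G\<^esub> g) t = f" using g FD(1) Delta(1) by auto
       then show ?thesis using f by (auto intro: generate.incl)
      next
       assume "t \<in> R"
       then have "conjg G (inv\<^bsub>G\<^esub> g) t \<in> R" using g by (intro G.normal_conjg[OF R(1)]) auto
       then show ?thesis by (auto intro: generate.incl)
      qed
     qed
     then show "conjg G (inv\<^bsub>G\<^esub> g) y \<in> cl D0 (H F)"
      using subset_cl[OF Hc[OF FD(1)]] by (auto simp: H_def)
    qed
    moreover have "conjg G (inv\<^bsub>G\<^esub> g) x \<in> \<Delta>" using Delta(2) x g by simp
    ultimately have "conjg G (inv\<^bsub>G\<^esub> g) x \<in> F" using FD by blast
    moreover have "x = conjg G g (conjg G (inv\<^bsub>G\<^esub> g) x)" using g xc by simp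
    ultimately show ?thesis by (rule rev_image_eqI)
   qed
   then show ?thesis using FD(1) Delta(2) g unfolding \<F>_def by blast
  qed
  show "\<Delta> \<inter> generate G (F \<union> R) \<subseteq> F" if "F \<in> \<F>" for F
   using that subset_cl[OF Hc, of F D0] unfolding \<F>_def H_def by blast
  show "Max (chains F) < Max (chains F')" if F: "F \<in> \<F>" "F' \<in> \<F>" "F \<subset> F'" for F F'
  proof -
   have FD: "F \<subseteq> \<Delta>" "\<Delta> \<inter> cl D0 (H F) \<subseteq> F" "F' \<subseteq> \<Delta>" using F by (auto simp: \<F>_def)
   obtain g where g: "g \<in> F'" "g \<notin> F" using F(3) by blast
   have "Max (chains F) \<in> chains F" using Max_in[OF fin ne] .
   then obtain gs where gs: "Max (chains F) = length gs" "indep D0 gs" "set gs \<subseteq> H F"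
    by (auto simp: chains_def)
   \<comment> \<open>An element of the larger flat outside the smaller one avoids the closure of
     \<open>H F\<close>, so it can be put in front of a longest independent list.\<close>
   have "g \<notin> cl D0 (H F)" using g FD by blast
   then have "g \<notin> cl D0 (set gs)" using cl_mono[OF gs(3) Hc[OF FD(1)]] by blast
   then have "indep D0 (g # gs)" using g FD(3) Delta(1) gs(2) by auto
   moreover have "set (g # gs) \<subseteq> H F'"
    using g gs(3) H_mono[of F F'] FD F(3) sub_H[of F'] by auto
   ultimately have "length (g # gs) \<in> chains F'" unfolding chains_def by blast
   then have "Suc (length gs) \<in> chains F'" by simp
   then show ?thesis using Max_ge[OF fin] gs(1) by fastforce
  qed
  show "Max (chains F) \<le> card (Mon D0)" if "F \<in> \<F>" for F
   using Max_in[OF fin ne, of F] by (auto simp: chains_def indep_bound)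
  show "\<exists>F \<in> \<F>. Y \<subseteq> F \<and> (\<exists>q. (derived G ^^ q) (generate G (F \<union> R)) \<subseteq> R)"
   if Y: "Y \<subseteq> \<Delta>" and q: "(derived G ^^ q) (generate G (Y \<union> R)) \<subseteq> R" for Y q
  proof (intro bexI[of _ "\<Delta> \<inter> cl D0 (H Y)"] conjI exI[of _ b])
   let ?F = "\<Delta> \<inter> cl D0 (H Y)"
   have CY: "subgroup (cl D0 (H Y)) G" by (rule cl_subgroup[OF Hs[OF Y]])
   have HC: "H Y \<subseteq> cl D0 (H Y)" by (rule subset_cl[OF Hc[OF Y]])
   have HF: "H ?F \<subseteq> cl D0 (H Y)"
    unfolding H_def[of ?F] using sub_H HC by (intro G.generate_subgroup_incl[OF _ CY]) blast
   show "Y \<subseteq> ?F" using Y sub_H HC by blast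
   show "?F \<in> \<F>" using cl_minimal[OF HF] by (auto simp: \<F>_def)
   \<comment> \<open>\<open>b\<close> derivations bring the degree from \<open>2 ^ b\<close> down to
     1, and closing in degree 1 adds nothing to the kernel.\<close>
   have "(derived G ^^ b) (H ?F) \<subseteq> (derived G ^^ b) (cl D0 (H Y))"
    by (rule G.exp_derived_mono[OF CY HF])
   also have "\<dots> \<subseteq> cl 1 ((derived G ^^ b) (H Y))"
    using cl_exp_derived[OF Hs[OF Y], of b 1] by (simp add: D0_def)
   also have "\<dots> \<subseteq> cl 1 Ker"
   proof (rule cl_minimal)
    have "Ker \<subseteq> cl 1 Ker" by (rule subset_cl) (auto simp: Ker_def)
    then show "(derived G ^^ b) (H Y) \<subseteq> cl 1 Ker"
     using solvable_bound[OF Y q[folded H_def]] by blast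
   qed
   also have "\<dots> \<subseteq> R" using cl_Ker R(2) by blast
   finally show "(derived G ^^ b) (generate G (?F \<union> R)) \<subseteq> R" by (simp add: H_def)
  qed
 qed
 show ?thesis
  using flats.engel_flats_solvable solvable_bound[of \<Delta>] unfolding H_def b_def by blast
qed

end

section \<open>Multilinear identities\<close>

text \<open>Scalars appear as central elements of the ring, so the base field drops out. One
  coefficient is normalized to 1 so that the identity can be violated wherever 1 is not
  zero.\<close>

locale multilinear_identity = ring R for R (structure) +
 fixes d :: nat and \<gamma> :: "nat list => 'a"
 assumes \<gamma>_closed: "\<gamma> js \<in> carrier R"
  and \<gamma>_central: "x \<in> carrier R ==> x \<otimes> \<gamma> js = \<gamma> js \<otimes> x"
  and \<gamma>_id: "\<gamma> [0..<d] = \<one>"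
  and identity: "y \<in> UNIV \<rightarrow> carrier R ==>
   (\<Oplus>js \<in> {js. distinct js \<and> set js = {..<d}}. \<gamma> js \<otimes> nc_monom_eval R y js) = \<zero>"

lemma finite_distinct_lists: "finite {js. distinct js \<and> set js = (A :: 'b set)}"
proof (cases "finite A")
 case True
 have "{js. distinct js \<and> set js = A} \<subseteq> {js. set js \<subseteq> A \<and> length js = card A}"
  using distinct_card by fastforce
 then show ?thesis using finite_lists_length_eq[OF True] finite_subset by blast
next
 case False
 then have "{js. distinct js \<and> set js = A} = {}" by auto
 then show ?thesis by (simp only: finite.emptyI)
qed

context ring
begin

lemma nc_monom_eval_Nil [simp]: "nc_monom_eval R y [] = \<one>"
 by (simp add: nc_monom_eval_def)

lemma nc_monom_eval_Cons [simp]: "nc_monom_eval R y (j # js) = y j \<otimes> nc_monom_eval R y js"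
 by (simp add: nc_monom_eval_def)

lemma nc_monom_eval_closed: "(\<And>j. j \<in> set js ==> y j \<in> carrier R) ==> nc_monom_eval R y js \<in> carrier R"
 by (induction js) auto

lemma nc_monom_eval_append:
 "(\<And>j. j \<in> set (js @ ks) ==> y j \<in> carrier R) ==>
  nc_monom_eval R y (js @ ks) = nc_monom_eval R y js \<otimes> nc_monom_eval R y ks"
 by (induction js) (auto simp: m_assoc nc_monom_eval_closed)

lemma nc_monom_eval_cong:
 "(\<And>j. j \<in> set js ==> y j = z j) ==> nc_monom_eval R y js = nc_monom_eval R z js"
 by (induction js) auto

text \<open>Expansion of a product of sums: \<open>c\<close> colours the variables in
  \<open>U\<close>, and a word \<open>w\<close> of colours collects the words in \<open>U\<close>
  that are coloured like it.\<close>

lemma nc_monom_eval_sum: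
 assumes U: "finite U" and y: "\<And>j. j \<in> U ==> y j \<in> carrier R"
 shows "nc_monom_eval R (\<lambda>i. \<Oplus>j \<in> {j \<in> U. c j = i}. y j) w =
  (\<Oplus>js \<in> {js. set js \<subseteq> U \<and> map c js = w}. nc_monom_eval R y js)"
proof (induction w)
 case Nil
 have "{js. set js \<subseteq> U \<and> map c js = []} = {[]}" by auto
 then show ?case by simp
next
 case (Cons i w)
 let ?F = "{js. set js \<subseteq> U \<and> map c js = w}" and ?I = "{j \<in> U. c j = i}"
 have finF: "finite ?F"
 proof (rule finite_subset)
  show "?F \<subseteq> {js. set js \<subseteq> U \<and> length js = length w}" by auto
  show "finite {js. set js \<subseteq> U \<and> length js = length w}" by (rule finite_lists_length_eq[OF U])
 qed
 have mc: "nc_monom_eval R y js \<in> carrier R" if "js \<in> ?F" for js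
  using that y by (intro nc_monom_eval_closed) auto
 have sc: "(\<Oplus>js \<in> ?F. nc_monom_eval R y js) \<in> carrier R" using mc by (intro finsum_closed) auto
 have "{js. set js \<subseteq> U \<and> map c js = i # w} = (\<Union>j \<in> ?I. (#) j ` ?F)"
  by (auto simp: map_eq_Cons_conv)
 then have "(\<Oplus>js \<in> {js. set js \<subseteq> U \<and> map c js = i # w}. nc_monom_eval R y js)
   = (\<Oplus>j \<in> ?I. \<Oplus>js \<in> (#) j ` ?F. nc_monom_eval R y js)"
  using U finF y mc
  by (simp only:, intro add.finprod_UN_disjoint) (auto simp: pairwise_def disjnt_def)
 also have "\<dots> = (\<Oplus>j \<in> ?I. y j \<otimes> (\<Oplus>js \<in> ?F. nc_monom_eval R y js))"
 proof (intro add.finprod_cong' refl)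
  fix j assume j: "j \<in> ?I"
  have "(\<Oplus>js \<in> (#) j ` ?F. nc_monom_eval R y js) = (\<Oplus>js \<in> ?F. y j \<otimes> nc_monom_eval R y js)"
   using y j mc by (subst add.finprod_reindex) (auto simp: inj_on_def)
  also have "\<dots> = y j \<otimes> (\<Oplus>js \<in> ?F. nc_monom_eval R y js)"
   using y j mc finF by (intro finsum_rdistr[symmetric]) auto
  finally show "(\<Oplus>js \<in> (#) j ` ?F. nc_monom_eval R y js) = y j \<otimes> (\<Oplus>js \<in> ?F. nc_monom_eval R y js)" .
 qed (use y sc in auto)
 also have "\<dots> = (\<Oplus>j \<in> ?I. y j) \<otimes> (\<Oplus>js \<in> ?F. nc_monom_eval R y js)"
  using U y sc by (intro finsum_ldistr[symmetric]) auto
 finally show ?case using Cons.IH by simp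
qed

end

text \<open>Full linearisation: the letters of a word \<open>w0\<close> of maximal length in the support of the
 identity are replaced by sums of new variables, and inclusion-exclusion over subsets of the new
 variables isolates the terms in which each of them occurs.\<close>

lemma PI_algebra_multilinear:
 assumes "PI_algebra P A"
 shows "\<exists>d \<gamma>. multilinear_identity A d \<gamma>"
proof -
 have alg: "assoc_algebra P A" using assms by (simp add: PI_algebra_def)
 interpret A: ring A using alg by (simp add: assoc_algebra_def)
 interpret P: field P using alg by (simp add: assoc_algebra_def)
 interpret assoc_algebra P A by (rule alg)
 obtain f where f: "nc_poly P f" "\<exists>w. f w \<noteq> \<zero>\<^bsub>P\<^esub>"
  and id: "\<And>s. s \<in> UNIV \<rightarrow> carrier A ==> nc_poly_eval P A f s = \<zero>\<^bsub>A\<^esub>"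
  using assms by (auto simp: PI_algebra_def)
 define supp where "supp = {w. f w \<noteq> \<zero>\<^bsub>P\<^esub>}"
 have supp: "finite supp" "supp \<noteq> {}" using f by (auto simp: nc_poly_def supp_def)
 have fc: "f w \<in> carrier P" for w using f by (simp add: nc_poly_def)
 obtain w0 where w0: "w0 \<in> supp" "\<And>w. w \<in> supp ==> length w \<le> length w0"
 proof -
  have "Max (length ` supp) \<in> length ` supp" using supp by (intro Max_in) auto
  then obtain w0 where "w0 \<in> supp" "length w0 = Max (length ` supp)" by auto
  then show ?thesis using that supp by simp
 qed
 define D where "D = length w0"
 let ?m = "nc_monom_eval A"
 let ?word = "map ((!) w0)"
 \<comment> \<open>Words over the new variables \<open>U\<close> in which all of \<open>T\<close>
   occur. A new variable is a position in \<open>w0\<close>, and \<open>?word\<close> turns it back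
   into the letter at that position.\<close>
 define Js where "Js T U = {js. length js \<le> D \<and> T \<subseteq> set js \<and> set js \<subseteq> U}" for T U :: "nat set"
 have finJs: "finite (Js T U)" if "finite U" for T and U :: "nat set"
  using finite_lists_length_le[OF that, of D] by (rule finite_subset[rotated]) (auto simp: Js_def)
 have sum_zero: "(\<Oplus>\<^bsub>A\<^esub>js \<in> Js T U. f (?word js) \<odot>\<^bsub>A\<^esub> ?m y js) = \<zero>\<^bsub>A\<^esub>"
  if y: "y \<in> UNIV \<rightarrow> carrier A" and "finite T" "T \<subseteq> U" "U \<subseteq> {..<D}" for y T U
  using that(2-)
 proof (induction T arbitrary: U rule: finite_induct)
  case empty
  have U: "finite U" using empty finite_subset by blast
  \<comment> \<open>Letters for which no variable of \<open>U\<close> stands receive the empty sum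
    0.\<close>
  define s where "s i = (\<Oplus>\<^bsub>A\<^esub>j \<in> {j \<in> U. w0 ! j = i}. y j)" for i
  have yc: "y j \<in> carrier A" for j using y by auto
  have mc: "?m y js \<in> carrier A" for js using yc by (intro A.nc_monom_eval_closed)
  have sc: "s i \<in> carrier A" for i unfolding s_def using yc by (intro A.finsum_closed) auto
  let ?F = "\<lambda>w. {js. set js \<subseteq> U \<and> ?word js = w}"
  have finF: "finite (?F w)" for w
  proof (rule finite_subset)
   show "?F w \<subseteq> {js. set js \<subseteq> U \<and> length js = length w}" by auto
   show "finite {js. set js \<subseteq> U \<and> length js = length w}" by (rule finite_lists_length_eq[OF U])
  qed
  have "\<zero>\<^bsub>A\<^esub> = (\<Oplus>\<^bsub>A\<^esub>w \<in> supp. f w \<odot>\<^bsub>A\<^esub> ?m s w)"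
   using id[of s] sc by (auto simp: nc_poly_eval_def supp_def)
  also have "\<dots> = (\<Oplus>\<^bsub>A\<^esub>w \<in> supp. \<Oplus>\<^bsub>A\<^esub>js \<in> ?F w. f (?word js) \<odot>\<^bsub>A\<^esub> ?m y js)"
  proof (intro A.add.finprod_cong' refl)
   fix w assume "w \<in> supp"
   have "?m s w = (\<Oplus>\<^bsub>A\<^esub>js \<in> ?F w. ?m y js)"
    unfolding s_def using U yc by (intro A.nc_monom_eval_sum) auto
   then have "f w \<odot>\<^bsub>A\<^esub> ?m s w = (\<Oplus>\<^bsub>A\<^esub>js \<in> ?F w. f w \<odot>\<^bsub>A\<^esub> ?m y js)"
   proof -
    have "f w \<odot>\<^bsub>A\<^esub> (\<Oplus>\<^bsub>A\<^esub>js \<in> J. ?m y js) = (\<Oplus>\<^bsub>A\<^esub>js \<in> J. f w \<odot>\<^bsub>A\<^esub> ?m y js)" if "finite J" for J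
     using that
    proof (induction J rule: finite_induct)
     case (insert x J)
     then show ?case using mc fc by (simp add: A.finsum_insert smult_r_distr)
    qed (simp add: fc)
    then show ?thesis using finF `?m s w = _` by simp
   qed
   also have "\<dots> = (\<Oplus>\<^bsub>A\<^esub>js \<in> ?F w. f (?word js) \<odot>\<^bsub>A\<^esub> ?m y js)"
    using mc fc by (intro A.add.finprod_cong') auto
   finally show "f w \<odot>\<^bsub>A\<^esub> ?m s w = (\<Oplus>\<^bsub>A\<^esub>js \<in> ?F w. f (?word js) \<odot>\<^bsub>A\<^esub> ?m y js)" .
  qed (use mc fc in \<open>auto intro!: A.finsum_closed\<close>)
  also have "\<dots> = (\<Oplus>\<^bsub>A\<^esub>js \<in> (\<Union>w \<in> supp. ?F w). f (?word js) \<odot>\<^bsub>A\<^esub> ?m y js)"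
   using supp finF mc fc
   by (intro A.add.finprod_UN_disjoint[symmetric]) (auto simp: pairwise_def disjnt_def)
  also have "\<dots> = (\<Oplus>\<^bsub>A\<^esub>js \<in> Js {} U. f (?word js) \<odot>\<^bsub>A\<^esub> ?m y js)"
  proof (rule A.add.finprod_mono_neutral_cong_left)
   show "finite (Js {} U)" by (rule finJs[OF U])
   show "(\<Union>w \<in> supp. ?F w) \<subseteq> Js {} U"
    using w0(2) by (auto simp: Js_def D_def) (metis length_map)
   show "f (?word js) \<odot>\<^bsub>A\<^esub> ?m y js = \<zero>\<^bsub>A\<^esub>" if "js \<in> Js {} U - (\<Union>w \<in> supp. ?F w)" for js
    using that mc by (auto simp: Js_def supp_def)
  qed (use mc fc in auto)
  finally show ?case by simp
 next
  case (insert j T)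
  have U: "finite U" using insert finite_subset by blast
  have yc: "y j \<in> carrier A" for j using y by auto
  have tc: "f (?word js) \<odot>\<^bsub>A\<^esub> ?m y js \<in> carrier A" for js
   using yc fc by (intro smult_closed A.nc_monom_eval_closed)
  \<comment> \<open>Inclusion-exclusion one variable at a time: the words containing
    \<open>j\<close> are all words over \<open>U\<close> without those over \<open>U - {j}\<close>,
    and the sums over both vanish by induction.\<close>
  have split: "Js T U = Js (insert j T) U \<union> Js T (U - {j})"
   using insert.prems by (auto simp: Js_def)
  have "(\<Oplus>\<^bsub>A\<^esub>js \<in> Js T U. f (?word js) \<odot>\<^bsub>A\<^esub> ?m y js) =
    (\<Oplus>\<^bsub>A\<^esub>js \<in> Js (insert j T) U. f (?word js) \<odot>\<^bsub>A\<^esub> ?m y js)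
    \<oplus>\<^bsub>A\<^esub> (\<Oplus>\<^bsub>A\<^esub>js \<in> Js T (U - {j}). f (?word js) \<odot>\<^bsub>A\<^esub> ?m y js)"
   unfolding split
  proof (rule A.finsum_Un_disjoint)
   show "finite (Js (insert j T) U)" "finite (Js T (U - {j}))" using finJs U by blast+
  qed (use tc in \<open>auto simp: Js_def\<close>)
  moreover have "(\<Oplus>\<^bsub>A\<^esub>js \<in> Js T U. f (?word js) \<odot>\<^bsub>A\<^esub> ?m y js) = \<zero>\<^bsub>A\<^esub>"
   using insert by auto
  moreover have "(\<Oplus>\<^bsub>A\<^esub>js \<in> Js T (U - {j}). f (?word js) \<odot>\<^bsub>A\<^esub> ?m y js) = \<zero>\<^bsub>A\<^esub>"
   using insert by (intro insert.IH) auto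
  moreover have "(\<Oplus>\<^bsub>A\<^esub>js \<in> Js (insert j T) U. f (?word js) \<odot>\<^bsub>A\<^esub> ?m y js) \<in> carrier A"
   using tc by (intro A.finsum_closed) auto
  ultimately show ?case by simp
 qed
 \<comment> \<open>At most \<open>D\<close> letters in which all \<open>D\<close> variables occur:
   each occurs exactly once. This is what the maximal length of \<open>w0\<close> is for.\<close>
 have Js_perm: "Js {..<D} {..<D} = {js. distinct js \<and> set js = {..<D}}"
 proof -
  have "distinct js \<longleftrightarrow> length js \<le> D" if "set js = {..<D}" for js
   using that card_distinct[of js] distinct_card[of js] card_length[of js] by auto
  then show ?thesis by (auto simp: Js_def)
 qed
 have f0: "f w0 \<in> carrier P" "f w0 \<noteq> \<zero>\<^bsub>P\<^esub>" using fc w0(1) by (auto simp: supp_def)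
 define p where "p = inv\<^bsub>P\<^esub> (f w0)"
 have p: "p \<in> carrier P" "p \<otimes>\<^bsub>P\<^esub> f w0 = \<one>\<^bsub>P\<^esub>" using f0 P.field_Units by (auto simp: p_def)
 define \<gamma> where "\<gamma> js = (p \<otimes>\<^bsub>P\<^esub> f (?word js)) \<odot>\<^bsub>A\<^esub> \<one>\<^bsub>A\<^esub>" for js
 have pf: "p \<otimes>\<^bsub>P\<^esub> f w \<in> carrier P" for w using p fc by simp
 have "multilinear_identity A D \<gamma>"
 proof unfold_locales
  show "\<gamma> js \<in> carrier A" for js using pf by (simp add: \<gamma>_def)
  show "x \<otimes>\<^bsub>A\<^esub> \<gamma> js = \<gamma> js \<otimes>\<^bsub>A\<^esub> x" if "x \<in> carrier A" for x js
   using that pf by (simp add: \<gamma>_def smult_assoc_left smult_assoc_right)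
  show "\<gamma> [0..<D] = \<one>\<^bsub>A\<^esub>" using p by (simp add: \<gamma>_def D_def map_nth)
  fix y :: "nat => 'c" assume y: "y \<in> UNIV \<rightarrow> carrier A"
  have yc: "y j \<in> carrier A" for j using y by auto
  have mc: "?m y js \<in> carrier A" for js using yc by (intro A.nc_monom_eval_closed)
  have "(\<Oplus>\<^bsub>A\<^esub>js \<in> {js. distinct js \<and> set js = {..<D}}. \<gamma> js \<otimes>\<^bsub>A\<^esub> ?m y js)
    = (\<Oplus>\<^bsub>A\<^esub>js \<in> {js. distinct js \<and> set js = {..<D}}. (p \<odot>\<^bsub>A\<^esub> \<one>\<^bsub>A\<^esub>) \<otimes>\<^bsub>A\<^esub> (f (?word js) \<odot>\<^bsub>A\<^esub> ?m y js))"
   using mc fc p pf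
   by (intro A.add.finprod_cong') (auto simp: \<gamma>_def smult_assoc_left smult_assoc1)
  also have "\<dots> = (p \<odot>\<^bsub>A\<^esub> \<one>\<^bsub>A\<^esub>) \<otimes>\<^bsub>A\<^esub> (\<Oplus>\<^bsub>A\<^esub>js \<in> Js {..<D} {..<D}. f (?word js) \<odot>\<^bsub>A\<^esub> ?m y js)"
   using mc fc p finite_distinct_lists unfolding Js_perm
   by (intro A.finsum_rdistr[symmetric]) auto
  also have "\<dots> = \<zero>\<^bsub>A\<^esub>" using sum_zero[OF y, of "{..<D}" "{..<D}"] p by simp
  finally show "(\<Oplus>\<^bsub>A\<^esub>js \<in> {js. distinct js \<and> set js = {..<D}}. \<gamma> js \<otimes>\<^bsub>A\<^esub> ?m y js) = \<zero>\<^bsub>A\<^esub>" .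
 qed
 then show ?thesis by blast
qed

section \<open>The Levitzki radical\<close>

context ring
begin

definition loc_nil :: "'a set => bool"
 where "loc_nil J \<longleftrightarrow> (\<forall>S. finite S \<and> S \<subseteq> J --> (\<exists>m. \<forall>ws. set ws \<subseteq> S \<and> length ws = m -->
  foldr (\<otimes>) ws \<one> = \<zero>))"

lemma foldr_closed: "set ws \<subseteq> carrier R ==> foldr (\<otimes>) ws \<one> \<in> carrier R"
 by (induction ws) auto

lemma loc_nil_zero: "loc_nil {\<zero>}"
proof -
 have "foldr (\<otimes>) ws \<one> = \<zero>" if "set ws \<subseteq> {\<zero>}" "length ws = 1" for ws
  using that by (cases ws) auto
 then show ?thesis unfolding loc_nil_def by (intro allI impI exI[of _ 1]) blast
qed

text \<open>Consecutive factors of a long product are multiplied in pairs, and the pairs come from a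
  finite subset of \<open>L\<close>.\<close>

lemma loc_nil_square:
 assumes L: "loc_nil L" and J: "J \<subseteq> carrier R" "\<And>x y. x \<in> J ==> y \<in> J ==> x \<otimes> y \<in> L"
 shows "loc_nil J"
 unfolding loc_nil_def
proof (intro allI impI)
 fix S assume S: "finite S \<and> S \<subseteq> J"
 define T where "T = (\<lambda>(x, y). x \<otimes> y) ` (S \<times> S)"
 have "finite T \<and> T \<subseteq> L" using S J(2) by (auto simp: T_def)
 from L[unfolded loc_nil_def, rule_format, OF this]
 obtain m where m: "\<And>ws. set ws \<subseteq> T ==> length ws = m ==> foldr (\<otimes>) ws \<one> = \<zero>"
  by blast
 have pair: "\<exists>vs. set vs \<subseteq> T \<and> length vs = k \<and> foldr (\<otimes>) ws \<one> = foldr (\<otimes>) vs \<one>"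
  if "set ws \<subseteq> S" "length ws = 2 * k" for ws k
  using that
 proof (induction k arbitrary: ws)
  case (Suc k)
  then obtain x y us where ws: "ws = x # y # us" by (cases ws; cases "tl ws") auto
  then obtain vs where vs: "set vs \<subseteq> T" "length vs = k" "foldr (\<otimes>) us \<one> = foldr (\<otimes>) vs \<one>"
   using Suc by auto
  have "x \<in> carrier R" "y \<in> carrier R" "set us \<subseteq> carrier R" using Suc.prems ws S J(1) by auto
  then have "foldr (\<otimes>) ws \<one> = foldr (\<otimes>) ((x \<otimes> y) # vs) \<one>"
   using vs(3) foldr_closed[of us] by (simp add: ws m_assoc)
  moreover have "x \<otimes> y \<in> T" using Suc.prems ws by (auto simp: T_def)
  ultimately show ?case using vs by (intro exI[of _ "(x \<otimes> y) # vs"]) auto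
 qed auto
 show "\<exists>m. \<forall>ws. set ws \<subseteq> S \<and> length ws = m --> foldr (\<otimes>) ws \<one> = \<zero>"
  using pair[of _ m] m by (intro exI[of _ "2 * m"]) metis
qed

lemma ex_maximal_loc_nil:
 obtains L where "ideal L R" "loc_nil L" "\<And>J. ideal J R ==> loc_nil J ==> L \<subseteq> J ==> J = L"
proof -
 let ?P = "{J. ideal J R \<and> loc_nil J}"
 have "\<exists>M \<in> ?P. \<forall>J \<in> ?P. M \<subseteq> J --> J = M"
 proof (rule subset_Zorn_nonempty)
  show "?P \<noteq> {}" using zeroideal loc_nil_zero by blast
  fix C assume C: "C \<noteq> {}" "subset.chain ?P C"
  have "subset.chain {J. ideal J R} C" using C(2) unfolding pred_on.chain_def by blast
  then have "ideal (\<Union>C) R" using chain_Union_is_ideal[of C] C(1) by simp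
  moreover have "loc_nil (\<Union>C)"
   unfolding loc_nil_def
  proof (intro allI impI)
   fix S assume S: "finite S \<and> S \<subseteq> \<Union>C"
   then obtain J where "J \<in> C" "S \<subseteq> J"
    using finite_subset_Union_chain[of S C ?P] C by blast
   then show "\<exists>m. \<forall>ws. set ws \<subseteq> S \<and> length ws = m --> foldr (\<otimes>) ws \<one> = \<zero>"
    using C(2) S unfolding pred_on.chain_def loc_nil_def by blast
  qed
  ultimately show "\<Union>C \<in> ?P" by blast
 qed
 then show ?thesis using that by blast
qed

definition left_ideal :: "'a set => bool"
 where "left_ideal I \<longleftrightarrow> I \<subseteq> carrier R \<and> \<zero> \<in> I \<and> (\<forall>x \<in> I. \<forall>y \<in> I. x \<oplus> y \<in> I) \<and>
  (\<forall>a \<in> carrier R. \<forall>x \<in> I. a \<otimes> x \<in> I)"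

lemma idealI':
 assumes "I \<subseteq> carrier R" "\<zero> \<in> I" "\<And>x y. x \<in> I ==> y \<in> I ==> x \<oplus> y \<in> I"
  "\<And>a x. a \<in> carrier R ==> x \<in> I ==> a \<otimes> x \<in> I" "\<And>a x. a \<in> carrier R ==> x \<in> I ==> x \<otimes> a \<in> I"
 shows "ideal I R"
proof (rule idealI[OF ring_axioms])
 show "subgroup I (add_monoid R)"
 proof (rule add.subgroupI)
  show "I \<subseteq> carrier R" "I \<noteq> {}" using assms by auto
  fix a assume a: "a \<in> I"
  have "\<ominus> a = (\<ominus> \<one>) \<otimes> a" using a assms(1) by (simp add: l_minus subset_iff)
  then show "\<ominus> a \<in> I" using assms(4)[of "\<ominus> \<one>" a] a by simp
  show "a \<oplus> b \<in> I" if "b \<in> I" for b using a that assms(3) by blast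
 qed
qed (use assms in auto)

text \<open>The maximality of \<open>L\<close> speaks of two-sided ideals. \<open>Q\<close> is the
  left annihilator of \<open>I\<close> modulo \<open>L\<close>, two-sided because \<open>I\<close>
  is a left ideal, and \<open>J\<close> is the part of \<open>Q\<close> that \<open>Q\<close>
  annihilates from the left. \<open>J\<close> contains \<open>I\<close> and has its square in
  \<open>L\<close>.\<close>

lemma semiprime_left_ideal:
 assumes L: "ideal L R" "loc_nil L" and max: "\<And>J. ideal J R ==> loc_nil J ==> L \<subseteq> J ==> J = L"
  and I: "left_ideal I" "\<And>x y. x \<in> I ==> y \<in> I ==> x \<otimes> y \<in> L"
 shows "I \<subseteq> L"
proof -
 interpret L: ideal L R by (rule L(1))
 have Lc: "x \<in> carrier R" if "x \<in> L" for x using that L.Icarr by blast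
 have Ic: "x \<in> carrier R" if "x \<in> I" for x using that I by (auto simp: left_ideal_def)
 define Q where "Q = {x \<in> carrier R. \<forall>y \<in> I. x \<otimes> y \<in> L}"
 define J where "J = {x \<in> Q. \<forall>z \<in> Q. z \<otimes> x \<in> L}"
 have Q_mult: "a \<otimes> x \<in> Q" "x \<otimes> a \<in> Q" if "a \<in> carrier R" "x \<in> Q" for a x
 proof -
  have "x \<otimes> a \<otimes> y \<in> L" if "y \<in> I" for y
   using `x \<in> Q` `a \<in> carrier R` that I(1) Ic by (auto simp: Q_def left_ideal_def m_assoc)
  then show "x \<otimes> a \<in> Q" using that by (auto simp: Q_def)
  show "a \<otimes> x \<in> Q" using that Ic L.I_l_closed by (auto simp: Q_def m_assoc)
 qed
 have IQ: "I \<subseteq> Q" using Ic I(2) by (auto simp: Q_def)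
 have LQ: "L \<subseteq> Q" using Lc Ic L.I_r_closed by (auto simp: Q_def)
 have "ideal J R"
 proof (rule idealI')
  show "J \<subseteq> carrier R" by (auto simp: J_def Q_def)
  show "\<zero> \<in> J" using Ic by (auto simp: J_def Q_def)
  show "x \<oplus> y \<in> J" if "x \<in> J" "y \<in> J" for x y
   using that Ic by (auto simp: J_def Q_def l_distr r_distr)
  show "a \<otimes> x \<in> J" if "a \<in> carrier R" "x \<in> J" for a x
  proof -
   have "z \<otimes> (a \<otimes> x) \<in> L" if z: "z \<in> Q" for z
   proof -
    have "(z \<otimes> a) \<otimes> x \<in> L" using Q_mult(2)[OF `a \<in> carrier R` z] `x \<in> J` by (auto simp: J_def)
    then show ?thesis using z that `a \<in> carrier R` `x \<in> J` by (simp add: J_def Q_def m_assoc)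
   qed
   then show ?thesis using that Q_mult by (auto simp: J_def)
  qed
  show "x \<otimes> a \<in> J" if "a \<in> carrier R" "x \<in> J" for a x
  proof -
   have "z \<otimes> (x \<otimes> a) \<in> L" if z: "z \<in> Q" for z
   proof -
    have "(z \<otimes> x) \<otimes> a \<in> L" using `a \<in> carrier R` z `x \<in> J` L.I_r_closed by (auto simp: J_def)
    then show ?thesis using z that `a \<in> carrier R` `x \<in> J` by (simp add: J_def Q_def m_assoc)
   qed
   then show ?thesis using that Q_mult by (auto simp: J_def)
  qed
 qed
 moreover have "loc_nil J"
  by (rule loc_nil_square[OF L(2)]) (auto simp: J_def Q_def)
 moreover have "L \<subseteq> J" using LQ L.I_l_closed by (auto simp: J_def Q_def)
 ultimately have "J = L" by (rule max)
 moreover have "I \<subseteq> J" using IQ by (auto simp: J_def Q_def)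
 ultimately show ?thesis by blast
qed

end

section \<open>Nil left ideals in rings with a multilinear identity\<close>

context multilinear_identity
begin

text \<open>The part of the identity whose words begin with 0, ..., k - 1 in this order, with that
  beginning removed: the whole identity for \<open>k = 0\<close>, and 1 for
  \<open>k = d\<close>.\<close>

definition tail_identity :: "nat => (nat => 'a) => 'a"
 where "tail_identity k y = (\<Oplus>js \<in> {js. distinct js \<and> set js = {k..<d}}.
  \<gamma> ([0..<k] @ js) \<otimes> nc_monom_eval R y js)"

text \<open>Peeling off the first variable: for \<open>b\<close> with \<open>I \<otimes> b \<otimes> b \<subseteq> L\<close> all terms in which \<open>b\<close> is not the
 leading factor vanish modulo \<open>L\<close> when the other variables range over \<open>I \<otimes> b\<close>.\<close>

lemma nil_left_ideal_tail:
 assumes L: "ideal L R" and semiprime: "\<And>I. left_ideal I ==>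
   (\<And>x y. x \<in> I ==> y \<in> I ==> x \<otimes> y \<in> L) ==> I \<subseteq> L"
  and "k \<le> d" and I: "left_ideal I" and nil: "\<And>x. x \<in> I ==> \<exists>n::nat. x [^] n \<in> L"
  and tail: "\<And>x y. x \<in> I ==> y \<in> UNIV \<rightarrow> I ==> x \<otimes> tail_identity k y \<in> L"
 shows "I \<subseteq> L"
 using `k \<le> d` I nil tail
proof (induction k arbitrary: I rule: inc_induct)
 case base
 have "{js. distinct js \<and> set js = {d..<d}} = {[]}" by auto
 then have "tail_identity d y = \<one>" for y
  using \<gamma>_closed by (simp add: tail_identity_def \<gamma>_id)
 moreover have "(\<lambda>_. \<zero>) \<in> UNIV \<rightarrow> I" using base(1) by (auto simp: left_ideal_def)
 ultimately have "x \<otimes> \<one> \<in> L" if "x \<in> I" for x using base(3)[OF that] by metis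
 moreover have "x \<in> carrier R" if "x \<in> I" for x using that base(1) by (auto simp: left_ideal_def)
 ultimately show ?case by fastforce
next
 case (step k)
 interpret L: ideal L R by (rule L)
 note I = step.prems(1)
 have Ic: "x \<in> carrier R" if "x \<in> I" for x using that I by (auto simp: left_ideal_def)
 have Il: "a \<otimes> x \<in> I" if "a \<in> carrier R" "x \<in> I" for a x using that I by (auto simp: left_ideal_def)
 show ?case
 proof (rule ccontr)
  assume notL: "\<not> I \<subseteq> L"
  \<comment> \<open>The elements that \<open>I\<close> annihilates from the left modulo
    \<open>L\<close>. The powers of \<open>x\<close> end up in \<open>T\<close>; \<open>b\<close> is
    a power outside \<open>T\<close> whose successor is inside, so \<open>I\<close> annihilates b b
    but not b.\<close>
  define T where "T = {x \<in> I. \<forall>y \<in> I. y \<otimes> x \<in> L}"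
  obtain x where x: "x \<in> I" "x \<notin> T" using semiprime[OF I] notL by (auto simp: T_def)
  have xc: "x \<in> carrier R" using x Ic by blast
  have pow_I: "x [^] n \<in> I" if "n > 0" for n :: nat
   using that x xc Il by (cases n) (auto simp: nat_pow_Suc)
  obtain n0 :: nat where "x [^] n0 \<in> L" using step.prems(2) x by blast
  then have n0: "x [^] Suc n0 \<in> T"
   using xc pow_I[of "Suc n0"] Ic L.I_l_closed L.I_r_closed by (auto simp: T_def)
  have "\<exists>l. x [^] Suc l \<notin> T \<and> x [^] Suc (Suc l) \<in> T"
  proof (rule ccontr)
   assume *: "\<nexists>l. x [^] Suc l \<notin> T \<and> x [^] Suc (Suc l) \<in> T"
   have "x [^] Suc j \<notin> T" for j
   proof (induction j)
    case 0
    then show ?case using x xc by simp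
   next
    case (Suc j)
    then show ?case using * by blast
   qed
   then show False using n0 by blast
  qed
  then obtain l where l: "x [^] Suc l \<notin> T" "x [^] Suc (Suc l) \<in> T" by blast
  define b where "b = x [^] Suc l"
  have bI: "b \<in> I" "b \<in> carrier R" "b \<notin> T"
   unfolding b_def using pow_I[of "Suc l"] l(1) xc by blast+
  have bb: "y \<otimes> (b \<otimes> b) \<in> L" if "y \<in> I" for y
  proof -
   have "b \<otimes> b = x [^] Suc (Suc l) \<otimes> x [^] l"
    unfolding b_def nat_pow_mult[OF xc] by (rule arg_cong[of _ _ "\<lambda>n. x [^] n"]) simp
   moreover have "y \<otimes> x [^] Suc (Suc l) \<in> L" using l that unfolding T_def by blast
   ultimately show ?thesis
    using m_assoc[OF Ic[OF that] nat_pow_closed[OF xc] nat_pow_closed[OF xc]]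
     L.I_r_closed nat_pow_closed[OF xc] by metis
  qed
  obtain y0 where y0: "y0 \<in> I" "y0 \<otimes> b \<notin> L" using bI by (auto simp: T_def)
  have y0c: "y0 \<in> carrier R" using y0 Ic by blast
  define c where "c = y0 \<otimes> b"
  have cI: "c \<in> I" "c \<in> carrier R" using Il bI y0c by (auto simp: c_def)
  define I' where "I' = (\<lambda>a. a \<otimes> c) ` carrier R"
  have I': "left_ideal I'"
   unfolding left_ideal_def
  proof (intro conjI ballI)
   show "I' \<subseteq> carrier R" using cI by (auto simp: I'_def)
   show "\<zero> \<in> I'" using cI by (auto simp: I'_def intro!: image_eqI[of _ _ \<zero>])
   show "u \<oplus> v \<in> I'" if uv: "u \<in> I'" "v \<in> I'" for u v
   proof -
    obtain a a' where "a \<in> carrier R" "u = a \<otimes> c" "a' \<in> carrier R" "v = a' \<otimes> c"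
     using uv by (auto simp: I'_def)
    then show ?thesis using cI by (auto simp: I'_def l_distr intro!: image_eqI[of _ _ "a \<oplus> a'"])
   qed
   show "a \<otimes> u \<in> I'" if au: "a \<in> carrier R" "u \<in> I'" for a u
   proof -
    obtain a' where "a' \<in> carrier R" "u = a' \<otimes> c" using au by (auto simp: I'_def)
    then show ?thesis using cI au by (auto simp: I'_def m_assoc intro!: image_eqI[of _ _ "a \<otimes> a'"])
   qed
  qed
  have I'I: "I' \<subseteq> I" using Il cI by (auto simp: I'_def)
  have "I' \<subseteq> L"
  proof (rule step.IH[OF I'])
   show "\<exists>n::nat. x [^] n \<in> L" if "x \<in> I'" for x using that I'I step.prems(2) by blast
   fix x' and y :: "nat => 'a" assume x': "x' \<in> I'" and y: "y \<in> UNIV \<rightarrow> I'"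
   have "\<exists>r. r \<in> I \<and> y j = r \<otimes> b" for j
   proof -
    obtain a where "a \<in> carrier R" "y j = a \<otimes> c" using y by (auto simp: I'_def)
    then show ?thesis using y0c bI Il[of a y0] y0 by (intro exI[of _ "a \<otimes> y0"]) (simp add: c_def m_assoc)
   qed
   then obtain r where r: "\<And>j. r j \<in> I" "\<And>j. y j = r j \<otimes> b" by metis
   have yc: "y j \<in> carrier R" "y j \<in> I" for j using y I'I Ic by auto
   \<comment> \<open>\<open>b\<close> is substituted for the variable \<open>k\<close>, while all
     other values end in the factor \<open>b\<close>.\<close>
   define z where "z = y(k := b)"
   have zc: "z j \<in> carrier R" "z j \<in> I" for j using yc bI by (auto simp: z_def)
   let ?Ps = "\<lambda>k. {js. distinct js \<and> set js = {k..<d}}"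
   let ?t = "\<lambda>js. \<gamma> ([0..<k] @ js) \<otimes> nc_monom_eval R z js"
   have tc: "?t js \<in> carrier R" for js using \<gamma>_closed zc by (simp add: nc_monom_eval_closed)
   let ?P1 = "(#) k ` ?Ps (Suc k)"
   have P1: "?P1 \<subseteq> ?Ps k" using step.hyps by auto
   have fin: "finite (?Ps j)" for j by (rule finite_distinct_lists)
   have "tail_identity k z = (\<Oplus>js \<in> ?P1 \<union> (?Ps k - ?P1). ?t js)"
    using P1 by (simp add: tail_identity_def Un_absorb1)
   also have "\<dots> = (\<Oplus>js \<in> ?P1. ?t js) \<oplus> (\<Oplus>js \<in> ?Ps k - ?P1. ?t js)"
    using fin tc by (intro finsum_Un_disjoint) auto
   finally have split: "tail_identity k z = (\<Oplus>js \<in> ?P1. ?t js) \<oplus> (\<Oplus>js \<in> ?Ps k - ?P1. ?t js)" .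
   have mc: "nc_monom_eval R y js \<in> carrier R" for js using yc by (simp add: nc_monom_eval_closed)
   have tl: "tail_identity (Suc k) y \<in> carrier R"
    unfolding tail_identity_def using \<gamma>_closed mc by (intro finsum_closed) auto
   have "(\<Oplus>js \<in> ?P1. ?t js) = (\<Oplus>js \<in> ?Ps (Suc k). ?t (k # js))"
    using tc by (intro add.finprod_reindex) (auto simp: inj_on_def)
   also have "\<dots> = (\<Oplus>js \<in> ?Ps (Suc k). b \<otimes> (\<gamma> ([0..<Suc k] @ js) \<otimes> nc_monom_eval R y js))"
   proof (intro add.finprod_cong' refl)
    fix js assume "js \<in> ?Ps (Suc k)"
    then have "nc_monom_eval R z js = nc_monom_eval R y js"
     by (intro nc_monom_eval_cong) (auto simp: z_def)
    then have "?t (k # js) = \<gamma> ([0..<k] @ k # js) \<otimes> (b \<otimes> nc_monom_eval R y js)"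
     by (simp add: z_def)
    also have "\<dots> = b \<otimes> \<gamma> ([0..<k] @ k # js) \<otimes> nc_monom_eval R y js"
     using \<gamma>_central[OF bI(2)] \<gamma>_closed bI mc by (simp add: m_assoc)
    finally show "?t (k # js) = b \<otimes> (\<gamma> ([0..<Suc k] @ js) \<otimes> nc_monom_eval R y js)"
     using \<gamma>_closed bI mc by (simp add: m_assoc)
   qed (use \<gamma>_closed bI mc in auto)
   also have "\<dots> = b \<otimes> tail_identity (Suc k) y"
    unfolding tail_identity_def using fin \<gamma>_closed bI mc by (intro finsum_rdistr[symmetric]) auto
   finally have P1_sum: "(\<Oplus>js \<in> ?P1. ?t js) = b \<otimes> tail_identity (Suc k) y" .
   \<comment> \<open>Some variable stands directly before \<open>k\<close>, and its value ends in
     \<open>b\<close>; together they produce the factor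
     \<open>r j \<otimes> (b \<otimes> b)\<close>, which lies in \<open>L\<close>.\<close>
   have trm: "y0 \<otimes> ?t js \<in> L" if js: "js \<in> ?Ps k - ?P1" for js
   proof -
    have "k \<in> set js" using js step.hyps by auto
    then obtain us vs where jsuv: "js = us @ k # vs" by (meson split_list)
    have "us \<noteq> []"
    proof
     assume "us = []"
     then have "js = k # vs" "distinct vs" "set vs = {k..<d} - {k}" using js jsuv by auto
     moreover have "{k..<d} - {k} = {Suc k..<d}" by auto
     ultimately show False using js by auto
    qed
    then obtain us' j where us: "us = us' @ [j]" by (metis append_butlast_last_id)
    have "j \<noteq> k" using js jsuv us by auto
    then have zj: "z j = r j \<otimes> b" using r by (simp add: z_def)
    have rc: "r j \<in> carrier R" using r Ic by blast
    have uc: "nc_monom_eval R z us' \<in> carrier R" "nc_monom_eval R z vs \<in> carrier R"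
     using zc by (simp_all add: nc_monom_eval_closed)
    have "nc_monom_eval R z js = nc_monom_eval R z us' \<otimes> (r j \<otimes> (b \<otimes> b) \<otimes> nc_monom_eval R z vs)"
     using zc rc bI uc
     by (simp add: jsuv us nc_monom_eval_append m_assoc zj) (simp add: z_def)
    moreover have "r j \<otimes> (b \<otimes> b) \<otimes> nc_monom_eval R z vs \<in> L"
     using bb[OF r(1)] L.I_r_closed uc by blast
    ultimately show ?thesis
     using L.I_l_closed uc \<gamma>_closed y0c by simp
   qed
   have P2: "y0 \<otimes> (\<Oplus>js \<in> ?Ps k - ?P1. ?t js) \<in> L"
   proof -
    have "y0 \<otimes> (\<Oplus>js \<in> ?Ps k - ?P1. ?t js) = (\<Oplus>js \<in> ?Ps k - ?P1. y0 \<otimes> ?t js)"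
     using fin tc y0c by (intro finsum_rdistr) auto
    also have "\<dots> \<in> L"
    proof -
     have "(\<Oplus>js \<in> J. y0 \<otimes> ?t js) \<in> L" if "finite J" "J \<subseteq> ?Ps k - ?P1" for J
      using that
     proof (induction J rule: finite_induct)
      case (insert js J)
      have "(\<Oplus>js \<in> insert js J. y0 \<otimes> ?t js) = y0 \<otimes> ?t js \<oplus> (\<Oplus>js \<in> J. y0 \<otimes> ?t js)"
       using insert.hyps tc y0c by (intro finsum_insert) auto
      then show ?case using insert trm by auto
     qed simp
     then show ?thesis using fin by simp
    qed
    finally show ?thesis .
   qed
   have "y0 \<otimes> tail_identity k z \<in> L" using step.prems(3) y0 zc by blast
   moreover have s2: "(\<Oplus>js \<in> ?Ps k - ?P1. ?t js) \<in> carrier R" using tc by (intro finsum_closed) auto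
   ultimately have "y0 \<otimes> (b \<otimes> tail_identity (Suc k) y) \<oplus> y0 \<otimes> (\<Oplus>js \<in> ?Ps k - ?P1. ?t js) \<in> L"
    using y0c bI tl by (simp add: split P1_sum r_distr)
   moreover have "u \<in> L" if "u \<oplus> v \<in> L" "v \<in> L" "u \<in> carrier R" for u v
   proof -
    have "(u \<oplus> v) \<oplus> \<ominus> v \<in> L" by (rule L.a_closed[OF that(1) L.a_inv_closed[OF that(2)]])
    moreover have "(u \<oplus> v) \<oplus> \<ominus> v = u" using L.Icarr[OF that(2)] that(3) by (simp add: a_assoc r_neg)
    ultimately show ?thesis by metis
   qed
   ultimately have "y0 \<otimes> (b \<otimes> tail_identity (Suc k) y) \<in> L" using P2 y0c bI(2) tl by blast
   then have cL: "c \<otimes> tail_identity (Suc k) y \<in> L"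
    unfolding c_def m_assoc[OF y0c bI(2) tl] .
   obtain a where "a \<in> carrier R" "x' = a \<otimes> c" using x' by (auto simp: I'_def)
   then show "x' \<otimes> tail_identity (Suc k) y \<in> L"
    using cL L.I_l_closed cI tl by (simp add: m_assoc)
  qed
  moreover have "c \<in> I'" using cI by (auto simp: I'_def intro!: image_eqI[of _ _ \<one>])
  ultimately show False using y0(2) by (auto simp: c_def)
 qed
qed

text \<open>The peeling starts at \<open>k = 0\<close>, where the tail is the identity itself and
  vanishes.\<close>

theorem levitzki:
 assumes "left_ideal N" "\<And>x. x \<in> N ==> \<exists>n::nat. x [^] n = \<zero>"
  and L: "ideal L R" "loc_nil L" "\<And>J. ideal J R ==> loc_nil J ==> L \<subseteq> J ==> J = L"
 shows "N \<subseteq> L"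
proof (rule nil_left_ideal_tail[OF L(1) semiprime_left_ideal[OF L], of 0])
 interpret L: ideal L R by (rule L(1))
 show "\<exists>n::nat. x [^] n \<in> L" if "x \<in> N" for x using assms(2)[OF that] by (metis L.additive_subgroup_axioms additive_subgroup.zero_closed)
 fix x and y :: "nat => 'a" assume x: "x \<in> N" and y: "y \<in> UNIV \<rightarrow> N"
 have "y \<in> UNIV \<rightarrow> carrier R" using y assms(1) by (auto simp: left_ideal_def)
 then have "tail_identity 0 y = \<zero>" using identity by (simp add: tail_identity_def atLeast0LessThan)
 then show "x \<otimes> tail_identity 0 y \<in> L" using x assms(1) by (auto simp: left_ideal_def)
qed (use assms in auto)

end

section \<open>Matrix representations of PI-rings\<close>

definition matrix_hom ::
  "('a, 'm) ring_scheme => ('k, 'n) ring_scheme => nat => ('a => nat => nat => 'k) => bool"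
 where "matrix_hom A K n \<phi> \<longleftrightarrow>
  (\<forall>x \<in> carrier A. \<forall>i < n. \<forall>j < n. \<phi> x i j \<in> carrier K) \<and>
  (\<forall>i < n. \<forall>j < n. \<phi> \<one>\<^bsub>A\<^esub> i j = (if i = j then \<one>\<^bsub>K\<^esub> else \<zero>\<^bsub>K\<^esub>)) \<and>
  (\<forall>x \<in> carrier A. \<forall>y \<in> carrier A. \<forall>i < n. \<forall>j < n.
   \<phi> (x \<oplus>\<^bsub>A\<^esub> y) i j = \<phi> x i j \<oplus>\<^bsub>K\<^esub> \<phi> y i j \<and>
   \<phi> (x \<otimes>\<^bsub>A\<^esub> y) i j = (\<Oplus>\<^bsub>K\<^esub>l \<in> {..<n}. \<phi> x i l \<otimes>\<^bsub>K\<^esub> \<phi> y l j))"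

text \<open>The simple left module is \<open>R/M\<close> for a maximal left ideal \<open>M\<close>. Its endomorphisms are the right
 multiplications by elements of the idealizer of \<open>M\<close>, and \<open>K0\<close> is a maximal subset of
 pairwise commuting ones.\<close>

locale simple_quotient = ring R for R (structure) +
 fixes M K0 A0 :: "'a set" and t :: 'a
 assumes M_left: "left_ideal M" and one_M: "\<one> \<notin> M"
  and M_max: "\<And>b. b \<in> carrier R ==> b \<notin> M ==> \<exists>c \<in> carrier R. \<one> \<ominus> c \<otimes> b \<in> M"
  and K0_car: "K0 \<subseteq> carrier R"
  and K0_Idl: "\<And>k m. k \<in> K0 ==> m \<in> M ==> m \<otimes> k \<in> M"
  and K0_comm: "\<And>k k'. k \<in> K0 ==> k' \<in> K0 ==> k \<otimes> k' \<ominus> k' \<otimes> k \<in> M"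
  and K0_max: "\<And>k. k \<in> carrier R ==> (\<And>m. m \<in> M ==> m \<otimes> k \<in> M) ==>
   (\<And>k'. k' \<in> K0 ==> k \<otimes> k' \<ominus> k' \<otimes> k \<in> M) ==> k \<in> K0"
  and A0_car: "A0 \<subseteq> carrier R" and A0_zero: "\<zero> \<in> A0" and A0_one: "\<one> \<in> A0"
  and A0_mult: "\<And>a b. a \<in> A0 ==> b \<in> A0 ==> a \<otimes> b \<in> A0"
  and t_car: "t \<in> carrier R" and t_central: "\<And>b. b \<in> carrier R ==> b \<otimes> t = t \<otimes> b"
  and poly: "\<And>b. b \<in> carrier R ==>
   \<exists>(n::nat) a. (\<forall>i. a i \<in> A0) \<and> b = (\<Oplus>i \<in> {..n}. a i \<otimes> t [^] i)"
begin

lemma M_car: "m \<in> M ==> m \<in> carrier R"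
 and M_zero: "\<zero> \<in> M"
 and M_add: "m \<in> M ==> m' \<in> M ==> m \<oplus> m' \<in> M"
 and M_mult: "b \<in> carrier R ==> m \<in> M ==> b \<otimes> m \<in> M"
 using M_left by (auto simp: left_ideal_def)

lemma M_inv: "m \<in> M ==> \<ominus> m \<in> M"
 using M_mult[of "\<ominus> \<one>" m] M_car by (simp add: l_minus)

lemma M_minus: "m \<in> M ==> m' \<in> M ==> m \<ominus> m' \<in> M"
 by (simp add: a_minus_def M_add M_inv)

definition eqM :: "'a => 'a => bool"
 where "eqM x y \<longleftrightarrow> x \<in> carrier R \<and> y \<in> carrier R \<and> x \<ominus> y \<in> M"

lemma eqM_refl [simp]: "x \<in> carrier R ==> eqM x x"
 by (simp add: eqM_def a_minus_def r_neg M_zero)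

lemma eqM_car: "eqM x y ==> x \<in> carrier R" "eqM x y ==> y \<in> carrier R"
 by (auto simp: eqM_def)

lemma eqM_sym: "eqM x y ==> eqM y x"
 using M_inv[of "x \<ominus> y"] by (auto simp: eqM_def a_minus_def minus_add a_comm)

lemma eqM_trans [trans]:
 assumes "eqM x y" "eqM y z"
 shows "eqM x z"
proof -
 have "x \<ominus> z = (x \<ominus> y) \<oplus> (y \<ominus> z)"
  using assms by (simp add: eqM_def a_minus_def a_assoc r_neg1)
 then show ?thesis using assms M_add by (auto simp: eqM_def)
qed

lemma eqM_add:
 assumes "eqM x y" "eqM x' y'"
 shows "eqM (x \<oplus> x') (y \<oplus> y')"
proof -
 have "(x \<oplus> x') \<ominus> (y \<oplus> y') = (x \<ominus> y) \<oplus> (x' \<ominus> y')"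
  using assms by (simp add: eqM_def a_minus_def minus_add a_ac)
 then show ?thesis using assms M_add by (auto simp: eqM_def)
qed

lemma eqM_left: "b \<in> carrier R ==> eqM x y ==> eqM (b \<otimes> x) (b \<otimes> y)"
 using M_mult[of b "x \<ominus> y"] by (auto simp: eqM_def a_minus_def r_distr r_minus)

lemma K0_carrier: "k \<in> K0 ==> k \<in> carrier R"
 using K0_car by blast

lemma eqM_right: "k \<in> K0 ==> eqM x y ==> eqM (x \<otimes> k) (y \<otimes> k)"
 using K0_Idl[of k "x \<ominus> y"] K0_carrier by (auto simp: eqM_def a_minus_def l_distr l_minus)

lemma eqM_memD: "eqM x y ==> y \<in> M ==> x \<in> M"
proof -
 assume a: "eqM x y" "y \<in> M"
 then have "(x \<ominus> y) \<oplus> y \<in> M" using M_add by (auto simp: eqM_def)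
 then show "x \<in> M" using a by (simp add: eqM_def a_minus_def a_assoc l_neg)
qed

lemma eqM_zero_iff: "x \<in> carrier R ==> eqM x \<zero> \<longleftrightarrow> x \<in> M"
proof -
 assume x: "x \<in> carrier R"
 have "x \<ominus> \<zero> = x" unfolding a_minus_def using x by simp
 then show ?thesis using x by (simp add: eqM_def)
qed

lemma M_imp_eqM_zero: "x \<in> M ==> eqM x \<zero>"
 using eqM_zero_iff M_car by blast

lemma eqM_finsum:
 assumes "finite J" "\<And>x. x \<in> J ==> eqM (f x) (g x)"
 shows "eqM (\<Oplus>x \<in> J. f x) (\<Oplus>x \<in> J. g x)"
 using assms
proof (induction J rule: finite_induct)
 case (insert x J)
 then have "f \<in> J \<rightarrow> carrier R" "g \<in> J \<rightarrow> carrier R" "f x \<in> carrier R" "g x \<in> carrier R"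
  by (auto simp: eqM_def)
 then show ?case using insert eqM_add by (simp add: finsum_insert)
qed simp

lemma K0_eqM_comm: "k \<in> K0 ==> k' \<in> K0 ==> eqM (k \<otimes> k') (k' \<otimes> k)"
 using K0_comm K0_carrier by (simp add: eqM_def)

lemma K0I:
 assumes "k \<in> carrier R" "\<And>m. m \<in> M ==> m \<otimes> k \<in> M" "\<And>k'. k' \<in> K0 ==> eqM (k \<otimes> k') (k' \<otimes> k)"
 shows "k \<in> K0"
 using K0_max[of k] assms by (auto simp: eqM_def)

lemma M_K0: "m \<in> M ==> m \<in> K0"
proof (rule K0I)
 assume m: "m \<in> M"
 show "m \<in> carrier R" using m M_car by blast
 show "m' \<otimes> m \<in> M" if "m' \<in> M" for m' using that m M_mult M_car by blast
 show "eqM (m \<otimes> k') (k' \<otimes> m)" if k: "k' \<in> K0" for k'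
  using K0_Idl[OF k m] M_mult[OF K0_carrier[OF k] m] M_minus M_car by (auto simp: eqM_def)
qed

lemma central_K0: "z \<in> carrier R ==> (\<And>b. b \<in> carrier R ==> b \<otimes> z = z \<otimes> b) ==> z \<in> K0"
 using M_mult M_car K0_carrier by (intro K0I) (metis, metis, metis eqM_refl m_closed)

lemma one_K0: "\<one> \<in> K0" and t_K0: "t \<in> K0"
 using central_K0 t_car t_central by auto

lemma K0_add: "k \<in> K0 ==> l \<in> K0 ==> k \<oplus> l \<in> K0"
proof (rule K0I)
 assume kl: "k \<in> K0" "l \<in> K0"
 have c: "k \<in> carrier R" "l \<in> carrier R" using kl K0_carrier by auto
 show "k \<oplus> l \<in> carrier R" using c by simp
 show "m \<otimes> (k \<oplus> l) \<in> M" if "m \<in> M" for m using that kl c M_car K0_Idl M_add by (simp add: r_distr)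
 show "eqM ((k \<oplus> l) \<otimes> k') (k' \<otimes> (k \<oplus> l))" if "k' \<in> K0" for k'
  using eqM_add[OF K0_eqM_comm[OF kl(1) that] K0_eqM_comm[OF kl(2) that]] c K0_carrier[OF that]
  by (simp add: l_distr r_distr)
qed

lemma K0_inv: "k \<in> K0 ==> \<ominus> k \<in> K0"
proof (rule K0I)
 assume k: "k \<in> K0"
 have c: "k \<in> carrier R" using k K0_carrier by auto
 show "\<ominus> k \<in> carrier R" using c by simp
 show "m \<otimes> (\<ominus> k) \<in> M" if "m \<in> M" for m using that k c M_car K0_Idl M_inv by (simp add: r_minus)
 show "eqM ((\<ominus> k) \<otimes> k') (k' \<otimes> (\<ominus> k))" if k': "k' \<in> K0" for k'
  using eqM_left[OF _ K0_eqM_comm[OF k k'], of "\<ominus> \<one>"] c K0_carrier[OF k']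
  by (simp add: l_minus r_minus)
qed

lemma K0_mult: "k \<in> K0 ==> l \<in> K0 ==> k \<otimes> l \<in> K0"
proof (rule K0I)
 assume kl: "k \<in> K0" "l \<in> K0"
 have c: "k \<in> carrier R" "l \<in> carrier R" using kl K0_carrier by auto
 show "k \<otimes> l \<in> carrier R" using c by simp
 show "m \<otimes> (k \<otimes> l) \<in> M" if "m \<in> M" for m
  using that kl c M_car K0_Idl by (simp flip: m_assoc)
 show "eqM ((k \<otimes> l) \<otimes> k') (k' \<otimes> (k \<otimes> l))" if k': "k' \<in> K0" for k'
 proof -
  have c': "k' \<in> carrier R" using k' K0_carrier by auto
  have "eqM (k \<otimes> (l \<otimes> k')) (k \<otimes> (k' \<otimes> l))" using eqM_left K0_eqM_comm kl k' c by blast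
  also have "k \<otimes> (k' \<otimes> l) = (k \<otimes> k') \<otimes> l" using c c' by (simp add: m_assoc)
  also have "eqM \<dots> ((k' \<otimes> k) \<otimes> l)" using eqM_right K0_eqM_comm kl k' by blast
  finally show ?thesis using c c' by (simp add: m_assoc)
 qed
qed

text \<open>Schur's lemma for right multiplications: \<open>c \<otimes> k\<close> congruent to 1
  gives surjectivity, the maximality of \<open>M\<close> injectivity. An inverse of \<open>k\<close>
  commutes with whatever \<open>k\<close> commutes with, so \<open>K0\<close>, being maximal,
  contains it.\<close>

lemma K0_inverse:
 assumes k: "k \<in> K0" "k \<notin> M"
 shows "\<exists>c \<in> K0. eqM (k \<otimes> c) \<one> \<and> eqM (c \<otimes> k) \<one>"
proof -
 have kc: "k \<in> carrier R" using k K0_carrier by auto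
 obtain c where c: "c \<in> carrier R" "\<one> \<ominus> c \<otimes> k \<in> M" using M_max kc k by blast
 have ck: "eqM (c \<otimes> k) \<one>" using c kc eqM_sym by (simp add: eqM_def)
 have inj: "v \<in> M" if v: "v \<in> carrier R" "v \<otimes> k \<in> M" for v
 proof (rule ccontr)
  assume "v \<notin> M"
  then obtain b where b: "b \<in> carrier R" "\<one> \<ominus> b \<otimes> v \<in> M" using M_max v by blast
  then have "eqM (\<one> \<otimes> k) ((b \<otimes> v) \<otimes> k)" using v by (intro eqM_right[OF k(1)]) (simp add: eqM_def)
  then have "k \<in> M" using eqM_memD[of k "b \<otimes> (v \<otimes> k)"] M_mult b v kc by (simp add: m_assoc)
  then show False using k by blast
 qed
 have injeq: "eqM x y" if "x \<in> carrier R" "y \<in> carrier R" "eqM (x \<otimes> k) (y \<otimes> k)" for x y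
  using that inj[of "x \<ominus> y"] kc by (auto simp: eqM_def a_minus_def l_distr l_minus)
 have cK: "c \<in> K0"
 proof (rule K0I[OF c(1)])
  show "m \<otimes> c \<in> M" if m: "m \<in> M" for m
  proof (rule inj)
   have "eqM (m \<otimes> (c \<otimes> k)) (m \<otimes> \<one>)" using eqM_left ck m M_car by blast
   then show "m \<otimes> c \<otimes> k \<in> M" using eqM_memD[of "m \<otimes> (c \<otimes> k)" m] m M_car c kc by (simp add: m_assoc)
  qed (use m M_car c in auto)
  show "eqM (c \<otimes> k') (k' \<otimes> c)" if k': "k' \<in> K0" for k'
  proof (rule injeq)
   have k'c: "k' \<in> carrier R" using k' K0_carrier by auto
   have "eqM (c \<otimes> (k' \<otimes> k)) (c \<otimes> (k \<otimes> k'))" using eqM_left K0_eqM_comm k k' c by blast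
   also have "c \<otimes> (k \<otimes> k') = (c \<otimes> k) \<otimes> k'" using c kc k'c by (simp add: m_assoc)
   also have "eqM \<dots> (\<one> \<otimes> k')" using eqM_right[OF k' ck] .
   also have "\<one> \<otimes> k' = k' \<otimes> \<one>" using k'c by simp
   also have "eqM (k' \<otimes> \<one>) (k' \<otimes> (c \<otimes> k))" using eqM_left[OF k'c eqM_sym[OF ck]] .
   finally show "eqM (c \<otimes> k' \<otimes> k) (k' \<otimes> c \<otimes> k)" using c kc k'c by (simp add: m_assoc)
  qed (use k' K0_carrier c in auto)
 qed
 have "eqM (k \<otimes> c) \<one>"
 proof (rule injeq)
  have "eqM (k \<otimes> (c \<otimes> k)) (k \<otimes> \<one>)" using eqM_left[OF kc ck] .
  then show "eqM (k \<otimes> c \<otimes> k) (\<one> \<otimes> k)" using c kc by (simp add: m_assoc)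
 qed (use c kc in auto)
 then show ?thesis using cK ck by blast
qed

text \<open>Elements of \<open>M\<close> act as zero on \<open>R/M\<close>, so \<open>K0\<close>
  modulo \<open>M\<close> is the commuting set of endomorphisms itself, a maximal subfield of the
  endomorphism ring.\<close>

definition K :: "'a set ring"
 where "K = (R\<lparr>carrier := K0\<rparr>) Quot M"

definition \<pi> :: "'a => 'a set"
 where "\<pi> k = M +>\<^bsub>R\<lparr>carrier := K0\<rparr>\<^esub> k"

lemma K0_subring: "subring K0 R"
 using K0_car one_K0 K0_inv K0_add K0_mult by (intro subringI) auto

lemma K0_ring: "ring (R\<lparr>carrier := K0\<rparr>)"
 by (rule subring_is_ring[OF K0_subring])

lemma M_ideal: "ideal M (R\<lparr>carrier := K0\<rparr>)"
proof (rule ring.idealI'[OF K0_ring])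
 show "M \<subseteq> carrier (R\<lparr>carrier := K0\<rparr>)" using M_K0 by auto
qed (use M_zero M_add M_mult K0_carrier K0_Idl in auto)

lemma K0_minus:
 assumes "x \<in> K0" "y \<in> K0"
 shows "x \<ominus>\<^bsub>R\<lparr>carrier := K0\<rparr>\<^esub> y = x \<ominus> y"
proof -
 interpret S: ring "R\<lparr>carrier := K0\<rparr>" by (rule K0_ring)
 have "\<ominus>\<^bsub>R\<lparr>carrier := K0\<rparr>\<^esub> y = \<ominus> y"
  using S.l_neg[of y] S.a_inv_closed[of y] assms K0_carrier minus_equality[of "\<ominus>\<^bsub>R\<lparr>carrier := K0\<rparr>\<^esub> y" y] by auto
 then show ?thesis by (simp add: a_minus_def)
qed

lemma \<pi>_eq_iff: "k \<in> K0 ==> l \<in> K0 ==> \<pi> k = \<pi> l \<longleftrightarrow> eqM k l"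
 using ring.quotient_eq_iff_same_a_r_cos[OF K0_ring M_ideal, of k l] K0_carrier
 by (simp add: \<pi>_def eqM_def K0_minus)

lemma \<pi>_hom: "\<pi> \<in> ring_hom (R\<lparr>carrier := K0\<rparr>) K"
 using ideal.rcos_ring_hom[OF M_ideal] by (simp add: K_def \<pi>_def[abs_def])

lemma \<pi>_simps:
 "k \<in> K0 ==> \<pi> k \<in> carrier K"
 "k \<in> K0 ==> l \<in> K0 ==> \<pi> (k \<otimes> l) = \<pi> k \<otimes>\<^bsub>K\<^esub> \<pi> l"
 "k \<in> K0 ==> l \<in> K0 ==> \<pi> (k \<oplus> l) = \<pi> k \<oplus>\<^bsub>K\<^esub> \<pi> l"
 "\<pi> \<one> = \<one>\<^bsub>K\<^esub>"
 using ring_hom_memE[OF \<pi>_hom] by auto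

lemma K_ring: "ring K"
 unfolding K_def by (rule ideal.quotient_is_ring[OF M_ideal])

lemma \<pi>_zero: "\<pi> \<zero> = \<zero>\<^bsub>K\<^esub>"
 using ring_hom_zero[OF \<pi>_hom K0_ring K_ring] by simp

lemma K_elem: "u \<in> carrier K ==> \<exists>k \<in> K0. u = \<pi> k"
 by (auto simp: K_def FactRing_def A_RCOSETS_def' \<pi>_def)

lemma K_field: "field K"
proof -
 interpret K: ring K by (rule K_ring)
 have "cring K"
 proof unfold_locales
  fix u w assume "u \<in> carrier K" "w \<in> carrier K"
  then obtain k l where kl: "k \<in> K0" "l \<in> K0" "u = \<pi> k" "w = \<pi> l" using K_elem by metis
  then have "\<pi> (k \<otimes> l) = \<pi> (l \<otimes> k)" using K0_eqM_comm K0_mult by (simp add: \<pi>_eq_iff)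
  then show "u \<otimes>\<^bsub>K\<^esub> w = w \<otimes>\<^bsub>K\<^esub> u" using kl by (simp add: \<pi>_simps)
 qed
 then show ?thesis
 proof (rule cring.cring_fieldI2)
  show "\<zero>\<^bsub>K\<^esub> \<noteq> \<one>\<^bsub>K\<^esub>"
  proof
   assume "\<zero>\<^bsub>K\<^esub> = \<one>\<^bsub>K\<^esub>"
   then have "\<pi> \<one> = \<pi> \<zero>" using \<pi>_simps(4) \<pi>_zero by simp
   then have "eqM \<one> \<zero>" using \<pi>_eq_iff one_K0 M_K0[OF M_zero] by blast
   then show False using eqM_zero_iff one_M by simp
  qed
  fix u assume u: "u \<in> carrier K" "u \<noteq> \<zero>\<^bsub>K\<^esub>"
  obtain k where k: "k \<in> K0" "u = \<pi> k" using K_elem u by metis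
  have "k \<notin> M"
  proof
   assume "k \<in> M"
   then have "\<pi> k = \<pi> \<zero>" using M_imp_eqM_zero k M_K0[OF M_zero] by (simp add: \<pi>_eq_iff)
   then show False using u k \<pi>_zero by simp
  qed
  then obtain c where c: "c \<in> K0" "eqM (k \<otimes> c) \<one>" using K0_inverse k by blast
  then have "\<pi> (k \<otimes> c) = \<pi> \<one>" using k K0_mult one_K0 by (simp add: \<pi>_eq_iff)
  then show "\<exists>w \<in> carrier K. u \<otimes>\<^bsub>K\<^esub> w = \<one>\<^bsub>K\<^esub>"
   using c k by (intro bexI[of _ "\<pi> c"]) (auto simp: \<pi>_simps)
 qed
qed

end

section \<open>Density of the operators taking v to a v k\<close>

context simple_quotient
begin

text \<open>The image of the tensor product of \<open>A0\<close> and \<open>K0\<close> acting by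
  left and right multiplication. Right multiplication by \<open>K0\<close> commutes with it modulo
  \<open>M\<close>, so these operators are linear over \<open>K\<close> on
  \<open>R/M\<close>.\<close>

inductive op :: "('a => 'a) => bool"
 where
  gen: "a \<in> A0 ==> k \<in> K0 ==> (\<And>v. v \<in> carrier R ==> r v = a \<otimes> (v \<otimes> k)) ==> op r"
 | add: "op r ==> op s ==> (\<And>v. v \<in> carrier R ==> r' v = r v \<oplus> s v) ==> op r'"

lemma A0_carrier: "a \<in> A0 ==> a \<in> carrier R"
 using A0_car by blast

lemma op_closed: "op r ==> v \<in> carrier R ==> r v \<in> carrier R"
 by (induction rule: op.induct) (auto simp: A0_carrier K0_carrier)

lemma op_additive:
 "op r ==> v \<in> carrier R ==> w \<in> carrier R ==> r (v \<oplus> w) = r v \<oplus> r w"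
proof (induction rule: op.induct)
 case (gen a k r)
 then show ?case by (simp add: A0_carrier K0_carrier l_distr r_distr)
next
 case (add r s r')
 then show ?case using op_closed by (simp add: a_ac)
qed

lemma op_M: "op r ==> m \<in> M ==> r m \<in> M"
proof (induction rule: op.induct)
 case (gen a k r)
 then show ?case using M_car K0_Idl M_mult A0_carrier by simp
next
 case (add r s r')
 then show ?case using M_car M_add by simp
qed

lemma op_zero_val: "op r ==> r \<zero> = \<zero>"
proof -
 assume r: "op r"
 have "r (\<zero> \<oplus> \<zero>) = r \<zero> \<oplus> r \<zero>" by (rule op_additive[OF r]) simp_all
 then have "r \<zero> \<oplus> r \<zero> = r \<zero>" by (simp only: l_zero zero_closed)
 then show "r \<zero> = \<zero>" using add.l_cancel_one op_closed[OF r zero_closed] by blast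
qed

lemma op_inv_val: "op r ==> v \<in> carrier R ==> r (\<ominus> v) = \<ominus> r v"
proof -
 assume r: "op r" and v: "v \<in> carrier R"
 have "r (\<ominus> v) \<oplus> r v = r (\<ominus> v \<oplus> v)" using op_additive[OF r, of "\<ominus> v" v] v by simp
 then have "r (\<ominus> v) \<oplus> r v = \<zero>" using v op_zero_val[OF r] by (simp add: l_neg)
 then show "r (\<ominus> v) = \<ominus> r v" using op_closed[OF r] v by (intro minus_equality[symmetric]) auto
qed

lemma op_eqM: "op r ==> eqM v w ==> eqM (r v) (r w)"
 using op_M[of r "v \<ominus> w"] op_additive[of r v "\<ominus> w"] op_inv_val[of r w] op_closed[of r]
 by (simp add: eqM_def a_minus_def)

lemma op_zero: "op (\<lambda>_. \<zero>)"
 by (rule op.gen[of \<zero> \<one>]) (auto simp: A0_zero one_K0)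

lemma op_cong: "op r ==> (\<And>v. v \<in> carrier R ==> r' v = r v) ==> op r'"
 by (rule op.add[OF _ op_zero]) (auto simp: op_closed)

lemma op_id: "op (\<lambda>v. v)"
 by (rule op.gen[of \<one> \<one>]) (auto simp: A0_one one_K0)

lemma op_finsum:
 assumes "finite J" "\<And>i. i \<in> J ==> op (r i)"
 shows "op (\<lambda>v. \<Oplus>i \<in> J. r i v)"
 using assms
proof (induction J rule: finite_induct)
 case (insert i J)
 then have "op (r i)" "op (\<lambda>v. \<Oplus>i \<in> J. r i v)" by auto
 then show ?case
 proof (rule op.add)
  fix v assume v: "v \<in> carrier R"
  show "(\<Oplus>i \<in> insert i J. r i v) = r i v \<oplus> (\<Oplus>i \<in> J. r i v)"
   using op_closed[OF _ v] insert by (intro finsum_insert) auto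
 qed
qed (simp add: op_zero)

lemma t_pow: "t [^] (i::nat) \<in> K0"
 by (induction i) (auto simp: one_K0 t_K0 K0_mult)

lemma t_pow_central: "b \<in> carrier R ==> b \<otimes> t [^] (i::nat) = t [^] i \<otimes> b"
proof (induction i)
 case (Suc i)
 have "b \<otimes> (t [^] i \<otimes> t) = (b \<otimes> t [^] i) \<otimes> t" using Suc.prems t_car by (simp add: m_assoc)
 also have "b \<otimes> t [^] i = t [^] i \<otimes> b" by (rule Suc.IH[OF Suc.prems])
 also have "t [^] i \<otimes> b \<otimes> t = t [^] i \<otimes> (b \<otimes> t)" using Suc.prems t_car by (simp add: m_assoc)
 also have "b \<otimes> t = t \<otimes> b" by (rule t_central[OF Suc.prems])
 also have "t [^] i \<otimes> (t \<otimes> b) = t [^] i \<otimes> t \<otimes> b" using Suc.prems t_car by (simp add: m_assoc)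
 finally show ?case by simp
qed simp

text \<open>A left factor from the polynomial ring can be absorbed, since powers of the central
  \<open>t\<close> may be moved to the right, where they belong to \<open>K0\<close>.\<close>

lemma op_left:
 assumes "b \<in> carrier R" "op r"
 shows "op (\<lambda>v. b \<otimes> r v)"
 using assms(2)
proof (induction rule: op.induct)
 case (gen a k r)
 obtain n :: nat and f where f: "\<And>i. f i \<in> A0" "b = (\<Oplus>i \<in> {..n}. f i \<otimes> t [^] i)"
  using poly[OF assms(1)] by blast
 have "op (\<lambda>v. \<Oplus>i \<in> {..n}. (f i \<otimes> a) \<otimes> (v \<otimes> (k \<otimes> t [^] i)))"
  using f gen t_pow by (intro op_finsum op.gen) (auto simp: A0_mult K0_mult)
 moreover have "b \<otimes> r v = (\<Oplus>i \<in> {..n}. (f i \<otimes> a) \<otimes> (v \<otimes> (k \<otimes> t [^] i)))" if v: "v \<in> carrier R" for v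
 proof -
  have c: "a \<in> carrier R" "k \<in> carrier R" "\<And>i. f i \<in> carrier R"
   using gen f A0_carrier K0_carrier by auto
  have "b \<otimes> r v = (\<Oplus>i \<in> {..n}. (f i \<otimes> t [^] i) \<otimes> (a \<otimes> (v \<otimes> k)))"
   unfolding f(2) using gen c v t_car by (simp add: finsum_ldistr Pi_def)
  also have "\<dots> = (\<Oplus>i \<in> {..n}. (f i \<otimes> a) \<otimes> (v \<otimes> (k \<otimes> t [^] i)))"
   using c v t_car t_pow_central[of "a \<otimes> (v \<otimes> k)"]
   by (intro finsum_cong') (auto simp: m_assoc simp flip: t_pow_central)
  finally show ?thesis .
 qed
 ultimately show ?case by (rule op_cong)
next
 case (add r s r')
 then show ?case
  by (intro op.add[OF add.IH]) (simp add: op_closed assms(1) r_distr)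
qed

lemma op_right:
 assumes "op r" "k' \<in> K0"
 shows "op (\<lambda>v. r v \<otimes> k')"
 using assms(1)
proof (induction rule: op.induct)
 case (gen a k r)
 then show ?case
  using assms(2) A0_carrier K0_carrier K0_mult
  by (intro op.gen[of a "k \<otimes> k'"]) (auto simp: m_assoc)
next
 case (add r s r')
 then show ?case
  using assms(2) K0_carrier by (intro op.add[OF add.IH]) (simp add: op_closed l_distr)
qed

lemma op_K0_linear:
 assumes "op r" "k' \<in> K0" "v \<in> carrier R"
 shows "eqM (r (v \<otimes> k')) (r v \<otimes> k')"
 using assms(1)
proof (induction rule: op.induct)
 case (gen a k r)
 have c: "a \<in> carrier R" "k \<in> carrier R" "k' \<in> carrier R" using gen assms A0_carrier K0_carrier by auto
 have "eqM (a \<otimes> (v \<otimes> (k' \<otimes> k))) (a \<otimes> (v \<otimes> (k \<otimes> k')))"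
  using K0_eqM_comm gen assms c by (intro eqM_left) auto
 then show ?case using c assms gen by (simp add: m_assoc)
next
 case (add r s r')
 then show ?case using eqM_add[OF add.IH] assms K0_carrier
  by (simp add: op_closed l_distr)
qed

definition Sp :: "(nat => 'a) => nat => 'a set"
 where "Sp v m = {b. \<exists>\<kappa>. (\<forall>i < m. \<kappa> i \<in> K0) \<and> eqM b (\<Oplus>i \<in> {..<m}. v i \<otimes> \<kappa> i)}"

lemma Sp_Suc:
 assumes v: "\<And>i. i \<le> m ==> v i \<in> carrier R" and k: "k \<in> K0" and b: "b \<in> carrier R"
  and s: "b \<ominus> v m \<otimes> k \<in> Sp v m"
 shows "b \<in> Sp v (Suc m)"
proof -
 obtain \<kappa> where \<kappa>: "\<forall>i < m. \<kappa> i \<in> K0" "eqM (b \<ominus> v m \<otimes> k) (\<Oplus>i \<in> {..<m}. v i \<otimes> \<kappa> i)"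
  using s by (auto simp: Sp_def)
 let ?\<kappa> = "\<kappa>(m := k)"
 have car: "v i \<otimes> \<kappa> i \<in> carrier R" if "i < m" for i using that \<kappa> K0_carrier v by auto
 have kc: "v m \<otimes> k \<in> carrier R" using k K0_carrier v by auto
 have "(\<Oplus>i \<in> {..<Suc m}. v i \<otimes> ?\<kappa> i) = v m \<otimes> k \<oplus> (\<Oplus>i \<in> {..<m}. v i \<otimes> ?\<kappa> i)"
  using car kc by (subst lessThan_Suc, subst finsum_insert) auto
 also have "(\<Oplus>i \<in> {..<m}. v i \<otimes> ?\<kappa> i) = (\<Oplus>i \<in> {..<m}. v i \<otimes> \<kappa> i)"
  using car by (intro finsum_cong') auto
 finally have sum: "(\<Oplus>i \<in> {..<Suc m}. v i \<otimes> ?\<kappa> i) = v m \<otimes> k \<oplus> (\<Oplus>i \<in> {..<m}. v i \<otimes> \<kappa> i)" .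
 have "eqM (v m \<otimes> k \<oplus> (b \<ominus> v m \<otimes> k)) (v m \<otimes> k \<oplus> (\<Oplus>i \<in> {..<m}. v i \<otimes> \<kappa> i))"
  using \<kappa> kc by (intro eqM_add) auto
 moreover have "v m \<otimes> k \<oplus> (b \<ominus> v m \<otimes> k) = b"
  using b kc by (simp add: a_minus_def a_lcomm r_neg)
 ultimately have "eqM b (\<Oplus>i \<in> {..<Suc m}. v i \<otimes> ?\<kappa> i)" unfolding sum by metis
 then show ?thesis using \<kappa> k unfolding Sp_def
  by (auto intro!: exI[of _ ?\<kappa>] simp: less_Suc_eq)
qed

text \<open>If \<open>r1\<close> kills the earlier vectors modulo \<open>M\<close> and sends
  \<open>v m\<close> to 1, then passing from r (v m) to r b is right multiplication by
  \<open>k = r1 b\<close>, for every r that kills the earlier vectors. This \<open>k\<close>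
  idealizes \<open>M\<close> and commutes with \<open>K0\<close>, so by maximality it is a
  legitimate coefficient of \<open>v m\<close>.\<close>

lemma jacobson_density:
 assumes "\<And>i. i < m ==> v i \<in> carrier R" "b \<in> carrier R"
  and "\<And>r. op r ==> (\<And>i. i < m ==> r (v i) \<in> M) ==> r b \<in> M"
 shows "b \<in> Sp v m"
 using assms
proof (induction m arbitrary: b)
 case 0
 have "b \<in> M" using 0(3)[OF op_id] by simp
 then show ?case using M_imp_eqM_zero by (simp add: Sp_def)
next
 case (Suc m)
 have v: "v i \<in> carrier R" if "i \<le> m" for i using that Suc.prems by auto
 show ?case
 proof (cases "\<forall>r. op r --> (\<forall>i < m. r (v i) \<in> M) --> r (v m) \<in> M")
  case True
  have "b \<in> Sp v m"
  proof (rule Suc.IH)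
   show "r b \<in> M" if "op r" "\<And>i. i < m ==> r (v i) \<in> M" for r
    using Suc.prems(3)[OF that(1)] that True by (auto simp: less_Suc_eq)
  qed (use Suc.prems in auto)
  moreover have "b \<ominus> v m \<otimes> \<zero> = b" using v Suc.prems(2) unfolding a_minus_def by simp
  ultimately show ?thesis using Sp_Suc[where m = m and v = v and k = \<zero> and b = b, OF v] M_K0[OF M_zero] Suc.prems(2) by simp
 next
  case False
  then obtain r0 where r0: "op r0" "\<And>i. i < m ==> r0 (v i) \<in> M" "r0 (v m) \<notin> M" by blast
  obtain c where c: "c \<in> carrier R" "\<one> \<ominus> c \<otimes> r0 (v m) \<in> M" using M_max[OF op_closed[OF r0(1) v[OF order_refl]] r0(3)] by blast
  define r1 where "r1 w = c \<otimes> r0 w" for w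
  have r1: "op r1" unfolding r1_def by (rule op_left[OF c(1) r0(1)])
  have r1M: "r1 (v i) \<in> M" if "i < m" for i using r0(2)[OF that] M_mult c by (simp add: r1_def)
  have r1m: "eqM (r1 (v m)) \<one>"
   using c r0 op_closed v eqM_sym by (simp add: eqM_def r1_def)
  define k where "k = r1 b"
  have kc: "k \<in> carrier R" using op_closed[OF r1] Suc.prems by (simp add: k_def)
  have key: "eqM (r b) (r (v m) \<otimes> k)" if r: "op r" "\<And>i. i < m ==> r (v i) \<in> M" for r
  proof -
   have rm: "r (v m) \<in> carrier R" using op_closed r v by blast
   \<comment> \<open>Kills \<open>v 0, ..., v m\<close>, hence also \<open>b\<close> by hypothesis;
     read at \<open>b\<close> this says that r b is congruent to r (v m) k.\<close>
   define s where "s w = r w \<oplus> (\<ominus> r (v m)) \<otimes> r1 w" for w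
   have s: "op s" by (rule op.add[OF r(1) op_left[OF _ r1]]) (auto simp: s_def rm)
   have "s (v i) \<in> M" if "i < Suc m" for i
   proof (cases "i = m")
    case True
    have "eqM (r (v m) \<oplus> (\<ominus> r (v m)) \<otimes> r1 (v m)) (r (v m) \<oplus> (\<ominus> r (v m)) \<otimes> \<one>)"
     using rm r1m by (intro eqM_add eqM_left) auto
    then have "eqM (s (v m)) \<zero>" using rm by (simp add: s_def r_neg)
    then show ?thesis using True eqM_memD M_zero by blast
   next
    case False
    then show ?thesis using that r(2) r1M M_add M_mult rm by (auto simp: s_def)
   qed
   then have "s b \<in> M" using Suc.prems(3)[OF s] by blast
   then show ?thesis
    using rm kc op_closed[OF r(1) Suc.prems(2)] by (simp add: eqM_def s_def a_minus_def l_minus flip: k_def)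
  qed
  have kK: "k \<in> K0"
  proof (rule K0I[OF kc])
   fix m' assume m': "m' \<in> M"
   have m'c: "m' \<in> carrier R" using m' M_car by blast
   have op': "op (\<lambda>w. m' \<otimes> r1 w)" by (rule op_left[OF m'c r1])
   have "m' \<otimes> r1 (v i) \<in> M" if "i < Suc m" for i
   proof (cases "i = m")
    case True
    have "eqM (m' \<otimes> r1 (v m)) (m' \<otimes> \<one>)" using eqM_left m'c r1m by blast
    then show ?thesis using True eqM_memD m' m'c by simp
   qed (use that r1M M_mult m'c in auto)
   then show "m' \<otimes> k \<in> M" unfolding k_def using Suc.prems(3)[OF op'] by blast
  next
   fix k' assume k': "k' \<in> K0"
   have k'c: "k' \<in> carrier R" using k' K0_carrier by blast
   \<comment> \<open>Another operator that kills all the \<open>v i\<close>; read at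
     \<open>b\<close> it says that \<open>k\<close> and \<open>k'\<close> commute modulo
     \<open>M\<close>.\<close>
   define s where "s w = r1 w \<otimes> k' \<oplus> (\<ominus> k') \<otimes> r1 w" for w
   have s: "op s" by (rule op.add[OF op_right[OF r1 k'] op_left[OF _ r1]]) (auto simp: s_def k'c)
   have "s (v i) \<in> M" if "i < Suc m" for i
   proof (cases "i = m")
    case True
    have "eqM (r1 (v m) \<otimes> k' \<oplus> (\<ominus> k') \<otimes> r1 (v m)) (\<one> \<otimes> k' \<oplus> (\<ominus> k') \<otimes> \<one>)"
     by (rule eqM_add[OF eqM_right[OF k' r1m] eqM_left[OF _ r1m]]) (simp add: k'c)
    then have "eqM (s (v m)) \<zero>" using k'c by (simp add: s_def r_neg)
    then show ?thesis using True eqM_memD M_zero by blast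
   next
    case False
    then have "i < m" using that by simp
    then show ?thesis
     using M_add[OF K0_Idl[OF k' r1M] M_mult[OF _ r1M]] k'c by (simp add: s_def)
   qed
   then have "s b \<in> M" using Suc.prems(3)[OF s] by blast
   then show "eqM (k \<otimes> k') (k' \<otimes> k)"
    using kc k'c by (simp add: eqM_def s_def a_minus_def l_minus flip: k_def)
  qed
  have vk: "v m \<otimes> k \<in> carrier R" using v kc by simp
  have "b \<ominus> v m \<otimes> k \<in> Sp v m"
  proof (rule Suc.IH)
   fix r assume r: "op r" "\<And>i. i < m ==> r (v i) \<in> M"
   have "eqM (r (v m \<otimes> k)) (r (v m) \<otimes> k)" by (rule op_K0_linear[OF r(1) kK]) (use v in auto)
   then have "eqM (r b) (r (v m \<otimes> k))" using key[OF r] eqM_sym eqM_trans by blast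
   then show "r (b \<ominus> v m \<otimes> k) \<in> M"
    using op_additive[OF r(1) Suc.prems(2), of "\<ominus> (v m \<otimes> k)"] op_inv_val[OF r(1) vk] vk
    by (simp add: eqM_def a_minus_def)
  qed (use v vk Suc.prems(2) in auto)
  then show ?thesis using Sp_Suc[where m = m and v = v, OF v kK Suc.prems(2)] by blast
 qed
qed

text \<open>Density provides an operator that kills the earlier vectors but not \<open>v m\<close>,
  and simplicity adjusts its value there to any prescribed \<open>w\<close>.\<close>

lemma separating_op:
 assumes "\<And>i. i \<le> m ==> v i \<in> carrier R" "v m \<notin> Sp v m" "w \<in> carrier R"
 shows "\<exists>r. op r \<and> (\<forall>i < m. r (v i) \<in> M) \<and> eqM (r (v m)) w"
proof -
 obtain r where r: "op r" "\<And>i. i < m ==> r (v i) \<in> M" "r (v m) \<notin> M"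
  using jacobson_density[of m v "v m"] assms(1,2) by (metis less_imp_le order_refl)
 have rc: "r (v m) \<in> carrier R" using op_closed r(1) assms(1) by blast
 obtain c where c: "c \<in> carrier R" "\<one> \<ominus> c \<otimes> r (v m) \<in> M" using M_max rc r(3) by blast
 then have "eqM (c \<otimes> r (v m)) \<one>" using rc eqM_sym by (simp add: eqM_def)
 then have "eqM (w \<otimes> (c \<otimes> r (v m))) (w \<otimes> \<one>)" using eqM_left assms(3) by blast
 moreover have "op (\<lambda>x. w \<otimes> (c \<otimes> r x))" using op_left assms(3) c(1) r(1) by blast
 moreover have "w \<otimes> (c \<otimes> r (v i)) \<in> M" if "i < m" for i using r(2)[OF that] M_mult assms(3) c(1) by simp
 ultimately show ?thesis using assms(3) by (intro exI[of _ "\<lambda>x. w \<otimes> (c \<otimes> r x)"]) simp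
qed

lemma independent_coefficients:
 assumes "\<And>i. i < n ==> v i \<in> carrier R" "\<And>i. i < n ==> v i \<notin> Sp v i"
  and "\<And>i. i < n ==> \<kappa> i \<in> K0" "(\<Oplus>i \<in> {..<n}. v i \<otimes> \<kappa> i) \<in> M" "i < n"
 shows "\<kappa> i \<in> M"
 using assms
proof (induction n)
 case (Suc n)
 have car: "v i \<otimes> \<kappa> i \<in> carrier R" if "i < Suc n" for i using that Suc.prems K0_carrier by auto
 let ?S = "\<Oplus>i \<in> {..<n}. v i \<otimes> \<kappa> i"
 have S: "?S \<in> carrier R" using car by (intro finsum_closed) auto
 have sum: "(\<Oplus>i \<in> {..<Suc n}. v i \<otimes> \<kappa> i) = v n \<otimes> \<kappa> n \<oplus> ?S"
  using car by (subst lessThan_Suc, subst finsum_insert) auto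
 have "\<kappa> n \<in> M"
 proof (rule ccontr)
  assume "\<kappa> n \<notin> M"
  then obtain c where c: "c \<in> K0" "eqM (\<kappa> n \<otimes> c) \<one>" using K0_inverse Suc.prems(3) by blast
  have cc: "c \<in> carrier R" and nc: "\<kappa> n \<in> carrier R" and vn: "v n \<in> carrier R"
   using c K0_carrier Suc.prems by auto
  have "eqM (v n \<otimes> \<kappa> n \<oplus> ?S \<oplus> \<ominus> ?S) (\<zero> \<oplus> \<ominus> ?S)"
   using Suc.prems(4) sum S M_imp_eqM_zero by (intro eqM_add) auto
  then have "eqM (v n \<otimes> \<kappa> n) (\<ominus> ?S)" using S car[of n] by (simp add: a_assoc r_neg)
  then have "eqM (v n \<otimes> \<kappa> n \<otimes> c) (\<ominus> ?S \<otimes> c)" by (rule eqM_right[OF c(1)])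
  moreover have "eqM (v n \<otimes> \<kappa> n \<otimes> c) (v n)" using eqM_left[OF vn c(2)] vn nc cc by (simp add: m_assoc)
  ultimately have 1: "eqM (v n) (\<ominus> ?S \<otimes> c)" using eqM_sym eqM_trans by blast
  have "\<ominus> ?S \<otimes> c = ?S \<otimes> (\<ominus> c)" using S cc by (simp add: l_minus r_minus)
  also have "\<dots> = (\<Oplus>i \<in> {..<n}. v i \<otimes> \<kappa> i \<otimes> (\<ominus> c))"
   using car cc by (intro finsum_ldistr) auto
  also have "\<dots> = (\<Oplus>i \<in> {..<n}. v i \<otimes> (\<kappa> i \<otimes> (\<ominus> c)))"
   using Suc.prems K0_carrier cc by (intro finsum_cong') (auto simp: m_assoc)
  finally have "v n \<in> Sp v n"
   using 1 Suc.prems(3) c K0_mult K0_inv unfolding Sp_def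
   by (auto intro!: exI[of _ "\<lambda>i. \<kappa> i \<otimes> (\<ominus> c)"])
  then show False using Suc.prems(2) by blast
 qed
 then have vM: "v n \<otimes> \<kappa> n \<in> M" using M_mult Suc.prems(1) by blast
 have "?S \<in> M"
 proof -
  have "(v n \<otimes> \<kappa> n \<oplus> ?S) \<ominus> v n \<otimes> \<kappa> n \<in> M" using vM Suc.prems(4) sum M_minus by simp
  then show ?thesis using S car[of n] by (simp add: a_minus_def a_ac r_neg1 r_neg2 r_neg)
 qed
 then show ?case using Suc `\<kappa> n \<in> M` by (cases "i = n") auto
qed simp

end

section \<open>A multilinear identity bounds the dimension of a simple module\<close>

locale PI_simple_quotient = simple_quotient + multilinear_A: ring R +
 fixes d :: nat and \<gamma> :: "nat list => 'a"
 assumes \<gamma>_closed: "\<gamma> js \<in> carrier R" and \<gamma>_id: "\<gamma> [0..<d] = \<one>"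
  and identity: "y \<in> UNIV \<rightarrow> A0 ==>
   (\<Oplus>js \<in> {js. distinct js \<and> set js = {..<d}}. \<gamma> js \<otimes> nc_monom_eval R y js) = \<zero>"
begin

abbreviation comp :: "(nat => 'a => 'a) => nat list => 'a => 'a"
 where "comp s js w \<equiv> foldr (\<lambda>j x. s j x) js w"

text \<open>The factors come in reverse order, as right multiplications compose.\<close>

definition kprod :: "(nat => 'a) => nat list => 'a"
 where "kprod k js = foldr (\<lambda>j x. x \<otimes> k j) js \<one>"

lemma kprod_K0: "(\<And>j. j \<in> set js ==> k j \<in> K0) ==> kprod k js \<in> K0"
 by (induction js) (auto simp: kprod_def one_K0 K0_mult)

lemma kprod_move:
 assumes "\<And>j. k j \<in> K0"
 shows "eqM (kprod k (us @ j # vs)) (kprod k (j # us @ vs))"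
proof (induction us)
 case Nil
 have "kprod k (j # vs) \<in> K0" using assms by (intro kprod_K0)
 then show ?case using K0_carrier by simp
next
 case (Cons u us)
 have P: "kprod k (us @ vs) \<in> K0" using assms by (intro kprod_K0)
 have c: "kprod k (us @ vs) \<in> carrier R" "k j \<in> carrier R" "k u \<in> carrier R"
  using P assms K0_carrier by auto
 have "eqM (kprod k (us @ j # vs) \<otimes> k u) (kprod k (us @ vs) \<otimes> k j \<otimes> k u)"
  using eqM_right[OF assms[of u] Cons.IH] by (simp add: kprod_def)
 also have "kprod k (us @ vs) \<otimes> k j \<otimes> k u = kprod k (us @ vs) \<otimes> (k j \<otimes> k u)"
  using c by (simp add: m_assoc)
 also have "eqM \<dots> (kprod k (us @ vs) \<otimes> (k u \<otimes> k j))"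
  using eqM_left[OF c(1) K0_eqM_comm] assms by blast
 also have "kprod k (us @ vs) \<otimes> (k u \<otimes> k j) = kprod k (us @ vs) \<otimes> k u \<otimes> k j"
  using c by (simp add: m_assoc)
 finally show ?case by (simp add: kprod_def)
qed

lemma kprod_perm:
 assumes k: "\<And>j. k j \<in> K0" and "mset js = mset ks"
 shows "eqM (kprod k js) (kprod k ks)"
 using assms(2)
proof (induction js arbitrary: ks)
 case Nil
 then show ?case by (simp add: kprod_def)
next
 case (Cons j js)
 then have "j \<in> set ks" by (metis list.set_intros(1) set_mset_mset)
 then obtain us vs where ks: "ks = us @ j # vs" by (meson split_list)
 then have "mset js = mset (us @ vs)" using Cons.prems by simp
 then have "eqM (kprod k js \<otimes> k j) (kprod k (us @ vs) \<otimes> k j)"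
  using eqM_right[OF k] Cons.IH by blast
 then have "eqM (kprod k (j # js)) (kprod k (j # us @ vs))" by (simp add: kprod_def)
 then show ?case unfolding ks by (rule eqM_trans[OF _ eqM_sym[OF kprod_move[OF k]]])
qed

abbreviation "perms \<equiv> {js. distinct js \<and> set js = {..<d}}"

lemma comp_closed: "(\<And>j. j \<in> set js ==> op (s j)) ==> w \<in> carrier R ==> comp s js w \<in> carrier R"
 by (induction js) (auto simp: op_closed)

text \<open>The right factors commute modulo \<open>M\<close>, so every permutation leaves the same
  factor \<open>w \<otimes> ?p\<close>, and what remains is the identity evaluated in
  \<open>A0\<close>.\<close>

lemma identity_gens:
 assumes a: "\<And>j. a j \<in> A0" and k: "\<And>j. k j \<in> K0" and w: "w \<in> carrier R"
  and s: "\<And>j v. j < d ==> v \<in> carrier R ==> s j v = a j \<otimes> (v \<otimes> k j)"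
 shows "(\<Oplus>js \<in> perms. \<gamma> js \<otimes> comp s js w) \<in> M"
proof -
 have ac: "a j \<in> carrier R" and kc: "k j \<in> carrier R" for j using a k A0_carrier K0_carrier by auto
 have mc: "nc_monom_eval R a js \<in> carrier R" for js using ac by (intro nc_monom_eval_closed)
 have pc: "kprod k js \<in> carrier R" for js using k kprod_K0 K0_carrier by blast
 have comp: "comp s js w = nc_monom_eval R a js \<otimes> (w \<otimes> kprod k js)" if "set js \<subseteq> {..<d}" for js
  using that
 proof (induction js)
  case (Cons j js)
  then show ?case using s[of j] ac kc mc pc w by (simp add: kprod_def m_assoc)
 qed (simp add: kprod_def w)
 let ?p = "kprod k [0..<d]"
 have "eqM (\<Oplus>js \<in> perms. \<gamma> js \<otimes> comp s js w)
   (\<Oplus>js \<in> perms. \<gamma> js \<otimes> (nc_monom_eval R a js \<otimes> (w \<otimes> ?p)))"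
 proof (rule eqM_finsum[OF finite_distinct_lists])
  fix js assume js: "js \<in> perms"
  then have "mset js = mset [0..<d]"
   by (metis (mono_tags, lifting) atLeast0LessThan atLeast_upt distinct_upt mem_Collect_eq set_eq_iff_mset_eq_distinct)
  then have "eqM (kprod k js) ?p" by (rule kprod_perm[OF k])
  then show "eqM (\<gamma> js \<otimes> comp s js w) (\<gamma> js \<otimes> (nc_monom_eval R a js \<otimes> (w \<otimes> ?p)))"
   using js comp[of js] mc w \<gamma>_closed by (auto intro!: eqM_left)
 qed
 also have "(\<Oplus>js \<in> perms. \<gamma> js \<otimes> (nc_monom_eval R a js \<otimes> (w \<otimes> ?p)))
   = (\<Oplus>js \<in> perms. \<gamma> js \<otimes> nc_monom_eval R a js \<otimes> (w \<otimes> ?p))"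
  using \<gamma>_closed mc pc w by (intro finsum_cong') (auto simp: m_assoc)
 also have "\<dots> = (\<Oplus>js \<in> perms. \<gamma> js \<otimes> nc_monom_eval R a js) \<otimes> (w \<otimes> ?p)"
  using \<gamma>_closed mc pc w finite_distinct_lists by (intro finsum_ldistr[symmetric]) auto
 also have "\<dots> = \<zero>" using identity[of a] a w pc by simp
 finally show ?thesis using eqM_memD M_zero by blast
qed

text \<open>In a permutation the letter \<open>m\<close> occurs exactly once, so the composition is
  additive in the operator at \<open>m\<close>.\<close>

lemma comp_add:
 assumes "distinct js" "m \<in> set js" "\<And>j. j \<in> set js ==> op (s j)" "op r1" "op r2" "w \<in> carrier R"
  and r: "\<And>v. v \<in> carrier R ==> r v = r1 v \<oplus> r2 v"
 shows "comp (s(m := r)) js w = comp (s(m := r1)) js w \<oplus> comp (s(m := r2)) js w"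
proof -
 obtain us vs where js: "js = us @ m # vs" using assms(2) by (meson split_list)
 have nm: "m \<notin> set us" "m \<notin> set vs" using assms(1) js by auto
 have cong: "comp (s(m := q)) ks x = comp s ks x" if "m \<notin> set ks" for q ks x
  using that by (induction ks) auto
 have x: "comp s vs w \<in> carrier R" using assms(3,6) js by (intro comp_closed) auto
 have us_add: "comp s us (x \<oplus> y) = comp s us x \<oplus> comp s us y \<and> comp s us x \<in> carrier R \<and> comp s us y \<in> carrier R"
  if "x \<in> carrier R" "y \<in> carrier R" "\<And>j. j \<in> set us ==> op (s j)" for x y us
  using that(3) by (induction us) (auto simp: that(1,2) op_additive op_closed)
 show ?thesis
  using us_add[of "r1 (comp s vs w)" "r2 (comp s vs w)" us] assms(3) js x op_closed[OF assms(4) x]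
   op_closed[OF assms(5) x] r[OF x]
  by (simp add: js cong nm del: fun_upd_apply) simp
qed

text \<open>The identity is only known on \<open>A0\<close>; being multilinear, it extends to sums
  of operators a v k. The induction counts the positions that may still hold sums, and each is
  resolved by induction over \<open>op\<close>.\<close>

lemma identity_ops:
 assumes w: "w \<in> carrier R" and "\<And>j. j < d ==> op (s j)"
 shows "(\<Oplus>js \<in> perms. \<gamma> js \<otimes> comp s js w) \<in> M"
proof -
 let ?gen = "\<lambda>r. \<exists>a k. a \<in> A0 \<and> k \<in> K0 \<and> (\<forall>v \<in> carrier R. r v = a \<otimes> (v \<otimes> k))"
 have "(\<Oplus>js \<in> perms. \<gamma> js \<otimes> comp s js w) \<in> M"
  if "m \<le> d" "\<And>j. j < d ==> op (s j)" "\<And>j. m \<le> j ==> j < d ==> ?gen (s j)" for m s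
  using that
 proof (induction m arbitrary: s)
  case 0
  then have "\<forall>j. \<exists>a k. j < d --> a \<in> A0 \<and> k \<in> K0 \<and> (\<forall>v \<in> carrier R. s j v = a \<otimes> (v \<otimes> k))" by blast
  then obtain a k where ak: "\<And>j. j < d ==> a j \<in> A0 \<and> k j \<in> K0 \<and> (\<forall>v \<in> carrier R. s j v = a j \<otimes> (v \<otimes> k j))"
   by metis
  show ?case
   by (rule identity_gens[of "\<lambda>j. if j < d then a j else \<zero>" "\<lambda>j. if j < d then k j else \<one>", OF _ _ w])
    (use ak A0_zero one_K0 in auto)
 next
  case (Suc m)
  have md: "m < d" using Suc.prems by simp
  have "(\<Oplus>js \<in> perms. \<gamma> js \<otimes> comp (s(m := r)) js w) \<in> M" if "op r" for r
   using that
  proof (induction rule: op.induct)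
   case (gen a k r)
   have opr: "op r" by (rule op.gen[OF gen])
   show ?case
   proof (rule Suc.IH)
    show "?gen ((s(m := r)) j)" if "m \<le> j" "j < d" for j
     using that gen Suc.prems(3)[of j] by (cases "j = m") auto
   qed (use Suc.prems opr md in auto)
  next
   case (add r1 r2 r)
   have oc: "comp (s(m := q)) js w \<in> carrier R" if "op q" "js \<in> perms" for q js
    using that w Suc.prems(2) by (intro comp_closed) auto
   have "(\<Oplus>js \<in> perms. \<gamma> js \<otimes> comp (s(m := r)) js w)
     = (\<Oplus>js \<in> perms. \<gamma> js \<otimes> comp (s(m := r1)) js w \<oplus> \<gamma> js \<otimes> comp (s(m := r2)) js w)"
   proof (intro finsum_cong' refl)
    fix js assume js: "js \<in> perms"
    have "comp (s(m := r)) js w = comp (s(m := r1)) js w \<oplus> comp (s(m := r2)) js w"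
     using js md Suc.prems(2) w add by (intro comp_add) auto
    then show "\<gamma> js \<otimes> comp (s(m := r)) js w
      = \<gamma> js \<otimes> comp (s(m := r1)) js w \<oplus> \<gamma> js \<otimes> comp (s(m := r2)) js w"
     using oc add js \<gamma>_closed by (simp add: r_distr)
   qed (use oc add \<gamma>_closed in auto)
   also have "\<dots> = (\<Oplus>js \<in> perms. \<gamma> js \<otimes> comp (s(m := r1)) js w)
     \<oplus> (\<Oplus>js \<in> perms. \<gamma> js \<otimes> comp (s(m := r2)) js w)"
    using oc add \<gamma>_closed by (intro finsum_addf) auto
   finally show ?case using add M_add by simp
  qed
  from this[of "s m"] show ?case using Suc.prems(2)[OF md] by simp
 qed
 from this[of d s] show ?thesis using assms by simp
qed

text \<open>A staircase argument: operators that kill the vectors before \<open>u i\<close> and send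
  \<open>u i\<close> to \<open>u (Suc i)\<close> compose to something nonzero in one order only.
  With \<open>d\<close> independent vectors the identity then reduces to its term of coefficient 1
  and puts 1 into \<open>M\<close>.\<close>

lemma dimension_bound:
 assumes v: "\<And>i. i < d ==> v i \<in> carrier R" "\<And>i. i < d ==> v i \<notin> Sp v i"
 shows False
proof -
 \<comment> \<open>The \<open>d\<close> independent vectors are followed by 1, the top of the
   staircase, which is not in \<open>M\<close>.\<close>
 define u where "u = v(d := \<one>)"
 have u: "u i \<in> carrier R" if "i \<le> d" for i using that v by (auto simp: u_def)
 have Sp_cong: "Sp u i = Sp v i" if "i \<le> d" for i
 proof -
  have "(\<Oplus>j \<in> {..<i}. u j \<otimes> \<kappa> j) = (\<Oplus>j \<in> {..<i}. v j \<otimes> \<kappa> j)" if "\<forall>j < i. \<kappa> j \<in> K0" for \<kappa>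
   using that `i \<le> d` v K0_carrier by (intro finsum_cong') (auto simp: u_def)
  then show ?thesis unfolding Sp_def by auto
 qed
 have "\<exists>r. op r \<and> (\<forall>j < i. r (u j) \<in> M) \<and> eqM (r (u i)) (u (Suc i))" if i: "i < d" for i
 proof (rule separating_op)
  show "u j \<in> carrier R" if "j \<le> i" for j using u that i by simp
  have "u i = v i" using i by (simp add: u_def)
  then show "u i \<notin> Sp u i" using v(2)[OF i] Sp_cong[of i] i by simp
  show "u (Suc i) \<in> carrier R" using u i by simp
 qed
 then obtain r where r: "\<And>i. i < d ==> op (r i)" "\<And>i j. i < d ==> j < i ==> r i (u j) \<in> M"
  "\<And>i. i < d ==> eqM (r i (u i)) (u (Suc i))" by metis
 \<comment> \<open>\<open>comp\<close> applies the last letter of a list first, so the operators are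
   numbered backwards to make \<open>[0..<d]\<close> the surviving order.\<close>
 define s where "s j = r (d - 1 - j)" for j
 have s: "op (s j)" if "j < d" for j using that r(1) by (simp add: s_def)
 have u0: "u 0 \<in> carrier R" using u by simp
 \<comment> \<open>A list survives only as a final segment of \<open>[0..<d]\<close>: after
   \<open>l\<close> letters the value is \<open>u l\<close>, and every remaining letter but one
   carries an operator from further up the staircase, which kills \<open>u l\<close>.\<close>
 have step: "comp s ks (u 0) \<in> M \<or> ks = [d - length ks..<d] \<and> eqM (comp s ks (u 0)) (u (length ks))"
  if "distinct ks" "set ks \<subseteq> {..<d}" for ks
  using that
 proof (induction ks)
  case Nil
  then show ?case using u0 by simp
 next
  case (Cons j ks)
  have jd: "j < d" using Cons.prems by simp
  have len: "length (j # ks) \<le> d"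
   using Cons.prems card_mono[of "{..<d}" "set (j # ks)"] distinct_card[of "j # ks"] by simp
  consider "comp s ks (u 0) \<in> M" | "ks = [d - length ks..<d]" "eqM (comp s ks (u 0)) (u (length ks))"
   using Cons by auto
  then show ?case
  proof cases
   case 1
   then show ?thesis using op_M[OF s[OF jd]] by simp
  next
   case 2
   define l where "l = length ks"
   have ld: "l < d" using len by (simp add: l_def)
   have "j \<notin> set ks" using Cons.prems by simp
   then have "j < d - l" using 2(1) jd unfolding l_def by (metis atLeastLessThan_iff not_less set_upt)
   have e: "eqM (s j (comp s ks (u 0))) (s j (u l))" using op_eqM[OF s[OF jd] 2(2)] by (simp add: l_def)
   show ?thesis
   proof (cases "j = d - 1 - l")
    case True
    then have "s j = r l" using ld by (simp add: s_def)
    then have "eqM (comp s (j # ks) (u 0)) (u (Suc l))" using e r(3)[OF ld] eqM_trans by auto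
    moreover have "j # ks = [d - Suc l..<d]"
     using True ld 2(1) upt_conv_Cons[of "d - Suc l" d] by (simp add: l_def Suc_diff_Suc)
    ultimately show ?thesis unfolding l_def length_Cons by blast
   next
    case False
    then have "l < d - 1 - j" "d - 1 - j < d" using `j < d - l` by auto
    then have "s j (u l) \<in> M" using r(2) by (simp add: s_def)
    then show ?thesis using e eqM_memD by simp
   qed
  qed
 qed
 have other: "comp s js (u 0) \<in> M" if "js \<in> perms - {[0..<d]}" for js
 proof -
  have "length js = d" using that distinct_card[of js] by auto
  then show ?thesis using step[of js] that by auto
 qed
 have "eqM (comp s [d - l..<d] (u 0)) (u l)" if "l \<le> d" for l
  using that
 proof (induction l)
  case (Suc l)
  then have ld: "l < d" by simp
  have "[d - Suc l..<d] = (d - Suc l) # [d - l..<d]"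
   using ld upt_conv_Cons[of "d - Suc l" d] by (simp add: Suc_diff_Suc)
  moreover have "s (d - Suc l) = r l" using ld by (simp add: s_def)
  moreover have "eqM (r l (comp s [d - l..<d] (u 0))) (r l (u l))"
   using Suc ld by (intro op_eqM[OF r(1)]) auto
  ultimately show ?case using eqM_trans r(3)[OF ld] by simp
 qed (simp add: u0)
 from this[of d] have id: "eqM (comp s [0..<d] (u 0)) (u d)" by simp
 have cc: "comp s js (u 0) \<in> carrier R" if "js \<in> perms" for js
  using that s u0 by (intro comp_closed) auto
 have idp: "[0..<d] \<in> perms" by auto
 have "(\<Oplus>js \<in> perms. \<gamma> js \<otimes> comp s js (u 0)) =
   \<gamma> [0..<d] \<otimes> comp s [0..<d] (u 0) \<oplus> (\<Oplus>js \<in> perms - {[0..<d]}. \<gamma> js \<otimes> comp s js (u 0))"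
  using cc \<gamma>_closed idp finite_distinct_lists
  by (subst insert_Diff[OF idp, symmetric], intro finsum_insert) auto
 moreover have partM: "(\<Oplus>js \<in> J. \<gamma> js \<otimes> comp s js (u 0)) \<in> M" if "finite J" "J \<subseteq> perms - {[0..<d]}" for J
  using that
 proof (induction J rule: finite_induct)
  case (insert js J)
  have "(\<Oplus>js \<in> insert js J. \<gamma> js \<otimes> comp s js (u 0))
    = \<gamma> js \<otimes> comp s js (u 0) \<oplus> (\<Oplus>js \<in> J. \<gamma> js \<otimes> comp s js (u 0))"
   using insert.hyps insert.prems cc \<gamma>_closed by (intro finsum_insert) auto
  moreover have "\<gamma> js \<otimes> comp s js (u 0) \<in> M" using insert.prems other M_mult \<gamma>_closed by auto
  ultimately show ?case using insert M_add by auto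
 qed (simp add: M_zero)
 then have rest: "(\<Oplus>js \<in> perms - {[0..<d]}. \<gamma> js \<otimes> comp s js (u 0)) \<in> M"
  by (intro partM finite_Diff finite_distinct_lists subset_refl)
 moreover have "(\<Oplus>js \<in> perms. \<gamma> js \<otimes> comp s js (u 0)) \<in> M"
  using s by (intro identity_ops[OF u0])
 ultimately have sumM: "comp s [0..<d] (u 0) \<oplus> (\<Oplus>js \<in> perms - {[0..<d]}. \<gamma> js \<otimes> comp s js (u 0)) \<in> M"
  using cc[OF idp] by (simp add: \<gamma>_id)
 have "comp s [0..<d] (u 0) \<in> M"
 proof -
  have "(comp s [0..<d] (u 0) \<oplus> (\<Oplus>js \<in> perms - {[0..<d]}. \<gamma> js \<otimes> comp s js (u 0)))
    \<ominus> (\<Oplus>js \<in> perms - {[0..<d]}. \<gamma> js \<otimes> comp s js (u 0)) \<in> M"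
   by (rule M_minus[OF sumM rest])
  then show ?thesis using cc[OF idp] M_car[OF rest] by (simp add: a_minus_def a_assoc r_neg)
 qed
 then have "u d \<in> M" using id eqM_memD eqM_sym by blast
 then show False using one_M by (simp add: u_def)
qed

text \<open>Vectors outside the span of the earlier ones are added as long as possible, and
  \<open>dimension_bound\<close> stops this before there are \<open>d\<close> of them.\<close>

lemma ex_basis: "\<exists>n \<le> d. \<exists>v. (\<forall>i < n. v i \<in> carrier R \<and> v i \<notin> Sp v i) \<and> carrier R \<subseteq> Sp v n"
proof (rule ccontr)
 assume not: "\<not> ?thesis"
 have "\<exists>v. \<forall>i < n. v i \<in> carrier R \<and> v i \<notin> Sp v i" if "n \<le> d" for n
  using that
 proof (induction n)
  case (Suc n)
  then obtain v where v: "\<forall>i < n. v i \<in> carrier R \<and> v i \<notin> Sp v i" by auto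
  then obtain b where b: "b \<in> carrier R" "b \<notin> Sp v n" using not Suc.prems by (metis Suc_leD subsetI)
  define w where "w = v(n := b)"
  have "Sp w i = Sp v i" if "i \<le> n" for i
  proof -
   have "(\<Oplus>j \<in> {..<i}. w j \<otimes> \<kappa> j) = (\<Oplus>j \<in> {..<i}. v j \<otimes> \<kappa> j)" if "\<forall>j < i. \<kappa> j \<in> K0" for \<kappa>
    using that `i \<le> n` v K0_carrier by (intro finsum_cong') (auto simp: w_def)
   then show ?thesis unfolding Sp_def by auto
  qed
  then have "\<forall>i < Suc n. w i \<in> carrier R \<and> w i \<notin> Sp w i"
   using v b by (auto simp: w_def less_Suc_eq)
  then show ?case by blast
 qed simp
 from this[of d] show False using dimension_bound by auto
qed

text \<open>Left multiplication by \<open>A0\<close> is linear for the right action of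
  \<open>K0\<close>, and \<open>\<phi> a\<close> is its matrix in a basis of \<open>R/M\<close>. For
  the last clause, an element with zero matrix kills every vector of the module, the class of
  \<open>t\<close> included.\<close>

theorem ex_matrix_hom:
 obtains n \<phi> where "n \<le> d"
  "\<And>a i j. a \<in> A0 ==> i < n ==> j < n ==> \<phi> a i j \<in> carrier K"
  "\<And>i j. i < n ==> j < n ==> \<phi> \<one> i j = (if i = j then \<one>\<^bsub>K\<^esub> else \<zero>\<^bsub>K\<^esub>)"
  "\<And>a b i j. a \<in> A0 ==> b \<in> A0 ==> i < n ==> j < n ==> a \<oplus> b \<in> A0 ==>
   \<phi> (a \<oplus> b) i j = \<phi> a i j \<oplus>\<^bsub>K\<^esub> \<phi> b i j"
  "\<And>a b i j. a \<in> A0 ==> b \<in> A0 ==> i < n ==> j < n ==>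
   \<phi> (a \<otimes> b) i j = (\<Oplus>\<^bsub>K\<^esub>l \<in> {..<n}. \<phi> a i l \<otimes>\<^bsub>K\<^esub> \<phi> b l j)"
  "\<And>a. a \<in> A0 ==> a \<otimes> t \<notin> M ==> \<exists>i < n. \<exists>j < n. \<phi> a i j \<noteq> \<zero>\<^bsub>K\<^esub>"
proof -
 interpret K: field K by (rule K_field)
 obtain n v where n: "n \<le> d" and v: "\<And>i. i < n ==> v i \<in> carrier R" "\<And>i. i < n ==> v i \<notin> Sp v i"
  and span: "carrier R \<subseteq> Sp v n" using ex_basis by blast
 have "\<exists>\<kappa>. (\<forall>i < n. \<kappa> i \<in> K0) \<and> eqM b (\<Oplus>i \<in> {..<n}. v i \<otimes> \<kappa> i)" if "b \<in> carrier R" for b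
  using span that by (auto simp: Sp_def)
 then obtain \<kappa> where \<kappa>: "\<And>b i. b \<in> carrier R ==> i < n ==> \<kappa> b i \<in> K0"
  "\<And>b. b \<in> carrier R ==> eqM b (\<Oplus>i \<in> {..<n}. v i \<otimes> \<kappa> b i)" by metis
 \<comment> \<open>Coordinates are unique only modulo \<open>M\<close>, so they are compared after
   \<open>\<pi>\<close>.\<close>
 have uniq: "\<pi> (\<kappa> b i) = \<pi> (l i)"
  if b: "b \<in> carrier R" and l: "\<And>i. i < n ==> l i \<in> K0" and e: "eqM b (\<Oplus>i \<in> {..<n}. v i \<otimes> l i)"
   and i: "i < n" for b l i
 proof -
  have lc: "l i \<in> carrier R" "\<kappa> b i \<in> carrier R" if "i < n" for i using that l \<kappa>(1)[OF b] K0_carrier by auto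
  have "(\<Oplus>i \<in> {..<n}. v i \<otimes> (\<kappa> b i \<oplus> (\<ominus> \<one>) \<otimes> l i))
    = (\<Oplus>i \<in> {..<n}. v i \<otimes> \<kappa> b i \<oplus> v i \<otimes> l i \<otimes> (\<ominus> \<one>))"
   using v lc by (intro finsum_cong') (auto simp: r_distr r_minus l_minus)
  also have "\<dots> = (\<Oplus>i \<in> {..<n}. v i \<otimes> \<kappa> b i) \<oplus> (\<Oplus>i \<in> {..<n}. v i \<otimes> l i \<otimes> (\<ominus> \<one>))"
   using v lc by (intro finsum_addf) auto
  also have "(\<Oplus>i \<in> {..<n}. v i \<otimes> l i \<otimes> (\<ominus> \<one>)) = (\<Oplus>i \<in> {..<n}. v i \<otimes> l i) \<otimes> (\<ominus> \<one>)"
   using v lc by (intro finsum_ldistr[symmetric]) auto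
  finally have "(\<Oplus>i \<in> {..<n}. v i \<otimes> (\<kappa> b i \<oplus> (\<ominus> \<one>) \<otimes> l i))
    = (\<Oplus>i \<in> {..<n}. v i \<otimes> \<kappa> b i) \<ominus> (\<Oplus>i \<in> {..<n}. v i \<otimes> l i)"
   using v lc by (simp add: a_minus_def r_minus finsum_closed Pi_def)
  also have "\<dots> \<in> M"
   using eqM_trans[OF eqM_sym[OF \<kappa>(2)[OF b]] e] by (simp add: eqM_def)
  finally have "\<kappa> b i \<oplus> (\<ominus> \<one>) \<otimes> l i \<in> M"
   using v l \<kappa>(1)[OF b] K0_add K0_inv K0_mult one_K0 i
   by (intro independent_coefficients[of n v "\<lambda>i. \<kappa> b i \<oplus> (\<ominus> \<one>) \<otimes> l i"]) auto
  then have "eqM (\<kappa> b i) (l i)" using lc i by (simp add: eqM_def a_minus_def l_minus)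
  then show ?thesis using \<pi>_eq_iff l \<kappa>(1)[OF b] i by blast
 qed
 have \<pi>_sum: "\<pi> (\<Oplus>l \<in> J. f l) = (\<Oplus>\<^bsub>K\<^esub>l \<in> J. \<pi> (f l)) \<and> (\<Oplus>l \<in> J. f l) \<in> K0"
  if "finite J" "\<And>l. l \<in> J ==> f l \<in> K0" for f and J :: "nat set"
  using that
 proof (induction J rule: finite_induct)
  case (insert l J)
  then have "(\<Oplus>l \<in> insert l J. f l) = f l \<oplus> (\<Oplus>l \<in> J. f l)"
   using K0_carrier by (intro finsum_insert) auto
  moreover have "(\<Oplus>\<^bsub>K\<^esub>l \<in> insert l J. \<pi> (f l)) = \<pi> (f l) \<oplus>\<^bsub>K\<^esub> (\<Oplus>\<^bsub>K\<^esub>l \<in> J. \<pi> (f l))"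
   using insert \<pi>_simps(1) by (intro K.finsum_insert) auto
  ultimately show ?case using insert K0_add by (simp add: \<pi>_simps)
 qed (simp add: \<pi>_zero M_K0[OF M_zero])
 define \<phi> where "\<phi> a i j = \<pi> (\<kappa> (a \<otimes> v j) i)" for a i j
 have av: "a \<otimes> v j \<in> carrier R" if "a \<in> A0" "j < n" for a j using that v A0_carrier by auto
 have f1: "\<phi> a i j \<in> carrier K" if "a \<in> A0" "i < n" "j < n" for a i j
  using \<kappa>(1) av that by (auto simp: \<phi>_def \<pi>_simps)
 have f2: "\<phi> \<one> i j = (if i = j then \<one>\<^bsub>K\<^esub> else \<zero>\<^bsub>K\<^esub>)" if ij: "i < n" "j < n" for i j
 proof -
  have "(\<Oplus>i \<in> {..<n}. v i \<otimes> (if i = j then \<one> else \<zero>)) = (\<Oplus>i \<in> {..<n}. if j = i then v i else \<zero>)"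
   using v by (intro finsum_cong') auto
  also have "\<dots> = v j" using v ij by (intro finsum_singleton) auto
  finally have "eqM (\<one> \<otimes> v j) (\<Oplus>i \<in> {..<n}. v i \<otimes> (if i = j then \<one> else \<zero>))" using v ij by simp
  then have "\<pi> (\<kappa> (\<one> \<otimes> v j) i) = \<pi> (if i = j then \<one> else \<zero>)"
   using v ij one_K0 M_K0[OF M_zero] by (intro uniq) auto
  then show ?thesis by (simp add: \<phi>_def \<pi>_simps \<pi>_zero)
 qed
 have f3: "\<phi> (a \<oplus> b) i j = \<phi> a i j \<oplus>\<^bsub>K\<^esub> \<phi> b i j"
  if ab: "a \<in> A0" "b \<in> A0" and ij: "i < n" "j < n" and abA: "a \<oplus> b \<in> A0" for a b i j
 proof -
  have c: "\<kappa> (a \<otimes> v j) l \<in> K0" "\<kappa> (b \<otimes> v j) l \<in> K0" if "l < n" for l using that \<kappa>(1) av ab ij by auto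
  have "(\<Oplus>l \<in> {..<n}. v l \<otimes> (\<kappa> (a \<otimes> v j) l \<oplus> \<kappa> (b \<otimes> v j) l))
    = (\<Oplus>l \<in> {..<n}. v l \<otimes> \<kappa> (a \<otimes> v j) l \<oplus> v l \<otimes> \<kappa> (b \<otimes> v j) l)"
   using v c K0_carrier by (intro finsum_cong') (auto simp: r_distr)
  also have "\<dots> = (\<Oplus>l \<in> {..<n}. v l \<otimes> \<kappa> (a \<otimes> v j) l) \<oplus> (\<Oplus>l \<in> {..<n}. v l \<otimes> \<kappa> (b \<otimes> v j) l)"
   using v c K0_carrier by (intro finsum_addf) auto
  finally have "eqM ((a \<oplus> b) \<otimes> v j) (\<Oplus>l \<in> {..<n}. v l \<otimes> (\<kappa> (a \<otimes> v j) l \<oplus> \<kappa> (b \<otimes> v j) l))"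
   using eqM_add[OF \<kappa>(2)[OF av[OF ab(1) ij(2)]] \<kappa>(2)[OF av[OF ab(2) ij(2)]]] ab A0_carrier v ij
   by (simp add: l_distr)
  then have "\<pi> (\<kappa> ((a \<oplus> b) \<otimes> v j) i) = \<pi> (\<kappa> (a \<otimes> v j) i \<oplus> \<kappa> (b \<otimes> v j) i)"
   using av[OF abA] ij c K0_add by (intro uniq) auto
  then show ?thesis using c ij by (simp add: \<phi>_def \<pi>_simps)
 qed
 have f4: "\<phi> (a \<otimes> b) i j = (\<Oplus>\<^bsub>K\<^esub>l \<in> {..<n}. \<phi> a i l \<otimes>\<^bsub>K\<^esub> \<phi> b l j)"
  if ab: "a \<in> A0" "b \<in> A0" and ij: "i < n" "j < n" for a b i j
 proof -
  have ac: "a \<in> carrier R" "b \<in> carrier R" using ab A0_carrier by auto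
  have cb: "\<kappa> (b \<otimes> v j) l \<in> K0" if "l < n" for l using that \<kappa>(1) av ab ij by auto
  have ca: "\<kappa> (a \<otimes> v l) h \<in> K0" if "l < n" "h < n" for l h using that \<kappa>(1) av ab ij by auto
  note cc = K0_carrier[OF cb] K0_carrier[OF ca]
  let ?s = "\<lambda>h. \<Oplus>l \<in> {..<n}. \<kappa> (a \<otimes> v l) h \<otimes> \<kappa> (b \<otimes> v j) l"
  have sK: "?s h \<in> K0" "\<pi> (?s h) = (\<Oplus>\<^bsub>K\<^esub>l \<in> {..<n}. \<pi> (\<kappa> (a \<otimes> v l) h \<otimes> \<kappa> (b \<otimes> v j) l))" if "h < n" for h
   using \<pi>_sum[of "{..<n}" "\<lambda>l. \<kappa> (a \<otimes> v l) h \<otimes> \<kappa> (b \<otimes> v j) l"] that ca cb K0_mult by auto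
  have "eqM (a \<otimes> (b \<otimes> v j)) (a \<otimes> (\<Oplus>l \<in> {..<n}. v l \<otimes> \<kappa> (b \<otimes> v j) l))"
   using eqM_left[OF ac(1)] \<kappa>(2) av ab ij by blast
  also have "a \<otimes> (\<Oplus>l \<in> {..<n}. v l \<otimes> \<kappa> (b \<otimes> v j) l) = (\<Oplus>l \<in> {..<n}. a \<otimes> (v l \<otimes> \<kappa> (b \<otimes> v j) l))"
   using v cc ac by (intro finsum_rdistr) auto
  also have "eqM \<dots> (\<Oplus>l \<in> {..<n}. (\<Oplus>h \<in> {..<n}. v h \<otimes> \<kappa> (a \<otimes> v l) h) \<otimes> \<kappa> (b \<otimes> v j) l)"
  proof (rule eqM_finsum)
   fix l assume "l \<in> {..<n}"
   then have l: "l < n" by simp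
   have "eqM ((a \<otimes> v l) \<otimes> \<kappa> (b \<otimes> v j) l) ((\<Oplus>h \<in> {..<n}. v h \<otimes> \<kappa> (a \<otimes> v l) h) \<otimes> \<kappa> (b \<otimes> v j) l)"
    using eqM_right[OF cb[OF l]] \<kappa>(2) av ab l by blast
   then show "eqM (a \<otimes> (v l \<otimes> \<kappa> (b \<otimes> v j) l)) ((\<Oplus>h \<in> {..<n}. v h \<otimes> \<kappa> (a \<otimes> v l) h) \<otimes> \<kappa> (b \<otimes> v j) l)"
    using ac v cc l by (simp add: m_assoc)
  qed simp
  also have "(\<Oplus>l \<in> {..<n}. (\<Oplus>h \<in> {..<n}. v h \<otimes> \<kappa> (a \<otimes> v l) h) \<otimes> \<kappa> (b \<otimes> v j) l)
    = (\<Oplus>l \<in> {..<n}. \<Oplus>h \<in> {..<n}. v h \<otimes> (\<kappa> (a \<otimes> v l) h \<otimes> \<kappa> (b \<otimes> v j) l))"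
  proof (intro finsum_cong' refl)
   fix l assume "l \<in> {..<n}"
   then have l: "l < n" by simp
   have "(\<Oplus>h \<in> {..<n}. v h \<otimes> \<kappa> (a \<otimes> v l) h) \<otimes> \<kappa> (b \<otimes> v j) l
     = (\<Oplus>h \<in> {..<n}. v h \<otimes> \<kappa> (a \<otimes> v l) h \<otimes> \<kappa> (b \<otimes> v j) l)"
    using v cc l by (intro finsum_ldistr) auto
   also have "\<dots> = (\<Oplus>h \<in> {..<n}. v h \<otimes> (\<kappa> (a \<otimes> v l) h \<otimes> \<kappa> (b \<otimes> v j) l))"
    using v cc l by (intro finsum_cong') (auto simp: m_assoc)
   finally show "(\<Oplus>h \<in> {..<n}. v h \<otimes> \<kappa> (a \<otimes> v l) h) \<otimes> \<kappa> (b \<otimes> v j) l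
     = (\<Oplus>h \<in> {..<n}. v h \<otimes> (\<kappa> (a \<otimes> v l) h \<otimes> \<kappa> (b \<otimes> v j) l))" .
  qed (use v cc in \<open>auto intro!: finsum_closed\<close>)
  also have "\<dots> = (\<Oplus>h \<in> {..<n}. \<Oplus>l \<in> {..<n}. v h \<otimes> (\<kappa> (a \<otimes> v l) h \<otimes> \<kappa> (b \<otimes> v j) l))"
   using v cc by (intro add.finprod_swap) auto
  also have "\<dots> = (\<Oplus>h \<in> {..<n}. v h \<otimes> ?s h)"
   using v cc by (intro finsum_cong' finsum_rdistr[symmetric]) (auto intro!: finsum_closed)
  finally have "eqM ((a \<otimes> b) \<otimes> v j) (\<Oplus>h \<in> {..<n}. v h \<otimes> ?s h)" using ac v ij by (simp add: m_assoc)
  then have "\<pi> (\<kappa> ((a \<otimes> b) \<otimes> v j) i) = \<pi> (?s i)"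
   using av A0_mult ab ij sK(1) by (intro uniq) auto
  also have "\<dots> = (\<Oplus>\<^bsub>K\<^esub>l \<in> {..<n}. \<phi> a i l \<otimes>\<^bsub>K\<^esub> \<phi> b l j)"
   unfolding sK(2)[OF ij(1)] using ca cb ij
   by (intro K.finsum_cong') (auto simp: \<phi>_def \<pi>_simps)
  finally show ?thesis by (simp add: \<phi>_def)
 qed
 have f5: "\<exists>i < n. \<exists>j < n. \<phi> a i j \<noteq> \<zero>\<^bsub>K\<^esub>" if a: "a \<in> A0" "a \<otimes> t \<notin> M" for a
 proof (rule ccontr)
  assume "\<not> ?thesis"
  then have z: "\<phi> a i j = \<zero>\<^bsub>K\<^esub>" if "i < n" "j < n" for i j using that by blast
  have ac: "a \<in> carrier R" using a A0_carrier by auto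
  have "\<kappa> (a \<otimes> v j) i \<in> M" if "i < n" "j < n" for i j
  proof -
   have "\<pi> (\<kappa> (a \<otimes> v j) i) = \<pi> \<zero>" using z[OF that] by (simp add: \<phi>_def \<pi>_zero)
   then have "eqM (\<kappa> (a \<otimes> v j) i) \<zero>" using \<pi>_eq_iff \<kappa>(1) av a that M_K0[OF M_zero] by blast
   then show ?thesis using eqM_memD M_zero by blast
  qed
  then have "eqM (\<Oplus>i \<in> {..<n}. v i \<otimes> \<kappa> (a \<otimes> v j) i) (\<Oplus>i \<in> {..<n}. \<zero>)" if "j < n" for j
   using that v M_mult M_imp_eqM_zero by (intro eqM_finsum) auto
  then have aM: "a \<otimes> v j \<in> M" if "j < n" for j
   using that eqM_trans[OF \<kappa>(2)[OF av[OF a(1) that]]] eqM_memD M_zero by auto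
  have tc: "\<kappa> t j \<in> K0" if "j < n" for j using \<kappa>(1) t_car that by blast
  have "eqM (a \<otimes> t) (a \<otimes> (\<Oplus>i \<in> {..<n}. v i \<otimes> \<kappa> t i))" using eqM_left ac \<kappa>(2) t_car by blast
  also have "a \<otimes> (\<Oplus>i \<in> {..<n}. v i \<otimes> \<kappa> t i) = (\<Oplus>i \<in> {..<n}. a \<otimes> (v i \<otimes> \<kappa> t i))"
   using ac v tc K0_carrier by (intro finsum_rdistr) auto
  also have "eqM \<dots> (\<Oplus>i \<in> {..<n}. \<zero>)"
  proof (rule eqM_finsum)
   fix i assume "i \<in> {..<n}"
   then have i: "i < n" by simp
   have "a \<otimes> v i \<otimes> \<kappa> t i \<in> M" using K0_Idl tc aM i by blast
   then show "eqM (a \<otimes> (v i \<otimes> \<kappa> t i)) \<zero>"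
    using M_imp_eqM_zero ac v tc K0_carrier i by (simp add: m_assoc)
  qed simp
  finally have "a \<otimes> t \<in> M" using eqM_memD M_zero by simp
  then show False using a by blast
 qed
 show ?thesis by (rule that[OF n f1 f2 f3 f4 f5])
qed

end

text \<open>Zorn's lemma for sets of pairwise related elements; with commutation modulo
  \<open>M\<close> as the relation it supplies \<open>K0\<close>.\<close>

lemma ex_maximal_related:
 assumes refl: "\<And>k. k \<in> D ==> r k k" and sym: "\<And>k l. k \<in> D ==> l \<in> D ==> r k l ==> r l k"
 shows "\<exists>C \<subseteq> D. (\<forall>k \<in> C. \<forall>l \<in> C. r k l) \<and> (\<forall>k \<in> D. (\<forall>l \<in> C. r k l) --> k \<in> C)"
proof -
 let ?P = "{C. C \<subseteq> D \<and> (\<forall>k \<in> C. \<forall>l \<in> C. r k l)}"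
 have "\<exists>C \<in> ?P. \<forall>C' \<in> ?P. C \<subseteq> C' --> C' = C"
 proof (rule subset_Zorn_nonempty)
  show "?P \<noteq> {}" by blast
  fix \<C> assume "\<C> \<noteq> {}" and C: "subset.chain ?P \<C>"
  have "r k l" if "k \<in> \<Union>\<C>" "l \<in> \<Union>\<C>" for k l
  proof -
   obtain A B where AB: "A \<in> \<C>" "B \<in> \<C>" "k \<in> A" "l \<in> B" using `k \<in> \<Union>\<C>` `l \<in> \<Union>\<C>` by blast
   have "A \<in> ?P" "B \<in> ?P" "A \<subseteq> B \<or> B \<subseteq> A" using C AB unfolding subset_chain_def by blast+
   then show ?thesis using AB by blast
  qed
  moreover have "\<Union>\<C> \<subseteq> D" using C unfolding subset_chain_def by blast
  ultimately show "\<Union>\<C> \<in> ?P" by blast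
 qed
 then obtain C where CP: "C \<in> ?P" and max: "\<forall>C' \<in> ?P. C \<subseteq> C' --> C' = C" by (elim bexE)
 have C: "C \<subseteq> D" "\<forall>k \<in> C. \<forall>l \<in> C. r k l" using CP by simp_all
 have "k \<in> C" if k: "k \<in> D" "\<forall>l \<in> C. r k l" for k
 proof -
  have "\<forall>l \<in> C. r l k" using k C(1) sym by blast
  then have "insert k C \<in> ?P" using k C(1,2) refl by blast
  then have "insert k C = C" using max by blast
  then show ?thesis by blast
 qed
 then show ?thesis using C(1,2) by blast
qed

context ring
begin

lemma left_ideal_inv: "left_ideal I ==> x \<in> I ==> \<ominus> x \<in> I"
proof -
 assume I: "left_ideal I" "x \<in> I"
 then have "(\<ominus> \<one>) \<otimes> x \<in> I" by (auto simp: left_ideal_def)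
 moreover have "x \<in> carrier R" using I by (auto simp: left_ideal_def)
 ultimately show ?thesis by (simp add: l_minus)
qed

lemma left_ideal_extend:
 assumes I: "left_ideal I" and b: "b \<in> carrier R"
 shows "left_ideal {m \<oplus> c \<otimes> b |m c. m \<in> I \<and> c \<in> carrier R}" (is "left_ideal ?J")
  "I \<subseteq> {m \<oplus> c \<otimes> b |m c. m \<in> I \<and> c \<in> carrier R}" "b \<in> {m \<oplus> c \<otimes> b |m c. m \<in> I \<and> c \<in> carrier R}"
proof -
 have Ic: "m \<in> carrier R" if "m \<in> I" for m using I that by (auto simp: left_ideal_def)
 have I0: "\<zero> \<in> I" and Ia: "x \<in> I ==> y \<in> I ==> x \<oplus> y \<in> I" and Im: "a \<in> carrier R ==> x \<in> I ==> a \<otimes> x \<in> I" for x y a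
  using I by (auto simp: left_ideal_def)
 show "I \<subseteq> ?J"
 proof
  fix m assume m: "m \<in> I"
  then have "m = m \<oplus> \<zero> \<otimes> b" using Ic b by simp
  then show "m \<in> ?J" using m by blast
 qed
 have "b = \<zero> \<oplus> \<one> \<otimes> b" using b by simp
 then show "b \<in> ?J" using I0 by blast
 show "left_ideal ?J"
  unfolding left_ideal_def
 proof (intro conjI ballI)
  show "?J \<subseteq> carrier R" using Ic b by auto
  show "\<zero> \<in> ?J" using I0 `I \<subseteq> ?J` by blast
  show "x \<oplus> y \<in> ?J" if xy: "x \<in> ?J" "y \<in> ?J" for x y
  proof -
   obtain m c m' c' where e: "x = m \<oplus> c \<otimes> b" "m \<in> I" "c \<in> carrier R"
    "y = m' \<oplus> c' \<otimes> b" "m' \<in> I" "c' \<in> carrier R"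
    using xy by blast
   then have "x \<oplus> y = (m \<oplus> m') \<oplus> (c \<oplus> c') \<otimes> b" using Ic b by (simp add: l_distr a_ac)
   then show ?thesis using Ia e by blast
  qed
  show "a \<otimes> x \<in> ?J" if ax: "a \<in> carrier R" "x \<in> ?J" for a x
  proof -
   obtain m c where e: "x = m \<oplus> c \<otimes> b" "m \<in> I" "c \<in> carrier R" using ax by blast
   then have "a \<otimes> x = a \<otimes> m \<oplus> (a \<otimes> c) \<otimes> b" using Ic b ax by (simp add: r_distr m_assoc)
   then show ?thesis using Im e ax by blast
  qed
 qed
qed

text \<open>Maximality is delivered in the form needed for simple modules: every \<open>b\<close>
  outside \<open>M\<close> has a left inverse modulo \<open>M\<close>.\<close>

lemma ex_maximal_left_ideal:
 assumes I: "left_ideal I" "\<one> \<notin> I"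
 shows "\<exists>M. I \<subseteq> M \<and> left_ideal M \<and> \<one> \<notin> M \<and>
  (\<forall>b \<in> carrier R. b \<notin> M --> (\<exists>c \<in> carrier R. \<one> \<ominus> c \<otimes> b \<in> M))"
proof -
 let ?P = "{J. I \<subseteq> J \<and> left_ideal J \<and> \<one> \<notin> J}"
 have "\<exists>M \<in> ?P. \<forall>J \<in> ?P. M \<subseteq> J --> J = M"
 proof (rule subset_Zorn_nonempty)
  show "?P \<noteq> {}" using I by blast
  fix \<C> assume ne: "\<C> \<noteq> {}" and C: "subset.chain ?P \<C>"
  have CP: "J \<in> ?P" if "J \<in> \<C>" for J using C that unfolding subset_chain_def by blast
  have "left_ideal (\<Union>\<C>)"
   unfolding left_ideal_def
  proof (intro conjI ballI)
   show "\<Union>\<C> \<subseteq> carrier R" using CP unfolding left_ideal_def by blast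
   show "\<zero> \<in> \<Union>\<C>" using CP ne unfolding left_ideal_def by blast
   show "x \<oplus> y \<in> \<Union>\<C>" if xy: "x \<in> \<Union>\<C>" "y \<in> \<Union>\<C>" for x y
   proof -
    obtain A B where AB: "A \<in> \<C>" "B \<in> \<C>" "x \<in> A" "y \<in> B" using xy by blast
    then have "A \<subseteq> B \<or> B \<subseteq> A" using C unfolding subset_chain_def by blast
    then obtain J where "J \<in> \<C>" "x \<in> J" "y \<in> J" using AB by blast
    then show ?thesis using CP[of J] unfolding left_ideal_def by blast
   qed
   show "a \<otimes> x \<in> \<Union>\<C>" if "a \<in> carrier R" "x \<in> \<Union>\<C>" for a x
    using that CP unfolding left_ideal_def by blast
  qed
  then show "\<Union>\<C> \<in> ?P" using CP ne by blast
 qed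
 then obtain M where MP: "M \<in> ?P" and max: "\<forall>J \<in> ?P. M \<subseteq> J --> J = M" by (elim bexE)
 have M: "I \<subseteq> M" "left_ideal M" "\<one> \<notin> M" using MP by simp_all
 have "\<exists>c \<in> carrier R. \<one> \<ominus> c \<otimes> b \<in> M" if b: "b \<in> carrier R" "b \<notin> M" for b
 proof -
  note ext = left_ideal_extend[OF M(2) b(1)]
  let ?J = "{m \<oplus> c \<otimes> b |m c. m \<in> M \<and> c \<in> carrier R}"
  have "?J \<noteq> M" using ext(3) b(2) by blast
  moreover have "?J = M" if "\<one> \<notin> ?J"
  proof (rule bspec[OF max, THEN mp])
   show "?J \<in> ?P" using that ext(1,2) M(1) by (intro CollectI conjI) (rule subset_trans)
  qed (rule ext(2))
  ultimately have "\<one> \<in> ?J" by (cases "\<one> \<in> ?J") simp_all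
  then obtain m c where mc: "\<one> = m \<oplus> c \<otimes> b" "m \<in> M" "c \<in> carrier R" by blast
  have "m \<in> carrier R" using mc(2) M(2) by (auto simp: left_ideal_def)
  then have "\<one> \<ominus> c \<otimes> b = m" unfolding mc(1) using mc(3) b(1) by (simp add: a_minus_def a_assoc r_neg)
  then show ?thesis using mc by metis
 qed
 then show ?thesis using M by blast
qed

end

section \<open>Polynomials in one central indeterminate over a ring that need not be
  commutative\<close>

lemma (in UP_ring) coeff_mult_monom_one:
 assumes "b \<in> carrier P" "x \<in> carrier R"
 shows "up_ring.coeff P (b \<otimes>\<^bsub>P\<^esub> up_ring.monom P x 1) k = (case k of 0 => \<zero> | Suc n => up_ring.coeff P b n \<otimes> x)"
proof (cases k)
 case 0
 then show ?thesis using assms by (simp add: finsum_Un_disjoint)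
next
 case (Suc n)
 have "up_ring.coeff P (b \<otimes>\<^bsub>P\<^esub> up_ring.monom P x 1) (Suc n) = (\<Oplus>i \<in> {..Suc n}. up_ring.coeff P b i \<otimes> up_ring.coeff P (up_ring.monom P x 1) (Suc n - i))"
  using assms by (intro coeff_mult) auto
 also have "\<dots> = (\<Oplus>i \<in> {..Suc n}. if n = i then up_ring.coeff P b i \<otimes> x else \<zero>)"
  using assms by (intro R.finsum_cong') (auto simp del: finsum_Suc)
 also have "\<dots> = up_ring.coeff P b n \<otimes> x" using assms by (intro R.finsum_singleton) auto
 finally show ?thesis using Suc by simp
qed

lemma (in UP_ring) coeff_var_mult:
 assumes "b \<in> carrier P"
 shows "up_ring.coeff P (up_ring.monom P \<one> 1 \<otimes>\<^bsub>P\<^esub> b) k = (case k of 0 => \<zero> | Suc n => up_ring.coeff P b n)"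
proof (cases k)
 case 0
 then show ?thesis using assms by simp
next
 case (Suc n)
 have "up_ring.coeff P (up_ring.monom P \<one> 1 \<otimes>\<^bsub>P\<^esub> b) (Suc n) = (\<Oplus>i \<in> {..Suc n}. up_ring.coeff P (up_ring.monom P \<one> 1) i \<otimes> up_ring.coeff P b (Suc n - i))"
  using assms by (intro coeff_mult) auto
 also have "\<dots> = (\<Oplus>i \<in> {..Suc n}. if 1 = i then up_ring.coeff P b (Suc n - i) else \<zero>)"
  using assms by (intro R.finsum_cong') auto
 also have "\<dots> = up_ring.coeff P b n" using assms by (subst R.finsum_singleton) auto
 finally show ?thesis using Suc by simp
qed

lemma (in UP_ring) var_central:
 assumes "b \<in> carrier P"
 shows "b \<otimes>\<^bsub>P\<^esub> up_ring.monom P \<one> 1 = up_ring.monom P \<one> 1 \<otimes>\<^bsub>P\<^esub> b"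
 using assms
 by (intro up_eqI) (auto simp: coeff_mult_monom_one coeff_var_mult simp del: coeff_mult One_nat_def split: nat.split)

text \<open>Comparing coefficients in b (1 - x t) = 1 gives b_0 = 1 and b_(k+1) = b_k x, so b_k =
  x^k, and a polynomial has only finitely many nonzero coefficients.\<close>

lemma (in UP_ring) nilpotent_if_left_inverse:
 assumes x: "x \<in> carrier R" and b: "b \<in> carrier P" "\<one>\<^bsub>P\<^esub> = b \<otimes>\<^bsub>P\<^esub> (\<one>\<^bsub>P\<^esub> \<ominus>\<^bsub>P\<^esub> up_ring.monom P x 1)"
 shows "\<exists>n::nat. x [^] n = \<zero>"
proof -
 have "b \<otimes>\<^bsub>P\<^esub> (\<one>\<^bsub>P\<^esub> \<ominus>\<^bsub>P\<^esub> up_ring.monom P x 1) \<oplus>\<^bsub>P\<^esub> b \<otimes>\<^bsub>P\<^esub> up_ring.monom P x 1 = b"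
  using x b(1) by (simp add: a_minus_def P.r_distr P.r_minus P.a_assoc P.l_neg)
 then have b_eq: "b = \<one>\<^bsub>P\<^esub> \<oplus>\<^bsub>P\<^esub> b \<otimes>\<^bsub>P\<^esub> up_ring.monom P x 1" using b(2) by simp
 have coeff: "up_ring.coeff P b k = (if k = 0 then \<one> else \<zero>) \<oplus> (case k of 0 => \<zero> | Suc n => up_ring.coeff P b n \<otimes> x)" for k
  using x b(1) by (subst b_eq) (simp add: coeff_mult_monom_one del: coeff_mult One_nat_def)
 have "up_ring.coeff P b k = x [^] k" for k
 proof (induction k)
  case 0
  then show ?case using coeff[of 0] by simp
 next
  case (Suc k)
  then show ?case using coeff[of "Suc k"] x by simp
 qed
 moreover have "up_ring.coeff P b (Suc (deg R b)) = \<zero>" using b(1) by (intro deg_aboveD) simp_all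
 ultimately show ?thesis by metis
qed

text \<open>If \<open>x\<close> is not nilpotent, then \<open>1 - x t\<close> has no left inverse in \<open>R[t]\<close>, and a maximal left
 ideal containing it yields a simple module on which \<open>x t\<close>, hence \<open>x\<close>, does not act as zero.\<close>

theorem (in multilinear_identity) non_nilpotent_matrix_hom:
 assumes x: "x \<in> carrier R" and nn: "\<And>n::nat. x [^] n \<noteq> \<zero>"
 shows "\<exists>(K :: (nat => 'a) set ring) n \<phi>. n \<le> d \<and> field K \<and> matrix_hom R K n \<phi> \<and>
  (\<exists>i < n. \<exists>j < n. \<phi> x i j \<noteq> \<zero>\<^bsub>K\<^esub>)"
proof -
 define P where "P \<equiv> UP R"
 interpret U: UP_ring R P by unfold_locales (rule P_def)
 define c where "c a = up_ring.monom P a 0" for a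
 define t where "t = up_ring.monom P \<one> 1"
 define q where "q = \<one>\<^bsub>P\<^esub> \<ominus>\<^bsub>P\<^esub> up_ring.monom P x 1"
 have cc: "c a \<in> carrier P" if "a \<in> carrier R" for a using that by (simp add: c_def)
 have c_mult: "c (a \<otimes> b) = c a \<otimes>\<^bsub>P\<^esub> c b" if "a \<in> carrier R" "b \<in> carrier R" for a b
  using U.monom_mult[OF that, of 0 0] by (simp add: c_def)
 have c_add: "c (a \<oplus> b) = c a \<oplus>\<^bsub>P\<^esub> c b" if "a \<in> carrier R" "b \<in> carrier R" for a b
  using that by (simp add: c_def)
 have c_one: "c \<one> = \<one>\<^bsub>P\<^esub>" and c_zero: "c \<zero> = \<zero>\<^bsub>P\<^esub>" by (simp_all add: c_def)
 have tc: "t \<in> carrier P" by (simp add: t_def)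
 have t_pow: "t [^]\<^bsub>P\<^esub> i = up_ring.monom P \<one> i" for i :: nat
 proof (induction i)
  case (Suc i)
  then show ?case unfolding U.monom_one_Suc[of i] by (simp add: t_def del: One_nat_def)
 qed simp
 have monom_ct: "up_ring.monom P a i = c a \<otimes>\<^bsub>P\<^esub> t [^]\<^bsub>P\<^esub> i" if "a \<in> carrier R" for a and i :: nat
  using U.monom_mult[OF that one_closed, of 0 i] that by (simp add: c_def t_pow)
 have qc: "q \<in> carrier P" using x by (simp add: q_def)
 \<comment> \<open>The left ideal generated by \<open>q\<close>, written in the form of
   \<open>left_ideal_extend\<close> over the zero ideal; hence the summand zero.\<close>
 define I where "I = {\<zero>\<^bsub>P\<^esub> \<oplus>\<^bsub>P\<^esub> b \<otimes>\<^bsub>P\<^esub> q |b. b \<in> carrier P}"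
 have "U.P.left_ideal {\<zero>\<^bsub>P\<^esub>}" by (auto simp: U.P.left_ideal_def)
 from U.P.left_ideal_extend[OF this qc]
 have I: "U.P.left_ideal I" "q \<in> I" by (simp_all add: I_def)
 have "\<one>\<^bsub>P\<^esub> \<notin> I"
 proof
  assume "\<one>\<^bsub>P\<^esub> \<in> I"
  then obtain b where "b \<in> carrier P" "\<one>\<^bsub>P\<^esub> = b \<otimes>\<^bsub>P\<^esub> q" using qc by (auto simp: I_def)
  then show False using U.nilpotent_if_left_inverse[OF x] nn unfolding q_def by blast
 qed
 from U.P.ex_maximal_left_ideal[OF I(1) this]
 obtain M where M: "I \<subseteq> M" "U.P.left_ideal M" "\<one>\<^bsub>P\<^esub> \<notin> M"
  "\<And>b. b \<in> carrier P ==> b \<notin> M ==> \<exists>c \<in> carrier P. \<one>\<^bsub>P\<^esub> \<ominus>\<^bsub>P\<^esub> c \<otimes>\<^bsub>P\<^esub> b \<in> M" by blast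
 \<comment> \<open>The idealizer of \<open>M\<close>: the elements whose right multiplication acts
   on the simple module.\<close>
 define Q where "Q = {k \<in> carrier P. \<forall>m \<in> M. m \<otimes>\<^bsub>P\<^esub> k \<in> M}"
 define r where "r k l \<longleftrightarrow> k \<otimes>\<^bsub>P\<^esub> l \<ominus>\<^bsub>P\<^esub> l \<otimes>\<^bsub>P\<^esub> k \<in> M" for k l
 have "\<exists>C \<subseteq> Q. (\<forall>k \<in> C. \<forall>l \<in> C. r k l) \<and> (\<forall>k \<in> Q. (\<forall>l \<in> C. r k l) --> k \<in> C)"
 proof (rule ex_maximal_related)
  show "r k k" if "k \<in> Q" for k
   using that M(2) by (auto simp: r_def Q_def U.P.left_ideal_def U.P.r_neg a_minus_def)
  show "r l k" if "k \<in> Q" "l \<in> Q" "r k l" for k l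
  proof -
   have "k \<in> carrier P" "l \<in> carrier P" using that by (auto simp: Q_def)
   then have "\<ominus>\<^bsub>P\<^esub> (k \<otimes>\<^bsub>P\<^esub> l \<ominus>\<^bsub>P\<^esub> l \<otimes>\<^bsub>P\<^esub> k) = l \<otimes>\<^bsub>P\<^esub> k \<ominus>\<^bsub>P\<^esub> k \<otimes>\<^bsub>P\<^esub> l"
    by (simp add: a_minus_def U.P.minus_add U.P.a_comm)
   then show ?thesis using U.P.left_ideal_inv[OF M(2)] `r k l` unfolding r_def by metis
  qed
 qed
 then obtain K0 where K0: "K0 \<subseteq> Q" "\<forall>k \<in> K0. \<forall>l \<in> K0. r k l" "\<forall>k \<in> Q. (\<forall>l \<in> K0. r k l) --> k \<in> K0"
  by blast
 interpret S: PI_simple_quotient P M K0 "c ` carrier R" t d "\<lambda>js. c (\<gamma> js)"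
 proof unfold_locales
  show "U.P.left_ideal M" "\<one>\<^bsub>P\<^esub> \<notin> M" by fact+
  show "\<exists>c \<in> carrier P. \<one>\<^bsub>P\<^esub> \<ominus>\<^bsub>P\<^esub> c \<otimes>\<^bsub>P\<^esub> b \<in> M" if "b \<in> carrier P" "b \<notin> M" for b
   using M(4) that .
  show "K0 \<subseteq> carrier P" using K0(1) by (auto simp: Q_def)
  show "m \<otimes>\<^bsub>P\<^esub> k \<in> M" if "k \<in> K0" "m \<in> M" for k m using K0(1) that by (auto simp: Q_def)
  show "k \<otimes>\<^bsub>P\<^esub> k' \<ominus>\<^bsub>P\<^esub> k' \<otimes>\<^bsub>P\<^esub> k \<in> M" if "k \<in> K0" "k' \<in> K0" for k k'
   using K0(2) that by (auto simp: r_def)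
  show "k \<in> K0" if "k \<in> carrier P" "\<And>m. m \<in> M ==> m \<otimes>\<^bsub>P\<^esub> k \<in> M"
   "\<And>k'. k' \<in> K0 ==> k \<otimes>\<^bsub>P\<^esub> k' \<ominus>\<^bsub>P\<^esub> k' \<otimes>\<^bsub>P\<^esub> k \<in> M" for k
   using K0(3) that by (auto simp: Q_def r_def)
  show "c ` carrier R \<subseteq> carrier P" using cc by blast
  show "\<zero>\<^bsub>P\<^esub> \<in> c ` carrier R" "\<one>\<^bsub>P\<^esub> \<in> c ` carrier R" using c_zero c_one by (metis imageI zero_closed one_closed)+
  show "a \<otimes>\<^bsub>P\<^esub> b \<in> c ` carrier R" if "a \<in> c ` carrier R" "b \<in> c ` carrier R" for a b
   using that c_mult by (metis (no_types, lifting) imageE imageI m_closed)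
  show "t \<in> carrier P" by (rule tc)
  show "b \<otimes>\<^bsub>P\<^esub> t = t \<otimes>\<^bsub>P\<^esub> b" if "b \<in> carrier P" for b
   unfolding t_def by (rule U.var_central[OF that])
  show "\<exists>(n::nat) a. (\<forall>i. a i \<in> c ` carrier R) \<and> b = (\<Oplus>\<^bsub>P\<^esub>i \<in> {..n}. a i \<otimes>\<^bsub>P\<^esub> t [^]\<^bsub>P\<^esub> i)"
   if b: "b \<in> carrier P" for b
  proof (intro exI conjI allI)
   show "c (up_ring.coeff P b i) \<in> c ` carrier R" for i using b by simp
   have "b = (\<Oplus>\<^bsub>P\<^esub>i \<in> {..deg R b}. up_ring.monom P (up_ring.coeff P b i) i)" using U.up_repr[OF b] by simp
   then show "b = (\<Oplus>\<^bsub>P\<^esub>i \<in> {..deg R b}. c (up_ring.coeff P b i) \<otimes>\<^bsub>P\<^esub> t [^]\<^bsub>P\<^esub> i)"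
    using b by (simp add: monom_ct)
  qed
  show "c (\<gamma> js) \<in> carrier P" for js using \<gamma>_closed cc by blast
  show "c (\<gamma> [0..<d]) = \<one>\<^bsub>P\<^esub>" by (simp add: \<gamma>_id c_one)
  fix y :: "nat => nat => 'a" assume "y \<in> UNIV \<rightarrow> c ` carrier R"
  then have "\<forall>j. \<exists>a. a \<in> carrier R \<and> y j = c a" by auto
  then obtain a where a: "\<And>j. a j \<in> carrier R" "\<And>j. y j = c (a j)" by metis
  have mc: "nc_monom_eval R a js \<in> carrier R" for js using a by (intro nc_monom_eval_closed)
  have mon: "nc_monom_eval P y js = c (nc_monom_eval R a js)" for js
   by (induction js) (simp_all add: c_one c_mult a mc)
  have sum: "(\<Oplus>\<^bsub>P\<^esub>js \<in> J. c (f js)) = c (\<Oplus>js \<in> J. f js)"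
   if "finite J" "\<And>js. f js \<in> carrier R" for f :: "nat list => 'a" and J
   using that
  proof (induction J rule: finite_induct)
   case (insert js J)
   then show ?case using cc by (simp add: U.P.finsum_insert finsum_insert c_add Pi_def)
  qed (simp add: c_zero)
  have "(\<Oplus>\<^bsub>P\<^esub>js \<in> {js. distinct js \<and> set js = {..<d}}. c (\<gamma> js) \<otimes>\<^bsub>P\<^esub> nc_monom_eval P y js)
    = (\<Oplus>\<^bsub>P\<^esub>js \<in> {js. distinct js \<and> set js = {..<d}}. c (\<gamma> js \<otimes> nc_monom_eval R a js))"
   by (simp add: mon c_mult \<gamma>_closed mc)
  also have "\<dots> = c (\<Oplus>js \<in> {js. distinct js \<and> set js = {..<d}}. \<gamma> js \<otimes> nc_monom_eval R a js)"
   by (intro sum finite_distinct_lists) (simp add: \<gamma>_closed mc)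
  also have "\<dots> = \<zero>\<^bsub>P\<^esub>" using identity[of a] a c_zero by simp
  finally show "(\<Oplus>\<^bsub>P\<^esub>js \<in> {js. distinct js \<and> set js = {..<d}}. c (\<gamma> js) \<otimes>\<^bsub>P\<^esub> nc_monom_eval P y js) = \<zero>\<^bsub>P\<^esub>" .
 qed
 \<comment> \<open>1 - x t lies in \<open>M\<close> and 1 does not, so x t does not either.\<close>
 have cx: "c x \<otimes>\<^bsub>P\<^esub> t \<notin> M"
 proof
  assume "c x \<otimes>\<^bsub>P\<^esub> t \<in> M"
  then have "up_ring.monom P x 1 \<in> M" using monom_ct[OF x, of 1] tc by simp
  moreover have "q \<in> M" using I(2) M(1) by blast
  ultimately have "q \<oplus>\<^bsub>P\<^esub> up_ring.monom P x 1 \<in> M" using M(2) by (auto simp: U.P.left_ideal_def)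
  moreover have "q \<oplus>\<^bsub>P\<^esub> up_ring.monom P x 1 = \<one>\<^bsub>P\<^esub>"
   using x by (simp add: q_def a_minus_def U.P.a_assoc U.P.l_neg)
  ultimately show False using M(3) by simp
 qed
 obtain n \<phi> where n: "n \<le> d" and
  \<phi>: "\<And>a i j. a \<in> c ` carrier R ==> i < n ==> j < n ==> \<phi> a i j \<in> carrier S.K"
  "\<And>i j. i < n ==> j < n ==> \<phi> \<one>\<^bsub>P\<^esub> i j = (if i = j then \<one>\<^bsub>S.K\<^esub> else \<zero>\<^bsub>S.K\<^esub>)"
  "\<And>a b i j. a \<in> c ` carrier R ==> b \<in> c ` carrier R ==> i < n ==> j < n ==> a \<oplus>\<^bsub>P\<^esub> b \<in> c ` carrier R ==>
   \<phi> (a \<oplus>\<^bsub>P\<^esub> b) i j = \<phi> a i j \<oplus>\<^bsub>S.K\<^esub> \<phi> b i j"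
  "\<And>a b i j. a \<in> c ` carrier R ==> b \<in> c ` carrier R ==> i < n ==> j < n ==>
   \<phi> (a \<otimes>\<^bsub>P\<^esub> b) i j = (\<Oplus>\<^bsub>S.K\<^esub>l \<in> {..<n}. \<phi> a i l \<otimes>\<^bsub>S.K\<^esub> \<phi> b l j)"
  "\<And>a. a \<in> c ` carrier R ==> a \<otimes>\<^bsub>P\<^esub> t \<notin> M ==> \<exists>i < n. \<exists>j < n. \<phi> a i j \<noteq> \<zero>\<^bsub>S.K\<^esub>"
  by (rule S.ex_matrix_hom) (rule that)
 have "\<exists>i < n. \<exists>j < n. \<phi> (c x) i j \<noteq> \<zero>\<^bsub>S.K\<^esub>" by (rule \<phi>(5)[OF imageI[OF x] cx])
 moreover have "matrix_hom R S.K n (\<lambda>a. \<phi> (c a))"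
  unfolding matrix_hom_def
 proof (intro conjI ballI allI impI)
  fix a b i j assume ab: "a \<in> carrier R" "b \<in> carrier R" and ij: "i < n" "j < n"
  have "c (a \<oplus> b) \<in> c ` carrier R" using ab by simp
  then show "\<phi> (c (a \<oplus> b)) i j = \<phi> (c a) i j \<oplus>\<^bsub>S.K\<^esub> \<phi> (c b) i j"
   using \<phi>(3)[OF imageI[OF ab(1)] imageI[OF ab(2)] ij] by (simp add: c_add[OF ab])
  show "\<phi> (c (a \<otimes> b)) i j = (\<Oplus>\<^bsub>S.K\<^esub>l \<in> {..<n}. \<phi> (c a) i l \<otimes>\<^bsub>S.K\<^esub> \<phi> (c b) l j)"
   using \<phi>(4)[OF imageI[OF ab(1)] imageI[OF ab(2)] ij] by (simp add: c_mult[OF ab])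
 qed (use \<phi>(1,2) c_one in auto)
 ultimately show ?thesis
  using n S.K_field
  by - (rule exI[of _ S.K], rule exI[of _ n], rule exI[of _ "\<lambda>a. \<phi> (c a)"], intro conjI)
qed

section \<open>Local nilpotence modulo a normal subgroup\<close>

context group
begin

text \<open>The lower central series of a subgroup is computed inside \<open>G\<close>, and
  \<open>loc_nilp_mod\<close> expresses local nilpotence modulo \<open>N\<close>, without forming
  restricted or quotient groups. The comparison with the notions of the theorem is made in
  \<open>locally_nilpotent_iff\<close> and \<open>quotient_loc_nilp\<close>.\<close>

primrec lcs :: "'a set => nat => 'a set"
 where "lcs H 0 = H"
 | "lcs H (Suc n) = generate G {comm G x y |x y. x \<in> lcs H n \<and> y \<in> H}"

definition loc_nilp_mod :: "'a set => 'a set => bool"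
 where "loc_nilp_mod N T \<longleftrightarrow> (\<forall>S. finite S \<and> S \<subseteq> T --> (\<exists>n. lcs (generate G S) n \<subseteq> N))"

lemma lcs_subgroup:
 assumes "subgroup H G"
 shows "subgroup (lcs H n) G \<and> lcs H n \<subseteq> H"
proof (induction n)
 case (Suc n)
 have "comm G x y \<in> H" if "x \<in> lcs H n" "y \<in> H" for x y
  using that Suc subgroup.m_closed[OF assms] subgroup.m_inv_closed[OF assms]
  by (auto simp: comm_def)
 then have "{comm G x y |x y. x \<in> lcs H n \<and> y \<in> H} \<subseteq> H" by blast
 then show ?case
  using generate_is_subgroup generate_subgroup_incl[OF _ assms] subgroup.subset[OF assms] by auto
qed (use assms in simp)

lemma derived_subset_lcs: "subgroup H G ==> (derived G ^^ n) H \<subseteq> lcs H n"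
proof (induction n)
 case (Suc n)
 have D: "subgroup ((derived G ^^ n) H) G" by (rule exp_of_derived_is_subgroup[OF Suc.prems])
 have DH: "(derived G ^^ n) H \<subseteq> H" using exp_derived_antimono[OF Suc.prems, of 0 n] by simp
 have "derived G ((derived G ^^ n) H) \<subseteq> lcs H (Suc n)"
 proof (rule derived_subsetI[OF D])
  show "subgroup (lcs H (Suc n)) G" using lcs_subgroup[OF Suc.prems] by blast
  fix x y assume "x \<in> (derived G ^^ n) H" "y \<in> (derived G ^^ n) H"
  then show "comm G x y \<in> lcs H (Suc n)" using Suc DH by (auto intro!: generate.incl)
 qed
 then show ?case by simp
qed simp

lemma engel_in_lcs:
 assumes "x \<in> H" "y \<in> H"
 shows "engel G n x y \<in> lcs H n"
proof (induction n)
 case (Suc n)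
 then show ?case using assms(2) by (auto intro!: generate.incl)
qed (use assms in simp)

lemma lower_central_eq_lcs:
 assumes "subgroup H G"
 shows "lower_central (G\<lparr>carrier := H\<rparr>) n = lcs H n"
proof (induction n)
 case (Suc n)
 have comm: "comm (G\<lparr>carrier := H\<rparr>) x y = comm G x y" if "x \<in> H" "y \<in> H" for x y
  using that m_inv_consistent[OF assms] by (simp add: comm_def)
 note L = lcs_subgroup[OF assms, of n]
 let ?C = "{comm G x y |x y. x \<in> lcs H n \<and> y \<in> H}"
 have C: "{comm (G\<lparr>carrier := H\<rparr>) x y |x y. x \<in> lcs H n \<and> y \<in> H} = ?C"
  using comm L by (metis (no_types, lifting) subsetD)
 have "generate G ?C \<subseteq> H" using lcs_subgroup[OF assms, of "Suc n"] by simp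
 moreover have "?C \<subseteq> generate G ?C" by (rule subsetI) (rule generate.incl)
 ultimately have "?C \<subseteq> H" by (rule subset_trans[rotated])
 then have "generate (G\<lparr>carrier := H\<rparr>) ?C = generate G ?C" by (rule generate_consistent[OF _ assms])
 then show ?case using Suc C by simp
qed simp

lemma locally_nilpotent_iff:
 assumes T: "subgroup T G"
 shows "locally_nilpotent (G\<lparr>carrier := T\<rparr>) \<longleftrightarrow> loc_nilp_mod {\<one>} T"
proof -
 have "nilpotent_group (G\<lparr>carrier := T, carrier := generate (G\<lparr>carrier := T\<rparr>) S\<rparr>)
   \<longleftrightarrow> (\<exists>n. lcs (generate G S) n \<subseteq> {\<one>})" if S: "S \<subseteq> T" for S
 proof -
  have g: "subgroup (generate G S) G"
   using S subgroup.subset[OF T] by (intro generate_is_subgroup) auto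
  have "lcs (generate G S) n \<subseteq> {\<one>} \<longleftrightarrow> lcs (generate G S) n = {\<one>}" for n
   using lcs_subgroup[OF g, of n] subgroup.one_closed by blast
  then show ?thesis
   using generate_consistent[OF S T] lower_central_eq_lcs[OF g] by (simp add: nilpotent_group_def)
 qed
 then show ?thesis unfolding locally_nilpotent_def loc_nilp_mod_def by auto
qed

lemma loc_nilp_mod_mono: "loc_nilp_mod N T ==> N \<subseteq> N' ==> loc_nilp_mod N' T"
 unfolding loc_nilp_mod_def by (intro allI impI) (drule spec, drule (1) mp, elim exE, rule exI, rule subset_trans)

lemma loc_nilp_mod_derived:
 assumes "subgroup T G" "derived G T \<subseteq> N"
 shows "loc_nilp_mod N T"
 unfolding loc_nilp_mod_def
proof (intro allI impI exI[of _ 1])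
 fix S assume S: "finite S \<and> S \<subseteq> T"
 have gT: "generate G S \<subseteq> T" using S generate_subgroup_incl assms(1) by blast
 have "comm G x y \<in> derived G T" if "x \<in> generate G S" "y \<in> generate G S" for x y
  using comm_in_derived[OF assms(1)] that gT by blast
 then have "{comm G x y |x y. x \<in> generate G S \<and> y \<in> generate G S} \<subseteq> derived G T" by blast
 then have "lcs (generate G S) 1 \<subseteq> derived G T"
  using generate_subgroup_incl[OF _ derived_is_subgroup[OF subgroup.subset[OF assms(1)]]] by simp
 then show "lcs (generate G S) 1 \<subseteq> N" using assms(2) by blast
qed

text \<open>An element of a derived subgroup involves finitely many commutators, so a finitely
  generated subgroup already produces it. Together with a uniform bound on derived lengths this
  turns local information into global.\<close>

lemma exp_derived_finitary:
 assumes T: "T \<subseteq> carrier G"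
 shows "x \<in> (derived G ^^ n) T ==> \<exists>S. finite S \<and> S \<subseteq> T \<and> x \<in> (derived G ^^ n) (generate G S)"
proof (induction n arbitrary: x)
 case 0
 then show ?case by (intro exI[of _ "{x}"]) (auto intro: generate.incl)
next
 case (Suc n)
 let ?D = "\<lambda>n S. (derived G ^^ n) (generate G S)"
 have mono: "?D k S \<subseteq> ?D k S'" if "S \<subseteq> S'" for S S' k
  using that mono_generate by (intro mono_exp_of_derived) auto
 have sub: "subgroup (?D k S) G" if "S \<subseteq> T" for S k
  using that T generate_is_subgroup by (intro exp_of_derived_is_subgroup) auto
 have gen: "\<exists>S. finite S \<and> S \<subseteq> T \<and> h \<in> ?D (Suc n) S" if h: "h \<in> derived_set G ((derived G ^^ n) T)" for h
 proof -
  obtain a b where ab: "a \<in> (derived G ^^ n) T" "b \<in> (derived G ^^ n) T" "h = a \<otimes> b \<otimes> inv a \<otimes> inv b"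
   using h by auto
  obtain A B where AB: "finite A" "A \<subseteq> T" "a \<in> ?D n A" "finite B" "B \<subseteq> T" "b \<in> ?D n B"
   using Suc.IH ab by meson
  then have "a \<in> ?D n (A \<union> B)" "b \<in> ?D n (A \<union> B)"
   using mono[OF Un_upper1, THEN subsetD] mono[OF Un_upper2, THEN subsetD] by blast+
  then have "h \<in> ?D (Suc n) (A \<union> B)" unfolding ab(3) by (auto simp: derived_def intro!: generate.incl)
  then show ?thesis using AB by (intro exI[of _ "A \<union> B"]) auto
 qed
 have "x \<in> derived G ((derived G ^^ n) T)" using Suc.prems by simp
 then have "x \<in> generate G (derived_set G ((derived G ^^ n) T))" by (subst (asm) (1) derived_def)
 then show ?case
 proof induction
  case one
  then show ?case using subgroup.one_closed[OF sub[of "{}" "Suc n"]] by blast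
 next
  case (incl h)
  then show ?case by (rule gen)
 next
  case (inv h)
  then show ?case using gen subgroup.m_inv_closed[OF sub[of _ "Suc n"]] by meson
 next
  case (eng h1 h2)
  then obtain A B where AB: "finite A" "A \<subseteq> T" "h1 \<in> ?D (Suc n) A" "finite B" "B \<subseteq> T" "h2 \<in> ?D (Suc n) B"
   by meson
  then have "h1 \<in> ?D (Suc n) (A \<union> B)" "h2 \<in> ?D (Suc n) (A \<union> B)"
   using mono[OF Un_upper1, THEN subsetD] mono[OF Un_upper2, THEN subsetD] by blast+
  then have "h1 \<otimes> h2 \<in> ?D (Suc n) (A \<union> B)" using AB by (intro subgroup.m_closed[OF sub]) auto
  then show ?case using AB by (intro exI[of _ "A \<union> B"]) auto
 qed
qed

end

section \<open>Passage to quotient groups\<close>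

lemma (in group_hom) hom_comm: "x \<in> carrier G ==> y \<in> carrier G ==> h (comm G x y) = comm H (h x) (h y)"
 by (simp add: comm_def)

lemma (in group_hom) lcs_img:
 assumes K: "subgroup K G"
 shows "group.lcs H (h ` K) n = h ` group.lcs G K n"
proof (induction n)
 case 0
 then show ?case by (simp add: H.lcs.simps G.lcs.simps)
next
 case (Suc n)
 let ?C = "{comm G x y |x y. x \<in> G.lcs K n \<and> y \<in> K}"
 have L: "G.lcs K n \<subseteq> carrier G" "K \<subseteq> carrier G"
  using G.lcs_subgroup[OF K] subgroup.subset K by blast+
 then have Lc: "x \<in> carrier G" "y \<in> carrier G" if "x \<in> G.lcs K n" "y \<in> K" for x y
  using that by blast+
 then have Cc: "?C \<subseteq> carrier G" by auto
 have "{comm H x y |x y. x \<in> h ` G.lcs K n \<and> y \<in> h ` K} = h ` ?C"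
 proof (intro equalityI subsetI)
  fix z assume "z \<in> {comm H x y |x y. x \<in> h ` G.lcs K n \<and> y \<in> h ` K}"
  then obtain x y where "x \<in> G.lcs K n" "y \<in> K" "z = comm H (h x) (h y)" by blast
  then have "z = h (comm G x y)" "comm G x y \<in> ?C" using hom_comm[OF Lc] by auto
  then show "z \<in> h ` ?C" by blast
 next
  fix z assume "z \<in> h ` ?C"
  then obtain x y where "x \<in> G.lcs K n" "y \<in> K" "z = h (comm G x y)" by blast
  moreover from this have "z = comm H (h x) (h y)" using hom_comm[OF Lc] by simp
  ultimately show "z \<in> {comm H x y |x y. x \<in> h ` G.lcs K n \<and> y \<in> h ` K}" by blast
 qed
 then show ?case using Suc generate_img[OF Cc] by (simp add: H.lcs.simps G.lcs.simps)
qed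

context group
begin

lemma quotient_hom:
 assumes "N \<lhd> G"
 shows "group_hom G (G Mod N) (\<lambda>x. N #> x)"
proof -
 interpret N: normal N G by (rule assms)
 show ?thesis
  using N.r_coset_hom_Mod N.factorgroup_is_group by (intro group_hom.intro group_hom_axioms.intro is_group)
qed

lemma rcos_eq_iff:
 assumes N: "N \<lhd> G" and xy: "x \<in> carrier G" "y \<in> carrier G"
 shows "N #> x = N #> y \<longleftrightarrow> x \<otimes> inv y \<in> N"
proof -
 interpret N: normal N G by (rule N)
 have "N #> x = N #> y \<longleftrightarrow> x \<in> N #> y"
  using xy N.subgroup_axioms repr_independence[of x N y] rcos_self[of x N] by auto
 then show ?thesis using N.rcos_module[OF is_group, of y x] xy by simp
qed

lemma rcos_in_image_iff:
 assumes N: "N \<lhd> G" and M: "subgroup M G" "N \<subseteq> M" and x: "x \<in> carrier G"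
 shows "N #> x \<in> (\<lambda>x. N #> x) ` M \<longleftrightarrow> x \<in> M"
proof
 assume "N #> x \<in> (\<lambda>x. N #> x) ` M"
 then obtain m where m: "m \<in> M" "N #> x = N #> m" by blast
 then have mc: "m \<in> carrier G" using subgroup.mem_carrier[OF M(1)] by blast
 then have "x \<otimes> inv m \<in> M" using rcos_eq_iff[OF N x] m M(2) by blast
 then have "x \<otimes> inv m \<otimes> m \<in> M" using m subgroup.m_closed[OF M(1)] by blast
 then show "x \<in> M" using x mc by (simp add: m_assoc)
qed blast

lemma rcos_one_iff:
 assumes N: "N \<lhd> G" and x: "x \<in> carrier G"
 shows "N #> x = \<one>\<^bsub>G Mod N\<^esub> \<longleftrightarrow> x \<in> N"
 using rcos_eq_iff[OF N x one_closed] coset_join2[of \<one> N] N x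
 by (simp add: FactGroup_def coset_mult_one normal_imp_subgroup subgroup.subset)

lemma quotient_loc_nilp:
 assumes N: "N \<lhd> G" and T: "subgroup T G"
 shows "locally_nilpotent ((G Mod N)\<lparr>carrier := (\<lambda>x. N #> x) ` T\<rparr>) \<longleftrightarrow> loc_nilp_mod N T"
proof -
 interpret h: group_hom G "G Mod N" "\<lambda>x. N #> x" by (rule quotient_hom[OF N])
 have Tc: "T \<subseteq> carrier G" by (rule subgroup.subset[OF T])
 have iff: "h.H.lcs (generate (G Mod N) ((\<lambda>x. N #> x) ` S)) n \<subseteq> {\<one>\<^bsub>G Mod N\<^esub>}
   \<longleftrightarrow> lcs (generate G S) n \<subseteq> N" if S: "S \<subseteq> T" for S n
 proof -
  have Sc: "S \<subseteq> carrier G" using S Tc by blast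
  have g: "subgroup (generate G S) G" by (rule generate_is_subgroup[OF Sc])
  have "lcs (generate G S) n \<subseteq> carrier G" using lcs_subgroup[OF g] subgroup.subset by blast
  then show ?thesis
   unfolding h.generate_img[OF Sc] h.lcs_img[OF g] using rcos_one_iff[OF N] by blast
 qed
 have "h.H.loc_nilp_mod {\<one>\<^bsub>G Mod N\<^esub>} ((\<lambda>x. N #> x) ` T) \<longleftrightarrow> loc_nilp_mod N T"
 proof
  assume l: "h.H.loc_nilp_mod {\<one>\<^bsub>G Mod N\<^esub>} ((\<lambda>x. N #> x) ` T)"
  show "loc_nilp_mod N T"
   unfolding loc_nilp_mod_def
  proof (intro allI impI)
   fix S assume S: "finite S \<and> S \<subseteq> T"
   then have "finite ((\<lambda>x. N #> x) ` S) \<and> (\<lambda>x. N #> x) ` S \<subseteq> (\<lambda>x. N #> x) ` T" by blast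
   from l[unfolded h.H.loc_nilp_mod_def, rule_format, OF this]
   obtain n where "h.H.lcs (generate (G Mod N) ((\<lambda>x. N #> x) ` S)) n \<subseteq> {\<one>\<^bsub>G Mod N\<^esub>}" ..
   then show "\<exists>n. lcs (generate G S) n \<subseteq> N" using iff[of S n] S by (intro exI[of _ n]) simp
  qed
 next
  assume l: "loc_nilp_mod N T"
  show "h.H.loc_nilp_mod {\<one>\<^bsub>G Mod N\<^esub>} ((\<lambda>x. N #> x) ` T)"
   unfolding h.H.loc_nilp_mod_def
  proof (intro allI impI)
   fix S' assume "finite S' \<and> S' \<subseteq> (\<lambda>x. N #> x) ` T"
   then obtain S where S: "S \<subseteq> T" "finite S" "S' = (\<lambda>x. N #> x) ` S"
    by (meson finite_subset_image)
   obtain n where "lcs (generate G S) n \<subseteq> N"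
    using l[unfolded loc_nilp_mod_def, rule_format, of S] S by blast
   then show "\<exists>n. h.H.lcs (generate (G Mod N) S') n \<subseteq> {\<one>\<^bsub>G Mod N\<^esub>}"
    unfolding S(3) using iff[OF S(1), of n] by (intro exI[of _ n]) simp
  qed
 qed
 then show ?thesis using h.H.locally_nilpotent_iff[OF h.subgroup_img_is_subgroup[OF T]] by simp
qed

lemma loc_nilp_mod_subset_radical_over:
 assumes N: "N \<lhd> G" and T: "T \<lhd> G" "loc_nilp_mod N T"
 shows "T \<subseteq> radical_over G N"
proof
 interpret h: group_hom G "G Mod N" "\<lambda>x. N #> x" by (rule quotient_hom[OF N])
 have Ts: "subgroup T G" by (rule normal_imp_subgroup[OF T(1)])
 have "(\<lambda>x. N #> x) ` T \<lhd> G Mod N"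
 proof (rule h.H.normalI_conjg[OF h.subgroup_img_is_subgroup[OF Ts]])
  fix g x assume "g \<in> carrier (G Mod N)" "x \<in> (\<lambda>x. N #> x) ` T"
  then obtain a t where at: "a \<in> carrier G" "g = N #> a" "t \<in> T" "x = N #> t"
   by (auto simp: FactGroup_def RCOSETS_def)
  have "t \<in> carrier G" using at(3) subgroup.mem_carrier[OF Ts] by blast
  then have "conjg (G Mod N) g x = N #> conjg G a t"
   using at(1) by (simp add: conjg_def at(2,4) del: mult_FactGroup)
  then show "conjg (G Mod N) g x \<in> (\<lambda>x. N #> x) ` T" using normal_conjg[OF T(1) at(1,3)] by blast
 qed
 then have sub: "(\<lambda>x. N #> x) ` T \<subseteq> loc_nilp_radical (G Mod N)"
  using quotient_loc_nilp[OF N Ts] T(2) unfolding loc_nilp_radical_def by (blast intro: generate.incl)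
 fix x assume "x \<in> T"
 then show "x \<in> radical_over G N"
  using sub subgroup.mem_carrier[OF Ts] by (auto simp: radical_over_def)
qed

text \<open>A locally nilpotent normal subgroup of \<open>G/N\<close> is the image of its full
  preimage \<open>U\<close>, which is normal in \<open>G\<close> and locally nilpotent modulo
  \<open>N\<close>.\<close>

lemma radical_over_subsetI:
 assumes N: "N \<lhd> G" and W: "subgroup W G" "N \<subseteq> W"
  and loc: "\<And>T. T \<lhd> G ==> loc_nilp_mod N T ==> T \<subseteq> W"
 shows "radical_over G N \<subseteq> W"
proof
 interpret h: group_hom G "G Mod N" "\<lambda>x. N #> x" by (rule quotient_hom[OF N])
 fix x assume x: "x \<in> radical_over G N"
 have "T \<subseteq> (\<lambda>x. N #> x) ` W" if T: "T \<lhd> G Mod N" "locally_nilpotent ((G Mod N)\<lparr>carrier := T\<rparr>)" for T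
 proof -
  define U where "U = {y \<in> carrier G. N #> y \<in> T}"
  interpret T: normal T "G Mod N" by (rule T(1))
  have "U \<lhd> G"
  proof (rule normalI_conjg)
   show "subgroup U G"
   proof (rule subgroupI)
    have "\<one> \<in> U" using T.one_closed h.hom_one by (simp add: U_def del: one_FactGroup)
    then show "U \<noteq> {}" by blast
   qed (use T.m_inv_closed h.hom_inv T.m_closed h.hom_mult in \<open>auto simp: U_def\<close>)
   fix g y assume g: "g \<in> carrier G" and y: "y \<in> U"
   then have "N #> conjg G g y = conjg (G Mod N) (N #> g) (N #> y)"
    using h.hom_inv by (simp add: conjg_def U_def del: mult_FactGroup)
   then show "conjg G g y \<in> U" using h.H.normal_conjg[OF T(1)] h.hom_closed g y by (simp add: U_def)
  qed
  moreover have TU: "T = (\<lambda>x. N #> x) ` U"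
  proof
   show "T \<subseteq> (\<lambda>x. N #> x) ` U"
   proof
    fix t assume t: "t \<in> T"
    then have "t \<in> carrier (G Mod N)" using T.mem_carrier by blast
    then obtain a where "a \<in> carrier G" "t = N #> a" by (auto simp: FactGroup_def RCOSETS_def)
    then show "t \<in> (\<lambda>x. N #> x) ` U" using t by (auto simp: U_def)
   qed
  qed (auto simp: U_def)
  ultimately have "U \<subseteq> W"
   using loc T(2) quotient_loc_nilp[OF N normal_imp_subgroup] by blast
  then show ?thesis using TU by blast
 qed
 then have "loc_nilp_radical (G Mod N) \<subseteq> (\<lambda>x. N #> x) ` W"
  unfolding loc_nilp_radical_def
  by (intro h.H.generate_subgroup_incl[OF _ h.subgroup_img_is_subgroup[OF W(1)]]) blast
 then show "x \<in> W" using x rcos_in_image_iff[OF N W] by (auto simp: radical_over_def)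
qed

text \<open>\<open>N <#> A\<close> and \<open>A\<close> have the same image in \<open>G/N\<close>,
  and taking derived subgroups commutes with homomorphisms.\<close>

lemma exp_derived_set_mult:
 assumes N: "N \<lhd> G" and A: "A \<subseteq> carrier G"
 shows "(derived G ^^ n) (N <#> A) \<subseteq> N <#> (derived G ^^ n) A"
proof
 interpret N: normal N G by (rule N)
 interpret h: group_hom G "G Mod N" "\<lambda>x. N #> x" by (rule quotient_hom[OF N])
 have NA: "N <#> A \<subseteq> carrier G" using A N.subset by (auto simp: set_mult_def)
 have "(\<lambda>x. N #> x) ` (N <#> A) = (\<lambda>x. N #> x) ` A"
 proof (intro equalityI image_subsetI)
  fix x assume "x \<in> N <#> A"
  then obtain u a where "u \<in> N" "a \<in> A" "x = u \<otimes> a" by (auto simp: set_mult_def)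
  moreover from this have "N #> x = N #> a"
   using A N.mem_carrier rcos_eq_iff[OF N, of x a] by (auto simp: m_assoc subset_iff)
  ultimately show "N #> x \<in> (\<lambda>x. N #> x) ` A" by blast
 next
  fix a assume "a \<in> A"
  then have "\<one> \<otimes> a \<in> N <#> A" "\<one> \<otimes> a = a" using N.one_closed A by (auto simp: set_mult_def)
  then show "N #> a \<in> (\<lambda>x. N #> x) ` (N <#> A)" by simp
 qed
 then have eq: "(\<lambda>x. N #> x) ` (derived G ^^ n) (N <#> A) = (\<lambda>x. N #> x) ` (derived G ^^ n) A"
  using h.exp_of_derived_img[OF NA, of n] h.exp_of_derived_img[OF A, of n] by simp
 fix x assume x: "x \<in> (derived G ^^ n) (N <#> A)"
 then obtain a where a: "a \<in> (derived G ^^ n) A" "N #> x = N #> a" using eq by blast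
 have c: "x \<in> carrier G" "a \<in> carrier G"
  using x a exp_of_derived_in_carrier[OF NA, of n] exp_of_derived_in_carrier[OF A, of n] by blast+
 then have "x \<otimes> inv a \<in> N" "x = (x \<otimes> inv a) \<otimes> a"
  using rcos_eq_iff[OF N] a by (simp_all add: m_assoc)
 then show "x \<in> N <#> (derived G ^^ n) A" using a unfolding set_mult_def by blast
qed

lemma set_mult_normal:
 assumes "A \<lhd> G" "B \<lhd> G"
 shows "A <#> B \<lhd> G"
proof (rule normalI_conjg)
 show "subgroup (A <#> B) G" using assms mult_norm_subgroup normal_imp_subgroup by blast
 fix g x assume g: "g \<in> carrier G" and "x \<in> A <#> B"
 then obtain a b where ab: "a \<in> A" "b \<in> B" "x = a \<otimes> b" by (auto simp: set_mult_def)
 then have "a \<in> carrier G" "b \<in> carrier G"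
  using assms by (meson normal_imp_subgroup subgroup.mem_carrier)+
 then have "conjg G g x = conjg G g a \<otimes> conjg G g b" using g ab(3) conjg_mult by simp
 then show "conjg G g x \<in> A <#> B"
  using normal_conjg[OF assms(1) g ab(1)] normal_conjg[OF assms(2) g ab(2)] unfolding set_mult_def by blast
qed

lemma subset_set_mult:
 assumes "subgroup A G" "subgroup B G"
 shows "A \<subseteq> A <#> B" "B \<subseteq> A <#> B"
proof -
 show "A \<subseteq> A <#> B"
 proof
  fix a assume "a \<in> A"
  then have "a = a \<otimes> \<one>" using subgroup.mem_carrier[OF assms(1)] by simp
  then show "a \<in> A <#> B" using `a \<in> A` subgroup.one_closed[OF assms(2)] unfolding set_mult_def by blast
 qed
 show "B \<subseteq> A <#> B"
 proof
  fix b assume "b \<in> B"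
  then have "b = \<one> \<otimes> b" using subgroup.mem_carrier[OF assms(2)] by simp
  then show "b \<in> A <#> B" using `b \<in> B` subgroup.one_closed[OF assms(1)] unfolding set_mult_def by blast
 qed
qed

text \<open>A uniform bound on derived lengths modulo \<open>K\<close> makes the solvable normal subgroups a directed
 family whose union is again solvable modulo \<open>K\<close>.\<close>

lemma ex_largest_solvable_mod:
 assumes K: "K \<lhd> G"
  and bound: "\<And>H q. subgroup H G ==> (derived G ^^ q) H \<subseteq> K ==> (derived G ^^ f) H \<subseteq> K"
 shows "\<exists>W. W \<lhd> G \<and> K \<subseteq> W \<and> (derived G ^^ f) W \<subseteq> K \<and> (\<forall>T. T \<lhd> G \<and> loc_nilp_mod W T --> T \<subseteq> W)"
proof -
 define \<S> where "\<S> = {T. T \<lhd> G \<and> (derived G ^^ f) T \<subseteq> K}"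
 define W where "W = \<Union>\<S>"
 have Ss: "subgroup T G" if "T \<in> \<S>" for T using that normal_imp_subgroup by (auto simp: \<S>_def)
 have KS: "K \<in> \<S>"
  using K exp_derived_antimono[OF normal_imp_subgroup[OF K], of 0 f] by (simp add: \<S>_def)
 \<comment> \<open>Modulo \<open>A\<close> the product looks like \<open>B\<close>, so
   \<open>f\<close> derivations lead into \<open>A <#> K\<close> and another \<open>f\<close> into
   \<open>K\<close>; then \<open>bound\<close> takes the length from \<open>f + f\<close> back to
   \<open>f\<close>.\<close>
 have prod: "A <#> B \<in> \<S>" if "A \<in> \<S>" "B \<in> \<S>" for A B
 proof -
  have AB: "A \<lhd> G" "B \<lhd> G" "(derived G ^^ f) A \<subseteq> K" "(derived G ^^ f) B \<subseteq> K" using that by (auto simp: \<S>_def)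
  have Ac: "A \<subseteq> carrier G" "B \<subseteq> carrier G" "K \<subseteq> carrier G" using Ss that KS subgroup.subset by blast+
  have "(derived G ^^ f) (A <#> B) \<subseteq> A <#> K"
   using exp_derived_set_mult[OF AB(1) Ac(2), of f] AB(4) unfolding set_mult_def by blast
  also have "A <#> K = K <#> A"
   using commut_normal[OF normal_imp_subgroup[OF AB(1)] K] .
  finally have "(derived G ^^ f) ((derived G ^^ f) (A <#> B)) \<subseteq> (derived G ^^ f) (K <#> A)"
   by (rule mono_exp_of_derived)
  also have "\<dots> \<subseteq> K <#> K"
   using exp_derived_set_mult[OF K Ac(1), of f] AB(3) unfolding set_mult_def by blast
  also have "\<dots> \<subseteq> K" using subgroup.m_closed[OF Ss[OF KS]] by (auto simp: set_mult_def)
  finally have "(derived G ^^ (f + f)) (A <#> B) \<subseteq> K" by (simp add: funpow_add)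
  then show ?thesis
   using bound[OF normal_imp_subgroup] set_mult_normal[OF AB(1,2)] unfolding \<S>_def by blast
 qed
 have directed: "\<exists>T \<in> \<S>. S \<subseteq> T" if "finite S" "S \<subseteq> W" for S
  using that
 proof (induction S rule: finite_induct)
  case empty
  then show ?case using KS by blast
 next
  case (insert x S)
  then obtain A B where "A \<in> \<S>" "S \<subseteq> A" "B \<in> \<S>" "x \<in> B" by (auto simp: W_def)
  then show ?case using prod[of A B] subset_set_mult[OF Ss Ss, of A B] by blast
 qed
 have W: "W \<lhd> G"
 proof (rule normalI_conjg)
  show "subgroup W G"
  proof (rule subgroupI)
   show "W \<subseteq> carrier G" using Ss subgroup.subset by (auto simp: W_def)
   show "W \<noteq> {}" using KS subgroup.one_closed[OF Ss[OF KS]] by (auto simp: W_def)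
   show "inv a \<in> W" if "a \<in> W" for a
    using that Ss subgroup.m_inv_closed by (fastforce simp: W_def)
   show "a \<otimes> b \<in> W" if ab: "a \<in> W" "b \<in> W" for a b
   proof -
    obtain T where "T \<in> \<S>" "a \<in> T" "b \<in> T" using directed[of "{a, b}"] ab by auto
    then show ?thesis using subgroup.m_closed[OF Ss] unfolding W_def by blast
   qed
  qed
  show "conjg G g x \<in> W" if "g \<in> carrier G" "x \<in> W" for g x
   using that normal_conjg by (auto simp: W_def \<S>_def)
 qed
 have Wc: "W \<subseteq> carrier G" using W normal_imp_subgroup subgroup.subset by blast
 have "(derived G ^^ f) W \<subseteq> K"
 proof
  fix x assume "x \<in> (derived G ^^ f) W"
  then obtain S where S: "finite S" "S \<subseteq> W" "x \<in> (derived G ^^ f) (generate G S)"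
   using exp_derived_finitary[OF Wc] by blast
  obtain T where T: "T \<in> \<S>" "S \<subseteq> T" using directed S by blast
  then have "generate G S \<subseteq> T" using generate_subgroup_incl Ss by blast
  then have "(derived G ^^ f) (generate G S) \<subseteq> (derived G ^^ f) T" by (rule mono_exp_of_derived)
  then show "x \<in> K" using S T(1) by (auto simp: \<S>_def)
 qed
 moreover have "T \<subseteq> W" if T: "T \<lhd> G" "loc_nilp_mod W T" for T
 proof -
  have Tc: "T \<subseteq> carrier G" using T(1) normal_imp_subgroup subgroup.subset by blast
  \<comment> \<open>A finitely generated part of \<open>T\<close> is nilpotent modulo
    \<open>W\<close>, of a class depending on that part, hence solvable modulo \<open>K\<close>;
    \<open>bound\<close> removes the dependence.\<close>
  have "(derived G ^^ f) T \<subseteq> K"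
  proof
   fix x assume "x \<in> (derived G ^^ f) T"
   then obtain S where S: "finite S" "S \<subseteq> T" "x \<in> (derived G ^^ f) (generate G S)"
    using exp_derived_finitary[OF Tc] by blast
   have g: "subgroup (generate G S) G" using S Tc by (intro generate_is_subgroup) auto
   obtain n where "lcs (generate G S) n \<subseteq> W" using T(2) S unfolding loc_nilp_mod_def by blast
   then have "(derived G ^^ n) (generate G S) \<subseteq> W" using derived_subset_lcs[OF g] by blast
   then have "(derived G ^^ f) ((derived G ^^ n) (generate G S)) \<subseteq> (derived G ^^ f) W"
    by (rule mono_exp_of_derived)
   also have "\<dots> \<subseteq> K" by fact
   finally have "(derived G ^^ (f + n)) (generate G S) \<subseteq> K" by (simp add: funpow_add)
   then show "x \<in> K" using bound[OF g] S(3) by blast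
  qed
  then show ?thesis using T(1) by (auto simp: W_def \<S>_def)
 qed
 ultimately show ?thesis using W KS by (intro exI[of _ W]) (auto simp: W_def)
qed

text \<open>Transfinite induction along the series: local nilpotence modulo a member inside
  \<open>W\<close> implies local nilpotence modulo \<open>W\<close>.\<close>

lemma solvable_radical_subsetI:
 assumes W: "W \<lhd> G" and loc: "\<And>T. T \<lhd> G ==> loc_nilp_mod W T ==> T \<subseteq> W"
 shows "solvable_radical G \<subseteq> W"
proof -
 let ?r = "series_index G" and ?R = "upper_radical_series G (series_index G)"
 have "Card_order ?r" by (rule cardSuc_Card_order) (rule card_of_Card_order)
 then have wo: "Well_order ?r" by (simp add: card_order_on_def)
 have wo_rel: "wo_rel ?r" using wo by (simp add: wo_rel_def)
 have Ws: "subgroup W G" by (rule normal_imp_subgroup[OF W])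
 have "?R j \<subseteq> W" for j
 proof (induction j rule: wo_rel.well_order_induct[OF wo_rel])
  case (1 j)
  then have IH: "?R i \<subseteq> W" if "i \<in> underS ?r j" for i
   using that by (auto simp: underS_def)
  show ?case
  proof (cases "underS ?r j = {}")
   case True
   then show ?thesis using upper_radical_series_zero[OF wo True, of G] subgroup.one_closed[OF Ws] by simp
  next
   case ne: False
   show ?thesis
   proof (cases "\<exists>i. is_succ ?r i j")
    case True
    then obtain i where i: "is_succ ?r i j" ..
    have "?R i \<lhd> G" using upper_radical_series_normal_mono[OF wo] by blast
    then have "radical_over G (?R i) \<subseteq> W"
     using IH[OF is_succ_underS[OF wo i]] Ws loc loc_nilp_mod_mono by (intro radical_over_subsetI) blast+
    then show ?thesis using upper_radical_series_succ[OF wo i, of G] by simp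
   next
    case False
    then show ?thesis using upper_radical_series_limit[OF wo ne False, of G] IH by blast
   qed
  qed
 qed
 then show ?thesis unfolding solvable_radical_def by blast
qed

lemma solvable_radical_normal: "solvable_radical G \<lhd> G"
proof -
 have "Card_order (series_index G)" by (rule cardSuc_Card_order) (rule card_of_Card_order)
 then have "Well_order (series_index G)" by (simp add: card_order_on_def)
 then show ?thesis using solvable_radical_terminal upper_radical_series_normal_mono by metis
qed

lemma loc_nilp_mod_subset_solvable_radical:
 assumes "T \<lhd> G" "loc_nilp_mod (solvable_radical G) T"
 shows "T \<subseteq> solvable_radical G"
 using loc_nilp_mod_subset_radical_over[OF solvable_radical_normal assms] solvable_radical_terminal by metis

text \<open>Each derived subgroup is abelian, hence locally nilpotent, modulo the next one. Since
  the series has become stationary, the radical absorbs them one by one from the bottom.\<close>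

lemma derived_subset_solvable_radicalD:
 "T \<lhd> G ==> (derived G ^^ n) T \<subseteq> solvable_radical G ==> T \<subseteq> solvable_radical G"
proof (induction n arbitrary: T)
 case (Suc n)
 have D: "(derived G ^^ n) T \<lhd> G" by (rule normal_exp_derived[OF Suc.prems(1)])
 have "(derived G ^^ n) T \<subseteq> solvable_radical G"
  using Suc.prems(2) loc_nilp_mod_derived[OF normal_imp_subgroup[OF D]]
  by (intro loc_nilp_mod_subset_solvable_radical[OF D]) simp
 then show ?case using Suc by blast
qed simp

end

section \<open>Quasi-nil elements\<close>

lemma engel_iter_cong:
 "(\<And>i. 1 \<le> i ==> i \<le> k ==> n i = n' i \<and> a i = a' i) ==> engel_iter G k n a y = engel_iter G k n' a' y"
 by (induction k) auto

text \<open>The recursion strips the last entry; an induction that keeps the first exponent fixed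
  has to strip the first.\<close>

lemma engel_iter_front:
 "engel_iter G (Suc k) n a y = engel_iter G k (\<lambda>i. n (Suc i)) (\<lambda>i. a (Suc i)) (engel G (n 1) (a 1) y)"
 by (induction k) auto

lemma (in group) solvable_radical_subset: "solvable_radical G \<subseteq> carrier G"
 by (rule subgroup.subset[OF normal_imp_subgroup[OF solvable_radical_normal]])

text \<open>What the group-theoretic part uses of the representations: normal subgroups
  \<open>\<N>\<close> with one derived-length bound \<open>f\<close> for all of them, the linear
  Engel theorem for each, and a locally nilpotent intersection.\<close>

locale engel_kernels = group +
 fixes \<N> :: "'a set set" and f :: nat
 assumes kernel_normal: "K \<in> \<N> ==> K \<lhd> G"
  and kernel_bound: "K \<in> \<N> ==> subgroup H G ==> (derived G ^^ q) H \<subseteq> K ==> (derived G ^^ f) H \<subseteq> K"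
  and kernel_engel: "K \<in> \<N> ==> R \<lhd> G ==> K \<subseteq> R ==> (derived G ^^ s) R \<subseteq> K ==>
   \<Delta> \<subseteq> carrier G ==> (\<And>u g. u \<in> \<Delta> ==> g \<in> carrier G ==> conjg G g u \<in> \<Delta>) ==>
   (\<And>u a. u \<in> \<Delta> ==> a \<in> carrier G ==> \<exists>m. engel G m a u \<in> R) ==>
   (derived G ^^ f) (generate G (\<Delta> \<union> R)) \<subseteq> K"
  and Inter_loc_nilp: "loc_nilp_mod {\<one>} {g \<in> carrier G. \<forall>K \<in> \<N>. g \<in> K}"
begin

abbreviation "core \<equiv> {g \<in> carrier G. \<forall>K \<in> \<N>. g \<in> K}"

lemma core_normal: "core \<lhd> G"
proof (rule normalI_conjg)
 have s: "subgroup K G" if "K \<in> \<N>" for K using kernel_normal[OF that] normal_imp_subgroup by blast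
 show "subgroup core G"
  using subgroup.one_closed[OF s] subgroup.m_inv_closed[OF s] subgroup.m_closed[OF s]
  by (intro subgroupI) (auto intro: exI[of _ \<one>])
 show "conjg G g x \<in> core" if "g \<in> carrier G" "x \<in> core" for g x
  using that kernel_normal normal_conjg by simp
qed

lemma core_subset_radical: "core \<subseteq> solvable_radical G"
 using loc_nilp_mod_mono[OF Inter_loc_nilp] solvable_radical_normal core_normal
 by (intro loc_nilp_mod_subset_solvable_radical) (auto simp: normal_imp_subgroup subgroup.one_closed)

lemma ex_largest_solvable:
 assumes K: "K \<in> \<N>"
 shows "\<exists>W. W \<lhd> G \<and> K \<subseteq> W \<and> (derived G ^^ f) W \<subseteq> K \<and> solvable_radical G \<subseteq> W"
proof -
 have "\<exists>W. W \<lhd> G \<and> K \<subseteq> W \<and> (derived G ^^ f) W \<subseteq> K \<and> (\<forall>T. T \<lhd> G \<and> loc_nilp_mod W T --> T \<subseteq> W)"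
  by (rule ex_largest_solvable_mod[OF kernel_normal[OF K]]) (rule kernel_bound[OF K])
 then obtain W where W: "W \<lhd> G" "K \<subseteq> W" "(derived G ^^ f) W \<subseteq> K"
  and max: "\<forall>T. T \<lhd> G \<and> loc_nilp_mod W T --> T \<subseteq> W" by (elim exE conjE)
 have "solvable_radical G \<subseteq> W" by (rule solvable_radical_subsetI[OF W(1)]) (use max in blast)
 then show ?thesis using W by blast
qed

text \<open>For each kernel the radical lies in a normal subgroup of length \<open>f\<close> modulo
  that kernel, and \<open>f\<close> is the same for all.\<close>

lemma derived_radical_subset_core: "(derived G ^^ f) (solvable_radical G) \<subseteq> core"
proof
 fix x assume x: "x \<in> (derived G ^^ f) (solvable_radical G)"
 have "solvable_radical G \<subseteq> carrier G"
  by (rule solvable_radical_subset)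
 then have xc: "x \<in> carrier G" using x exp_of_derived_in_carrier by blast
 have "x \<in> K" if K: "K \<in> \<N>" for K
 proof -
  obtain W where W: "(derived G ^^ f) W \<subseteq> K" "solvable_radical G \<subseteq> W"
   using ex_largest_solvable[OF K] by blast
  then show ?thesis using mono_exp_of_derived[of "solvable_radical G" W f] x by blast
 qed
 then show "x \<in> core" using xc by blast
qed

text \<open>The conjugates of \<open>g\<close> are Engel modulo the radical, hence modulo the
  solvable subgroup \<open>W\<close> above each kernel, which contains the radical. The resulting
  length \<open>f\<close> is common to all kernels, so the derived subgroup falls into the core, and
  the normal closure of \<open>g\<close> is solvable modulo the radical.\<close>

lemma engel_mod_radical:
 assumes g: "g \<in> carrier G" and engel: "\<And>a. a \<in> carrier G ==> \<exists>n. engel G n a g \<in> solvable_radical G"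
 shows "g \<in> solvable_radical G"
proof -
 define \<Delta> where "\<Delta> = {conjg G x g |x. x \<in> carrier G}"
 have Dc: "\<Delta> \<subseteq> carrier G" using g by (auto simp: \<Delta>_def)
 have D_conjg: "conjg G h u \<in> \<Delta>" if u: "u \<in> \<Delta>" and h: "h \<in> carrier G" for u h
 proof -
  obtain x where x: "x \<in> carrier G" "u = conjg G x g" using u by (auto simp: \<Delta>_def)
  then have "conjg G h u = conjg G (x \<otimes> h) g" using g h by (simp add: conjg_mult_left)
  then show ?thesis using x h by (auto simp: \<Delta>_def)
 qed
 have conjg_comm: "conjg G h (comm G x y) = comm G (conjg G h x) (conjg G h y)"
  if "h \<in> carrier G" "x \<in> carrier G" "y \<in> carrier G" for h x y
  using that by (simp add: grp)
 have conjg_engel: "conjg G h (engel G n x y) = engel G n (conjg G h x) (conjg G h y)"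
  if "h \<in> carrier G" "x \<in> carrier G" "y \<in> carrier G" for h n x y
  using that by (induction n) (simp_all add: conjg_comm)
 have D_engel: "\<exists>m. engel G m a u \<in> solvable_radical G" if ua: "u \<in> \<Delta>" "a \<in> carrier G" for u a
 proof -
  obtain x where x: "x \<in> carrier G" "u = conjg G x g" using ua by (auto simp: \<Delta>_def)
  obtain m where m: "engel G m (conjg G (inv x) a) g \<in> solvable_radical G"
   using engel[of "conjg G (inv x) a"] ua x by auto
  have "conjg G x (engel G m (conjg G (inv x) a) g) = engel G m a u"
   using x ua g by (simp add: conjg_engel)
  then show ?thesis using normal_conjg[OF solvable_radical_normal x(1) m] by metis
 qed
 have "(derived G ^^ f) (generate G \<Delta>) \<subseteq> K" if K: "K \<in> \<N>" for K
 proof -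
  obtain W where W: "W \<lhd> G" "K \<subseteq> W" "(derived G ^^ f) W \<subseteq> K" "solvable_radical G \<subseteq> W"
   using ex_largest_solvable[OF K] by blast
  have "(derived G ^^ f) (generate G (\<Delta> \<union> W)) \<subseteq> K"
   using D_engel W(4) by (intro kernel_engel[OF K W(1-3) Dc D_conjg]) blast+
  moreover have "generate G \<Delta> \<subseteq> generate G (\<Delta> \<union> W)" by (rule mono_generate) blast
  ultimately show ?thesis using mono_exp_of_derived[of "generate G \<Delta>" _ f] by blast
 qed
 moreover have T: "generate G \<Delta> \<lhd> G"
 proof (rule normal_generateI[OF Dc])
  fix h x assume "h \<in> \<Delta>" "x \<in> carrier G"
  then show "x \<otimes> h \<otimes> inv x \<in> \<Delta>" using D_conjg[of h "inv x"] by (simp add: conjg_def)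
 qed
 moreover have "(derived G ^^ f) (generate G \<Delta>) \<subseteq> carrier G"
  using exp_of_derived_in_carrier subgroup.subset normal_imp_subgroup[OF T] by blast
 ultimately have "(derived G ^^ f) (generate G \<Delta>) \<subseteq> solvable_radical G"
  using core_subset_radical by blast
 then have "generate G \<Delta> \<subseteq> solvable_radical G" by (rule derived_subset_solvable_radicalD[OF T])
 moreover have "g \<in> \<Delta>" using g by (auto simp: \<Delta>_def intro!: exI[of _ \<one>])
 ultimately show ?thesis by (auto intro: generate.incl)
qed

text \<open>The element e_n(a, g) with n = \<open>N 1 [a]\<close> satisfies the hypothesis with one
  entry fewer. Compatibility matters here: n is fixed before the other entries are chosen. By
  induction that element lies in the radical, so \<open>g\<close> is Engel modulo the
  radical.\<close>

lemma engel_iter_one_imp_radical: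
 assumes "g \<in> carrier G"
  and "\<And>a. (\<And>i. a i \<in> carrier G) ==> engel_iter G k (\<lambda>i. N i (map a [1..<Suc i])) a g = \<one>"
 shows "g \<in> solvable_radical G"
 using assms
proof (induction k arbitrary: g N)
 case 0
 have "g = \<one>" using "0.prems"(2)[of "\<lambda>_. \<one>"] by simp
 then show ?case using solvable_radical_normal normal_imp_subgroup subgroup.one_closed by blast
next
 case (Suc k)
 show ?case
 proof (rule engel_mod_radical[OF Suc.prems(1)])
  fix a assume a: "a \<in> carrier G"
  let ?n = "N 1 [a]"
  have "engel G ?n a g \<in> solvable_radical G"
  proof (rule Suc.IH[where N = "\<lambda>i as. N (Suc i) (a # as)"])
   show "engel G ?n a g \<in> carrier G" using a Suc.prems(1) by simp
   fix b :: "nat => 'a" assume b: "\<And>i. b i \<in> carrier G"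
   \<comment> \<open>\<open>a\<close> followed by the entries of \<open>b\<close>, counted from
     1.\<close>
   define c where "c i = (if i = 1 then a else b (i - 1))" for i
   have map_c: "map c [1..<Suc (Suc i)] = a # map b [1..<Suc i]" for i
   proof -
    have "[1..<Suc (Suc i)] = 1 # map Suc [1..<Suc i]" 
     unfolding map_Suc_upt by (rule upt_conv_Cons) simp
    moreover have "map c (map Suc [1..<Suc i]) = map b [1..<Suc i]" by (auto simp: c_def)
    ultimately show ?thesis by (simp add: c_def del: upt_Suc)
   qed
   have "c i \<in> carrier G" for i using a b by (simp add: c_def)
   then have "\<one> = engel_iter G (Suc k) (\<lambda>i. N i (map c [1..<Suc i])) c g"
    by (rule Suc.prems(2)[symmetric])
   also have "\<dots> = engel_iter G k (\<lambda>i. N (Suc i) (map c [1..<Suc (Suc i)])) (\<lambda>i. c (Suc i))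
     (engel G (N 1 (map c [1..<Suc 1])) (c 1) g)" by (rule engel_iter_front)
   also have "engel G (N 1 (map c [1..<Suc 1])) (c 1) g = engel G ?n a g" by (simp add: c_def)
   also have "engel_iter G k (\<lambda>i. N (Suc i) (map c [1..<Suc (Suc i)])) (\<lambda>i. c (Suc i)) (engel G ?n a g)
     = engel_iter G k (\<lambda>i. N (Suc i) (a # map b [1..<Suc i])) b (engel G ?n a g)"
    unfolding map_c by (rule engel_iter_cong) (simp add: c_def)
   finally show "engel_iter G k (\<lambda>i. N (Suc i) (a # map b [1..<Suc i])) b (engel G ?n a g) = \<one>" by simp
  qed
  then show "\<exists>n. engel G n a g \<in> solvable_radical G" by blast
 qed
qed

text \<open>With exponent 2 each entry moves the value one step down the derived series of the
  radical: [a, y] stays in the current term by normality, and [[a, y], y] is a commutator of two of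
  its elements. After \<open>f\<close> entries the value is in the core, where one more entry with a
  suitable exponent gives 1.\<close>

lemma radical_quasi_nil:
 assumes g: "g \<in> solvable_radical G"
 shows "quasi_nil G g"
proof -
 let ?E = "\<lambda>as. engel_iter G f (\<lambda>_. 2) (\<lambda>i. as ! (i - 1)) g"
 \<comment> \<open>Lists are indexed from 0, so \<open>as ! f\<close> is entry number
   \<open>f + 1\<close>, and \<open>?E as\<close> is the value after the first \<open>f\<close>
   entries.\<close>
 define N where "N i as = (if i \<le> f then 2 else SOME n. n \<ge> 1 \<and> engel G n (as ! f) (?E as) = \<one>)"
  for i :: nat and as
 have gc: "g \<in> carrier G" using g solvable_radical_subset by blast
 have y: "engel_iter G i (\<lambda>_. 2) a g \<in> (derived G ^^ i) (solvable_radical G)"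
  if "\<And>j. 1 \<le> j ==> j \<le> i ==> a j \<in> carrier G" for i a
  using that
 proof (induction i)
  case (Suc i)
  let ?y = "engel_iter G i (\<lambda>_. 2) a g" and ?D = "(derived G ^^ i) (solvable_radical G)"
  have D: "?D \<lhd> G" by (rule normal_exp_derived[OF solvable_radical_normal])
  have yD: "?y \<in> ?D" using Suc by simp
  have "comm G (a (Suc i)) ?y \<in> ?D" using normal_comm_right[OF D _ yD] Suc.prems by simp
  then have "comm G (comm G (a (Suc i)) ?y) ?y \<in> derived G ?D"
   using comm_in_derived[OF normal_imp_subgroup[OF D]] yD by blast
  then show ?case by (simp add: numeral_2_eq_2)
 qed (use g in simp)
 \<comment> \<open>From [a, u] on the sequence stays in the group generated by [a, u] and
   \<open>u\<close>, which is nilpotent. The first step is taken separately because \<open>a\<close>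
   itself may lie outside the core.\<close>
 have ex: "\<exists>n \<ge> 1. engel G n a u = \<one>" if u: "u \<in> core" and a: "a \<in> carrier G" for u a
 proof -
  let ?S = "{comm G a u, u}"
  have "comm G a u \<in> core" using normal_comm_right[OF core_normal a u] .
  then obtain m where m: "lcs (generate G ?S) m \<subseteq> {\<one>}"
   using Inter_loc_nilp[unfolded loc_nilp_mod_def, rule_format, of ?S] u by auto
  have "engel G m (comm G a u) u \<in> lcs (generate G ?S) m"
   by (rule engel_in_lcs) (auto intro: generate.incl)
  then have "engel G m (comm G a u) u = \<one>" using m by blast
  moreover have "engel G (Suc m) a u = engel G m (comm G a u) u" for m by (induction m) simp_all
  ultimately show ?thesis by (intro exI[of _ "Suc m"]) auto
 qed
 have N_last: "N (Suc f) as \<ge> 1 \<and> engel G (N (Suc f) as) (as ! f) (?E as) = \<one>"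
  if as: "length as = Suc f" "set as \<subseteq> carrier G" for as
 proof -
  have nth: "as ! i \<in> carrier G" if "i \<le> f" for i using as that by (auto simp: subset_iff)
  then have "?E as \<in> core" using y[of f "\<lambda>i. as ! (i - 1)"] derived_radical_subset_core by auto
  then have "\<exists>n. n \<ge> 1 \<and> engel G n (as ! f) (?E as) = \<one>" using ex nth[of f] by blast
  from someI_ex[OF this] show ?thesis by (simp add: N_def)
 qed
 have "N i as \<ge> 1" if "i \<in> {1..Suc f}" "length as = i" "set as \<subseteq> carrier G" for i as
  using that N_last[of as] by (cases "i = Suc f") (auto simp: N_def)
 moreover have "engel_iter G (Suc f) (\<lambda>i. N i (map a [1..<Suc i])) a g = \<one>"
  if a: "\<forall>i \<in> {1..Suc f}. a i \<in> carrier G" for a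
 proof -
  let ?as = "map a [1..<Suc (Suc f)]"
  have nth: "?as ! i = a (Suc i)" if "i \<le> f" for i using that by (simp add: nth_append del: upt_Suc)
  have "engel_iter G f (\<lambda>i. N i (map a [1..<Suc i])) a g = ?E ?as"
   using nth by (intro engel_iter_cong) (auto simp: N_def simp del: upt_Suc)
  moreover have "set ?as \<subseteq> carrier G" using a by (auto simp del: upt_Suc)
  ultimately show ?thesis using N_last[of ?as] nth[of f] by (simp del: upt_Suc)
 qed
 ultimately show ?thesis unfolding quasi_nil_def by (intro exI[of _ "Suc f"] conjI exI[of _ N]) auto
qed

theorem solvable_radical_eq_quasi_nil: "solvable_radical G = {g \<in> carrier G. quasi_nil G g}"
proof (intro equalityI subsetI CollectI conjI)
 fix g assume g: "g \<in> solvable_radical G"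
 then show "g \<in> carrier G" using solvable_radical_subset by blast
 show "quasi_nil G g" by (rule radical_quasi_nil[OF g])
next
 fix g assume "g \<in> {g \<in> carrier G. quasi_nil G g}"
 then obtain k and N :: "nat => 'a list => nat" where "g \<in> carrier G"
  "\<And>a. (\<forall>i \<in> {1..k}. a i \<in> carrier G) ==> engel_iter G k (\<lambda>i. N i (map a [1..<Suc i])) a g = \<one>"
  unfolding quasi_nil_def by blast
 then show "g \<in> solvable_radical G" by (intro engel_iter_one_imp_radical[of g k N]) auto
qed

end

section \<open>PI-groups\<close>

lemma matrix_homD:
 assumes "matrix_hom A K n \<phi>" "i < n" "j < n" "x \<in> carrier A"
 shows "\<phi> x i j \<in> carrier K"
  "y \<in> carrier A ==> \<phi> (x \<oplus>\<^bsub>A\<^esub> y) i j = \<phi> x i j \<oplus>\<^bsub>K\<^esub> \<phi> y i j"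
  "y \<in> carrier A ==> \<phi> (x \<otimes>\<^bsub>A\<^esub> y) i j = (\<Oplus>\<^bsub>K\<^esub>l \<in> {..<n}. \<phi> x i l \<otimes>\<^bsub>K\<^esub> \<phi> y l j)"
 using assms unfolding matrix_hom_def by simp_all

lemma matrix_hom_comp:
 assumes "matrix_hom A K n \<phi>" and h: "h \<in> ring_hom K L" and K: "ring K" and L: "ring L"
 shows "matrix_hom A L n (\<lambda>x i j. h (\<phi> x i j))"
proof -
 interpret K: ring K by (rule K)
 interpret L: ring L by (rule L)
 have h0: "h \<zero>\<^bsub>K\<^esub> = \<zero>\<^bsub>L\<^esub>" by (rule ring_hom_zero[OF h K L])
 have sum: "h (\<Oplus>\<^bsub>K\<^esub>l \<in> J. f l) = (\<Oplus>\<^bsub>L\<^esub>l \<in> J. h (f l))"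
  if "finite J" "\<And>l. l \<in> J ==> f l \<in> carrier K" for f and J :: "nat set"
  using that
 proof (induction J rule: finite_induct)
  case (insert l J)
  then have "f \<in> J \<rightarrow> carrier K" "f l \<in> carrier K" "(\<lambda>l. h (f l)) \<in> J \<rightarrow> carrier L" "h (f l) \<in> carrier L"
   using ring_hom_closed[OF h] by auto
  then show ?case using insert by (simp add: K.finsum_insert L.finsum_insert ring_hom_add[OF h])
 qed (simp add: h0)
 have \<phi>: "\<phi> x i j \<in> carrier K" if "x \<in> carrier A" "i < n" "j < n" for x i j
  using assms(1) that by (auto simp: matrix_hom_def)
 have mult: "h (\<Oplus>\<^bsub>K\<^esub>l \<in> {..<n}. \<phi> x i l \<otimes>\<^bsub>K\<^esub> \<phi> y l j) = (\<Oplus>\<^bsub>L\<^esub>l \<in> {..<n}. h (\<phi> x i l) \<otimes>\<^bsub>L\<^esub> h (\<phi> y l j))"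
  if "x \<in> carrier A" "y \<in> carrier A" "i < n" "j < n" for x y i j
 proof -
  have "h (\<Oplus>\<^bsub>K\<^esub>l \<in> {..<n}. \<phi> x i l \<otimes>\<^bsub>K\<^esub> \<phi> y l j) = (\<Oplus>\<^bsub>L\<^esub>l \<in> {..<n}. h (\<phi> x i l \<otimes>\<^bsub>K\<^esub> \<phi> y l j))"
   using \<phi> that by (intro sum) auto
  also have "\<dots> = (\<Oplus>\<^bsub>L\<^esub>l \<in> {..<n}. h (\<phi> x i l) \<otimes>\<^bsub>L\<^esub> h (\<phi> y l j))"
   using \<phi> that ring_hom_closed[OF h] by (intro L.finsum_cong') (auto simp: ring_hom_mult[OF h])
  finally show ?thesis .
 qed
 show ?thesis
  using assms(1) \<phi> mult h0 ring_hom_one[OF h] ring_hom_closed[OF h] ring_hom_add[OF h]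
  unfolding matrix_hom_def by (simp split: if_splits)
qed

text \<open>The type of HOL-Algebra's algebraic closure of the field of cosets \<open>K0/M\<close> over \<open>A[t]\<close>.\<close>

type_synonym 'a coeff_field = "(((nat => 'a) set list \<times> nat) multiset => (nat => 'a) set) ring"

text \<open>Zassenhaus' theorem needs eigenvalues, so the scalars are extended to an algebraic
  closure; a nonzero entry stays nonzero because it is invertible.\<close>

lemma (in multilinear_identity) non_nilpotent_closed_matrix_hom:
 assumes "x \<in> carrier R" "\<And>n::nat. x [^] n \<noteq> \<zero>"
 obtains L :: "'a coeff_field" and n \<phi>
 where "n \<le> d" "algebraically_closed L" "matrix_hom R L n \<phi>" "\<exists>i < n. \<exists>j < n. \<phi> x i j \<noteq> \<zero>\<^bsub>L\<^esub>"
proof -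
 obtain K :: "(nat => 'a) set ring" and n \<phi> where n: "n \<le> d" and K: "field K"
  and \<phi>: "matrix_hom R K n \<phi>" "\<exists>i < n. \<exists>j < n. \<phi> x i j \<noteq> \<zero>\<^bsub>K\<^esub>"
  using non_nilpotent_matrix_hom[OF assms] by blast
 interpret K: field K by (rule K)
 interpret L: algebraic_closure K.alg_closure "K.indexed_const ` carrier K" by (rule K.alg_closureE(1))
 note h = K.alg_closureE(2)
 have "K.indexed_const c \<noteq> \<zero>\<^bsub>K.alg_closure\<^esub>" if "c \<in> carrier K" "c \<noteq> \<zero>\<^bsub>K\<^esub>" for c
 proof
  assume "K.indexed_const c = \<zero>\<^bsub>K.alg_closure\<^esub>"
  moreover have ci: "inv\<^bsub>K\<^esub> c \<in> carrier K" "c \<otimes>\<^bsub>K\<^esub> inv\<^bsub>K\<^esub> c = \<one>\<^bsub>K\<^esub>" using that K.field_Units by auto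
  then have "K.indexed_const c \<otimes>\<^bsub>K.alg_closure\<^esub> K.indexed_const (inv\<^bsub>K\<^esub> c) = \<one>\<^bsub>K.alg_closure\<^esub>"
   using ring_hom_mult[OF h that(1) ci(1)] ring_hom_one[OF h] by simp
  ultimately show False using ring_hom_closed[OF h ci(1)] by simp
 qed
 moreover obtain i j where "i < n" "j < n" "\<phi> x i j \<noteq> \<zero>\<^bsub>K\<^esub>" using \<phi>(2) by blast
 moreover from this have "\<phi> x i j \<in> carrier K" using \<phi>(1) assms(1) by (auto simp: matrix_hom_def)
 ultimately have "\<exists>i < n. \<exists>j < n. K.indexed_const (\<phi> x i j) \<noteq> \<zero>\<^bsub>K.alg_closure\<^esub>" by blast
 then show thesis
  using that[OF n L.algebraically_closed_axioms matrix_hom_comp[OF \<phi>(1) h K.ring_axioms L.ring_axioms]] by blast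
qed

locale unit_embedding = G: group G + A: multilinear_identity A d \<gamma>
 for G :: "('g, 'm) monoid_scheme" (structure) and A :: "('a, 'n) ring_scheme" (structure) and d \<gamma> +
 fixes \<psi> :: "'g => 'a"
 assumes \<psi>_closed: "g \<in> carrier G ==> \<psi> g \<in> carrier A"
  and \<psi>_mult: "g \<in> carrier G ==> h \<in> carrier G ==> \<psi> (g \<otimes>\<^bsub>G\<^esub> h) = \<psi> g \<otimes>\<^bsub>A\<^esub> \<psi> h"
  and \<psi>_one: "\<psi> \<one>\<^bsub>G\<^esub> = \<one>\<^bsub>A\<^esub>"
  and \<psi>_inj: "inj_on \<psi> (carrier G)"
begin

definition \<delta> :: "'g => 'a"
 where "\<delta> g = \<psi> g \<ominus>\<^bsub>A\<^esub> \<one>\<^bsub>A\<^esub>"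

lemma \<delta>_closed: "g \<in> carrier G ==> \<delta> g \<in> carrier A"
 by (simp add: \<delta>_def \<psi>_closed)

lemma \<psi>_eq: "g \<in> carrier G ==> \<psi> g = \<delta> g \<oplus>\<^bsub>A\<^esub> \<one>\<^bsub>A\<^esub>"
 by (simp add: \<delta>_def \<psi>_closed a_minus_def A.a_assoc A.l_neg)

lemma \<delta>_zero_iff: "g \<in> carrier G ==> \<delta> g = \<zero>\<^bsub>A\<^esub> \<longleftrightarrow> g = \<one>\<^bsub>G\<^esub>"
 using inj_onD[OF \<psi>_inj, of g "\<one>\<^bsub>G\<^esub>"] \<psi>_closed[of g] by (auto simp: \<delta>_def \<psi>_one)

lemma \<delta>_one: "\<delta> \<one>\<^bsub>G\<^esub> = \<zero>\<^bsub>A\<^esub>"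
 using \<delta>_zero_iff[of "\<one>\<^bsub>G\<^esub>"] by simp

lemma \<delta>_mult:
 assumes "g \<in> carrier G" "h \<in> carrier G"
 shows "\<delta> (g \<otimes>\<^bsub>G\<^esub> h) = \<delta> g \<otimes>\<^bsub>A\<^esub> \<delta> h \<oplus>\<^bsub>A\<^esub> \<delta> g \<oplus>\<^bsub>A\<^esub> \<delta> h"
proof -
 note c = \<delta>_closed[OF assms(1)] \<delta>_closed[OF assms(2)]
 have "\<delta> (g \<otimes>\<^bsub>G\<^esub> h) = \<psi> g \<otimes>\<^bsub>A\<^esub> \<psi> h \<ominus>\<^bsub>A\<^esub> \<one>\<^bsub>A\<^esub>" using assms by (simp add: \<delta>_def \<psi>_mult)
 then have "\<delta> (g \<otimes>\<^bsub>G\<^esub> h) = (\<delta> g \<oplus>\<^bsub>A\<^esub> \<one>\<^bsub>A\<^esub>) \<otimes>\<^bsub>A\<^esub> (\<delta> h \<oplus>\<^bsub>A\<^esub> \<one>\<^bsub>A\<^esub>) \<ominus>\<^bsub>A\<^esub> \<one>\<^bsub>A\<^esub>"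
  unfolding \<psi>_eq[OF assms(1)] \<psi>_eq[OF assms(2)] .
 then show ?thesis
  using c by (simp add: A.l_distr A.r_distr a_minus_def A.a_assoc A.r_neg A.a_lcomm A.a_comm[of "\<delta> g \<otimes>\<^bsub>A\<^esub> \<delta> h" "\<delta> h"])
qed

text \<open>A consequence of g^-1 g = 1. On the right the unknown occurs only multiplied by
  \<open>\<delta> g\<close>, so ideals and powers of ideals that contain \<open>\<delta> g\<close>
  contain it as well.\<close>

lemma \<delta>_inv:
 assumes "g \<in> carrier G"
 shows "\<delta> (inv\<^bsub>G\<^esub> g) = \<ominus>\<^bsub>A\<^esub> (\<delta> (inv\<^bsub>G\<^esub> g) \<otimes>\<^bsub>A\<^esub> \<delta> g) \<ominus>\<^bsub>A\<^esub> \<delta> g"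
proof -
 note c = \<delta>_closed[OF assms] \<delta>_closed[OF G.inv_closed[OF assms]]
 have "\<delta> (inv\<^bsub>G\<^esub> g) \<otimes>\<^bsub>A\<^esub> \<delta> g \<oplus>\<^bsub>A\<^esub> \<delta> (inv\<^bsub>G\<^esub> g) \<oplus>\<^bsub>A\<^esub> \<delta> g = \<zero>\<^bsub>A\<^esub>"
  using \<delta>_mult[of "inv\<^bsub>G\<^esub> g" g] assms \<delta>_one by simp
 then have "\<delta> (inv\<^bsub>G\<^esub> g) \<oplus>\<^bsub>A\<^esub> (\<delta> (inv\<^bsub>G\<^esub> g) \<otimes>\<^bsub>A\<^esub> \<delta> g \<oplus>\<^bsub>A\<^esub> \<delta> g) = \<zero>\<^bsub>A\<^esub>"
  using c by (simp add: A.a_ac)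
 then have "\<ominus>\<^bsub>A\<^esub> (\<delta> (inv\<^bsub>G\<^esub> g) \<otimes>\<^bsub>A\<^esub> \<delta> g \<oplus>\<^bsub>A\<^esub> \<delta> g) = \<delta> (inv\<^bsub>G\<^esub> g)"
  using c by (intro A.minus_equality) auto
 then show ?thesis using c by (simp add: A.minus_add a_minus_def)
qed

text \<open>[g, h] - 1 = (h g)^-1 (g h - h g), and g h - h g does not change when 1 is subtracted
  from both elements. So each commutator with a unipotent element gains a factor, and the lower
  central series sinks into ever higher powers.\<close>

lemma \<delta>_comm:
 assumes "g \<in> carrier G" "h \<in> carrier G"
 shows "\<delta> (comm G g h) = \<delta> (inv\<^bsub>G\<^esub> (h \<otimes>\<^bsub>G\<^esub> g)) \<otimes>\<^bsub>A\<^esub> (\<delta> g \<otimes>\<^bsub>A\<^esub> \<delta> h \<ominus>\<^bsub>A\<^esub> \<delta> h \<otimes>\<^bsub>A\<^esub> \<delta> g)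
  \<oplus>\<^bsub>A\<^esub> (\<delta> g \<otimes>\<^bsub>A\<^esub> \<delta> h \<ominus>\<^bsub>A\<^esub> \<delta> h \<otimes>\<^bsub>A\<^esub> \<delta> g)"
proof -
 let ?w = "inv\<^bsub>G\<^esub> (h \<otimes>\<^bsub>G\<^esub> g)"
 define s where "s = \<delta> g \<oplus>\<^bsub>A\<^esub> \<delta> h \<oplus>\<^bsub>A\<^esub> \<one>\<^bsub>A\<^esub>"
 define z where "z = \<delta> g \<otimes>\<^bsub>A\<^esub> \<delta> h \<ominus>\<^bsub>A\<^esub> \<delta> h \<otimes>\<^bsub>A\<^esub> \<delta> g"
 note c = \<delta>_closed[OF assms(1)] \<delta>_closed[OF assms(2)]
 have gh: "g \<otimes>\<^bsub>G\<^esub> h \<in> carrier G" "h \<otimes>\<^bsub>G\<^esub> g \<in> carrier G" using assms by simp_all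
 have wc: "?w \<in> carrier G" "\<delta> ?w \<in> carrier A" "\<psi> ?w \<in> carrier A" using assms by (simp_all add: \<psi>_closed \<delta>_closed)
 have sc: "s \<in> carrier A" and zc: "z \<in> carrier A" using c by (simp_all add: s_def z_def)
 have "\<psi> (g \<otimes>\<^bsub>G\<^esub> h) = \<delta> g \<otimes>\<^bsub>A\<^esub> \<delta> h \<oplus>\<^bsub>A\<^esub> s"
  unfolding \<psi>_eq[OF gh(1)] \<delta>_mult[OF assms] s_def using c by (simp add: A.a_assoc)
 moreover have "\<psi> (h \<otimes>\<^bsub>G\<^esub> g) = \<delta> h \<otimes>\<^bsub>A\<^esub> \<delta> g \<oplus>\<^bsub>A\<^esub> s"
  unfolding \<psi>_eq[OF gh(2)] \<delta>_mult[OF assms(2,1)] s_def using c by (simp add: A.a_ac)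
 moreover have "(a \<oplus>\<^bsub>A\<^esub> s) \<ominus>\<^bsub>A\<^esub> (b \<oplus>\<^bsub>A\<^esub> s) = a \<ominus>\<^bsub>A\<^esub> b" if "a \<in> carrier A" "b \<in> carrier A" for a b
 proof -
  have "(a \<oplus>\<^bsub>A\<^esub> s) \<ominus>\<^bsub>A\<^esub> (b \<oplus>\<^bsub>A\<^esub> s) = (a \<ominus>\<^bsub>A\<^esub> b) \<oplus>\<^bsub>A\<^esub> (s \<oplus>\<^bsub>A\<^esub> \<ominus>\<^bsub>A\<^esub> s)"
   using that sc by (simp add: a_minus_def A.minus_add A.a_ac del: A.r_neg)
  then show ?thesis using that sc by (simp add: A.r_neg)
 qed
 ultimately have z: "z = \<psi> (g \<otimes>\<^bsub>G\<^esub> h) \<ominus>\<^bsub>A\<^esub> \<psi> (h \<otimes>\<^bsub>G\<^esub> g)" using c by (simp add: z_def)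
 have "\<psi> ?w \<otimes>\<^bsub>A\<^esub> z = \<psi> (?w \<otimes>\<^bsub>G\<^esub> (g \<otimes>\<^bsub>G\<^esub> h)) \<ominus>\<^bsub>A\<^esub> \<psi> (?w \<otimes>\<^bsub>G\<^esub> (h \<otimes>\<^bsub>G\<^esub> g))"
  unfolding z \<psi>_mult[OF wc(1) gh(1)] \<psi>_mult[OF wc(1) gh(2)]
  using wc \<psi>_closed[OF gh(1)] \<psi>_closed[OF gh(2)] by (simp add: a_minus_def A.r_distr A.r_minus)
 also have "?w \<otimes>\<^bsub>G\<^esub> (h \<otimes>\<^bsub>G\<^esub> g) = \<one>\<^bsub>G\<^esub>" using gh by simp
 also have "?w \<otimes>\<^bsub>G\<^esub> (g \<otimes>\<^bsub>G\<^esub> h) = comm G g h" using assms by (simp add: comm_def G.inv_mult_group G.m_assoc)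
 finally have "\<delta> (comm G g h) = \<psi> ?w \<otimes>\<^bsub>A\<^esub> z" by (simp add: \<delta>_def \<psi>_one)
 then show ?thesis using wc zc unfolding \<psi>_eq[OF wc(1)] by (simp add: A.l_distr flip: z_def)
qed

end

text \<open>For positive \<open>k\<close> the \<open>k\<close>-th power of the ring without unit
  generated by \<open>T\<close>: the additive group generated by the products of at least
  \<open>k\<close> factors.\<close>

inductive_set (in ring) span :: "'a set => nat => 'a set" for T k
 where
  zero: "\<zero> \<in> span T k"
 | add: "x \<in> span T k ==> set ws \<subseteq> T ==> k \<le> length ws ==> x \<oplus> foldr (\<otimes>) ws \<one> \<in> span T k"
 | diff: "x \<in> span T k ==> set ws \<subseteq> T ==> k \<le> length ws ==> x \<ominus> foldr (\<otimes>) ws \<one> \<in> span T k"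

context ring
begin

context
 fixes T assumes T: "T \<subseteq> carrier R"
begin

lemma span_prod_closed: "set ws \<subseteq> T ==> foldr (\<otimes>) ws \<one> \<in> carrier R"
 using T foldr_closed by blast

lemma span_closed: "x \<in> span T k ==> x \<in> carrier R"
 by (induction rule: span.induct) (simp_all add: span_prod_closed)

lemma span_add: "y \<in> span T k ==> x \<in> span T k ==> x \<oplus> y \<in> span T k"
proof (induction rule: span.induct)
 case zero
 then show ?case using span_closed by simp
next
 case (add y ws)
 have "x \<oplus> (y \<oplus> foldr (\<otimes>) ws \<one>) = x \<oplus> y \<oplus> foldr (\<otimes>) ws \<one>"
  using add span_closed span_prod_closed by (simp add: a_assoc)
 then show ?case using add by (simp add: span.add)
next
 case (diff y ws)
 have "x \<oplus> (y \<ominus> foldr (\<otimes>) ws \<one>) = x \<oplus> y \<ominus> foldr (\<otimes>) ws \<one>"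
  using diff span_closed span_prod_closed by (simp add: a_minus_def a_assoc)
 then show ?case using diff by (simp add: span.diff)
qed

lemma span_inv: "x \<in> span T k ==> \<ominus> x \<in> span T k"
proof (induction rule: span.induct)
 case (add x ws)
 have "\<ominus> (x \<oplus> foldr (\<otimes>) ws \<one>) = \<ominus> x \<ominus> foldr (\<otimes>) ws \<one>"
  using add span_closed span_prod_closed by (simp add: a_minus_def minus_add)
 then show ?case using add by (simp add: span.diff)
next
 case (diff x ws)
 have "\<ominus> (x \<ominus> foldr (\<otimes>) ws \<one>) = \<ominus> x \<oplus> foldr (\<otimes>) ws \<one>"
  using diff span_closed span_prod_closed by (simp add: a_minus_def minus_add)
 then show ?case using diff by (simp add: span.add)
qed (simp add: span.zero)

lemma span_minus: "x \<in> span T k ==> y \<in> span T k ==> x \<ominus> y \<in> span T k"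
 by (simp add: a_minus_def span_add span_inv)

lemma span_prod: "set ws \<subseteq> T ==> k \<le> length ws ==> foldr (\<otimes>) ws \<one> \<in> span T k"
 using span.add[OF span.zero, of ws T k] span_prod_closed by simp

lemma foldr_append_mult:
 "set us \<subseteq> T ==> set ws \<subseteq> T ==> foldr (\<otimes>) (us @ ws) \<one> = foldr (\<otimes>) us \<one> \<otimes> foldr (\<otimes>) ws \<one>"
proof (induction us)
 case (Cons u us)
 then show ?case using T span_prod_closed by (auto simp: m_assoc subset_iff)
qed (simp add: span_prod_closed)

lemma span_mult: "x \<in> span T j ==> y \<in> span T k ==> x \<otimes> y \<in> span T (j + k)"
proof -
 have 1: "foldr (\<otimes>) us \<one> \<otimes> y \<in> span T (j + k)" if "y \<in> span T k" "set us \<subseteq> T" "j \<le> length us" for us y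
  using that(1)
 proof (induction rule: span.induct)
  case zero
  then show ?case using that span_prod_closed by (simp add: span.zero)
 next
  case (add y ws)
  have "foldr (\<otimes>) us \<one> \<otimes> (y \<oplus> foldr (\<otimes>) ws \<one>) = foldr (\<otimes>) us \<one> \<otimes> y \<oplus> foldr (\<otimes>) (us @ ws) \<one>"
   using add that span_closed span_prod_closed
   by (simp only: foldr_append_mult r_distr)
  then show ?case using add that by (auto intro!: span.add simp del: foldr_append)
 next
  case (diff y ws)
  have "foldr (\<otimes>) us \<one> \<otimes> (y \<ominus> foldr (\<otimes>) ws \<one>) = foldr (\<otimes>) us \<one> \<otimes> y \<ominus> foldr (\<otimes>) (us @ ws) \<one>"
   using diff that span_closed span_prod_closed
   by (simp add: foldr_append_mult r_distr a_minus_def r_minus del: foldr_append)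
  then show ?case using diff that by (auto intro!: span.diff simp del: foldr_append)
 qed
 show "x \<in> span T j ==> y \<in> span T k ==> x \<otimes> y \<in> span T (j + k)"
 proof (induction rule: span.induct)
  case zero
  then show ?case using span_closed by (simp add: span.zero)
 next
  case (add x ws)
  then show ?case using 1[of y ws] span_closed span_prod_closed by (simp add: l_distr span_add)
 next
  case (diff x ws)
  then show ?case using 1[of y ws] span_closed span_prod_closed
   by (simp add: l_distr a_minus_def l_minus span_add span_inv)
 qed
qed

lemma span_antimono: "x \<in> span T k ==> j \<le> k ==> x \<in> span T j"
 by (induction rule: span.induct) (auto intro: span.intros)

lemma span_vanish:
 assumes "\<And>ws. set ws \<subseteq> T ==> length ws = m ==> foldr (\<otimes>) ws \<one> = \<zero>"
 shows "x \<in> span T m ==> x = \<zero>"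
proof -
 have 0: "foldr (\<otimes>) ws \<one> = \<zero>" if "set ws \<subseteq> T" "m \<le> length ws" for ws
 proof -
  have sub: "set (take m ws) \<subseteq> T" "set (drop m ws) \<subseteq> T"
   using that set_take_subset[of m ws] set_drop_subset[of m ws] by auto
  have "foldr (\<otimes>) (take m ws @ drop m ws) \<one> = \<zero> \<otimes> foldr (\<otimes>) (drop m ws) \<one>"
   using foldr_append_mult[OF sub] assms[OF sub(1)] that by simp
  then show ?thesis using span_prod_closed[OF sub(2)] by simp
 qed
 show "x \<in> span T m ==> x = \<zero>"
  by (induction rule: span.induct) (simp_all add: 0 a_minus_def)
qed

end

end

context unit_embedding
begin

text \<open>By \<open>\<delta>_comm\<close>, term \<open>k\<close> of the lower central series of
  the group generated by \<open>S\<close> lies in 1 + \<open>span T (Suc k)\<close>. The finite set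
  \<open>T\<close> contains the \<open>\<delta>\<close> of the generators and of their inverses and
  lies in \<open>L\<close>, so long products of its elements vanish.\<close>

lemma loc_nilp_unipotent:
 assumes L: "ideal L A" "A.loc_nil L"
 shows "G.loc_nilp_mod {\<one>\<^bsub>G\<^esub>} {g \<in> carrier G. \<delta> g \<in> L}"
 unfolding G.loc_nilp_mod_def
proof (intro allI impI)
 interpret L: ideal L A by (rule L(1))
 fix S assume S: "finite S \<and> S \<subseteq> {g \<in> carrier G. \<delta> g \<in> L}"
 then have Sc: "S \<subseteq> carrier G" by blast
 define T where "T = \<delta> ` S \<union> (\<lambda>s. \<delta> (inv\<^bsub>G\<^esub> s)) ` S"
 have "\<delta> (inv\<^bsub>G\<^esub> s) \<in> L" if "s \<in> S" for s
 proof -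
  have s: "s \<in> carrier G" "\<delta> s \<in> L" using S that by auto
  then have "\<delta> (inv\<^bsub>G\<^esub> s) \<otimes>\<^bsub>A\<^esub> \<delta> s \<in> L" by (intro L.I_l_closed) (simp_all add: \<delta>_closed)
  then show ?thesis using s by (subst \<delta>_inv) (auto simp: a_minus_def)
 qed
 then have TL: "T \<subseteq> L" "finite T" using S by (auto simp: T_def)
 then have Tc: "T \<subseteq> carrier A" using L.Icarr by blast
 obtain m where m: "\<And>ws. set ws \<subseteq> T ==> length ws = m ==> foldr (\<otimes>\<^bsub>A\<^esub>) ws \<one>\<^bsub>A\<^esub> = \<zero>\<^bsub>A\<^esub>"
  using L(2)[unfolded A.loc_nil_def, rule_format, of T] TL by blast
 let ?I = "A.span T" and ?H = "generate G S"
 have H: "subgroup ?H G" by (rule G.generate_is_subgroup[OF Sc])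
 have Hc: "g \<in> carrier G" if "g \<in> ?H" for g using subgroup.mem_carrier[OF H that] .
 have T1: "\<delta> t \<in> ?I 1" if "\<delta> t \<in> T" for t
  using A.span_prod[OF Tc, of "[\<delta> t]" 1] that Tc by (auto simp: subset_iff)
 have one: "\<delta> g \<in> ?I 1" if "g \<in> ?H" for g
  using that
 proof induction
  case (eng g h)
  have "\<delta> g \<otimes>\<^bsub>A\<^esub> \<delta> h \<in> ?I 1"
   using A.span_antimono[OF Tc A.span_mult[OF Tc eng.IH]] by simp
  then show ?case using eng Hc by (simp add: \<delta>_mult A.span_add[OF Tc])
 qed (use T1 in \<open>auto simp: \<delta>_one A.span.zero T_def\<close>)
 have "G.lcs ?H k \<subseteq> {g \<in> ?H. \<delta> g \<in> ?I (Suc k)}" for k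
 proof (induction k)
  case 0
  then show ?case using one by auto
 next
  case (Suc k)
  have sub: "subgroup {g \<in> ?H. \<delta> g \<in> ?I (Suc (Suc k))} G" (is "subgroup ?D G")
  proof (rule G.subgroupI)
   show "?D \<subseteq> carrier G" using Hc by blast
   have "\<one>\<^bsub>G\<^esub> \<in> ?D" using subgroup.one_closed[OF H] by (simp add: \<delta>_one A.span.zero)
   then show "?D \<noteq> {}" by blast
   show "inv\<^bsub>G\<^esub> g \<in> ?D" if g: "g \<in> ?D" for g
   proof -
    have gi: "inv\<^bsub>G\<^esub> g \<in> ?H" using subgroup.m_inv_closed[OF H] g by blast
    have gk: "\<delta> g \<in> ?I (Suc (Suc k))" using g by blast
    have "\<delta> (inv\<^bsub>G\<^esub> g) \<otimes>\<^bsub>A\<^esub> \<delta> g \<in> ?I (Suc (Suc k))"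
     by (rule A.span_antimono[OF Tc A.span_mult[OF Tc one[OF gi] gk]]) simp
    then have "\<delta> (inv\<^bsub>G\<^esub> g) \<in> ?I (Suc (Suc k))"
     using g Hc by (subst \<delta>_inv) (auto intro!: A.span_minus[OF Tc] A.span_inv[OF Tc])
    then show ?thesis using gi by blast
   qed
   show "g \<otimes>\<^bsub>G\<^esub> h \<in> ?D" if gh: "g \<in> ?D" "h \<in> ?D" for g h
   proof -
    have "\<delta> g \<otimes>\<^bsub>A\<^esub> \<delta> h \<in> ?I (Suc (Suc k))"
     using A.span_antimono[OF Tc A.span_mult[OF Tc, of "\<delta> g" "Suc (Suc k)" "\<delta> h" "Suc (Suc k)"]] gh by simp
    then show ?thesis
     using gh Hc subgroup.m_closed[OF H] by (simp add: \<delta>_mult A.span_add[OF Tc])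
   qed
  qed
  have "comm G g h \<in> ?D" if g: "g \<in> G.lcs ?H k" and h: "h \<in> ?H" for g h
  proof -
   have gH: "g \<in> ?H" "\<delta> g \<in> ?I (Suc k)" using Suc g by auto
   let ?z = "\<delta> g \<otimes>\<^bsub>A\<^esub> \<delta> h \<ominus>\<^bsub>A\<^esub> \<delta> h \<otimes>\<^bsub>A\<^esub> \<delta> g"
   have "?z \<in> ?I (Suc (Suc k))"
    using A.span_mult[OF Tc gH(2) one[OF h]] A.span_mult[OF Tc one[OF h] gH(2)]
    by (intro A.span_minus[OF Tc]) simp_all
   moreover have w: "inv\<^bsub>G\<^esub> (h \<otimes>\<^bsub>G\<^esub> g) \<in> ?H"
    using gH h subgroup.m_closed[OF H] subgroup.m_inv_closed[OF H] by blast
   ultimately have "\<delta> (inv\<^bsub>G\<^esub> (h \<otimes>\<^bsub>G\<^esub> g)) \<otimes>\<^bsub>A\<^esub> ?z \<oplus>\<^bsub>A\<^esub> ?z \<in> ?I (Suc (Suc k))"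
    using A.span_antimono[OF Tc A.span_mult[OF Tc one[OF w], of ?z "Suc (Suc k)"], of "Suc (Suc k)"]
    by (intro A.span_add[OF Tc]) simp_all
   moreover have "comm G g h \<in> ?H"
    using gH h subgroup.m_closed[OF H] subgroup.m_inv_closed[OF H] by (simp add: comm_def)
   ultimately show ?thesis using \<delta>_comm[OF Hc[OF gH(1)] Hc[OF h]] by simp
  qed
  then have "{comm G x y |x y. x \<in> G.lcs ?H k \<and> y \<in> ?H} \<subseteq> ?D" by blast
  then show ?case using G.generate_subgroup_incl[OF _ sub] by simp
 qed
 then have "G.lcs ?H m \<subseteq> {g \<in> ?H. \<delta> g \<in> ?I m}"
  using A.span_antimono[OF Tc, of _ "Suc m" m] by fastforce
 moreover have "g = \<one>\<^bsub>G\<^esub>" if "g \<in> ?H" "\<delta> g \<in> ?I m" for g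
  using A.span_vanish[OF Tc m that(2)] \<delta>_zero_iff Hc[OF that(1)] by blast
 ultimately show "\<exists>n. G.lcs ?H n \<subseteq> {\<one>\<^bsub>G\<^esub>}" by blast
qed

lemma matrix_rep:
 assumes "field K" "matrix_hom A K n \<phi>"
 shows "matrix_rep K G n (\<lambda>g. \<phi> (\<psi> g))"
 using assms \<psi>_closed \<psi>_mult \<psi>_one
 by (intro matrix_rep.intro matrix_rep_axioms.intro G.is_group) (auto simp: matrix_hom_def)

definition kernel :: "nat => ('a => nat => nat => 'k) => 'g set"
 where "kernel n \<phi> = {g \<in> carrier G. \<forall>i < n. \<forall>j < n. \<phi> (\<psi> g) i j = \<phi> (\<psi> \<one>\<^bsub>G\<^esub>) i j}"

text \<open>The fields range over a single type, as the formation of a set requires;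
  \<open>non_nilpotent_closed_matrix_hom\<close> supplies its fields in exactly this type.\<close>

definition kernels :: "'g set set"
 where "kernels = {kernel n \<phi> |n \<phi>. n \<le> d \<and>
  (\<exists>K :: 'a coeff_field.
   algebraically_closed K \<and> matrix_hom A K n \<phi>)}"

text \<open>An element of all kernels has its \<open>\<delta>\<close> in \<open>Nil\<close>, the set
  of elements killed by all these representations. \<open>Nil\<close> is a left ideal, and it is nil
  because non-nilpotent elements survive somewhere; so Levitzki's theorem places it in
  \<open>L\<close>.\<close>

lemma engel_kernels: "engel_kernels G kernels (zassenhaus_bound d)"
proof (intro engel_kernels.intro engel_kernels_axioms.intro)
 show "group G" by (rule G.is_group)
 have kernelE: thesis if N: "N \<in> kernels"
  and rule: "\<And>n (K :: 'a coeff_field) \<phi>. n \<le> d ==>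
   algebraically_closed K ==> matrix_rep K G n \<phi> ==> N = matrix_rep.Ker G n \<phi> ==> thesis"
  for N thesis
 proof -
  obtain n \<phi> and K :: "'a coeff_field"
   where n: "N = kernel n \<phi>" "n \<le> d" and K: "algebraically_closed K" and \<phi>: "matrix_hom A K n \<phi>"
   using N by (auto simp: kernels_def)
  interpret K: algebraically_closed K by (rule K)
  interpret rep: matrix_rep K G n "\<lambda>g. \<phi> (\<psi> g)" by (rule matrix_rep[OF K.field_axioms \<phi>])
  have "N = rep.Ker" by (simp add: n(1) kernel_def rep.Ker_def)
  then show thesis by (rule rule[OF n(2) K rep.matrix_rep_axioms])
 qed
 \<comment> \<open>The size \<open>n\<close> varies with the kernel but is at most \<open>d\<close>,
   and the bound is monotone; so one length serves all kernels.\<close>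
 have bound: "(derived G ^^ zassenhaus_bound d) H \<subseteq> (derived G ^^ zassenhaus_bound n) H"
  if "subgroup H G" "n \<le> d" for H n
  using G.exp_derived_antimono[OF that(1) zassenhaus_bound_mono[OF that(2)]] .
 show "N \<lhd> G" if "N \<in> kernels" for N
  using that by (rule kernelE) (simp add: matrix_rep.Ker_normal)
 show "(derived G ^^ zassenhaus_bound d) H \<subseteq> N"
  if N: "N \<in> kernels" and H: "subgroup H G" "(derived G ^^ q) H \<subseteq> N" for N H q
  using N
 proof (rule kernelE)
  fix n and K :: "'a coeff_field" and \<phi>
  assume *: "n \<le> d" "algebraically_closed K" "matrix_rep K G n \<phi>" "N = matrix_rep.Ker G n \<phi>"
  then show ?thesis
   using matrix_rep.exp_derived_subset_Ker[OF *(3,2) H(1)] H(2) bound[OF H(1) *(1)] by blast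
 qed
 show "(derived G ^^ zassenhaus_bound d) (generate G (\<Delta> \<union> R)) \<subseteq> N"
  if N: "N \<in> kernels" and R: "R \<lhd> G" "N \<subseteq> R" "(derived G ^^ s) R \<subseteq> N"
   and D: "\<Delta> \<subseteq> carrier G" "\<And>u g. u \<in> \<Delta> ==> g \<in> carrier G ==> conjg G g u \<in> \<Delta>"
    "\<And>u a. u \<in> \<Delta> ==> a \<in> carrier G ==> \<exists>m. engel G m a u \<in> R"
  for N R s \<Delta>
  using N
 proof (rule kernelE)
  fix n and K :: "'a coeff_field" and \<phi>
  assume *: "n \<le> d" "algebraically_closed K" "matrix_rep K G n \<phi>" "N = matrix_rep.Ker G n \<phi>"
  have H: "subgroup (generate G (\<Delta> \<union> R)) G"
   using D(1) subgroup.subset[OF normal_imp_subgroup[OF R(1)]] by (intro G.generate_is_subgroup) auto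
  have "(derived G ^^ zassenhaus_bound n) (generate G (\<Delta> \<union> R)) \<subseteq> N"
   using matrix_rep.linear_engel[OF *(3,2) R(1) R(2,3)[unfolded *(4)] D] *(4) by simp
  then show ?thesis using bound[OF H *(1)] by blast
 qed
 obtain L where L: "ideal L A" "A.loc_nil L" "\<And>J. ideal J A ==> A.loc_nil J ==> L \<subseteq> J ==> J = L"
  using A.ex_maximal_loc_nil by blast
 define Nil where "Nil = {x \<in> carrier A. \<forall>n \<phi>. \<forall>K :: 'a coeff_field.
  n \<le> d --> algebraically_closed K --> matrix_hom A K n \<phi> --> (\<forall>i < n. \<forall>j < n. \<phi> x i j = \<zero>\<^bsub>K\<^esub>)}"
 have NilD: "\<phi> x i j = \<zero>\<^bsub>K\<^esub>" if "x \<in> Nil" "n \<le> d" "algebraically_closed K" "matrix_hom A K n \<phi>" "i < n" "j < n"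
  for x n \<phi> i j and K :: "'a coeff_field"
  using that(1)[unfolded Nil_def, THEN CollectD, THEN conjunct2, rule_format, OF that(2-6)] .
 have Nil_car: "x \<in> carrier A" if "x \<in> Nil" for x using that by (simp add: Nil_def)
 have hom_zero: "\<phi> \<zero>\<^bsub>A\<^esub> i j = \<zero>\<^bsub>K\<^esub>" if "ring K" "matrix_hom A K n \<phi>" "i < n" "j < n"
  for K :: "'a coeff_field" and n \<phi> i j
 proof -
  interpret K: ring K by (rule that(1))
  note * = matrix_homD[OF that(2-4) A.zero_closed]
  have c: "\<phi> \<zero>\<^bsub>A\<^esub> i j \<in> carrier K" and "\<phi> (\<zero>\<^bsub>A\<^esub> \<oplus>\<^bsub>A\<^esub> \<zero>\<^bsub>A\<^esub>) i j = \<phi> \<zero>\<^bsub>A\<^esub> i j \<oplus>\<^bsub>K\<^esub> \<phi> \<zero>\<^bsub>A\<^esub> i j"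
   by (rule *(1), rule *(2)[OF A.zero_closed])
  then have "\<phi> \<zero>\<^bsub>A\<^esub> i j \<oplus>\<^bsub>K\<^esub> \<phi> \<zero>\<^bsub>A\<^esub> i j = \<phi> \<zero>\<^bsub>A\<^esub> i j" by simp
  then show ?thesis using K.add.l_cancel_one[OF c c] by simp
 qed
 have "A.left_ideal Nil"
  unfolding A.left_ideal_def
 proof (intro conjI ballI)
  show "Nil \<subseteq> carrier A" by (auto simp: Nil_def)
  show "\<zero>\<^bsub>A\<^esub> \<in> Nil"
   using hom_zero algebraically_closed.axioms(1) field.is_ring by (simp add: Nil_def) blast
  show "x \<oplus>\<^bsub>A\<^esub> y \<in> Nil" if xy: "x \<in> Nil" "y \<in> Nil" for x y
   unfolding Nil_def
  proof (intro CollectI conjI allI impI)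
   show "x \<oplus>\<^bsub>A\<^esub> y \<in> carrier A" using xy by (simp add: Nil_def)
   fix n \<phi> i j and K :: "'a coeff_field"
   assume *: "n \<le> d" "algebraically_closed K" "matrix_hom A K n \<phi>" "i < n" "j < n"
   interpret K: algebraically_closed K by (rule *(2))
   show "\<phi> (x \<oplus>\<^bsub>A\<^esub> y) i j = \<zero>\<^bsub>K\<^esub>"
    using matrix_homD(2)[OF *(3-5) Nil_car[OF xy(1)] Nil_car[OF xy(2)]] NilD[OF xy(1) *] NilD[OF xy(2) *]
    by simp
  qed
  show "a \<otimes>\<^bsub>A\<^esub> x \<in> Nil" if a: "a \<in> carrier A" and x: "x \<in> Nil" for a x
   unfolding Nil_def
  proof (intro CollectI conjI allI impI)
   show "a \<otimes>\<^bsub>A\<^esub> x \<in> carrier A" using a x by (simp add: Nil_def)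
   fix n \<phi> i j and K :: "'a coeff_field"
   assume *: "n \<le> d" "algebraically_closed K" "matrix_hom A K n \<phi>" "i < n" "j < n"
   interpret K: algebraically_closed K by (rule *(2))
   have z: "\<phi> x l j = \<zero>\<^bsub>K\<^esub>" if "l < n" for l by (rule NilD[OF x *(1-3) that *(5)])
   have ac: "\<phi> a i l \<in> carrier K" if "l < n" for l by (rule matrix_homD(1)[OF *(3,4) that a])
   have "\<phi> (a \<otimes>\<^bsub>A\<^esub> x) i j = (\<Oplus>\<^bsub>K\<^esub>l \<in> {..<n}. \<phi> a i l \<otimes>\<^bsub>K\<^esub> \<phi> x l j)"
    by (rule matrix_homD(3)[OF *(3-5) a Nil_car[OF x]])
   also have "\<dots> = (\<Oplus>\<^bsub>K\<^esub>l \<in> {..<n}. \<zero>\<^bsub>K\<^esub>)" using z ac by (intro K.finsum_cong') auto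
   finally show "\<phi> (a \<otimes>\<^bsub>A\<^esub> x) i j = \<zero>\<^bsub>K\<^esub>" by simp
  qed
 qed
 moreover have "\<exists>n::nat. x [^]\<^bsub>A\<^esub> n = \<zero>\<^bsub>A\<^esub>" if x: "x \<in> Nil" for x
 proof (rule ccontr)
  assume "\<not> ?thesis"
  then have nn: "x [^]\<^bsub>A\<^esub> n \<noteq> \<zero>\<^bsub>A\<^esub>" for n :: nat by blast
  show False
  proof (rule A.non_nilpotent_closed_matrix_hom[OF Nil_car[OF x] nn])
   fix n \<phi> and K :: "'a coeff_field"
   assume *: "n \<le> d" "algebraically_closed K" "matrix_hom A K n \<phi>"
    and "\<exists>i < n. \<exists>j < n. \<phi> x i j \<noteq> \<zero>\<^bsub>K\<^esub>"
   then show False using NilD[OF x *] by blast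
  qed
 qed
 ultimately have NL: "Nil \<subseteq> L" by (rule A.levitzki[OF _ _ L])
 have "\<delta> g \<in> Nil" if g: "g \<in> carrier G" "\<forall>N \<in> kernels. g \<in> N" for g
  unfolding Nil_def
 proof (intro CollectI conjI allI impI)
  show dc: "\<delta> g \<in> carrier A" by (rule \<delta>_closed[OF g(1)])
  fix n \<phi> i j and K :: "'a coeff_field"
  assume *: "n \<le> d" "algebraically_closed K" "matrix_hom A K n \<phi>" "i < n" "j < n"
  interpret K: algebraically_closed K by (rule *(2))
  have "kernel n \<phi> \<in> kernels" using * unfolding kernels_def by blast
  then have "\<phi> (\<psi> g) i j = \<phi> \<one>\<^bsub>A\<^esub> i j" using g(2) * by (auto simp: kernel_def \<psi>_one)
  moreover have "\<phi> (\<delta> g \<oplus>\<^bsub>A\<^esub> \<one>\<^bsub>A\<^esub>) i j = \<phi> (\<delta> g) i j \<oplus>\<^bsub>K\<^esub> \<phi> \<one>\<^bsub>A\<^esub> i j"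
   by (rule matrix_homD(2)[OF *(3-5) dc A.one_closed])
  moreover have c: "\<phi> (\<delta> g) i j \<in> carrier K" "\<phi> \<one>\<^bsub>A\<^esub> i j \<in> carrier K"
   using matrix_homD(1)[OF *(3-5)] dc by simp_all
  ultimately have "\<phi> (\<delta> g) i j \<oplus>\<^bsub>K\<^esub> \<phi> \<one>\<^bsub>A\<^esub> i j = \<phi> \<one>\<^bsub>A\<^esub> i j" using \<psi>_eq[OF g(1)] by simp
  then show "\<phi> (\<delta> g) i j = \<zero>\<^bsub>K\<^esub>" using K.add.r_cancel_one[OF c(2,1)] by simp
 qed
 then have "{g \<in> carrier G. \<forall>N \<in> kernels. g \<in> N} \<subseteq> {g \<in> carrier G. \<delta> g \<in> L}" using NL by blast
 then show "G.loc_nilp_mod {\<one>\<^bsub>G\<^esub>} {g \<in> carrier G. \<forall>N \<in> kernels. g \<in> N}"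
  using loc_nilp_unipotent[OF L(1,2)] unfolding G.loc_nilp_mod_def by (meson subset_trans)
qed

end

theorem theorem6:
  fixes G :: "('g, 'm) monoid_scheme"
  assumes "PI_group TYPE('p) TYPE('a) G"
  shows "solvable_radical G = {g \<in> carrier G. quasi_nil G g}"
proof -
 obtain P :: "'p ring" and A :: "('p, 'a) module" and H where G: "group G"
  and PI: "PI_algebra P A" and H: "subgroup H (units_of A)" and iso: "G \<cong> (units_of A)\<lparr>carrier := H\<rparr>"
  using assms unfolding PI_group_def by blast
 obtain d \<gamma> where "multilinear_identity A d \<gamma>" using PI_algebra_multilinear[OF PI] by blast
 then interpret A: multilinear_identity A d \<gamma> .
 interpret G: group G by (rule G)
 interpret U: group "units_of A" by (rule A.units_group)
 let ?U = "(units_of A)\<lparr>carrier := H\<rparr>"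
 interpret H: group ?U by (rule subgroup.subgroup_is_group[OF H U.is_group])
 obtain \<psi> where \<psi>: "\<psi> \<in> hom G ?U" "bij_betw \<psi> (carrier G) H"
  using iso by (auto simp: is_iso_def iso_def)
 interpret \<psi>: group_hom G ?U \<psi> by unfold_locales (rule \<psi>(1))
 \<comment> \<open>From here on \<open>H\<close> is forgotten: \<open>units_of A\<close> has the
   multiplication of \<open>A\<close>, and \<open>\<psi>\<close> is a multiplicative injection into
   the ring.\<close>
 have "unit_embedding G A d \<gamma> \<psi>"
 proof unfold_locales
  show "\<psi> g \<in> carrier A" if "g \<in> carrier G" for g
   using \<psi>.hom_closed[OF that] subgroup.subset[OF H] by (auto simp: units_of_def Units_def)
  show "\<psi> (g \<otimes>\<^bsub>G\<^esub> h) = \<psi> g \<otimes>\<^bsub>A\<^esub> \<psi> h" if "g \<in> carrier G" "h \<in> carrier G" for g h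
   using \<psi>.hom_mult[OF that] by (simp add: units_of_def)
  show "\<psi> \<one>\<^bsub>G\<^esub> = \<one>\<^bsub>A\<^esub>" using \<psi>.hom_one by (simp add: units_of_def)
  show "inj_on \<psi> (carrier G)" using \<psi>(2) by (rule bij_betw_imp_inj_on)
 qed
 then show ?thesis
  using engel_kernels.solvable_radical_eq_quasi_nil[OF unit_embedding.engel_kernels] by blast
qed

end
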